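(* Let $\mathrm{Dpr}$ be the monoidal category described in the context, with its distinguished dual pair $-\dashv+$. For any monoidal category $\mathcal{V}$, the functor $$\mathrm{StMon}_{\mathrm{g}}(\mathrm{Dpr},\mathcal{V})\longrightarrow\mathrm{Dp}_{\mathrm{g}}\mathcal{V},\qquad\Phi\mapsto(\Phi(-)\dashv\Phi(+))$$ is an equivalence of groupoids.
   Context: Dual pairs. A dual pair $X\dashv Y$ in a monoidal category $\mathcal{V}$ with unit $\mathbb{I}$ is a quadruple $(X,Y,\varepsilon,\eta)$ with $\varepsilon:X\otimes Y\to\mathbb{I}$ (counit) and $\eta:\mathbb{I}\to Y\otimes X$ (unit) such that the composites $X\to X\otimes Y\otimes X\to X$ (of $X\otimes\eta$ and $\varepsilon\otimes X$) and $Y\to Y\otimes X\otimes Y\to Y$ (of $\eta\otimes Y$ and $Y\otimes\varepsilon$) are identities. A morphism $(u,v):(X,Y,\varepsilon,\eta)\to(X_1,Y_1,\varepsilon_1,\eta_1)$ of dual pairs consists of $u:X\to X_1$ and $v:Y_1\to Y$ with $\varepsilon_1\circ(u\otimes 1)=\varepsilon\circ(1\otimes v)$. These form a category $\mathrm{Dp}\mathcal{V}$; $\mathrm{Dp}_{\mathrm{g}}\mathcal{V}$ is its subcategory consisting of all the objects but only the invertible morphisms. For monoidal categories $\mathcal{A}$ and $\mathcal{V}$, $\mathrm{StMon}_{\mathrm{g}}(\mathcal{A},\mathcal{V})$ is the groupoid of strong monoidal functors $\mathcal{A}\to\mathcal{V}$ and monoidal natural isomorphisms. The dual pair $\Phi(-)\dashv\Phi(+)$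 has counit and unit obtained from $\Phi\varepsilon$, $\Phi\eta$ and the monoidal constraints of $\Phi$. Cups, caps, snaking, cobbers. Let $S$ be a subset of a linearly ordered set $M$. A subset $K$ of $M$ is an interval when $a\le b\le c$ and $a,c\in K$ imply $b\in K$; write $[a,c]=\{b\in M: a\le b\le c\}$. A finite interval $K$ in $M$ is an $S$-cup [respectively, $S$-cap] when $K$ has even cardinality and $S\cap K$ is a final [respectively, initial] segment of $K$ containing exactly half of the elements of $K$. For $a\in M$, write $a^{\cup}$ [respectively, $a^{\cap}$] for the element of $M$, if it exists, for which $[a,a^{\cup}]$ is an $S$-cup [respectively, $[a,a^{\cap}]$ is an $S$-cap]. For $H\subseteq M$ and $x,x'\in M$, write $x\rightsquigarrow_H x'$ when there is a sequence $x=x_0,x_1,\dots,x_n=x'$ with $x_i\in H$ for $0<i<n$ and, for each $0\le m<n$, either $x_{m+1}=x_m^{\cup}$ or $x_{m+1}=x_m^{\cap}$. If $A\subseteq M$ and $B\subseteq N$ are subsets of linearly ordered sets, of the same (finite) cardinality, then $a\in A$ and $b\in B$ are called cobbers when they correspond under the unique order-preserving bijection $A\to B$. The category $\mathrm{Dpr}$. An object $(M,S)$ consists of a finite linearly ordered set $M$ and a subset $S\subseteq M$. A morphism $(A,B):(M,S)\to(N,T)$ consists of subsets $A\subseteq M$ and $B\subseteq N$ such that: (i) $\#A=\#B$; (ii) for all cobbers $a\in A$ and $b\in B$, $a\in S$ if and only if $b\in T$; (iii) $A'=M\setminus A$ is a union of $S$-cup intervals in $M$; (iv) $B'=N\setminus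 B$ is a union of $T$-cap intervals in $N$. The identity of $(M,S)$ is $(M,M)$. The composite $(E,F):(M,S)\to(P,U)$ of $(A,B):(M,S)\to(N,T)$ followed by $(C,D):(N,T)\to(P,U)$ is defined as follows, where primes denote complements, and cups, caps and snaking in $N$ are taken with respect to $T$: $$E=\{x\in A: \text{the cobber } y\in B \text{ of } x \text{ has } y\rightsquigarrow_{B'\cap C'}y' \text{ with } y'\in C\}\cup\{x'\in A: \text{the cobber } y'\in B \text{ of } x' \text{ has } y\rightsquigarrow_{B'\cap C'}y' \text{ with } y\in C\},$$ $$F=\{z\in D: \text{the cobber } y\in C \text{ of } z \text{ has } y\rightsquigarrow_{B'\cap C'}y' \text{ with } y'\in B\}\cup\{z'\in D: \text{the cobber } y'\in C \text{ of } z' \text{ has } y\rightsquigarrow_{B'\cap C'}y' \text{ with } y\in B\}.$$ The tensor product is componentwise ordinal sum: $(M,S)\otimes(M_1,S_1)=(M+M_1,S+S_1)$ and $(A,B)\otimes(A_1,B_1)=(A+A_1,B+B_1)$. With $\mathbf{n}=\{0,1,\dots,n-1\}$, the unit is $\mathbb{I}=(\mathbf{0},\varnothing)$. The distinguished dual pair $-\dashv+$ in $\mathrm{Dpr}$ has $-=(\mathbf{1},\varnothing)$ and $+=(\mathbf{1},\{0\})$, so that $-\otimes+=(\mathbf{2},\{1\})$ and $+\otimes-=(\mathbf{2},\{0\})$, with counit $\varepsilon=(\varnothing,\varnothing):-\otimes+\to\mathbb{I}$ and unit $\eta=(\varnothing,\varnothing):\mathbb{I}\to+\otimes-$.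
   Formalization: As described, Dpr is not a category. Here S-cups/caps are balanced intervals with first element matched to last (not only those where S∩K is a final/initial half), and x⇝x' uses only sequences of even length n; finite linear orders are taken as finite sets of naturals. *)

theory Defs
  imports Main "HOL-Library.FuncSet"
begin

section \<open>Categories and functors\<close>

record ('o, 'm) cat =
  Obj :: "'o set"
  Arr :: "'m set"
  Dom :: "'m \<Rightarrow> 'o"
  Cod :: "'m \<Rightarrow> 'o"
  Ident :: "'o \<Rightarrow> 'm"
  Cmp :: "'m \<Rightarrow> 'm \<Rightarrow> 'm"  (infixr "\<cdot>\<index>" 60)

definition Hom :: "('o, 'm, 'x) cat_scheme \<Rightarrow> 'o \<Rightarrow> 'o \<Rightarrow> 'm set" where
  "Hom C x y = {f \<in> Arr C. Dom C f = x \<and> Cod C f = y}"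

locale category =
  fixes C :: "('o, 'm, 'x) cat_scheme" (structure)
  assumes Dom_in: "f \<in> Arr C \<Longrightarrow> Dom C f \<in> Obj C"
    and Cod_in: "f \<in> Arr C \<Longrightarrow> Cod C f \<in> Obj C"
    and Ident_in: "x \<in> Obj C \<Longrightarrow> Ident C x \<in> Hom C x x"
    and Cmp_in: "f \<in> Hom C x y \<Longrightarrow> g \<in> Hom C y z \<Longrightarrow> g \<cdot> f \<in> Hom C x z"
    and Ident_left: "f \<in> Hom C x y \<Longrightarrow> Ident C y \<cdot> f = f"
    and Ident_right: "f \<in> Hom C x y \<Longrightarrow> f \<cdot> Ident C x = f"
    and Cmp_assoc: "f \<in> Hom C w x \<Longrightarrow> g \<in> Hom C x y \<Longrightarrow> h \<in> Hom C y z \<Longrightarrow>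
      (h \<cdot> g) \<cdot> f = h \<cdot> (g \<cdot> f)"

definition inverse_arrows :: "('o, 'm, 'x) cat_scheme \<Rightarrow> 'm \<Rightarrow> 'm \<Rightarrow> bool" where
  "inverse_arrows C f g \<longleftrightarrow>
     f \<in> Arr C \<and> g \<in> Hom C (Cod C f) (Dom C f) \<and>
     g \<cdot>\<^bsub>C\<^esub> f = Ident C (Dom C f) \<and> f \<cdot>\<^bsub>C\<^esub> g = Ident C (Cod C f)"

definition iso_arrow :: "('o, 'm, 'x) cat_scheme \<Rightarrow> 'm \<Rightarrow> bool" where
  "iso_arrow C f \<longleftrightarrow> (\<exists>g. inverse_arrows C f g)"

definition inv_arrow :: "('o, 'm, 'x) cat_scheme \<Rightarrow> 'm \<Rightarrow> 'm" where
  "inv_arrow C f = (THE g. inverse_arrows C f g)"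

locale groupoid = category +
  assumes all_iso: "f \<in> Arr C \<Longrightarrow> iso_arrow C f"

definition core :: "('o, 'm) cat \<Rightarrow> ('o, 'm) cat" where
  "core C = C \<lparr>Arr := {f \<in> Arr C. iso_arrow C f}\<rparr>"

record ('o, 'm, 'p, 'n) func =
  FObj :: "'o \<Rightarrow> 'p"
  FArr :: "'m \<Rightarrow> 'n"

locale cat_functor = A: category A + B: category B
  for A :: "('o, 'm, 'x) cat_scheme" and B :: "('p, 'n, 'y) cat_scheme" +
  fixes F :: "('o, 'm, 'p, 'n, 'z) func_scheme"
  assumes FObj_in: "x \<in> Obj A \<Longrightarrow> FObj F x \<in> Obj B"
    and FArr_in: "f \<in> Hom A x y \<Longrightarrow> FArr F f \<in> Hom B (FObj F x) (FObj F y)"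
    and FArr_Ident: "x \<in> Obj A \<Longrightarrow> FArr F (Ident A x) = Ident B (FObj F x)"
    and FArr_Cmp: "f \<in> Hom A x y \<Longrightarrow> g \<in> Hom A y z \<Longrightarrow>
      FArr F (g \<cdot>\<^bsub>A\<^esub> f) = FArr F g \<cdot>\<^bsub>B\<^esub> FArr F f"

definition id_func :: "('o, 'm, 'o, 'm) func" where
  "id_func = \<lparr>FObj = \<lambda>x. x, FArr = \<lambda>f. f\<rparr>"

definition comp_func ::
  "('p, 'n, 'q, 'k) func \<Rightarrow> ('o, 'm, 'p, 'n) func \<Rightarrow> ('o, 'm, 'q, 'k) func" where
  "comp_func G F = \<lparr>FObj = FObj G \<circ> FObj F, FArr = FArr G \<circ> FArr F\<rparr>"

definition nat_trans ::
  "('o, 'm, 'x) cat_scheme \<Rightarrow> ('p, 'n, 'y) cat_scheme \<Rightarrow>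
   ('o, 'm, 'p, 'n, 'z) func_scheme \<Rightarrow> ('o, 'm, 'p, 'n, 'w) func_scheme \<Rightarrow> ('o \<Rightarrow> 'n) \<Rightarrow> bool" where
  "nat_trans A B F G \<sigma> \<longleftrightarrow>
     (\<forall>x\<in>Obj A. \<sigma> x \<in> Hom B (FObj F x) (FObj G x)) \<and>
     (\<forall>x\<in>Obj A. \<forall>y\<in>Obj A. \<forall>f\<in>Hom A x y. \<sigma> y \<cdot>\<^bsub>B\<^esub> FArr F f = FArr G f \<cdot>\<^bsub>B\<^esub> \<sigma> x)"

definition nat_iso ::
  "('o, 'm, 'x) cat_scheme \<Rightarrow> ('p, 'n, 'y) cat_scheme \<Rightarrow>
   ('o, 'm, 'p, 'n, 'z) func_scheme \<Rightarrow> ('o, 'm, 'p, 'n, 'w) func_scheme \<Rightarrow> ('o \<Rightarrow> 'n) \<Rightarrow> bool" where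
  "nat_iso A B F G \<sigma> \<longleftrightarrow> nat_trans A B F G \<sigma> \<and> (\<forall>x\<in>Obj A. iso_arrow B (\<sigma> x))"

definition equivalence_of_categories ::
  "('o, 'm) cat \<Rightarrow> ('p, 'n) cat \<Rightarrow> ('o, 'm, 'p, 'n) func \<Rightarrow> bool" where
  "equivalence_of_categories A B F \<longleftrightarrow>
     cat_functor A B F \<and>
     (\<exists>G \<sigma> \<tau>. cat_functor B A G \<and>
        nat_iso A A id_func (comp_func G F) \<sigma> \<and> nat_iso B B (comp_func F G) id_func \<tau>)"

definition equivalence_of_groupoids ::
  "('o, 'm) cat \<Rightarrow> ('p, 'n) cat \<Rightarrow> ('o, 'm, 'p, 'n) func \<Rightarrow> bool" where
  "equivalence_of_groupoids A B F \<longleftrightarrow> groupoid A \<and> groupoid B \<and> equivalence_of_categories A B F"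


section \<open>Monoidal categories and strong monoidal functors\<close>

record ('o, 'm) moncat = "('o, 'm) cat" +
  TensO :: "'o \<Rightarrow> 'o \<Rightarrow> 'o"  (infixr "\<odot>\<index>" 70)
  TensA :: "'m \<Rightarrow> 'm \<Rightarrow> 'm"  (infixr "\<otimes>\<index>" 70)
  UnitO :: "'o"
  Assoc :: "'o \<Rightarrow> 'o \<Rightarrow> 'o \<Rightarrow> 'm"
  LUnit :: "'o \<Rightarrow> 'm"
  RUnit :: "'o \<Rightarrow> 'm"

locale monoidal_category = category C
  for C :: "('o, 'm) moncat" (structure) +
  assumes UnitO_in: "UnitO C \<in> Obj C"
    and TensO_in: "x \<in> Obj C \<Longrightarrow> y \<in> Obj C \<Longrightarrow> x \<odot> y \<in> Obj C"
    and TensA_in: "f \<in> Hom C x x' \<Longrightarrow> g \<in> Hom C y y' \<Longrightarrow> f \<otimes> g \<in> Hom C (x \<odot> y) (x' \<odot> y')"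
    and TensA_Ident: "x \<in> Obj C \<Longrightarrow> y \<in> Obj C \<Longrightarrow> Ident C x \<otimes> Ident C y = Ident C (x \<odot> y)"
    and TensA_Cmp: "f \<in> Hom C x x' \<Longrightarrow> f' \<in> Hom C x' x'' \<Longrightarrow> g \<in> Hom C y y' \<Longrightarrow> g' \<in> Hom C y' y'' \<Longrightarrow>
      (f' \<cdot> f) \<otimes> (g' \<cdot> g) = (f' \<otimes> g') \<cdot> (f \<otimes> g)"
    and Assoc_in: "x \<in> Obj C \<Longrightarrow> y \<in> Obj C \<Longrightarrow> z \<in> Obj C \<Longrightarrow>
      Assoc C x y z \<in> Hom C ((x \<odot> y) \<odot> z) (x \<odot> (y \<odot> z))"
    and Assoc_iso: "x \<in> Obj C \<Longrightarrow> y \<in> Obj C \<Longrightarrow> z \<in> Obj C \<Longrightarrow> iso_arrow C (Assoc C x y z)"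
    and Assoc_natural: "f \<in> Hom C x x' \<Longrightarrow> g \<in> Hom C y y' \<Longrightarrow> h \<in> Hom C z z' \<Longrightarrow>
      Assoc C x' y' z' \<cdot> ((f \<otimes> g) \<otimes> h) = (f \<otimes> (g \<otimes> h)) \<cdot> Assoc C x y z"
    and LUnit_in: "x \<in> Obj C \<Longrightarrow> LUnit C x \<in> Hom C (UnitO C \<odot> x) x"
    and LUnit_iso: "x \<in> Obj C \<Longrightarrow> iso_arrow C (LUnit C x)"
    and LUnit_natural: "f \<in> Hom C x y \<Longrightarrow>
      LUnit C y \<cdot> (Ident C (UnitO C) \<otimes> f) = f \<cdot> LUnit C x"
    and RUnit_in: "x \<in> Obj C \<Longrightarrow> RUnit C x \<in> Hom C (x \<odot> UnitO C) x"
    and RUnit_iso: "x \<in> Obj C \<Longrightarrow> iso_arrow C (RUnit C x)"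
    and RUnit_natural: "f \<in> Hom C x y \<Longrightarrow>
      RUnit C y \<cdot> (f \<otimes> Ident C (UnitO C)) = f \<cdot> RUnit C x"
    and pentagon: "w \<in> Obj C \<Longrightarrow> x \<in> Obj C \<Longrightarrow> y \<in> Obj C \<Longrightarrow> z \<in> Obj C \<Longrightarrow>
      (Ident C w \<otimes> Assoc C x y z) \<cdot> Assoc C w (x \<odot> y) z \<cdot> (Assoc C w x y \<otimes> Ident C z)
        = Assoc C w x (y \<odot> z) \<cdot> Assoc C (w \<odot> x) y z"
    and triangle: "x \<in> Obj C \<Longrightarrow> y \<in> Obj C \<Longrightarrow>
      (Ident C x \<otimes> LUnit C y) \<cdot> Assoc C x (UnitO C) y = RUnit C x \<otimes> Ident C y"

record ('o, 'm, 'p, 'n) monfunc = "('o, 'm, 'p, 'n) func" +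
  FMult :: "'o \<Rightarrow> 'o \<Rightarrow> 'n"
  FUnit :: "'n"

text \<open>
  The last three assumptions fix the values off the source category, so that two functors which
  agree there are equal.
\<close>

locale strong_monoidal_functor =
  A: monoidal_category A + V: monoidal_category V + cat_functor A V F
  for A :: "('o, 'm) moncat" and V :: "('p, 'n) moncat" and F :: "('o, 'm, 'p, 'n) monfunc" +
  assumes FMult_in: "x \<in> Obj A \<Longrightarrow> y \<in> Obj A \<Longrightarrow>
      FMult F x y \<in> Hom V (FObj F x \<odot>\<^bsub>V\<^esub> FObj F y) (FObj F (x \<odot>\<^bsub>A\<^esub> y))"
    and FMult_iso: "x \<in> Obj A \<Longrightarrow> y \<in> Obj A \<Longrightarrow> iso_arrow V (FMult F x y)"
    and FMult_natural: "f \<in> Hom A x x' \<Longrightarrow> g \<in> Hom A y y' \<Longrightarrow>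
      FMult F x' y' \<cdot>\<^bsub>V\<^esub> (FArr F f \<otimes>\<^bsub>V\<^esub> FArr F g) = FArr F (f \<otimes>\<^bsub>A\<^esub> g) \<cdot>\<^bsub>V\<^esub> FMult F x y"
    and FUnit_in: "FUnit F \<in> Hom V (UnitO V) (FObj F (UnitO A))"
    and FUnit_iso: "iso_arrow V (FUnit F)"
    and F_assoc: "x \<in> Obj A \<Longrightarrow> y \<in> Obj A \<Longrightarrow> z \<in> Obj A \<Longrightarrow>
      FArr F (Assoc A x y z) \<cdot>\<^bsub>V\<^esub> FMult F (x \<odot>\<^bsub>A\<^esub> y) z \<cdot>\<^bsub>V\<^esub> (FMult F x y \<otimes>\<^bsub>V\<^esub> Ident V (FObj F z))
        = FMult F x (y \<odot>\<^bsub>A\<^esub> z) \<cdot>\<^bsub>V\<^esub> (Ident V (FObj F x) \<otimes>\<^bsub>V\<^esub> FMult F y z)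
            \<cdot>\<^bsub>V\<^esub> Assoc V (FObj F x) (FObj F y) (FObj F z)"
    and F_lunit: "x \<in> Obj A \<Longrightarrow>
      FArr F (LUnit A x) \<cdot>\<^bsub>V\<^esub> FMult F (UnitO A) x \<cdot>\<^bsub>V\<^esub> (FUnit F \<otimes>\<^bsub>V\<^esub> Ident V (FObj F x))
        = LUnit V (FObj F x)"
    and F_runit: "x \<in> Obj A \<Longrightarrow>
      FArr F (RUnit A x) \<cdot>\<^bsub>V\<^esub> FMult F x (UnitO A) \<cdot>\<^bsub>V\<^esub> (Ident V (FObj F x) \<otimes>\<^bsub>V\<^esub> FUnit F)
        = RUnit V (FObj F x)"
    and FObj_ext: "FObj F \<in> extensional (Obj A)"
    and FArr_ext: "FArr F \<in> extensional (Arr A)"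
    and FMult_ext: "\<not> (x \<in> Obj A \<and> y \<in> Obj A) \<Longrightarrow> FMult F x y = undefined"

definition monoidal_nat_iso ::
  "('o, 'm) moncat \<Rightarrow> ('p, 'n) moncat \<Rightarrow>
   ('o, 'm, 'p, 'n) monfunc \<Rightarrow> ('o, 'm, 'p, 'n) monfunc \<Rightarrow> ('o \<Rightarrow> 'n) \<Rightarrow> bool" where
  "monoidal_nat_iso A V F G \<sigma> \<longleftrightarrow>
     nat_iso A V F G \<sigma> \<and> \<sigma> \<in> extensional (Obj A) \<and>
     (\<forall>x\<in>Obj A. \<forall>y\<in>Obj A.
        \<sigma> (x \<odot>\<^bsub>A\<^esub> y) \<cdot>\<^bsub>V\<^esub> FMult F x y = FMult G x y \<cdot>\<^bsub>V\<^esub> (\<sigma> x \<otimes>\<^bsub>V\<^esub> \<sigma> y)) \<and>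
     \<sigma> (UnitO A) \<cdot>\<^bsub>V\<^esub> FUnit F = FUnit G"

text \<open>In the next categories an arrow is a triple (domain, underlying data, codomain).\<close>

definition StMon_g ::
  "('o, 'm) moncat \<Rightarrow> ('p, 'n) moncat \<Rightarrow>
   (('o, 'm, 'p, 'n) monfunc,
    ('o, 'm, 'p, 'n) monfunc \<times> ('o \<Rightarrow> 'n) \<times> ('o, 'm, 'p, 'n) monfunc) cat" where
  "StMon_g A V =
    \<lparr>Obj = {F. strong_monoidal_functor A V F},
     Arr = {(F, \<sigma>, G). strong_monoidal_functor A V F \<and> strong_monoidal_functor A V G \<and>
                        monoidal_nat_iso A V F G \<sigma>},
     Dom = \<lambda>(F, \<sigma>, G). F,
     Cod = \<lambda>(F, \<sigma>, G). G,
     Ident = \<lambda>F. (F, \<lambda>x\<in>Obj A. Ident V (FObj F x), F),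
     Cmp = \<lambda>(G, \<tau>, H) (F, \<sigma>, G'). (F, \<lambda>x\<in>Obj A. \<tau> x \<cdot>\<^bsub>V\<^esub> \<sigma> x, H)\<rparr>"


section \<open>Dual pairs\<close>

record ('o, 'm) dpair =
  LeftO :: "'o"
  RightO :: "'o"
  Counit :: "'m"
  UnitA :: "'m"

definition dual_pair :: "('o, 'm) moncat \<Rightarrow> ('o, 'm) dpair \<Rightarrow> bool" where
  "dual_pair V P \<longleftrightarrow>
    (let X = LeftO P; Y = RightO P; \<epsilon> = Counit P; \<eta> = UnitA P in
      X \<in> Obj V \<and> Y \<in> Obj V \<and>
      \<epsilon> \<in> Hom V (X \<odot>\<^bsub>V\<^esub> Y) (UnitO V) \<and> \<eta> \<in> Hom V (UnitO V) (Y \<odot>\<^bsub>V\<^esub> X) \<and>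
      LUnit V X \<cdot>\<^bsub>V\<^esub> (\<epsilon> \<otimes>\<^bsub>V\<^esub> Ident V X) \<cdot>\<^bsub>V\<^esub> inv_arrow V (Assoc V X Y X)
        \<cdot>\<^bsub>V\<^esub> (Ident V X \<otimes>\<^bsub>V\<^esub> \<eta>) \<cdot>\<^bsub>V\<^esub> inv_arrow V (RUnit V X) = Ident V X \<and>
      RUnit V Y \<cdot>\<^bsub>V\<^esub> (Ident V Y \<otimes>\<^bsub>V\<^esub> \<epsilon>) \<cdot>\<^bsub>V\<^esub> Assoc V Y X Y
        \<cdot>\<^bsub>V\<^esub> (\<eta> \<otimes>\<^bsub>V\<^esub> Ident V Y) \<cdot>\<^bsub>V\<^esub> inv_arrow V (LUnit V Y) = Ident V Y)"

definition Dp ::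
  "('o, 'm) moncat \<Rightarrow>
   (('o, 'm) dpair, ('o, 'm) dpair \<times> ('m \<times> 'm) \<times> ('o, 'm) dpair) cat" where
  "Dp V =
    \<lparr>Obj = {P. dual_pair V P},
     Arr = {(P, (u, v), Q). dual_pair V P \<and> dual_pair V Q \<and>
              u \<in> Hom V (LeftO P) (LeftO Q) \<and> v \<in> Hom V (RightO Q) (RightO P) \<and>
              Counit Q \<cdot>\<^bsub>V\<^esub> (u \<otimes>\<^bsub>V\<^esub> Ident V (RightO Q)) = Counit P \<cdot>\<^bsub>V\<^esub> (Ident V (LeftO P) \<otimes>\<^bsub>V\<^esub> v)},
     Dom = \<lambda>(P, a, Q). P,
     Cod = \<lambda>(P, a, Q). Q,
     Ident = \<lambda>P. (P, (Ident V (LeftO P), Ident V (RightO P)), P),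
     Cmp = \<lambda>(Q, (u', v'), R) (P, (u, v), Q'). (P, (u' \<cdot>\<^bsub>V\<^esub> u, v \<cdot>\<^bsub>V\<^esub> v'), R)\<rparr>"

definition Dp_g ::
  "('o, 'm) moncat \<Rightarrow>
   (('o, 'm) dpair, ('o, 'm) dpair \<times> ('m \<times> 'm) \<times> ('o, 'm) dpair) cat" where
  "Dp_g V = core (Dp V)"

definition image_dpair ::
  "('o, 'm) moncat \<Rightarrow> ('p, 'n) moncat \<Rightarrow> ('o, 'm) dpair \<Rightarrow>
   ('o, 'm, 'p, 'n) monfunc \<Rightarrow> ('p, 'n) dpair" where
  "image_dpair A V P F =
    \<lparr>LeftO = FObj F (LeftO P),
     RightO = FObj F (RightO P),
     Counit = inv_arrow V (FUnit F) \<cdot>\<^bsub>V\<^esub> FArr F (Counit P) \<cdot>\<^bsub>V\<^esub> FMult F (LeftO P) (RightO P),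
     UnitA = inv_arrow V (FMult F (RightO P) (LeftO P)) \<cdot>\<^bsub>V\<^esub> FArr F (UnitA P) \<cdot>\<^bsub>V\<^esub> FUnit F\<rparr>"

text \<open>
  Morphisms of dual pairs are contravariant in the right-hand object; hence the inverse component.
\<close>

definition eval_functor ::
  "('o, 'm) moncat \<Rightarrow> ('p, 'n) moncat \<Rightarrow> ('o, 'm) dpair \<Rightarrow>
   (('o, 'm, 'p, 'n) monfunc,
    ('o, 'm, 'p, 'n) monfunc \<times> ('o \<Rightarrow> 'n) \<times> ('o, 'm, 'p, 'n) monfunc,
    ('p, 'n) dpair, ('p, 'n) dpair \<times> ('n \<times> 'n) \<times> ('p, 'n) dpair) func" where
  "eval_functor A V P =
    \<lparr>FObj = image_dpair A V P,
     FArr = \<lambda>(F, \<sigma>, G).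
       (image_dpair A V P F, (\<sigma> (LeftO P), inv_arrow V (\<sigma> (RightO P))), image_dpair A V P G)\<rparr>"


section \<open>Cups, caps, snaking and cobbers\<close>

definition interval_in :: "'a::linorder set \<Rightarrow> 'a set \<Rightarrow> bool" where
  "interval_in M K \<longleftrightarrow> K \<subseteq> M \<and> (\<forall>a\<in>K. \<forall>c\<in>K. \<forall>b\<in>M. a \<le> b \<and> b \<le> c \<longrightarrow> b \<in> K)"

definition initial_segment :: "'a::linorder set \<Rightarrow> 'a set \<Rightarrow> bool" where
  "initial_segment K J \<longleftrightarrow> J \<subseteq> K \<and> (\<forall>a\<in>J. \<forall>b\<in>K. b \<le> a \<longrightarrow> b \<in> J)"

text \<open>
  Read the elements outside \<open>S\<close> as \<open>-\<close> and those in \<open>S\<close> as \<open>+\<close>. A cup is a balanced word in which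
  the first letter is matched with the last, so that \<open>cup_end M S a b\<close> pairs the two ends of an arc
  \<open>- +\<close> of a planar diagram; dually for caps. In particular every interval of the form
  \<open>- ... - + ... +\<close>, in which \<open>S\<close> is a final segment with exactly half of the elements, is a cup.
  These intervals alone do not suffice: the arcs of \<open>- - + - + +\<close> are nested without being
  concentric, and the counit of \<open>- \<stileturn> +\<close> precomposed with two further counits inserted between
  \<open>-\<close> and \<open>+\<close> would have a complement which is not a union of such intervals, so that
  morphisms would not be closed under composition.
\<close>

definition is_cup :: "'a::linorder set \<Rightarrow> 'a set \<Rightarrow> 'a set \<Rightarrow> bool" where
  "is_cup M S K \<longleftrightarrow>
     finite K \<and> interval_in M K \<and> even (card K) \<and> card (S \<inter> K) = card K div 2 \<and>
     (\<forall>J. initial_segment K J \<and> J \<noteq> {} \<and> J \<noteq> K \<longrightarrow> card (J \<inter> S) < card (J - S))"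

definition is_cap :: "'a::linorder set \<Rightarrow> 'a set \<Rightarrow> 'a set \<Rightarrow> bool" where
  "is_cap M S K \<longleftrightarrow>
     finite K \<and> interval_in M K \<and> even (card K) \<and> card (S \<inter> K) = card K div 2 \<and>
     (\<forall>J. initial_segment K J \<and> J \<noteq> {} \<and> J \<noteq> K \<longrightarrow> card (J - S) < card (J \<inter> S))"

text \<open>Without \<open>a \<le> b\<close> the interval \<open>[a, b]\<close> could be empty, and hence a cup and a cap.\<close>

definition cup_end :: "'a::linorder set \<Rightarrow> 'a set \<Rightarrow> 'a \<Rightarrow> 'a \<Rightarrow> bool" where
  "cup_end M S a b \<longleftrightarrow> a \<in> M \<and> b \<in> M \<and> a \<le> b \<and> is_cup M S {x \<in> M. a \<le> x \<and> x \<le> b}"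

definition cap_end :: "'a::linorder set \<Rightarrow> 'a set \<Rightarrow> 'a \<Rightarrow> 'a \<Rightarrow> bool" where
  "cap_end M S a b \<longleftrightarrow> a \<in> M \<and> b \<in> M \<and> a \<le> b \<and> is_cap M S {x \<in> M. a \<le> x \<and> x \<le> b}"

text \<open>
  A strand which passes through the middle object of a composite uses as many cups of the second
  diagram as caps of the first, so only snakes of even length are admitted. A single step may
  join two elements of \<open>B\<close> which the diagrams do not connect: for \<open>M = {0, 1, 2}\<close>, \<open>S = {0, 2}\<close>,
  \<open>B = M\<close> and \<open>C = {0}\<close>, the step from \<open>0\<close> to \<open>1\<close> would break the identity law.
\<close>

definition snake :: "'a::linorder set \<Rightarrow> 'a set \<Rightarrow> 'a set \<Rightarrow> 'a \<Rightarrow> 'a \<Rightarrow> bool" where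
  "snake M S H x x' \<longleftrightarrow>
     (\<exists>(n::nat) s. even n \<and> s 0 = x \<and> s n = x' \<and> (\<forall>i. 0 < i \<and> i < n \<longrightarrow> s i \<in> H) \<and>
        (\<forall>m<n. cup_end M S (s m) (s (Suc m)) \<or> cap_end M S (s m) (s (Suc m))))"

definition cobbers :: "'a::linorder set \<Rightarrow> 'b::linorder set \<Rightarrow> 'a \<Rightarrow> 'b \<Rightarrow> bool" where
  "cobbers A B a b \<longleftrightarrow> a \<in> A \<and> (\<exists>h. bij_betw h A B \<and> strict_mono_on A h \<and> h a = b)"


section \<open>The monoidal category Dpr\<close>

text \<open>
  Every finite linearly ordered set is uniquely isomorphic to a finite set of natural numbers
  with the induced order, so the objects are pairs of such sets.
\<close>

type_synonym dpr_obj = "nat set \<times> nat set"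
type_synonym dpr_arr = "dpr_obj \<times> (nat set \<times> nat set) \<times> dpr_obj"

definition dpr_Obj :: "dpr_obj set" where
  "dpr_Obj = {(M, S). finite M \<and> S \<subseteq> M}"

definition dpr_Arr :: "dpr_arr set" where
  "dpr_Arr = {((M, S), (A, B), (N, T)).
     (M, S) \<in> dpr_Obj \<and> (N, T) \<in> dpr_Obj \<and> A \<subseteq> M \<and> B \<subseteq> N \<and>
     card A = card B \<and>
     (\<forall>a b. cobbers A B a b \<longrightarrow> (a \<in> S \<longleftrightarrow> b \<in> T)) \<and>
     (\<exists>\<K>. (\<forall>K\<in>\<K>. is_cup M S K) \<and> M - A = \<Union>\<K>) \<and>
     (\<exists>\<K>. (\<forall>K\<in>\<K>. is_cap N T K) \<and> N - B = \<Union>\<K>)}"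

definition dpr_Cmp :: "dpr_arr \<Rightarrow> dpr_arr \<Rightarrow> dpr_arr" where
  "dpr_Cmp = (\<lambda>((N, T), (C, D), Z) (X, (A, B), _).
     let H = (N - B) \<inter> (N - C);
         E = {x \<in> A. \<exists>y y'. cobbers A B x y \<and> snake N T H y y' \<and> y' \<in> C} \<union>
             {x' \<in> A. \<exists>y y'. cobbers A B x' y' \<and> snake N T H y y' \<and> y \<in> C};
         F = {z \<in> D. \<exists>y y'. cobbers C D y z \<and> snake N T H y y' \<and> y' \<in> B} \<union>
             {z' \<in> D. \<exists>y y'. cobbers C D y' z' \<and> snake N T H y y' \<and> y \<in> B}
     in (X, (E, F), Z))"

text \<open>
  \<open>M + M'\<close> is realised as \<open>M\<close> together with a translate of \<open>M'\<close> lying above it;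
  \<open>osum M A A'\<close> is the image of \<open>A + A'\<close> in \<open>M + M'\<close>.
\<close>

definition offset :: "nat set \<Rightarrow> nat" where
  "offset M = (LEAST k. \<forall>m\<in>M. m < k)"

definition osum :: "nat set \<Rightarrow> nat set \<Rightarrow> nat set \<Rightarrow> nat set" where
  "osum M A A' = A \<union> (\<lambda>i. offset M + i) ` A'"

definition dpr_TensO :: "dpr_obj \<Rightarrow> dpr_obj \<Rightarrow> dpr_obj" where
  "dpr_TensO = (\<lambda>(M, S) (M', S'). (osum M M M', osum M S S'))"

definition dpr_TensA :: "dpr_arr \<Rightarrow> dpr_arr \<Rightarrow> dpr_arr" where
  "dpr_TensA = (\<lambda>((M, S), (A, B), (N, T)) ((M', S'), (A', B'), (N', T')).
     (dpr_TensO (M, S) (M', S'), (osum M A A', osum N B B'), dpr_TensO (N, T) (N', T')))"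

definition dpr_Ident :: "dpr_obj \<Rightarrow> dpr_arr" where
  "dpr_Ident = (\<lambda>(M, S). ((M, S), (M, M), (M, S)))"

text \<open>The constraints are identities, as \<open>dpr_TensO\<close> is strictly associative and unital.\<close>

definition Dpr :: "(dpr_obj, dpr_arr) moncat" where
  "Dpr =
    \<lparr>Obj = dpr_Obj, Arr = dpr_Arr, Dom = \<lambda>(x, a, y). x, Cod = \<lambda>(x, a, y). y,
     Ident = dpr_Ident, Cmp = dpr_Cmp,
     TensO = dpr_TensO, TensA = dpr_TensA, UnitO = ({}, {}),
     Assoc = \<lambda>x y z. dpr_Ident (dpr_TensO (dpr_TensO x y) z),
     LUnit = dpr_Ident, RUnit = dpr_Ident\<rparr>"

definition dpr_minus :: dpr_obj where
  "dpr_minus = ({0}, {})"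

definition dpr_plus :: dpr_obj where
  "dpr_plus = ({0}, {0})"

definition dpr_dpair :: "(dpr_obj, dpr_arr) dpair" where
  "dpr_dpair =
    \<lparr>LeftO = dpr_minus, RightO = dpr_plus,
     Counit = (dpr_TensO dpr_minus dpr_plus, ({}, {}), ({}, {})),
     UnitA = (({}, {}), ({}, {}), dpr_TensO dpr_plus dpr_minus)\<rparr>"

end

theory Submission
  imports Defs "HOL-Library.Stream"
begin

text \<open>
  A morphism of Dpr is a planar diagram of cups, caps and through strands: each of its two boundaries
  is a sequence of Dyck words separated by end points of strands. Such a diagram can be evaluated in
  every category on which the signs act by an adjoint pair of endofunctors. Inserting a cup or a cap
  into an evaluated diagram, at any position, yields the value of another diagram, by naturality and
  the triangle identities; hence diagrams are closed under composition, uniformly in the action.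
  Evaluated as a relation between streams of labels, a diagram says that labels agree along all arcs
  and strands, and this relation determines the arcs and strands; so the composite prescribed by
  snaking is the one obtained by evaluation.

  A dual pair in a monoidal category acts by tensoring on the left. Evaluating diagrams at the unit
  object then gives a strong monoidal functor that sends the distinguished pair to the given one up
  to isomorphism, which is essential surjectivity. Conversely, for a strong monoidal functor and an
  isomorphism from a dual pair to the image of the distinguished one, the comparison maps along words
  of signs are natural in diagrams, because compatibility with counits forces compatibility with
  units. This gives fullness, and faithfulness holds since every object is a tensor product of signs.
\<close>

section \<open>Diagrams and their evaluation\<close>

text \<open>The signs act on the left, so concatenation of diagrams is not visibly a tensor product
  of their values at the unit object. What makes it one is that the action commutes with tensoring
  on the right (\<open>regroup\<close>). Label relations use streams because a stream absorbs a
  further label: prefixing a label becomes an endofunctor of a category with one object, adjoint to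
  itself with contraction as counit and its converse as unit. Signs are forgotten there without
  loss, since the boundary words carry them. Closure under composition is an existence statement
  proved inside one action, so a composite found for relations is not by itself the one for another
  action; hence the later passage to a product of actions. Snaking is compared with relations by
  labellings with values 0 and 1: the mark on a strand is passed along the cups and caps that
  continue it, and these paths end because they move in one direction. Finally, objects of Dpr are
  arbitrary finite sets of numbers, so words of signs represent them only up to the isomorphisms
  \<open>from_word\<close>.\<close>

context category
begin

lemma HomD [simp]: "f \<in> Hom C x y \<longleftrightarrow> f \<in> Arr C \<and> Dom C f = x \<and> Cod C f = y"
  by (auto simp: Hom_def)

lemma Cmp_typing [simp]:
  assumes "f \<in> Arr C" "g \<in> Arr C" "Dom C g = Cod C f"
  shows "g \<cdot> f \<in> Arr C" "Dom C (g \<cdot> f) = Dom C f" "Cod C (g \<cdot> f) = Cod C g"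
  using Cmp_in[of f "Dom C f" "Cod C f" g "Cod C g"] assms by auto

lemma Ident_typing [simp]:
  assumes "x \<in> Obj C"
  shows "Ident C x \<in> Arr C" "Dom C (Ident C x) = x" "Cod C (Ident C x) = x"
  using Ident_in[OF assms] by auto

lemma Ident_cancel [simp]:
  assumes "f \<in> Arr C"
  shows "Cod C f = y \<Longrightarrow> Ident C y \<cdot> f = f" "Dom C f = x \<Longrightarrow> f \<cdot> Ident C x = f"
  using Ident_left[of f "Dom C f" y] Ident_right[of f x "Cod C f"] assms by auto

lemma Obj_typing [simp]:
  assumes "f \<in> Arr C"
  shows "Dom C f \<in> Obj C" "Cod C f \<in> Obj C"
  using Dom_in Cod_in assms by auto

lemma Cmp_assoc' [simp]:
  assumes "f \<in> Arr C" "g \<in> Arr C" "h \<in> Arr C" "Dom C g = Cod C f" "Dom C h = Cod C g"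
  shows "(h \<cdot> g) \<cdot> f = h \<cdot> (g \<cdot> f)"
  using Cmp_assoc[of f "Dom C f" "Cod C f" g "Cod C g" h "Cod C h"] assms by auto

text \<open>Composites are kept nested to the right, so the left side of an equation
  \<open>f \<cdot> g = h\<close> is usually not a subterm of a longer chain. This form rewrites it
  in front of a further factor \<open>k\<close>.\<close>

lemma Cmp_rotate:
  assumes "f \<cdot> g = h" "f \<in> Arr C" "g \<in> Arr C" "k \<in> Arr C" "Dom C f = Cod C g" "Dom C g = Cod C k"
  shows "f \<cdot> (g \<cdot> k) = h \<cdot> k"
  using assms Cmp_assoc' by metis

end

text \<open>
  A forest encodes a Dyck word: \<open>Br f g\<close> is an arc around \<open>f\<close>, followed by \<open>g\<close>. A diagram is read
  from left to right; \<open>Nx c k s D\<close> consists of the cups \<open>c\<close> on the lower boundary, the caps \<open>k\<close> on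
  the upper boundary, a strand of sign \<open>s\<close> and the rest \<open>D\<close>. The sign \<open>True\<close> stands for \<open>+\<close>, and the
  left end of a cup has sign \<open>-\<close>, that of a cap sign \<open>+\<close>.
\<close>

datatype forest = Leaf | Br forest forest

datatype diag = End forest forest | Nx forest forest bool diag

primrec forest_word :: "bool \<Rightarrow> forest \<Rightarrow> bool list" where
  "forest_word s Leaf = []"
| "forest_word s (Br f g) = s # forest_word s f @ (\<not> s) # forest_word s g"

primrec forest_append :: "forest \<Rightarrow> forest \<Rightarrow> forest" where
  "forest_append Leaf h = h"
| "forest_append (Br f g) h = Br f (forest_append g h)"

lemma forest_word_forest_append [simp]: "forest_word s (forest_append f g) = forest_word s f @ forest_word s g"
  by (induction f) auto

primrec lower :: "diag \<Rightarrow> bool list" where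
  "lower (End c k) = forest_word False c"
| "lower (Nx c k s D) = forest_word False c @ s # lower D"

primrec upper :: "diag \<Rightarrow> bool list" where
  "upper (End c k) = forest_word True k"
| "upper (Nx c k s D) = forest_word True k @ s # upper D"

primrec diag_prepend :: "forest \<Rightarrow> forest \<Rightarrow> diag \<Rightarrow> diag" where
  "diag_prepend c k (End c' k') = End (forest_append c c') (forest_append k k')"
| "diag_prepend c k (Nx c' k' s D) = Nx (forest_append c c') (forest_append k k') s D"

lemma lower_diag_prepend [simp]: "lower (diag_prepend c k D) = forest_word False c @ lower D"
  and upper_diag_prepend [simp]: "upper (diag_prepend c k D) = forest_word True k @ upper D"
  by (cases D; simp)+

text \<open>The last gap of \<open>D\<close> and the first gap of \<open>E\<close> become one gap,
  so the base case merges forests by \<open>diag_prepend\<close> and creates no new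
  constructor.\<close>

primrec diag_append :: "diag \<Rightarrow> diag \<Rightarrow> diag" where
  "diag_append (End c k) E = diag_prepend c k E"
| "diag_append (Nx c k s D) E = Nx c k s (diag_append D E)"

lemma lower_diag_append [simp]: "lower (diag_append D E) = lower D @ lower E"
  and upper_diag_append [simp]: "upper (diag_append D E) = upper D @ upper E"
  by (induction D; simp)+

primrec diag_ident :: "bool list \<Rightarrow> diag" where
  "diag_ident [] = End Leaf Leaf"
| "diag_ident (s # w) = Nx Leaf Leaf s (diag_ident w)"

lemma lower_diag_ident [simp]: "lower (diag_ident w) = w" and upper_diag_ident [simp]: "upper (diag_ident w) = w"
  by (induction w; simp)+

text \<open>An adjunction of endofunctors: \<open>TO False\<close> is left adjoint to
  \<open>TO True\<close>, with counit \<open>ev\<close> and unit \<open>cv\<close>; the last two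
  assumptions are the triangle identities. One axiomatization serves label relations, monoidal
  categories with a dual pair, their product with relations, and Dpr itself.\<close>

locale adjoint_action = category C
  for C :: "('o, 'm, 'x) cat_scheme" (structure) +
  fixes TO :: "bool \<Rightarrow> 'o \<Rightarrow> 'o" and TA :: "bool \<Rightarrow> 'm \<Rightarrow> 'm"
    and ev :: "'o \<Rightarrow> 'm" and cv :: "'o \<Rightarrow> 'm"
  assumes TO_in [simp]: "x \<in> Obj C \<Longrightarrow> TO s x \<in> Obj C"
    and TA_typing [simp]: "f \<in> Arr C \<Longrightarrow> TA s f \<in> Arr C"
      "f \<in> Arr C \<Longrightarrow> Dom C (TA s f) = TO s (Dom C f)"
      "f \<in> Arr C \<Longrightarrow> Cod C (TA s f) = TO s (Cod C f)"
    and TA_Ident [simp]: "x \<in> Obj C \<Longrightarrow> TA s (Ident C x) = Ident C (TO s x)"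
    and TA_Cmp [simp]: "f \<in> Arr C \<Longrightarrow> g \<in> Arr C \<Longrightarrow> Dom C g = Cod C f \<Longrightarrow>
      TA s (g \<cdot> f) = TA s g \<cdot> TA s f"
    and ev_typing [simp]: "x \<in> Obj C \<Longrightarrow> ev x \<in> Arr C"
      "x \<in> Obj C \<Longrightarrow> Dom C (ev x) = TO False (TO True x)" "x \<in> Obj C \<Longrightarrow> Cod C (ev x) = x"
    and ev_natural: "f \<in> Arr C \<Longrightarrow> ev (Cod C f) \<cdot> TA False (TA True f) = f \<cdot> ev (Dom C f)"
    and cv_typing [simp]: "x \<in> Obj C \<Longrightarrow> cv x \<in> Arr C"
      "x \<in> Obj C \<Longrightarrow> Cod C (cv x) = TO True (TO False x)" "x \<in> Obj C \<Longrightarrow> Dom C (cv x) = x"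
    and cv_natural: "f \<in> Arr C \<Longrightarrow> TA True (TA False f) \<cdot> cv (Dom C f) = cv (Cod C f) \<cdot> f"
    and zigzag_False: "x \<in> Obj C \<Longrightarrow> ev (TO False x) \<cdot> TA False (cv x) = Ident C (TO False x)"
    and zigzag_True: "x \<in> Obj C \<Longrightarrow> TA True (ev x) \<cdot> cv (TO True x) = Ident C (TO True x)"
begin

text \<open>Functors preserve commuting squares. The images are stated as already split, because
  \<open>TA_Cmp\<close> as a simplification rule splits them.\<close>

lemma TA_eq: "f \<cdot> g = h \<cdot> k \<Longrightarrow> f \<in> Arr C \<Longrightarrow> g \<in> Arr C \<Longrightarrow> Dom C f = Cod C g \<Longrightarrow>
    h \<in> Arr C \<Longrightarrow> k \<in> Arr C \<Longrightarrow> Dom C h = Cod C k \<Longrightarrow> TA s f \<cdot> TA s g = TA s h \<cdot> TA s k"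
  by (metis TA_Cmp)

section \<open>Evaluation of words, forests and diagrams\<close>

primrec WO :: "bool list \<Rightarrow> 'o \<Rightarrow> 'o" where
  "WO [] x = x"
| "WO (s # w) x = TO s (WO w x)"

primrec WA :: "bool list \<Rightarrow> 'm \<Rightarrow> 'm" where
  "WA [] f = f"
| "WA (s # w) f = TA s (WA w f)"

lemma WO_append [simp]: "WO (u @ v) x = WO u (WO v x)"
  and WA_append [simp]: "WA (u @ v) f = WA u (WA v f)"
  by (induction u; simp)+

lemma WO_in [simp]: "x \<in> Obj C \<Longrightarrow> WO w x \<in> Obj C"
  by (induction w) auto

lemma WA_typing [simp]:
  assumes "f \<in> Arr C"
  shows "WA w f \<in> Arr C" "Dom C (WA w f) = WO w (Dom C f)" "Cod C (WA w f) = WO w (Cod C f)"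
  using assms by (induction w) auto

lemma WA_Ident [simp]: "x \<in> Obj C \<Longrightarrow> WA w (Ident C x) = Ident C (WO w x)"
  by (induction w) auto

lemma WA_Cmp [simp]: "f \<in> Arr C \<Longrightarrow> g \<in> Arr C \<Longrightarrow> Dom C g = Cod C f \<Longrightarrow>
    WA w (g \<cdot> f) = WA w g \<cdot> WA w f"
  by (induction w) auto

text \<open>The forest \<open>f\<close> enclosed by the arc is contracted first, under the outer
  \<open>TA False\<close>; then \<open>ev\<close> contracts the arc itself; \<open>g\<close>, which
  lies further right and hence acts further inside, comes last.\<close>

primrec cups :: "forest \<Rightarrow> 'o \<Rightarrow> 'm" where
  "cups Leaf x = Ident C x"
| "cups (Br f g) x = cups g x \<cdot> ev (WO (forest_word False g) x) \<cdot> TA False (cups f (TO True (WO (forest_word False g) x)))"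

primrec caps :: "forest \<Rightarrow> 'o \<Rightarrow> 'm" where
  "caps Leaf x = Ident C x"
| "caps (Br f g) x = TA True (caps f (TO False (WO (forest_word True g) x))) \<cdot> cv (WO (forest_word True g) x) \<cdot> caps g x"

primrec Phi :: "diag \<Rightarrow> 'o \<Rightarrow> 'm" where
  "Phi (End c k) x = caps k x \<cdot> cups c x"
| "Phi (Nx c k s D) x = caps k (TO s (WO (upper D) x)) \<cdot> TA s (Phi D x) \<cdot> cups c (TO s (WO (lower D) x))"

lemma cups_typing [simp]: 
  assumes "x \<in> Obj C"
  shows "cups c x \<in> Arr C" "Dom C (cups c x) = WO (forest_word False c) x" "Cod C (cups c x) = x"
  using assms by (induction c arbitrary: x) auto

lemma caps_typing [simp]: 
  assumes "x \<in> Obj C"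
  shows "caps c x \<in> Arr C" "Cod C (caps c x) = WO (forest_word True c) x" "Dom C (caps c x) = x"
  using assms by (induction c arbitrary: x) auto

lemma Phi_typing [simp]: 
  assumes "x \<in> Obj C"
  shows "Phi D x \<in> Arr C" "Dom C (Phi D x) = WO (lower D) x" "Cod C (Phi D x) = WO (upper D) x"
  using assms by (induction D) auto

text \<open>Naturality passes from \<open>ev\<close> to every forest by induction. It is the means
  by which operations at different positions of a boundary are interchanged.\<close>

lemma cups_natural:
  "f \<in> Arr C \<Longrightarrow> cups c (Cod C f) \<cdot> WA (forest_word False c) f = f \<cdot> cups c (Dom C f)"
proof (induction c arbitrary: f)
  case (Br c d)
  let ?x = "WO (forest_word False d) (Dom C f)" and ?y = "WO (forest_word False d) (Cod C f)" and ?f = "WA (forest_word False d) f"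
  have 1: "TA False (cups c (TO True ?y)) \<cdot> TA False (WA (forest_word False c) (TA True ?f))
     = TA False (TA True ?f) \<cdot> TA False (cups c (TO True ?x))"
    by (rule TA_eq) (use Br.IH(1)[of "TA True ?f"] Br.prems in auto)
  have 2: "ev ?y \<cdot> TA False (TA True ?f) = ?f \<cdot> ev ?x"
    using ev_natural[of ?f] Br.prems by simp
  show ?case
    using Br.prems Br.IH(2)[OF Br.prems] 1 2 
    by (simp add: Cmp_rotate[OF 1] Cmp_rotate[OF 2] Cmp_rotate[OF Br.IH(2)])
qed simp

lemma caps_natural:
  "f \<in> Arr C \<Longrightarrow> WA (forest_word True c) f \<cdot> caps c (Dom C f) = caps c (Cod C f) \<cdot> f"
proof (induction c arbitrary: f)
  case (Br c d)
  let ?x = "WO (forest_word True d) (Dom C f)" and ?y = "WO (forest_word True d) (Cod C f)" and ?f = "WA (forest_word True d) f"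
  have 1: "TA True (WA (forest_word True c) (TA False ?f)) \<cdot> TA True (caps c (TO False ?x))
     = TA True (caps c (TO False ?y)) \<cdot> TA True (TA False ?f)"
    by (rule TA_eq) (use Br.IH(1)[of "TA False ?f"] Br.prems in auto)
  have 2: "TA True (TA False ?f) \<cdot> cv ?x = cv ?y \<cdot> ?f"
    using cv_natural[of ?f] Br.prems by simp
  show ?case
    using Br.prems Br.IH(2)[OF Br.prems] 1 2 
    by (simp add: Cmp_rotate[OF 1] Cmp_rotate[OF 2] Cmp_rotate[OF Br.IH(2)])
qed simp

lemma Phi_natural:
  "f \<in> Arr C \<Longrightarrow> WA (upper D) f \<cdot> Phi D (Dom C f) = Phi D (Cod C f) \<cdot> WA (lower D) f"
proof (induction D)
  case (End c k)
  then show ?case using cups_natural[of f c] caps_natural[of f k]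
    by (simp add: Cmp_rotate[OF caps_natural])
next
  case (Nx c k s D)
  let ?x = "WO (lower D) (Dom C f)" and ?y = "WO (lower D) (Cod C f)"
  let ?x' = "WO (upper D) (Dom C f)" and ?y' = "WO (upper D) (Cod C f)"
  have 1: "TA s (WA (upper D) f) \<cdot> TA s (Phi D (Dom C f)) = TA s (Phi D (Cod C f)) \<cdot> TA s (WA (lower D) f)"
    by (rule TA_eq) (use Nx in auto)
  have 2: "cups c (TO s ?y) \<cdot> WA (forest_word False c) (TA s (WA (lower D) f)) = TA s (WA (lower D) f) \<cdot> cups c (TO s ?x)"
    using cups_natural[of "TA s (WA (lower D) f)" c] Nx by simp
  have 3: "WA (forest_word True k) (TA s (WA (upper D) f)) \<cdot> caps k (TO s ?x') = caps k (TO s ?y') \<cdot> TA s (WA (upper D) f)"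
    using caps_natural[of "TA s (WA (upper D) f)" k] Nx by simp
  show ?case
    using Nx.prems by (simp add: Cmp_rotate[OF 1] Cmp_rotate[OF 3] 2)
qed

lemma cups_forest_append: "x \<in> Obj C \<Longrightarrow> cups (forest_append c d) x = cups d x \<cdot> cups c (WO (forest_word False d) x)"
  by (induction c arbitrary: x) auto

lemma caps_forest_append: "x \<in> Obj C \<Longrightarrow> caps (forest_append c d) x = caps c (WO (forest_word True d) x) \<cdot> caps d x"
  by (induction c arbitrary: x) auto

lemma Phi_diag_prepend: "x \<in> Obj C \<Longrightarrow>
    Phi (diag_prepend c k D) x = caps k (WO (upper D) x) \<cdot> Phi D x \<cdot> cups c (WO (lower D) x)"
  by (cases D) (auto simp: cups_forest_append caps_forest_append)

text \<open>\<open>E\<close> acts inside all letters of \<open>D\<close>. The cups of the last gap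
  of \<open>D\<close> stand between the two evaluations, and \<open>cups_natural\<close> moves the
  value of \<open>E\<close> past them.\<close>

lemma Phi_diag_append: "x \<in> Obj C \<Longrightarrow>
    Phi (diag_append D E) x = Phi D (WO (upper E) x) \<cdot> WA (lower D) (Phi E x)"
proof (induction D)
  case (End c k)
  then show ?case using cups_natural[of "Phi E x" c] by (simp add: Phi_diag_prepend)
next
  case (Nx c k s D)
  then show ?case using cups_natural[of "TA s (WA (lower D) (Phi E x))" c] by simp
qed

lemma Phi_diag_ident [simp]: "x \<in> Obj C \<Longrightarrow> Phi (diag_ident w) x = Ident C (WO w x)"
  by (induction w) auto

section \<open>Closure of diagrams under insertion and removal of adjacent pairs\<close>

lemma caps_insert:
  assumes "forest_word True k = u @ v"
  shows "\<exists>k'. forest_word True k' = u @ True # False # v \<and>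
    (\<forall>x\<in>Obj C. caps k' x = WA u (cv (WO v x)) \<cdot> caps k x)"
  using assms
proof (induction k arbitrary: u v)
  case Leaf
  then show ?case by (intro exI[of _ "Br Leaf Leaf"]) auto
next
  case (Br f g)
  show ?case
  proof (cases u)
    case Nil
    then show ?thesis using Br.prems[symmetric]
      by (intro exI[of _ "Br Leaf (Br f g)"]) auto
  next
    case (Cons s u')
    then have "s = True" and eq: "forest_word True f @ False # forest_word True g = u' @ v"
      using Br.prems by auto
    \<comment> \<open>The insertion point lies below the first arc, possibly just before its right
      end, or to the right of the arc.\<close>
    have cases: "(\<exists>w. forest_word True f = u' @ w \<and> v = w @ False # forest_word True g) \<or>
      (\<exists>w. u' = forest_word True f @ False # w \<and> forest_word True g = w @ v)"
      using eq by (auto simp: append_eq_append_conv2 append_eq_Cons_conv Cons_eq_append_conv)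
    then show ?thesis
    proof (elim disjE exE conjE)
      fix w assume w: "forest_word True f = u' @ w" "v = w @ False # forest_word True g"
      from Br.IH(1)[OF w(1)] obtain f' where f': "forest_word True f' = u' @ True # False # w"
        "\<And>x. x\<in>Obj C \<Longrightarrow> caps f' x = WA u' (cv (WO w x)) \<cdot> caps f x" by blast
      show ?thesis
        by (rule exI[of _ "Br f' g"]) (use w f' \<open>s = True\<close> Cons in auto)
    next
      fix w assume w: "u' = forest_word True f @ False # w" "forest_word True g = w @ v"
      from Br.IH(2)[OF w(2)] obtain g' where g': "forest_word True g' = w @ True # False # v"
        "\<And>x. x\<in>Obj C \<Longrightarrow> caps g' x = WA w (cv (WO v x)) \<cdot> caps g x" by blast
      \<comment> \<open>The new cap arises inside \<open>g\<close>; naturality of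
        \<open>caps f\<close> and of \<open>cv\<close> moves it past the first arc.\<close>
      have "caps (Br f g') x = WA u (cv (WO v x)) \<cdot> caps (Br f g) x" if x: "x \<in> Obj C" for x
      proof -
        let ?h = "WA w (cv (WO v x))"
        have h: "?h \<in> Arr C" "Dom C ?h = WO w (WO v x)" "Cod C ?h = WO w (WO [True, False] (WO v x))"
          using x by auto
        have 1: "TA True (WA (forest_word True f) (TA False ?h)) \<cdot> TA True (caps f (TO False (Dom C ?h)))
          = TA True (caps f (TO False (Cod C ?h))) \<cdot> TA True (TA False ?h)"
          by (rule TA_eq) (use caps_natural[of "TA False ?h" f] h x in auto)
        have 2: "TA True (TA False ?h) \<cdot> cv (Dom C ?h) = cv (Cod C ?h) \<cdot> ?h"
          using cv_natural h by blast
        show ?thesis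
          using x w Cons \<open>s = True\<close> 
          by (simp add: g' Cmp_rotate[OF 1[simplified h]] Cmp_rotate[OF 2[simplified h]] del: TA_Cmp)
      qed
      then show ?thesis
        by (intro exI[of _ "Br f g'"]) (use w g' \<open>s = True\<close> Cons in auto)
    qed
  qed
qed

text \<open>In a word of caps \<open>False\<close> is a right end and \<open>True\<close> a left
  end, so an adjacent pair \<open>False\<close>, \<open>True\<close> consists of the right end of
  one arc and the left end of its right neighbour. Contracting the pair by \<open>ev\<close>
  straightens a zigzag and fuses the two arcs.\<close>

lemma caps_remove:
  assumes "forest_word True k = u @ False # True # v"
  shows "\<exists>k'. forest_word True k' = u @ v \<and>
    (\<forall>x\<in>Obj C. caps k' x = WA u (ev (WO v x)) \<cdot> caps k x)"
  using assms
proof (induction k arbitrary: u v)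
  case Leaf
  then show ?case by auto
next
  case (Br f g)
  then obtain u' where u: "u = True # u'" and eq: "forest_word True f @ False # forest_word True g = u' @ False # True # v"
    by (cases u) auto
  have "(\<exists>w. forest_word True f = u' @ False # True # w \<and> v = w @ False # forest_word True g) \<or>
      (u' = forest_word True f \<and> forest_word True g = True # v) \<or>
      (\<exists>w. u' = forest_word True f @ False # w \<and> forest_word True g = w @ False # True # v)"
    using eq by (auto simp: append_eq_append_conv2 append_eq_Cons_conv Cons_eq_append_conv)
  then show ?case
  proof (elim disjE exE conjE)
    fix w assume w: "forest_word True f = u' @ False # True # w" "v = w @ False # forest_word True g"
    from Br.IH(1)[OF w(1)] obtain f' where f': "forest_word True f' = u' @ w"
      "\<And>x. x\<in>Obj C \<Longrightarrow> caps f' x = WA u' (ev (WO w x)) \<cdot> caps f x" by blast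
    show ?thesis
      by (rule exI[of _ "Br f' g"]) (use w f' u in auto)
  next
    assume u': "u' = forest_word True f" and g: "forest_word True g = True # v"
    then obtain f' g' where g': "g = Br f' g'" and v: "v = forest_word True f' @ False # forest_word True g'"
      by (cases g) auto
    \<comment> \<open>The fused arc spans both interiors, \<open>f\<close> followed by
      \<open>f'\<close>. \<open>zigzag_True\<close> cancels \<open>ev\<close> against the unit of
      the first arc.\<close>
    have "caps (Br (forest_append f f') g') x = WA u (ev (WO v x)) \<cdot> caps (Br f g) x" if x: "x \<in> Obj C" for x
    proof -
      let ?y = "TO False (WO (forest_word True g') x)" and ?z = "WO v x"
      have 1: "TA True (WA (forest_word True f) (ev ?z)) \<cdot> TA True (caps f (TO False (TO True ?z)))
          = TA True (caps f ?z) \<cdot> TA True (ev ?z)"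
        by (rule TA_eq) (use caps_natural[of "ev ?z" f] x in auto)
      have 2: "TA True (TA False (TA True (caps f' ?y))) \<cdot> cv (TO True ?y) = cv (TO True ?z) \<cdot> TA True (caps f' ?y)"
        using cv_natural[of "TA True (caps f' ?y)"] x v by simp
      have 3: "TA True (ev ?z) \<cdot> cv (TO True ?z) = Ident C (TO True ?z)"
        using zigzag_True x by simp
      have z: "?z = WO (forest_word True f') ?y" using v by simp
      show ?thesis
        using x u u' g' v
        by (simp add: caps_forest_append Cmp_rotate[OF 1[simplified z]] Cmp_rotate[OF 2[simplified z]] Cmp_rotate[OF 3[simplified z]] )
    qed
    then show ?thesis
      by (intro exI[of _ "Br (forest_append f f') g'"]) (use u u' g' v in auto)
  next
    fix w assume w: "u' = forest_word True f @ False # w" "forest_word True g = w @ False # True # v"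
    from Br.IH(2)[OF w(2)] obtain g' where g': "forest_word True g' = w @ v"
      "\<And>x. x\<in>Obj C \<Longrightarrow> caps g' x = WA w (ev (WO v x)) \<cdot> caps g x" by blast
    have "caps (Br f g') x = WA u (ev (WO v x)) \<cdot> caps (Br f g) x" if x: "x \<in> Obj C" for x
    proof -
      let ?h = "WA w (ev (WO v x))"
      have h: "?h \<in> Arr C" "Dom C ?h = WO w (WO [False, True] (WO v x))" "Cod C ?h = WO w (WO v x)"
        using x by auto
      have 1: "TA True (WA (forest_word True f) (TA False ?h)) \<cdot> TA True (caps f (TO False (Dom C ?h)))
        = TA True (caps f (TO False (Cod C ?h))) \<cdot> TA True (TA False ?h)"
        by (rule TA_eq) (use caps_natural[of "TA False ?h" f] h x in auto)
      have 2: "TA True (TA False ?h) \<cdot> cv (Dom C ?h) = cv (Cod C ?h) \<cdot> ?h"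
        using cv_natural h by blast
      have "WA u (ev (WO v x)) \<cdot> caps (Br f g) x = TA True (WA (forest_word True f) (TA False ?h)) \<cdot>
        TA True (caps f (TO False (Dom C ?h))) \<cdot> cv (Dom C ?h) \<cdot> caps g x"
        using x w u by (simp del: TA_Cmp)
      also have "\<dots> = TA True (caps f (TO False (Cod C ?h))) \<cdot> TA True (TA False ?h) \<cdot> cv (Dom C ?h) \<cdot> caps g x"
        using Cmp_rotate[OF 1, of "cv (Dom C ?h) \<cdot> caps g x"] h x w by (simp del: TA_Cmp)
      also have "\<dots> = caps (Br f g') x"
        using Cmp_rotate[OF 2, of "caps g x"] h x w by (simp add: g' del: TA_Cmp)
      finally show ?thesis ..
    qed
    then show ?thesis
      by (intro exI[of _ "Br f g'"]) (use w g' u in auto)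
  qed
qed

text \<open>The letter after this word is a strand of sign \<open>True\<close>, and
  \<open>ev\<close> contracts the right end of the last arc with it. The zigzag straightens to a
  strand that ends at the left end of that arc: \<open>k1\<close> are the caps before the arc,
  \<open>k2\<close> those enclosed by it.\<close>

lemma caps_last:
  assumes "forest_word True k = u @ [False]"
  shows "\<exists>k1 k2. u = forest_word True k1 @ True # forest_word True k2 \<and>
    (\<forall>x\<in>Obj C. WA u (ev x) \<cdot> caps k (TO True x) = caps k1 (TO True (WO (forest_word True k2) x)) \<cdot> TA True (caps k2 x))"
  using assms
proof (induction k arbitrary: u)
  case Leaf
  then show ?case by auto
next
  case (Br f g)
  show ?case
  proof (cases g)
    case Leaf
    with Br.prems have u: "u = True # forest_word True f" by auto
    have "WA u (ev x) \<cdot> caps (Br f g) (TO True x) = TA True (caps f x)" if x: "x \<in> Obj C" for x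
    proof -
      have 1: "TA True (WA (forest_word True f) (ev x)) \<cdot> TA True (caps f (TO False (TO True x)))
          = TA True (caps f x) \<cdot> TA True (ev x)"
        by (rule TA_eq) (use caps_natural[of "ev x" f] x in auto)
      show ?thesis using x Leaf u 
        by (simp add: Cmp_rotate[OF 1] zigzag_True)
    qed
    then show ?thesis using u by (intro exI[of _ Leaf] exI[of _ f]) auto
  next
    case g: (Br g1 g2)
    have "\<exists>u'. forest_word True g = u' @ [False] \<and> u = True # forest_word True f @ False # u'"
    proof (cases "forest_word True g" rule: rev_cases)
      case (snoc u' s)
      with Br.prems have "(True # forest_word True f @ False # u') @ [s] = u @ [False]" by auto
      with snoc show ?thesis unfolding append1_eq_conv by auto
    qed (use g in auto)
    then obtain u' where u': "forest_word True g = u' @ [False]" and u: "u = True # forest_word True f @ False # u'" by blast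
    from Br.IH(2)[OF u'] obtain k1 k2 where k: "u' = forest_word True k1 @ True # forest_word True k2"
      "\<And>x. x\<in>Obj C \<Longrightarrow> WA u' (ev x) \<cdot> caps g (TO True x) = caps k1 (TO True (WO (forest_word True k2) x)) \<cdot> TA True (caps k2 x)"
      by blast
    have "WA u (ev x) \<cdot> caps (Br f g) (TO True x) =
        caps (Br f k1) (TO True (WO (forest_word True k2) x)) \<cdot> TA True (caps k2 x)" if x: "x \<in> Obj C" for x
    proof -
      let ?h = "WA u' (ev x)"
      have h: "?h \<in> Arr C" "Dom C ?h = WO (forest_word True g) (TO True x)" "Cod C ?h = WO (forest_word True k1) (TO True (WO (forest_word True k2) x))"
        using x u' k by auto
      have 1: "TA True (WA (forest_word True f) (TA False ?h)) \<cdot> TA True (caps f (TO False (Dom C ?h)))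
        = TA True (caps f (TO False (Cod C ?h))) \<cdot> TA True (TA False ?h)"
        by (rule TA_eq) (use caps_natural[of "TA False ?h" f] h x in auto)
      have 2: "TA True (TA False ?h) \<cdot> cv (Dom C ?h) = cv (Cod C ?h) \<cdot> ?h"
        using cv_natural h by blast
      have "WA u (ev x) \<cdot> caps (Br f g) (TO True x) =
        TA True (WA (forest_word True f) (TA False ?h)) \<cdot> TA True (caps f (TO False (Dom C ?h))) \<cdot> cv (Dom C ?h) \<cdot> caps g (TO True x)"
        unfolding h(2) using x u by (simp del: TA_Cmp)
      also have "\<dots> = TA True (caps f (TO False (Cod C ?h))) \<cdot> cv (Cod C ?h) \<cdot> ?h \<cdot> caps g (TO True x)"
        using Cmp_rotate[OF 1, of "cv (Dom C ?h) \<cdot> caps g (TO True x)"]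
          Cmp_rotate[OF 2, of "caps g (TO True x)"] x u' k(1) by (simp del: TA_Cmp)
      also have "?h \<cdot> caps g (TO True x) = caps k1 (TO True (WO (forest_word True k2) x)) \<cdot> TA True (caps k2 x)"
        using k x by blast
      finally show ?thesis unfolding h(3) using x by simp
    qed
    then show ?thesis using u k by (intro exI[of _ "Br f k1"] exI[of _ k2]) auto
  qed
qed

text \<open>A strand of sign \<open>False\<close> meets the left end of the first arc on its right.
  By \<open>zigzag_False\<close> it continues to the right end of this arc, with \<open>f\<close>
  now to its left and \<open>g\<close> to its right.\<close>

lemma ev_caps_Br:
  assumes "x \<in> Obj C"
  shows "ev (WO (forest_word True f) (TO False (WO (forest_word True g) x))) \<cdot> TA False (caps (Br f g) x)
    = caps f (TO False (WO (forest_word True g) x)) \<cdot> TA False (caps g x)"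
proof -
  let ?z = "TO False (WO (forest_word True g) x)"
  have 1: "ev (WO (forest_word True f) ?z) \<cdot> TA False (TA True (caps f ?z)) = caps f ?z \<cdot> ev ?z"
    using ev_natural[of "caps f ?z"] assms by simp
  have 2: "ev ?z \<cdot> TA False (cv (WO (forest_word True g) x)) = Ident C ?z"
    using zigzag_False assms by simp
  show ?thesis using assms by (simp add: Cmp_rotate[OF 1] Cmp_rotate[OF 2])
qed

lemma Phi_insert:
  assumes "upper D = u @ v"
  shows "\<exists>D'. lower D' = lower D \<and> upper D' = u @ True # False # v \<and>
    (\<forall>x\<in>Obj C. Phi D' x = WA u (cv (WO v x)) \<cdot> Phi D x)"
  using assms
proof (induction D arbitrary: u v)
  case (End c k)
  then obtain k' where k': "forest_word True k' = u @ True # False # v"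
    "\<And>x. x\<in>Obj C \<Longrightarrow> caps k' x = WA u (cv (WO v x)) \<cdot> caps k x" using caps_insert[of k u v] by auto
  have "WO u (WO v x) = WO (forest_word True k) x" for x using End by simp
  then show ?case by (intro exI[of _ "End c k'"]) (auto simp: k')
next
  case (Nx c k s D)
  then have "(\<exists>w. forest_word True k = u @ w \<and> v = w @ s # upper D) \<or>
      (\<exists>w. u = forest_word True k @ s # w \<and> upper D = w @ v)"
    by (auto simp: append_eq_append_conv2 append_eq_Cons_conv Cons_eq_append_conv)
  then show ?case
  proof (elim disjE exE conjE)
    fix w assume w: "forest_word True k = u @ w" "v = w @ s # upper D"
    from caps_insert[OF w(1)] obtain k' where k': "forest_word True k' = u @ True # False # w"
      "\<And>x. x\<in>Obj C \<Longrightarrow> caps k' x = WA u (cv (WO w x)) \<cdot> caps k x" by blast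
    show ?thesis by (rule exI[of _ "Nx c k' s D"]) (use k' w in auto)
  next
    fix w assume w: "u = forest_word True k @ s # w" "upper D = w @ v"
    from Nx.IH[OF w(2)] obtain D' where D': "lower D' = lower D" "upper D' = w @ True # False # v"
      "\<And>x. x\<in>Obj C \<Longrightarrow> Phi D' x = WA w (cv (WO v x)) \<cdot> Phi D x" by blast
    have "Phi (Nx c k s D') x = WA u (cv (WO v x)) \<cdot> Phi (Nx c k s D) x" if x: "x \<in> Obj C" for x
    proof -
      let ?h = "TA s (WA w (cv (WO v x)))"
      have 1: "WA (forest_word True k) ?h \<cdot> caps k (TO s (WO (upper D) x)) = caps k (TO s (WO (upper D') x)) \<cdot> ?h"
        using caps_natural[of ?h k] x D' w by simp
      show ?thesis using x D' w Cmp_rotate[OF 1, of "TA s (Phi D x) \<cdot> cups c (TO s (WO (lower D) x))"] by simp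
    qed
    then show ?thesis by (intro exI[of _ "Nx c k s D'"]) (use D' w in auto)
  qed
qed

lemma Phi_remove:
  assumes "upper D = u @ False # True # v"
  shows "\<exists>D'. lower D' = lower D \<and> upper D' = u @ v \<and>
    (\<forall>x\<in>Obj C. Phi D' x = WA u (ev (WO v x)) \<cdot> Phi D x)"
  using assms
proof (induction D arbitrary: u v)
  case (End c k)
  then obtain k' where k': "forest_word True k' = u @ v"
    "\<And>x. x\<in>Obj C \<Longrightarrow> caps k' x = WA u (ev (WO v x)) \<cdot> caps k x" using caps_remove[of k u v] by auto
  have "WO u (TO False (TO True (WO v x))) = WO (forest_word True k) x" for x using End by simp
  then show ?case by (intro exI[of _ "End c k'"]) (auto simp: k')
next
  case (Nx c k s D)
  \<comment> \<open>Four positions of the pair \<open>False\<close>, \<open>True\<close>: within the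
    caps of the first gap, the last cap end together with the strand, the strand together with the
    letter after it, or beyond the strand.\<close>
  then have "(\<exists>w. forest_word True k = u @ False # True # w \<and> v = w @ s # upper D) \<or>
      (forest_word True k = u @ [False] \<and> s = True \<and> v = upper D) \<or>
      (u = forest_word True k \<and> s = False \<and> upper D = True # v) \<or>
      (\<exists>w. u = forest_word True k @ s # w \<and> upper D = w @ False # True # v)"
    by (auto simp: append_eq_append_conv2 append_eq_Cons_conv Cons_eq_append_conv)
  then show ?case
  proof (elim disjE exE conjE)
    fix w assume w: "forest_word True k = u @ False # True # w" "v = w @ s # upper D"
    from caps_remove[OF w(1)] obtain k' where k': "forest_word True k' = u @ w"
      "\<And>x. x\<in>Obj C \<Longrightarrow> caps k' x = WA u (ev (WO w x)) \<cdot> caps k x" by blast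
    show ?thesis by (rule exI[of _ "Nx c k' s D"]) (use k' w in auto)
  next
    fix w assume w: "u = forest_word True k @ s # w" "upper D = w @ False # True # v"
    from Nx.IH[OF w(2)] obtain D' where D': "lower D' = lower D" "upper D' = w @ v"
      "\<And>x. x\<in>Obj C \<Longrightarrow> Phi D' x = WA w (ev (WO v x)) \<cdot> Phi D x" by blast
    have "Phi (Nx c k s D') x = WA u (ev (WO v x)) \<cdot> Phi (Nx c k s D) x" if x: "x \<in> Obj C" for x
    proof -
      let ?h = "TA s (WA w (ev (WO v x)))"
      have 1: "WA (forest_word True k) ?h \<cdot> caps k (TO s (WO (upper D) x)) = caps k (TO s (WO (upper D') x)) \<cdot> ?h"
        using caps_natural[of ?h k] x D' w by simp
      show ?thesis using x D' w Cmp_rotate[OF 1, of "TA s (Phi D x) \<cdot> cups c (TO s (WO (lower D) x))"] by simp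
    qed
    then show ?thesis by (intro exI[of _ "Nx c k s D'"]) (use D' w in auto)
  next
    assume w: "forest_word True k = u @ [False]" "s = True" "v = upper D"
    from caps_last[OF w(1)] obtain k1 k2 where k: "u = forest_word True k1 @ True # forest_word True k2"
      "\<And>x. x\<in>Obj C \<Longrightarrow> WA u (ev x) \<cdot> caps k (TO True x)
         = caps k1 (TO True (WO (forest_word True k2) x)) \<cdot> TA True (caps k2 x)" by blast
    have "Phi (Nx c k1 True (diag_prepend Leaf k2 D)) x = WA u (ev (WO v x)) \<cdot> Phi (Nx c k s D) x"
      if x: "x \<in> Obj C" for x
      using k(2)[of "WO v x"] x w k(1)
        Cmp_rotate[OF k(2)[of "WO v x"], of "TA s (Phi D x) \<cdot> cups c (TO s (WO (lower D) x))"]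
      by (simp add: Phi_diag_prepend)
    then show ?thesis
      by (intro exI[of _ "Nx c k1 True (diag_prepend Leaf k2 D)"]) (use k w in auto)
  next
    assume w: "u = forest_word True k" "s = False" "upper D = True # v"
    show ?thesis
    proof (cases D)
      case (End c' k')
      with w obtain f g where k': "k' = Br f g" "v = forest_word True f @ False # forest_word True g" by (cases k') auto
      have "Phi (Nx c (forest_append k f) False (End c' g)) x = WA u (ev (WO v x)) \<cdot> Phi (Nx c k s D) x"
        if x: "x \<in> Obj C" for x
      proof -
        have 1: "WA (forest_word True k) (ev (WO v x)) \<cdot> caps k (TO False (TO True (WO v x))) = caps k (WO v x) \<cdot> ev (WO v x)"
          using caps_natural[of "ev (WO v x)" k] x by simp
        have "WA u (ev (WO v x)) \<cdot> Phi (Nx c k s D) x =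
          WA (forest_word True k) (ev (WO v x)) \<cdot> caps k (TO False (TO True (WO v x))) \<cdot>
          TA False (caps (Br f g) x) \<cdot> TA False (cups c' x) \<cdot> cups c (TO False (WO (lower D) x))"
          using x w End k' by simp
        also have "\<dots> = caps k (WO v x) \<cdot> ev (WO v x) \<cdot>
          TA False (caps (Br f g) x) \<cdot> TA False (cups c' x) \<cdot> cups c (TO False (WO (lower D) x))"
          using x w End k' Cmp_rotate[OF 1, of "TA False (caps (Br f g) x) \<cdot> TA False (cups c' x) \<cdot> cups c (TO False (WO (lower D) x))"]
          by simp
        also have "\<dots> = caps k (WO v x) \<cdot> caps f (TO False (WO (forest_word True g) x)) \<cdot> TA False (caps g x)
          \<cdot> TA False (cups c' x) \<cdot> cups c (TO False (WO (lower D) x))"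
          using x w End k' Cmp_rotate[OF ev_caps_Br[OF x, of f g], of "TA False (cups c' x) \<cdot> cups c (TO False (WO (lower D) x))"]
          by (simp del: caps.simps)
        finally show ?thesis using x End k' by (simp add: caps_forest_append)
      qed
      then show ?thesis
        by (intro exI[of _ "Nx c (forest_append k f) False (End c' g)"]) (use w k' End in auto)
    next
      case D: (Nx c' k' s' D')
      show ?thesis
      proof (cases k')
        case (Br f g)
        have v: "v = forest_word True f @ False # forest_word True g @ s' # upper D'" using D Br w by simp
        have "Phi (Nx c (forest_append k f) False (Nx c' g s' D')) x = WA u (ev (WO v x)) \<cdot> Phi (Nx c k s D) x"
          if x: "x \<in> Obj C" for x
        proof -
          let ?y = "TO s' (WO (upper D') x)"
          let ?r = "TA False (TA s' (Phi D' x)) \<cdot> TA False (cups c' (TO s' (WO (lower D') x))) \<cdot> cups c (TO False (WO (lower D) x))"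
          have 1: "WA (forest_word True k) (ev (WO v x)) \<cdot> caps k (TO False (TO True (WO v x))) = caps k (WO v x) \<cdot> ev (WO v x)"
            using caps_natural[of "ev (WO v x)" k] x by simp
          have "WA u (ev (WO v x)) \<cdot> Phi (Nx c k s D) x =
            WA (forest_word True k) (ev (WO v x)) \<cdot> caps k (TO False (TO True (WO v x))) \<cdot>
            TA False (caps (Br f g) ?y) \<cdot> ?r"
            using x w D Br v by simp
          also have "\<dots> = caps k (WO v x) \<cdot> ev (WO v x) \<cdot> TA False (caps (Br f g) ?y) \<cdot> ?r"
            using x w D Br v Cmp_rotate[OF 1, of "TA False (caps (Br f g) ?y) \<cdot> ?r"]
            by simp
          also have "\<dots> = caps k (WO v x) \<cdot> caps f (TO False (WO (forest_word True g) ?y)) \<cdot> TA False (caps g ?y) \<cdot> ?r"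
            using x w D Br v Cmp_rotate[OF ev_caps_Br[of ?y f g], of ?r]
            by (simp del: caps.simps)
          finally show ?thesis using x D Br v by (simp add: caps_forest_append)
        qed
        then show ?thesis
          by (intro exI[of _ "Nx c (forest_append k f) False (Nx c' g s' D')"]) (use w Br D in auto)
      next
        \<comment> \<open>Two strands \<open>-\<close>, \<open>+\<close> with no caps between them
          are joined at the top. They disappear as strands, and their lower ends become the ends of
          a new cup around \<open>c'\<close>; this is the only place where a cup arises.\<close>
        case Leaf
        with D w have s': "s' = True" and v: "v = upper D'" by auto
        have "Phi (diag_prepend (forest_append c (Br c' Leaf)) k D') x = WA u (ev (WO v x)) \<cdot> Phi (Nx c k s D) x"
          if x: "x \<in> Obj C" for x
        proof -
          let ?p = "Phi D' x"
          let ?r = "TA False (cups c' (TO True (WO (lower D') x))) \<cdot> cups c (TO False (WO (lower D) x))"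
          have 1: "WA (forest_word True k) (ev (WO v x)) \<cdot> caps k (TO False (TO True (WO v x))) = caps k (WO v x) \<cdot> ev (WO v x)"
            using caps_natural[of "ev (WO v x)" k] x by simp
          have 2: "ev (WO v x) \<cdot> TA False (TA True ?p) = ?p \<cdot> ev (WO (lower D') x)"
            using ev_natural[of ?p] x v by simp
          have "WA u (ev (WO v x)) \<cdot> Phi (Nx c k s D) x =
            WA (forest_word True k) (ev (WO v x)) \<cdot> caps k (TO False (TO True (WO v x))) \<cdot>
            TA False (TA True ?p) \<cdot> ?r"
            using x w D Leaf v s' by simp
          also have "\<dots> = caps k (WO v x) \<cdot> ev (WO v x) \<cdot> TA False (TA True ?p) \<cdot> ?r"
            using x w D v s' Cmp_rotate[OF 1, of "TA False (TA True ?p) \<cdot> ?r"]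
            by simp
          also have "\<dots> = caps k (WO v x) \<cdot> ?p \<cdot> ev (WO (lower D') x) \<cdot> ?r"
            using x w D v s' Cmp_rotate[OF 2, of ?r] by simp
          finally show ?thesis using x D v s' Leaf by (simp add: Phi_diag_prepend cups_forest_append)
        qed
        then show ?thesis
          by (intro exI[of _ "diag_prepend (forest_append c (Br c' Leaf)) k D'"]) (use w s' v D Leaf in auto)
      qed
    qed
  qed
qed

text \<open>A forest of cups is applied one contraction at a time, from the inside outwards, so that
  each contracted pair is adjacent when its turn comes.\<close>

lemma Phi_cups:
  assumes "upper D = u @ forest_word False c @ v"
  shows "\<exists>D'. lower D' = lower D \<and> upper D' = u @ v \<and>
    (\<forall>x\<in>Obj C. Phi D' x = WA u (cups c (WO v x)) \<cdot> Phi D x)"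
  using assms
proof (induction c arbitrary: D u v)
  case Leaf
  then show ?case by (intro exI[of _ D]) auto
next
  case (Br f g)
  from Br.IH(1)[of D "u @ [False]" "True # forest_word False g @ v"] Br.prems
  obtain D1 where D1: "lower D1 = lower D" "upper D1 = u @ False # True # forest_word False g @ v"
    "\<And>x. x\<in>Obj C \<Longrightarrow> Phi D1 x = WA u (TA False (cups f (TO True (WO (forest_word False g) (WO v x))))) \<cdot> Phi D x"
    by auto
  from Phi_remove[OF D1(2)] obtain D2 where D2: "lower D2 = lower D1" "upper D2 = u @ forest_word False g @ v"
    "\<And>x. x\<in>Obj C \<Longrightarrow> Phi D2 x = WA u (ev (WO (forest_word False g) (WO v x))) \<cdot> Phi D1 x" by auto
  from Br.IH(2)[OF D2(2)] obtain D3 where D3: "lower D3 = lower D2" "upper D3 = u @ v"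
    "\<And>x. x\<in>Obj C \<Longrightarrow> Phi D3 x = WA u (cups g (WO v x)) \<cdot> Phi D2 x" by auto
  show ?case
    by (rule exI[of _ D3]) (use D1 D2 D3 Br.prems in auto)
qed

lemma Phi_caps:
  assumes "upper D = u @ v"
  shows "\<exists>D'. lower D' = lower D \<and> upper D' = u @ forest_word True k @ v \<and>
    (\<forall>x\<in>Obj C. Phi D' x = WA u (caps k (WO v x)) \<cdot> Phi D x)"
  using assms
proof (induction k arbitrary: D u v)
  case Leaf
  then show ?case by (intro exI[of _ D]) auto
next
  case (Br f g)
  from Br.IH(2)[OF Br.prems] obtain D1 where D1: "lower D1 = lower D" "upper D1 = u @ forest_word True g @ v"
    "\<And>x. x\<in>Obj C \<Longrightarrow> Phi D1 x = WA u (caps g (WO v x)) \<cdot> Phi D x" by auto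
  from Phi_insert[OF D1(2)] obtain D2 where D2: "lower D2 = lower D1" "upper D2 = u @ True # False # forest_word True g @ v"
    "\<And>x. x\<in>Obj C \<Longrightarrow> Phi D2 x = WA u (cv (WO (forest_word True g) (WO v x))) \<cdot> Phi D1 x" by auto
  from Br.IH(1)[of D2 "u @ [True]" "False # forest_word True g @ v"] D2
  obtain D3 where D3: "lower D3 = lower D2" "upper D3 = u @ forest_word True (Br f g) @ v"
    "\<And>x. x\<in>Obj C \<Longrightarrow> Phi D3 x = WA u (TA True (caps f (TO False (WO (forest_word True g) (WO v x))))) \<cdot> Phi D2 x"
    by auto
  show ?case
    by (rule exI[of _ D3]) (use D1 D2 D3 Br.prems in auto)
qed

text \<open>\<open>E\<close> is applied behind a prefix \<open>u\<close> of the boundary because the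
  recursion passes the strand of each gap to the prefix. The caps of the gap are inserted only after
  the rest of \<open>E\<close>.\<close>

lemma Phi_compose_at:
  assumes "upper D = u @ lower E"
  shows "\<exists>D'. lower D' = lower D \<and> upper D' = u @ upper E \<and>
    (\<forall>x\<in>Obj C. Phi D' x = WA u (Phi E x) \<cdot> Phi D x)"
  using assms
proof (induction E arbitrary: D u)
  case (End c k)
  from Phi_cups[of D u c "[]"] End obtain D1 where D1: "lower D1 = lower D" "upper D1 = u @ []"
    "\<And>x. x\<in>Obj C \<Longrightarrow> Phi D1 x = WA u (cups c x) \<cdot> Phi D x" by auto
  from Phi_caps[OF D1(2), of k] obtain D2 where D2: "lower D2 = lower D1" "upper D2 = u @ forest_word True k"
    "\<And>x. x\<in>Obj C \<Longrightarrow> Phi D2 x = WA u (caps k x) \<cdot> Phi D1 x" by auto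
  show ?case by (rule exI[of _ D2]) (use D1 D2 End in auto)
next
  case (Nx c k s E)
  from Phi_cups[of D u c "s # lower E"] Nx.prems
  obtain D1 where D1: "lower D1 = lower D" "upper D1 = (u @ [s]) @ lower E"
    "\<And>x. x\<in>Obj C \<Longrightarrow> Phi D1 x = WA u (cups c (TO s (WO (lower E) x))) \<cdot> Phi D x" by auto
  from Nx.IH[OF D1(2)] obtain D2 where D2: "lower D2 = lower D1" "upper D2 = u @ s # upper E"
    "\<And>x. x\<in>Obj C \<Longrightarrow> Phi D2 x = WA u (TA s (Phi E x)) \<cdot> Phi D1 x" by auto
  from Phi_caps[OF D2(2), of k] obtain D3 where D3: "lower D3 = lower D2" "upper D3 = u @ forest_word True k @ s # upper E"
    "\<And>x. x\<in>Obj C \<Longrightarrow> Phi D3 x = WA u (caps k (TO s (WO (upper E) x))) \<cdot> Phi D2 x" by auto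
  show ?case by (rule exI[of _ D3]) (use D1 D2 D3 Nx.prems in auto)
qed

text \<open>The witness is produced inside one fixed action; that a single witness serves two
  actions at once is a separate fact, \<open>joint_compose\<close>.\<close>

lemma Phi_compose:
  assumes "upper D = lower E"
  shows "\<exists>D'. lower D' = lower D \<and> upper D' = upper E \<and> (\<forall>x\<in>Obj C. Phi D' x = Phi E x \<cdot> Phi D x)"
  using Phi_compose_at[of D "[]" E] assms by simp

end

section \<open>Cups as balanced words\<close>

text \<open>A sign \<open>-\<close> counts 1 and a sign \<open>+\<close> counts -1, so that the word
  of a forest of cups is a Dyck path.\<close>

definition height :: "bool list \<Rightarrow> int" where
  "height w = sum_list (map (\<lambda>s. if s then - 1 else 1) w)"

lemma height_simps [simp]: "height [] = 0" "height (s # w) = (if s then - 1 else 1) + height w" "height (u @ v) = height u + height v"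
  by (auto simp: height_def)

lemma height_forest_word [simp]: "height (forest_word s f) = 0"
  by (induction f) auto

lemma height_forest_word_prefix: "forest_word False f = u @ v \<Longrightarrow> height u \<ge> 0"
proof (induction f arbitrary: u v)
  case (Br f g)
  show ?case
  proof (cases u)
    case (Cons s u')
    then have "forest_word False f @ True # forest_word False g = u' @ v" "s = False" using Br.prems by auto
    then consider w where "forest_word False f = u' @ w" | "u' = forest_word False f @ [True]"
      | w where "u' = forest_word False f @ True # w" "forest_word False g = w @ v"
      by (auto simp: append_eq_append_conv2 append_eq_Cons_conv Cons_eq_append_conv)
    then show ?thesis
    proof cases
      case 1
      with Br.IH(1)[OF 1] Cons \<open>s = False\<close> show ?thesis by simp
    next
      case 2
      with Cons \<open>s = False\<close> show ?thesis by simp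
    next
      case 3
      with Br.IH(2)[OF 3(2)] Cons \<open>s = False\<close> show ?thesis by simp
    qed
  qed simp
qed simp

text \<open>First-return decomposition: cutting a Dyck path at its first return to height 0 gives an
  arc around its interior, followed by a shorter Dyck path.\<close>

lemma dyck_forest:
  assumes "height w = 0" "\<And>u v. w = u @ v \<Longrightarrow> height u \<ge> 0"
  shows "\<exists>f. forest_word False f = w"
  using assms
proof (induction w rule: length_induct)
  case (1 w)
  show ?case
  proof (cases w)
    case Nil
    then show ?thesis by (intro exI[of _ Leaf]) auto
  next
    case (Cons s w')
    with 1(3)[of "[s]" w'] have s: "s = False" by (auto split: if_splits)
    define n where "n = (LEAST n. 0 < n \<and> n \<le> length w \<and> height (take n w) = 0)"
    have ex: "0 < length w \<and> length w \<le> length w \<and> height (take (length w) w) = 0"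
      using 1 Cons by auto
    have n: "0 < n \<and> n \<le> length w \<and> height (take n w) = 0"
      unfolding n_def by (rule LeastI[of _ "length w"]) (rule ex)
    have least: "0 < height (take m w)" if "0 < m" "m < n" for m
    proof -
      have "\<not> (0 < m \<and> m \<le> length w \<and> height (take m w) = 0)"
        using not_less_Least[of m "\<lambda>n. 0 < n \<and> n \<le> length w \<and> height (take n w) = 0"] that n_def by simp
      moreover have "height (take m w) \<ge> 0" using 1(3)[of "take m w" "drop m w"] by simp
      ultimately show ?thesis using that n by simp
    qed
    have "n \<noteq> 1" using n Cons s by auto
    then obtain k where k: "n = Suc (Suc k)" using n by (cases n; cases "n - 1") auto
    define u where "u = take k w'"
    have klen: "k < length w'" using n k Cons by simp
    have t1: "take (Suc k) w = False # u" using Cons s by (simp add: u_def)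
    have t2: "take n w = False # u @ [w' ! k]" using Cons s k klen by (simp add: u_def take_Suc_conv_app_nth)
    have pos: "height (False # u) > 0" using least[of "Suc k"] k t1 by simp
    have "height (False # u @ [w' ! k]) = 0" using n t2 by simp
    with pos have b: "w' ! k = True" and hu: "height u = 0" by (auto split: if_splits)
    define v where "v = drop n w"
    have w: "w = False # u @ True # v"
      using t2 b append_take_drop_id[of n w] by (simp add: v_def)
    have "\<exists>f. forest_word False f = u"
    proof (rule 1(1)[rule_format])
      show "length u < length w" using w by simp
      show "height u = 0" by (rule hu)
      \<comment> \<open>Before the first return the heights of \<open>w\<close> are positive, and
        the opening letter accounts for 1 of them.\<close>
      fix p q assume pq: "u = p @ q"
      have "length u = k" using klen by (simp add: u_def)
      then have "length p \<le> k" using pq by simp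
      then have "0 < height (take (Suc (length p)) w)" using least[of "Suc (length p)"] k by simp
      then show "0 \<le> height p" using w pq by simp
    qed
    moreover have "\<exists>g. forest_word False g = v"
    proof (rule 1(1)[rule_format])
      show "length v < length w" using w by simp
      show "height v = 0" using w hu 1(2) by simp
      fix p q assume "v = p @ q"
      then show "0 \<le> height p" using 1(3)[of "False # u @ True # p" q] w hu by simp
    qed
    ultimately obtain f g where "forest_word False f = u" "forest_word False g = v" by blast
    then show ?thesis using w by (intro exI[of _ "Br f g"]) simp
  qed
qed

section \<open>Cup intervals as words of positive height\<close>

abbreviation word :: "'a set \<Rightarrow> 'a list \<Rightarrow> bool list" where
  "word S \<equiv> map (\<lambda>x. x \<in> S)"

lemma card_height: "distinct q \<Longrightarrow> int (card (set q - S)) - int (card (set q \<inter> S)) = height (word S q)"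
  by (induction q) (auto simp: insert_Diff_if)

lemma initial_segment_take:
  assumes "sorted_wrt (<) q" "initial_segment (set q) J"
  shows "J = set (take (length (takeWhile (\<lambda>x. x \<in> J) q)) q)"
proof -
  let ?t = "takeWhile (\<lambda>x. x \<in> J) q" and ?d = "dropWhile (\<lambda>x. x \<in> J) q"
  have "x \<in> set ?t" if x: "x \<in> J" for x
  proof (rule ccontr)
    assume "x \<notin> set ?t"
    moreover have "x \<in> set q" using x assms(2) by (auto simp: initial_segment_def)
    ultimately have xd: "x \<in> set ?d" by (metis UnE set_append takeWhile_dropWhile_id)
    then have ne: "?d \<noteq> []" by (metis empty_iff list.set(1))
    have "sorted_wrt (<) ?d" by (metis assms(1) sorted_wrt_append takeWhile_dropWhile_id)
    with ne xd have "hd ?d \<le> x" by (metis list.collapse order_le_less set_ConsD sorted_wrt.simps(2))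
    moreover have "hd ?d \<in> set q" using ne by (metis list.set_sel(1) set_dropWhileD)
    ultimately have "hd ?d \<in> J" using x assms(2) unfolding initial_segment_def by blast
    then show False using ne hd_dropWhile by blast
  qed
  then have "set ?t = J" by (auto dest: set_takeWhileD)
  then show ?thesis by (metis takeWhile_eq_take)
qed

lemma initial_segment_prefix:
  assumes "sorted_wrt (<) (u @ v)"
  shows "initial_segment (set (u @ v)) (set u)"
  using assms by (fastforce simp: initial_segment_def sorted_wrt_append dest: leD)

text \<open>Initial segments of a sorted list are its prefixes, and the comparison of cardinalities
  inside and outside \<open>S\<close> becomes a height. A cup is thus a path that returns to 0 at
  its end and is positive in between.\<close>

lemma is_cup_iff:
  assumes q: "sorted_wrt (<) q"
  shows "is_cup M S (set q) \<longleftrightarrow> interval_in M (set q) \<and> height (word S q) = 0 \<and>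
    (\<forall>u v. q = u @ v \<longrightarrow> u \<noteq> [] \<longrightarrow> v \<noteq> [] \<longrightarrow> height (word S u) > 0)"
proof -
  have d: "distinct q" using q strict_sorted_iff by blast
  have sc: "card (set q) = card (set q - S) + card (set q \<inter> S)"
    by (metis List.finite_set card_Diff_subset_Int card_mono finite_Int inf_le1 le_add_diff_inverse2)
  have bal: "even (card (set q)) \<and> card (S \<inter> set q) = card (set q) div 2 \<longleftrightarrow> height (word S q) = 0"
  proof -
    have "even (p + n) \<and> n = (p + n) div 2 \<longleftrightarrow> int p - int n = 0" for p n :: nat by presburger
    then show ?thesis using card_height[OF d, of S] sc by (metis Int_commute)
  qed
  have J_eq: "(\<forall>J. initial_segment (set q) J \<and> J \<noteq> {} \<and> J \<noteq> set q \<longrightarrow> card (J \<inter> S) < card (J - S))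
    \<longleftrightarrow> (\<forall>u v. q = u @ v \<longrightarrow> u \<noteq> [] \<longrightarrow> v \<noteq> [] \<longrightarrow> height (word S u) > 0)" (is "?L \<longleftrightarrow> ?R")
  proof
    assume L: ?L
    show ?R
    proof (intro allI impI)
      fix u v assume uv: "q = u @ v" "u \<noteq> []" "v \<noteq> []"
      have "hd v \<in> set q" "hd v \<notin> set u" using uv d hd_in_set[of v] by auto
      then have "set u \<noteq> set q" by blast
      moreover have "initial_segment (set q) (set u)" using initial_segment_prefix[of u v] q uv(1) by simp
      ultimately have "card (set u \<inter> S) < card (set u - S)" using L uv(2) by simp
      then show "height (word S u) > 0" using card_height[of u S] uv d by simp
    qed
  next
    assume R: ?R
    show ?L
    proof (intro allI impI)
      fix J assume J: "initial_segment (set q) J \<and> J \<noteq> {} \<and> J \<noteq> set q"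
      define n where "n = length (takeWhile (\<lambda>x. x \<in> J) q)"
      have Jn: "J = set (take n q)" unfolding n_def using initial_segment_take[OF q] J by blast
      have "take n q \<noteq> []" using J Jn by (metis list.set(1))
      moreover have "drop n q \<noteq> []" using J Jn by (metis append_Nil2 append_take_drop_id)
      ultimately have "height (word S (take n q)) > 0" using R[rule_format, of "take n q" "drop n q"] by simp
      then show "card (J \<inter> S) < card (J - S)" using card_height[of "take n q" S] d Jn by simp
    qed
  qed
  show ?thesis unfolding is_cup_def J_eq using bal List.finite_set[of q] by argo
qed

text \<open>Exchanging \<open>S\<close> with its complement exchanges cups and caps; the facts about
  caps are obtained from those about cups in this way.\<close>

lemma is_cap_iff: "is_cap M S K \<longleftrightarrow> is_cup M (- S) K"
proof -
  have half: "card (- S \<inter> K) = card K div 2 \<longleftrightarrow> card (S \<inter> K) = card K div 2" if K: "finite K" "even (card K)"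
  proof -
    have "- S \<inter> K = K - S" "S \<inter> K = K \<inter> S" by auto
    moreover have "m = k div 2 \<longleftrightarrow> n = k div 2" if "k = n + m" "even k" for m n k :: nat
      using that by presburger
    ultimately show ?thesis using card_Int_Diff[OF K(1), of S] K(2) by metis
  qed
  have J: "J \<inter> - S = J - S" "J - - S = J \<inter> S" for J by auto
  show ?thesis unfolding is_cap_def is_cup_def J by (intro conj_cong refl half[symmetric])
qed

lemma cap_end_iff: "cap_end M S a b \<longleftrightarrow> cup_end M (- S) a b"
  unfolding cap_end_def cup_end_def is_cap_iff ..

lemma is_cup_card:
  assumes "is_cup M S K"
  shows "card (K \<inter> S) = card (K - S)"
proof -
  have "card K = card (K - S) + card (K \<inter> S)"
    using assms card_Diff_subset_Int[of K S] card_mono[of K "K \<inter> S"] by (simp add: is_cup_def)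
  moreover have "even (card K)" "card (K \<inter> S) = card K div 2" using assms by (auto simp: is_cup_def Int_commute)
  ultimately show ?thesis by presburger
qed

lemma is_cup_initial:
  assumes "is_cup M S K" "initial_segment K J" "J \<noteq> {}" "J \<noteq> K"
  shows "card (J \<inter> S) < card (J - S)"
  using assms by (simp add: is_cup_def)

lemma card_split:
  assumes "finite K" "J \<subseteq> K"
  shows "card (K \<inter> S) = card (J \<inter> S) + card ((K - J) \<inter> S)"
    "card (K - S) = card (J - S) + card ((K - J) - S)"
proof -
  have fin: "finite J" "finite (K - J)" using assms by (auto intro: finite_subset)
  have "K \<inter> S = (J \<inter> S) \<union> ((K - J) \<inter> S)" "K - S = (J - S) \<union> ((K - J) - S)" using assms by auto
  moreover have "card ((J \<inter> S) \<union> ((K - J) \<inter> S)) = card (J \<inter> S) + card ((K - J) \<inter> S)"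
    "card ((J - S) \<union> ((K - J) - S)) = card (J - S) + card ((K - J) - S)"
    using fin by (intro card_Un_disjoint; auto)+
  ultimately show "card (K \<inter> S) = card (J \<inter> S) + card ((K - J) \<inter> S)"
    "card (K - S) = card (J - S) + card ((K - J) - S)" by simp_all
qed

lemma cup_end_sign:
  assumes "cup_end M S a b"
  shows "a < b" "a \<notin> S" "b \<in> S"
proof -
  let ?K = "{x \<in> M. a \<le> x \<and> x \<le> b}"
  have cup: "is_cup M S ?K" and ab: "a \<in> M" "b \<in> M" "a \<le> b" using assms by (auto simp: cup_end_def)
  have fin: "finite ?K" using cup by (simp add: is_cup_def)
  have "a \<noteq> b"
  proof
    assume "a = b"
    then have "?K = {a}" using ab by auto
    then show False using cup by (simp add: is_cup_def)
  qed
  then show "a < b" using ab by simp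
  have "card ({a} \<inter> S) < card ({a} - S)"
    by (rule is_cup_initial[OF cup]) (use ab \<open>a \<noteq> b\<close> in \<open>auto simp: initial_segment_def\<close>)
  then show "a \<notin> S" by (cases "a \<in> S") auto
  have lt: "card ((?K - {b}) \<inter> S) < card ((?K - {b}) - S)"
    by (rule is_cup_initial[OF cup]) (use ab \<open>a < b\<close> in \<open>auto simp: initial_segment_def\<close>)
  show "b \<in> S"
  proof (rule ccontr)
    assume "b \<notin> S"
    then have "(?K - {b}) \<inter> S = ?K \<inter> S" by auto
    moreover have "card ((?K - {b}) - S) \<le> card (?K - S)" by (rule card_mono) (use fin in auto)
    ultimately show False using lt is_cup_card[OF cup] by simp
  qed
qed

text \<open>A shorter cup with the same left end would be a proper initial segment of the longer one
  and have a surplus of \<open>-\<close>, whereas a cup is balanced.\<close>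

lemma cup_end_unique_right:
  assumes "cup_end M S a b" "cup_end M S a b'"
  shows "b = b'"
proof -
  have False if "cup_end M S a b" "cup_end M S a b'" "b < b'" for b b'
  proof -
    let ?K = "{x \<in> M. a \<le> x \<and> x \<le> b}" and ?K' = "{x \<in> M. a \<le> x \<and> x \<le> b'}"
    have "b' \<in> ?K'" "b' \<notin> ?K" "a \<in> ?K" using that by (auto simp: cup_end_def)
    then have "?K \<noteq> ?K'" "?K \<noteq> {}" by blast+
    moreover have "initial_segment ?K' ?K" using that by (auto simp: initial_segment_def)
    ultimately have "card (?K \<inter> S) < card (?K - S)"
      using is_cup_initial[of M S ?K' ?K] that(2) by (simp add: cup_end_def)
    then show False using is_cup_card[of M S ?K] that by (simp add: cup_end_def)
  qed
  with assms show ?thesis by (metis linorder_neqE)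
qed

text \<open>Removing the shorter cup from the longer one would leave a proper initial segment that
  is balanced, against the surplus of \<open>-\<close> required there.\<close>

lemma cup_end_unique_left:
  assumes "cup_end M S a b" "cup_end M S a' b"
  shows "a = a'"
proof -
  have False if "cup_end M S a b" "cup_end M S a' b" "a < a'" for a a'
  proof -
    let ?K = "{x \<in> M. a \<le> x \<and> x \<le> b}" and ?K' = "{x \<in> M. a' \<le> x \<and> x \<le> b}"
    have sub: "?K' \<subseteq> ?K" using that by auto
    have "a \<in> ?K - ?K'" "b \<in> ?K" "b \<notin> ?K - ?K'" using that by (auto simp: cup_end_def)
    then have "?K - ?K' \<noteq> ?K" "?K - ?K' \<noteq> {}" by blast+
    moreover have "initial_segment ?K (?K - ?K')" using that by (auto simp: initial_segment_def)
    ultimately have "card ((?K - ?K') \<inter> S) < card ((?K - ?K') - S)"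
      using is_cup_initial[of M S ?K "?K - ?K'"] that(1) by (simp add: cup_end_def)
    moreover have "finite ?K" using that by (simp add: cup_end_def is_cup_def)
    moreover have "card (?K \<inter> S) = card (?K - S)" "card (?K' \<inter> S) = card (?K' - S)"
      using is_cup_card[of M S ?K] is_cup_card[of M S ?K'] that by (simp_all add: cup_end_def)
    ultimately show False using card_split[OF _ sub, of S] by linarith
  qed
  with assms show ?thesis by (metis linorder_neqE)
qed

text \<open>An overlap would be a proper initial segment of \<open>K'\<close> and so have more
  \<open>-\<close> than \<open>+\<close>, while the rest of \<open>K\<close> is an initial segment
  of \<open>K\<close> and has at least as many \<open>-\<close> as \<open>+\<close>; together
  \<open>K\<close> would not be balanced.\<close>

lemma cup_nested:
  assumes K: "is_cup M S K" "initial_segment M K" and K': "is_cup M S K'" "y \<in> K'" "y \<notin> K"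
  shows "K' \<inter> K = {}"
proof (rule ccontr)
  assume ne: "K' \<inter> K \<noteq> {}"
  have sub: "K \<subseteq> M" "K' \<subseteq> M" using K K' by (auto simp: is_cup_def interval_in_def)
  have fin: "finite K" using K by (simp add: is_cup_def)
  have 1: "card ((K' \<inter> K) \<inter> S) < card ((K' \<inter> K) - S)"
    by (rule is_cup_initial[OF K'(1)])
      (use ne K' K(2) sub in \<open>auto simp: initial_segment_def\<close>)
  have above: "a \<le> y" if "a \<in> K" for a
    using that K(2) K'(2,3) sub by (metis initial_segment_def nle_le subsetD)
  have seg: "initial_segment K (K - K')"
    unfolding initial_segment_def
  proof (intro conjI ballI impI)
    fix a b assume "a \<in> K - K'" "b \<in> K" "b \<le> a"
    moreover have "b \<notin> K'"
    proof
      assume "b \<in> K'"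
      moreover have "a \<le> y" "a \<in> M" using above \<open>a \<in> K - K'\<close> sub by auto
      ultimately have "a \<in> K'" using K'(1,2) \<open>b \<le> a\<close> unfolding is_cup_def interval_in_def by blast
      then show False using \<open>a \<in> K - K'\<close> by simp
    qed
    ultimately show "b \<in> K - K'" by simp
  qed auto
  have 2: "card ((K - K') \<inter> S) \<le> card ((K - K') - S)"
  proof (cases "K - K' = {}")
    case True
    show ?thesis unfolding True by simp
  next
    case False
    moreover have "K - K' \<noteq> K" using ne by blast
    ultimately show ?thesis using is_cup_initial[OF K(1) seg] by simp
  qed
  have e: "K - K' \<inter> K = K - K'" by blast
  show False
    using 1 2 is_cup_card[OF K(1)] card_split[OF fin Int_lower2[of K' K], where S = S, unfolded e] by linarith
qed

section \<open>Arcs and strand end points of a boundary\<close>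

primrec forest_size :: "forest \<Rightarrow> nat" where
  "forest_size Leaf = 0"
| "forest_size (Br f g) = Suc (Suc (forest_size f + forest_size g))"

lemma length_forest_word [simp]: "length (forest_word s f) = forest_size f"
  by (induction f) auto

text \<open>The entries of \<open>l\<close> are the boundary points in order, and positions 0 and
  \<open>Suc (forest_size f)\<close> are the ends of the first outermost arc. In simplification the
  split form \<open>arcs_Br\<close> replaces this equation.\<close>

primrec arcs :: "forest \<Rightarrow> 'a list \<Rightarrow> ('a \<times> 'a) set" where
  "arcs Leaf l = {}"
| "arcs (Br f g) l = insert (l ! 0, l ! Suc (forest_size f))
     (arcs f (take (forest_size f) (tl l)) \<union> arcs g (drop (Suc (Suc (forest_size f))) l))"

lemma arcs_Br [simp]: "length u = forest_size f \<Longrightarrow>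
    arcs (Br f g) (a # u @ b # v) = insert (a, b) (arcs f u \<union> arcs g v)"
  by (auto simp: nth_append)

declare arcs.simps(2) [simp del]

text \<open>Induction along a forest together with a list that is cut like its word, so that the
  ends of arcs appear as list elements and not as positions.\<close>

lemma forest_list_induct [consumes 1, case_names Leaf Br]:
  assumes "length l = forest_size f" and "P Leaf []"
    and "\<And>f g a u b v. length u = forest_size f \<Longrightarrow> length v = forest_size g \<Longrightarrow> P f u \<Longrightarrow> P g v \<Longrightarrow> P (Br f g) (a # u @ b # v)"
  shows "P f l"
  using assms(1)
proof (induction f arbitrary: l)
  case Leaf
  then show ?case using assms(2) by simp
next
  case (Br f g)
  then obtain a l' where l: "l = a # l'" "length l' = Suc (forest_size f + forest_size g)" by (cases l) auto
  have "l' = take (forest_size f) l' @ (l' ! forest_size f) # drop (Suc (forest_size f)) l'"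
    using l(2) by (simp add: id_take_nth_drop)
  moreover have "P (Br f g) (a # take (forest_size f) l' @ (l' ! forest_size f) # drop (Suc (forest_size f)) l')"
    by (rule assms(3)) (use Br.IH l in auto)
  ultimately show ?case using l by simp
qed

text \<open>
  One boundary of a diagram: forests separated by the end points of strands.
\<close>

datatype half = HE forest | HN forest bool half

primrec half_word :: "bool \<Rightarrow> half \<Rightarrow> bool list" where
  "half_word s (HE c) = forest_word s c"
| "half_word s (HN c t h) = forest_word s c @ t # half_word s h"

primrec half_size :: "half \<Rightarrow> nat" where
  "half_size (HE c) = forest_size c"
| "half_size (HN c t h) = Suc (forest_size c + half_size h)"

lemma length_half_word [simp]: "length (half_word s h) = half_size h"
  by (induction h) auto

primrec strands :: "half \<Rightarrow> 'a list \<Rightarrow> 'a list" where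
  "strands (HE c) l = []"
| "strands (HN c t h) l = l ! forest_size c # strands h (drop (Suc (forest_size c)) l)"

primrec half_arcs_of :: "half \<Rightarrow> 'a list \<Rightarrow> ('a \<times> 'a) set" where
  "half_arcs_of (HE c) l = arcs c l"
| "half_arcs_of (HN c t h) l = arcs c (take (forest_size c) l) \<union> half_arcs_of h (drop (Suc (forest_size c)) l)"

primrec signs :: "half \<Rightarrow> bool list" where
  "signs (HE c) = []"
| "signs (HN c t h) = t # signs h"

lemma HN_append [simp]:
  assumes "length u = forest_size c"
  shows "strands (HN c t h) (u @ a # v) = a # strands h v"
    "half_arcs_of (HN c t h) (u @ a # v) = arcs c u \<union> half_arcs_of h v"
  using assms by (auto simp: nth_append)

declare strands.simps(2) [simp del] half_arcs_of.simps(2) [simp del]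

lemma half_list_induct [consumes 1, case_names HE HN]:
  assumes "length l = half_size h" and "\<And>c u. length u = forest_size c \<Longrightarrow> P (HE c) u"
    and "\<And>c t h u a v. length u = forest_size c \<Longrightarrow> length v = half_size h \<Longrightarrow> P h v \<Longrightarrow> P (HN c t h) (u @ a # v)"
  shows "P h l"
  using assms(1)
proof (induction h arbitrary: l)
  case (HE c)
  then show ?case using assms(2) by simp
next
  case (HN c t h)
  have "l = take (forest_size c) l @ (l ! forest_size c) # drop (Suc (forest_size c)) l"
    using HN.prems by (simp add: id_take_nth_drop)
  moreover have "P (HN c t h) (take (forest_size c) l @ (l ! forest_size c) # drop (Suc (forest_size c)) l)"
    by (rule assms(3)) (use HN in auto)
  ultimately show ?case by simp
qed

lemma length_strands [simp]: "length (strands h l) = length (signs h)"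
  by (induction h arbitrary: l) (auto simp: strands.simps)

primrec lower_half :: "diag \<Rightarrow> half" where
  "lower_half (End c k) = HE c"
| "lower_half (Nx c k s D) = HN c s (lower_half D)"

primrec upper_half :: "diag \<Rightarrow> half" where
  "upper_half (End c k) = HE k"
| "upper_half (Nx c k s D) = HN k s (upper_half D)"

lemma lower_lower_half: "lower D = half_word False (lower_half D)" and upper_upper_half: "upper D = half_word True (upper_half D)"
  by (induction D; simp)+

lemma signs_upper_half [simp]: "signs (upper_half D) = signs (lower_half D)"
  by (induction D) auto

text \<open>Strands connect the two boundaries in order, so equality of the sign sequences is the
  only condition for two halves to form a diagram.\<close>

lemma ex_diag: "signs h = signs h' \<Longrightarrow> \<exists>D. lower_half D = h \<and> upper_half D = h'"
proof (induction h arbitrary: h')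
  case (HE c)
  then obtain k where "h' = HE k" by (cases h') auto
  then show ?case by (intro exI[of _ "End c k"]) auto
next
  case (HN c t h)
  then obtain c' h'' where h': "h' = HN c' t h''" "signs h = signs h''" by (cases h') auto
  with HN.IH obtain D where "lower_half D = h" "upper_half D = h''" by blast
  with h' show ?case by (intro exI[of _ "Nx c c' t D"]) auto
qed

lemma diag_eqI: "lower_half D = lower_half E \<Longrightarrow> upper_half D = upper_half E \<Longrightarrow> D = E"
proof (induction D arbitrary: E)
  case (End c k)
  then show ?case by (cases E) auto
next
  case (Nx c k s D)
  then show ?case by (cases E) auto
qed

lemma arcs_set: "length l = forest_size c \<Longrightarrow> Field (arcs c l) = set l"
  by (induction rule: forest_list_induct) (auto simp: Field_insert)

text \<open>The Dyck word \<open>f\<close> certifies that the segment from \<open>a\<close> to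
  \<open>b\<close> is one arc with everything it encloses; for \<open>s = False\<close> this is the
  list form of a cup.\<close>

definition encloses :: "('a \<Rightarrow> bool) \<Rightarrow> bool \<Rightarrow> 'a \<Rightarrow> 'a list \<Rightarrow> 'a \<Rightarrow> bool" where
  "encloses w s a m b \<longleftrightarrow> (\<exists>f. map w (a # m @ [b]) = s # forest_word s f @ [\<not> s])"

lemma arcs_split:
  assumes "length l = forest_size c" "(a, b) \<in> arcs c l" "map w l = forest_word s c"
  shows "\<exists>u m v. l = u @ a # m @ b # v \<and> encloses w s a m b"
  using assms
proof (induction rule: forest_list_induct)
  case (Br f g p u q v)
  then have eq: "map w u = forest_word s f" "map w v = forest_word s g" and enc: "encloses w s p u q"
    by (auto simp: append_eq_append_conv encloses_def)
  from Br.prems(1) consider "a = p" "b = q" | "(a, b) \<in> arcs f u" | "(a, b) \<in> arcs g v"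
    using Br.hyps by auto
  then show ?case
  proof cases
    case 1
    then have "p # u @ q # v = [] @ a # u @ b # v" by simp
    with enc 1 show ?thesis by blast
  next
    case 2
    from Br.IH(1)[OF 2 eq(1)] obtain u' m v' where u: "u = u' @ a # m @ b # v'" and m: "encloses w s a m b"
      by blast
    have "p # u @ q # v = (p # u') @ a # m @ b # (v' @ q # v)" using u by simp
    with m show ?thesis by blast
  next
    case 3
    from Br.IH(2)[OF 3 eq(2)] obtain u' m v' where v: "v = u' @ a # m @ b # v'" and m: "encloses w s a m b"
      by blast
    have "p # u @ q # v = (p # u @ q # u') @ a # m @ b # v'" using v by simp
    with m show ?thesis by blast
  qed
qed simp

lemma strands_subset: "length l = half_size h \<Longrightarrow> set (strands h l) \<subseteq> set l"
  by (induction rule: half_list_induct) auto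

lemma half_arcs_of_set:
  assumes "length l = half_size h" "distinct l"
  shows "Field (half_arcs_of h l) = set l - set (strands h l)"
  using assms
proof (induction rule: half_list_induct)
  case (HN c t h u a v)
  then show ?case using strands_subset[of v h] by (auto simp: arcs_set)
qed (auto simp: arcs_set)

text \<open>Arcs stay within one gap, so no strand ends inside an arc. The last clause records this;
  it makes the interval of an arc disjoint from the strands.\<close>

lemma half_arcs_of_split:
  assumes "length l = half_size h" "(a, b) \<in> half_arcs_of h l" "map w l = half_word s h" "distinct l"
  shows "\<exists>u m v. l = u @ a # m @ b # v \<and> encloses w s a m b \<and>
    set (a # m @ [b]) \<inter> set (strands h l) = {}"
  using assms
proof (induction rule: half_list_induct)
  case (HE c u)
  then show ?case using arcs_split[of u c a b w s] by auto
next
  case (HN c t h u p v)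
  then have eq: "map w u = forest_word s c" "map w v = half_word s h" by (auto simp: append_eq_append_conv)
  have sub: "set (strands h v) \<subseteq> set v" using strands_subset HN.hyps by blast
  from HN.prems(1) consider "(a, b) \<in> arcs c u" | "(a, b) \<in> half_arcs_of h v" using HN.hyps by auto
  then show ?case
  proof cases
    case 1
    from arcs_split[OF HN.hyps(1) 1 eq(1)] obtain u' m v' where u: "u = u' @ a # m @ b # v'"
      and m: "encloses w s a m b" by blast
    have "u @ p # v = u' @ a # m @ b # (v' @ p # v)" using u by simp
    moreover have "set (a # m @ [b]) \<inter> set (strands (HN c t h) (u @ p # v)) = {}"
    proof -
      have "set (a # m @ [b]) \<subseteq> set u" using u by auto
      moreover have "set (strands (HN c t h) (u @ p # v)) \<inter> set u = {}"
        using HN.prems(3) HN.hyps sub by auto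
      ultimately show ?thesis by blast
    qed
    ultimately show ?thesis using m by blast
  next
    case 2
    have "distinct v" using HN.prems by simp
    from HN.IH[OF 2 eq(2) this] obtain u' m v' where v: "v = u' @ a # m @ b # v'"
      and m: "encloses w s a m b" and dis: "set (a # m @ [b]) \<inter> set (strands h v) = {}" by blast
    have "u @ p # v = (u @ p # u') @ a # m @ b # v'" using v by simp
    moreover have "set (a # m @ [b]) \<inter> set (strands (HN c t h) (u @ p # v)) = {}"
    proof -
      have "set (a # m @ [b]) \<subseteq> set v" using v by auto
      then have "p \<notin> set (a # m @ [b])" using HN.prems(3) by auto
      then show ?thesis using HN.hyps dis by auto
    qed
    ultimately show ?thesis using m by blast
  qed
qed

lemma forest_word_Not: "map Not (forest_word s f) = forest_word (\<not> s) f"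
  by (induction f) auto

text \<open>The opening \<open>-\<close> lifts the Dyck path of the interior by 1, so the heights
  strictly inside the segment are positive.\<close>

lemma arc_cup_end:
  assumes "sorted_wrt (<) l" "l = u @ a # m @ b # v" "encloses (\<lambda>x. x \<in> S) False a m b"
  shows "cup_end (set l) S a b" "{x \<in> set l. a \<le> x \<and> x \<le> b} = set (a # m @ [b])"
proof -
  let ?q = "a # m @ [b]"
  obtain f where f: "word S ?q = False # forest_word False f @ [True]" using assms(3) by (auto simp: encloses_def)
  have q: "sorted_wrt (<) ?q" and less: "\<And>x y. x \<in> set u \<Longrightarrow> y \<in> set ?q \<Longrightarrow> x < y"
    "\<And>x y. x \<in> set ?q \<Longrightarrow> y \<in> set v \<Longrightarrow> x < y"
    using assms(1,2) by (auto simp: sorted_wrt_append)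
  show K: "{x \<in> set l. a \<le> x \<and> x \<le> b} = set ?q"
  proof
    show "{x \<in> set l. a \<le> x \<and> x \<le> b} \<subseteq> set ?q"
      using less(1)[of _ a] less(2)[of b] assms(2) by (auto dest: leD)
    show "set ?q \<subseteq> {x \<in> set l. a \<le> x \<and> x \<le> b}"
      using q assms(2) by (auto simp: sorted_wrt_append less_imp_le)
  qed
  have "is_cup (set l) S (set ?q)"
    unfolding is_cup_iff[OF q]
  proof (intro conjI allI impI)
    show "interval_in (set l) (set ?q)"
      unfolding K[symmetric] interval_in_def by auto
    show "height (word S ?q) = 0" unfolding f by simp
    fix x y assume xy: "?q = x @ y" "x \<noteq> []" "y \<noteq> []"
    then obtain x' y' where x: "x = a # x'" and y: "y = y' @ [b]" and m: "m = x' @ y'"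
      by (cases x; cases y rule: rev_cases) (auto simp flip: append_assoc)
    have "forest_word False f = word S x' @ word S y'" "a \<notin> S" using f m by auto
    then show "0 < height (word S x)" using height_forest_word_prefix[of f "word S x'" "word S y'"] x by simp
  qed
  then show "cup_end (set l) S a b" unfolding cup_end_def K using q assms(2) by auto
qed

definition half_prepend :: "forest \<Rightarrow> half \<Rightarrow> half" where
  "half_prepend c h = (case h of HE d \<Rightarrow> HE (forest_append c d) | HN d t h' \<Rightarrow> HN (forest_append c d) t h')"

lemma half_word_half_prepend [simp]: "half_word s (half_prepend c h) = forest_word s c @ half_word s h"
  by (cases h) (auto simp: half_prepend_def)

lemma forest_size_forest_append [simp]: "forest_size (forest_append c d) = forest_size c + forest_size d"
  by (induction c) auto

lemma strands_half_prepend [simp]: "length u = forest_size c \<Longrightarrow> strands (half_prepend c h) (u @ v) = strands h v"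
  by (cases h) (auto simp: half_prepend_def strands.simps nth_append)

text \<open>The boundary is read greedily from the left. A first point in \<open>A\<close> ends a
  strand; any other first point lies in a cup, which is then an initial segment and parses as a
  forest. By \<open>cup_nested\<close> the cups through points outside it are disjoint from it, so
  the hypothesis is inherited by the remainder.\<close>

lemma parse_half:
  assumes "sorted_wrt (<) l" "A \<subseteq> set l"
    "\<And>x. x \<in> set l - A \<Longrightarrow> \<exists>K. is_cup (set l) S K \<and> x \<in> K \<and> K \<inter> A = {}"
  shows "\<exists>h. half_word False h = word S l \<and> set (strands h l) = A"
  using assms
proof (induction l arbitrary: A rule: length_induct)
  case (1 l)
  \<comment> \<open>The ambient set enters only through the interval condition, which survives the
    passage to a subset that contains the cup.\<close>
  have is_cup_mono: "is_cup (set r) S K" if "is_cup (set l) S K" "K \<subseteq> set r" "set r \<subseteq> set l" for r K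
    using that unfolding is_cup_def interval_in_def by (meson subset_iff)
  show ?case
  proof (cases l)
    case Nil
    then show ?thesis using 1 by (intro exI[of _ "HE Leaf"]) auto
  next
    case (Cons x r)
    then have r: "sorted_wrt (<) r" "\<And>y. y \<in> set r \<Longrightarrow> x < y" using 1 by auto
    show ?thesis
    proof (cases "x \<in> A")
      case True
      have "\<exists>h. half_word False h = word S r \<and> set (strands h r) = A - {x}"
      proof (rule 1(1)[rule_format])
        fix y assume y: "y \<in> set r - (A - {x})"
        with r(2) have "y \<noteq> x" by auto
        with y Cons 1(4)[of y] obtain K where K: "is_cup (set l) S K" "y \<in> K" "K \<inter> A = {}" by auto
        then have "K \<subseteq> set r" using True Cons by (auto simp: is_cup_def interval_in_def)
        then show "\<exists>K. is_cup (set r) S K \<and> y \<in> K \<and> K \<inter> (A - {x}) = {}"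
          using K is_cup_mono[OF K(1)] Cons by auto
      qed (use Cons r 1 in auto)
      then obtain h where h: "half_word False h = word S r" "set (strands h r) = A - {x}" by blast
      show ?thesis
        by (intro exI[of _ "HN Leaf (x \<in> S) h"])
          (use h Cons True in \<open>auto simp: strands.simps\<close>)
    next
      case False
      with Cons 1(4)[of x] obtain K where K: "is_cup (set l) S K" "x \<in> K" "K \<inter> A = {}" by auto
      then have iK: "interval_in (set l) K" by (simp add: is_cup_def)
      have seg: "initial_segment (set l) K"
        unfolding initial_segment_def
      proof (intro conjI ballI impI)
        show "K \<subseteq> set l" using iK by (simp add: interval_in_def)
        fix a b assume "a \<in> K" "b \<in> set l" "b \<le> a"
        moreover have "x \<le> b" using \<open>b \<in> set l\<close> Cons r(2) by (auto intro: less_imp_le)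
        ultimately show "b \<in> K" using iK K(2) unfolding interval_in_def by blast
      qed
      define n where "n = length (takeWhile (\<lambda>x. x \<in> K) l)"
      define q r' where "q = take n l" and "r' = drop n l"
      have Kq: "K = set q" unfolding q_def n_def by (rule initial_segment_take[OF 1(2) seg])
      have l: "l = q @ r'" by (simp add: q_def r'_def)
      have qs: "sorted_wrt (<) q" "sorted_wrt (<) r'" and dis: "set q \<inter> set r' = {}" "q \<noteq> []"
        using 1(2) l K(2) Kq by (auto simp: sorted_wrt_append)
      have "\<exists>c. forest_word False c = word S q"
      proof (rule dyck_forest)
        show "height (word S q) = 0" using K(1) is_cup_iff[OF qs(1)] Kq by blast
        fix u v assume uv: "word S q = u @ v"
        then obtain u' v' where "q = u' @ v'" "u = word S u'" "v = word S v'"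
          by (auto simp: map_eq_append_conv)
        then show "0 \<le> height u" using K(1)[unfolded Kq is_cup_iff[OF qs(1)]]
          by (cases "u' = []"; cases "v' = []") (auto intro: less_imp_le)
      qed
      then obtain c where c: "forest_word False c = word S q" by blast
      then have lc: "length q = forest_size c" by (metis length_forest_word length_map)
      have "\<exists>h. half_word False h = word S r' \<and> set (strands h r') = A"
      proof (rule 1(1)[rule_format])
        show "length r' < length l" using l dis by simp
        show "A \<subseteq> set r'" using 1(3) l K(3) Kq by auto
        fix y assume y: "y \<in> set r' - A"
        with l 1(4)[of y] obtain K' where K': "is_cup (set l) S K'" "y \<in> K'" "K' \<inter> A = {}" by auto
        have "K' \<inter> K = {}" using cup_nested[OF K(1) seg K'(1,2)] y dis Kq by auto
        then have "K' \<subseteq> set r'" using K'(1) l Kq by (auto simp: is_cup_def interval_in_def)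
        then show "\<exists>K. is_cup (set r') S K \<and> y \<in> K \<and> K \<inter> A = {}"
          using K' is_cup_mono[OF K'(1)] l by auto
      qed (rule qs)
      then obtain h where "half_word False h = word S r'" "set (strands h r') = A" by blast
      \<comment> \<open>The remainder may begin with further cups of the same gap, hence
        \<open>half_prepend\<close> and not a new constructor.\<close>
      then show ?thesis using c lc l by (intro exI[of _ "half_prepend c h"]) simp
    qed
  qed
qed

section \<open>Evaluation in relations between label streams\<close>

definition lift_rel :: "('a stream \<times> 'a stream) set \<Rightarrow> ('a stream \<times> 'a stream) set" where
  "lift_rel r = {(x, y). shd x = shd y \<and> (stl x, stl y) \<in> r}"

text \<open>One object suffices, since every word acts on the same set of streams. The operator
  \<open>O\<close> composes in diagrammatic order, opposite to \<open>Cmp\<close>.\<close>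

definition rel_cat :: "(nat, ('a \<times> 'a) set) cat" where
  "rel_cat = \<lparr>Obj = {0}, Arr = UNIV, Dom = \<lambda>_. 0, Cod = \<lambda>_. 0, Ident = \<lambda>_. Id, Cmp = \<lambda>s r. r O s\<rparr>"

definition contract_rel :: "('a stream \<times> 'a stream) set" where
  "contract_rel = {(x, y). shd x = shd (stl x) \<and> y = stl (stl x)}"

text \<open>Both signs act by the same functor \<open>lift_rel\<close>, which is adjoint to itself:
  \<open>contract_rel\<close> is the counit and its converse the unit.\<close>

interpretation R: adjoint_action "rel_cat :: (nat, (nat stream \<times> nat stream) set) cat"
  "\<lambda>s x. x" "\<lambda>s. lift_rel" "\<lambda>_. contract_rel" "\<lambda>_. contract_rel\<inverse>"
proof unfold_locales
  show "lift_rel (Cmp rel_cat g f) = Cmp rel_cat (lift_rel g) (lift_rel f)" for f g :: "(nat stream \<times> nat stream) set"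
  proof -
    have "(x, y) \<in> lift_rel f O lift_rel g" if "shd x = shd y" "(stl x, z) \<in> f" "(z, stl y) \<in> g" for x y z
      using that by (intro relcompI[of _ "shd x ## z"]) (auto simp: lift_rel_def)
    then show ?thesis by (auto simp: rel_cat_def lift_rel_def relcomp_unfold)
  qed
  show "lift_rel (Ident rel_cat x) = (Ident rel_cat y :: (nat stream \<times> nat stream) set)" for x y
    by (auto simp: rel_cat_def lift_rel_def stream.expand)
  have 0: "(x, y) \<in> contract_rel \<longleftrightarrow> (\<exists>a. x = a ## a ## y)" for x y :: "nat stream"
    by (auto simp: contract_rel_def) (metis stream.collapse)
  have 1: "(x, y) \<in> contract_rel O r \<longleftrightarrow> shd x = shd (stl x) \<and> (stl (stl x), y) \<in> r"
    and 4: "(x, y) \<in> r O contract_rel\<inverse> \<longleftrightarrow> shd y = shd (stl y) \<and> (x, stl (stl y)) \<in> r"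
    for x y :: "nat stream" and r
    by (auto simp: contract_rel_def relcomp_unfold)
  have 2: "(x, y) \<in> r O contract_rel \<longleftrightarrow> (\<exists>a. (x, a ## a ## y) \<in> r)"
    and 3: "(x, y) \<in> contract_rel\<inverse> O r \<longleftrightarrow> (\<exists>a. (a ## a ## x, y) \<in> r)"
    for x y :: "nat stream" and r
    by (auto simp: 0 relcomp_unfold)
  note simps = 1 2 3 4
  show "Cmp rel_cat contract_rel (lift_rel (lift_rel f)) = Cmp rel_cat f contract_rel" for f :: "(nat stream \<times> nat stream) set"
  proof -
    have "p \<in> lift_rel (lift_rel f) O contract_rel \<longleftrightarrow> p \<in> contract_rel O f" for p
      by (cases p; simp only: 1 2) (auto simp: lift_rel_def)
    then show ?thesis by (simp add: rel_cat_def set_eq_iff)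
  qed
  show "Cmp rel_cat (lift_rel (lift_rel f)) (contract_rel\<inverse>) = Cmp rel_cat (contract_rel\<inverse>) f" for f :: "(nat stream \<times> nat stream) set"
  proof -
    have "p \<in> contract_rel\<inverse> O lift_rel (lift_rel f) \<longleftrightarrow> p \<in> f O contract_rel\<inverse>" for p
      by (cases p; simp only: 3 4) (auto simp: lift_rel_def)
    then show ?thesis by (simp add: rel_cat_def set_eq_iff)
  qed
  have zz: "p \<in> lift_rel (contract_rel\<inverse>) O contract_rel \<longleftrightarrow> p \<in> Id"
    "p \<in> contract_rel\<inverse> O lift_rel contract_rel \<longleftrightarrow> p \<in> Id" for p :: "nat stream \<times> nat stream"
    by (cases p; simp only: 2 3; simp add: lift_rel_def contract_rel_def; metis stream.collapse)+
  show "Cmp rel_cat contract_rel (lift_rel (contract_rel\<inverse>)) = (Ident rel_cat x :: (nat stream \<times> nat stream) set)" for x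
    using zz(1) by (simp add: rel_cat_def set_eq_iff)
  show "Cmp rel_cat (lift_rel contract_rel) (contract_rel\<inverse>) = (Ident rel_cat x :: (nat stream \<times> nat stream) set)" for x
    using zz(2) by (simp add: rel_cat_def set_eq_iff)
qed (auto simp: rel_cat_def Hom_def split: if_splits)

lemma rel_cat_simps [simp]: "Cmp rel_cat s r = r O s" "Ident rel_cat x = Id" "Obj rel_cat = {0}" "Arr rel_cat = UNIV"
  by (simp_all add: rel_cat_def)

lemma R_WO [simp]: "R.WO w x = x"
  by (induction w) auto

abbreviation Rel :: "diag \<Rightarrow> (nat stream \<times> nat stream) set" where
  "Rel D \<equiv> R.Phi D 0"

lemma lift_rel_Cons [simp]: "(a ## x, y) \<in> lift_rel r \<longleftrightarrow> (\<exists>z. y = a ## z \<and> (x, z) \<in> r)"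
  "(x, a ## y) \<in> lift_rel r \<longleftrightarrow> (\<exists>z. x = a ## z \<and> (z, y) \<in> r)"
  by (auto simp: lift_rel_def) (metis stream.collapse)+

lemma contract_iff: "(x, y) \<in> contract_rel \<longleftrightarrow> shd x = shd (stl x) \<and> y = stl (stl x)"
  by (simp add: contract_rel_def)

lemma rel_cups: "length l = forest_size c \<Longrightarrow>
    (map f l @- t, x) \<in> R.cups c 0 \<longleftrightarrow> (\<forall>(a, b)\<in>arcs c l. f a = f b) \<and> x = t"
proof (induction arbitrary: t x rule: forest_list_induct)
  case (Br c d a u b v)
  have "(map f (a # u @ b # v) @- t, x) \<in> R.cups (Br c d) 0 \<longleftrightarrow>
    (\<exists>y z. (map f (a # u @ b # v) @- t, y) \<in> lift_rel (R.cups c 0) \<and> (y, z) \<in> contract_rel \<and> (z, x) \<in> R.cups d 0)"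
    by (auto simp: relcomp_unfold)
  also have "\<dots> \<longleftrightarrow> (\<forall>(a, b)\<in>arcs c u. f a = f b) \<and> f a = f b \<and> (map f v @- t, x) \<in> R.cups d 0"
    by (auto simp: Br.IH(1) contract_iff)
  finally show ?case unfolding Br.IH(2) arcs_Br[OF Br.hyps(1)] by auto
qed auto

lemma rel_caps: "length l = forest_size c \<Longrightarrow>
    (x, map f l @- t) \<in> R.caps c 0 \<longleftrightarrow> (\<forall>(a, b)\<in>arcs c l. f a = f b) \<and> x = t"
proof (induction arbitrary: t x rule: forest_list_induct)
  case (Br c d a u b v)
  have "(x, map f (a # u @ b # v) @- t) \<in> R.caps (Br c d) 0 \<longleftrightarrow>
    (\<exists>y z. (y, map f (a # u @ b # v) @- t) \<in> lift_rel (R.caps c 0) \<and> (y, z) \<in> contract_rel \<and> (x, z) \<in> R.caps d 0)"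
    by (auto simp: relcomp_unfold)
  also have "\<dots> \<longleftrightarrow> (\<forall>(a, b)\<in>arcs c u. f a = f b) \<and> f a = f b \<and> (x, map f v @- t) \<in> R.caps d 0"
    by (auto simp: Br.IH(1) contract_iff)
  finally show ?case unfolding Br.IH(2) arcs_Br[OF Br.hyps(1)] by auto
qed auto

lemma split_length:
  assumes "length l = Suc (m + n)"
  obtains u a v where "l = u @ a # v" "length u = m" "length v = n"
proof
  show "l = take m l @ (l ! m) # drop (Suc m) l" using assms by (simp add: id_take_nth_drop)
qed (use assms in auto)

text \<open>Arcs impose equations within a boundary, strands impose equations across, and the stream
  beyond the boundary is passed on unchanged. The streams met in between are determined by the outer
  ones, so the existential quantifiers of the composition disappear.\<close>

lemma Rel_iff: "length ms = half_size (lower_half D) \<Longrightarrow> length ns = half_size (upper_half D) \<Longrightarrow>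
    (map f ms @- t, map g ns @- t') \<in> Rel D \<longleftrightarrow>
      (\<forall>(a, b)\<in>half_arcs_of (lower_half D) ms. f a = f b) \<and> (\<forall>(a, b)\<in>half_arcs_of (upper_half D) ns. g a = g b) \<and>
      map f (strands (lower_half D) ms) = map g (strands (upper_half D) ns) \<and> t = t'"
proof (induction D arbitrary: ms ns)
  case (End c k)
  then show ?case by (auto simp: relcomp_unfold rel_cups rel_caps)
next
  case (Nx c k s D)
  obtain u a v where ms: "ms = u @ a # v" "length u = forest_size c" "length v = half_size (lower_half D)"
    using Nx.prems(1) by (auto elim: split_length)
  obtain u' a' v' where ns: "ns = u' @ a' # v'" "length u' = forest_size k" "length v' = half_size (upper_half D)"
    using Nx.prems(2) by (auto elim: split_length)
  have "(map f ms @- t, map g ns @- t') \<in> Rel (Nx c k s D) \<longleftrightarrow>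
    (\<exists>x y. (map f u @- (f a ## map f v @- t), x) \<in> R.cups c 0 \<and> (x, y) \<in> lift_rel (Rel D) \<and>
       (y, map g u' @- (g a' ## map g v' @- t')) \<in> R.caps k 0)"
    using ms ns by (auto simp: relcomp_unfold)
  also have "\<dots> \<longleftrightarrow> (\<forall>(a, b)\<in>arcs c u. f a = f b) \<and> (\<forall>(a, b)\<in>arcs k u'. g a = g b) \<and>
      f a = g a' \<and> (map f v @- t, map g v' @- t') \<in> Rel D"
    using ms(2) ns(2) by (auto simp: rel_cups rel_caps)
  finally show ?case unfolding Nx.IH[OF ms(3) ns(3)] ms(1) ns(1) lower_half.simps upper_half.simps HN_append[OF ms(2)] HN_append[OF ns(2)]
    by auto
qed

text \<open>An increasing map carries the sorted list \<open>xs\<close> to a sorted list, and a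
  strictly sorted list is determined by its set; so the order-preserving bijection pairs equal
  positions.\<close>

lemma cobbers_zip:
  fixes xs :: "'a::linorder list" and ys :: "'b::linorder list"
  assumes xs: "sorted_wrt (<) xs" and ys: "sorted_wrt (<) ys" and len: "length xs = length ys"
  shows "cobbers (set xs) (set ys) a b \<longleftrightarrow> (a, b) \<in> set (zip xs ys)"
proof
  assume "cobbers (set xs) (set ys) a b"
  then obtain h where h: "a \<in> set xs" "bij_betw h (set xs) (set ys)" "strict_mono_on (set xs) h" "h a = b"
    by (auto simp: cobbers_def)
  have "sorted_wrt (<) (map h xs)"
    unfolding sorted_wrt_map
    by (rule sorted_wrt_mono_rel[OF _ xs]) (use h(3) in \<open>auto simp: strict_mono_on_def\<close>)
  moreover have "set (map h xs) = set ys" using h(2) by (simp add: bij_betw_def)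
  ultimately have "map h xs = ys"
    using ys by (intro sorted_distinct_set_unique) (auto simp: strict_sorted_iff)
  then show "(a, b) \<in> set (zip xs ys)" using h(1,4) by (auto simp: in_set_zip in_set_conv_nth)
next
  assume ab: "(a, b) \<in> set (zip xs ys)"
  define h where "h = the \<circ> map_of (zip xs ys)"
  have dx: "distinct xs" and dy: "distinct ys" using xs ys strict_sorted_iff by blast+
  have h: "h (xs ! i) = ys ! i" if "i < length xs" for i
    using that dx len by (simp add: h_def map_of_zip_nth)
  have "map h xs = ys" using len h by (auto intro: nth_equalityI)
  then have "h ` set xs = set ys" by (metis set_map)
  moreover have "inj_on h (set xs)"
    using dy \<open>map h xs = ys\<close> distinct_map by blast
  moreover have "strict_mono_on (set xs) h"
    unfolding strict_mono_on_def
  proof (intro allI impI)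
    fix r s assume "r \<in> set xs \<and> s \<in> set xs \<and> r < s"
    then obtain i j where ij: "i < length xs" "j < length xs" "r = xs ! i" "s = xs ! j" "xs ! i < xs ! j"
      by (auto simp: in_set_conv_nth)
    have "i < j"
      using ij xs sorted_wrt_nth_less[OF xs, of j i] by (metis linorder_neqE_nat order_less_asym)
    then show "h r < h s" using ij h len sorted_wrt_nth_less[OF ys, of i j] by simp
  qed
  moreover have "a \<in> set xs" "h a = b"
    using ab h len by (auto simp: in_set_zip)
  ultimately show "cobbers (set xs) (set ys) a b"
    by (auto simp: cobbers_def bij_betw_def)
qed

text \<open>Only the signs of strands are stored; those of arcs follow from the argument of
  \<open>half_word\<close>. A cap boundary for \<open>S\<close> thereby becomes a cup boundary for
  the complement, with the same arcs and strands.\<close>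

primrec half_flip :: "half \<Rightarrow> half" where
  "half_flip (HE c) = HE c"
| "half_flip (HN c t h) = HN c (\<not> t) (half_flip h)"

lemma half_flip_simps [simp]: "half_flip (half_flip h) = h" "strands (half_flip h) l = strands h l" "half_arcs_of (half_flip h) l = half_arcs_of h l"
  "half_size (half_flip h) = half_size h" "signs (half_flip h) = map Not (signs h)"
  by (induction h arbitrary: l) (auto simp: strands.simps half_arcs_of.simps)

lemma half_word_half_flip: "half_word s (half_flip h) = map Not (half_word (\<not> s) h)"
  by (induction h) (auto simp: forest_word_Not)

lemma half_word_compl: "word S l = half_word True h \<longleftrightarrow> word (- S) l = half_word False (half_flip h)"
proof -
  have 1: "word (- S) l = map Not (word S l)" by simp
  have 2: "half_word False (half_flip h) = map Not (half_word True h)" by (simp add: half_word_half_flip)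
  have "inj Not" by (auto simp: inj_def)
  then show ?thesis unfolding 1 2 by (simp only: inj_map_eq_map)
qed

text \<open>A perfect matching of the \<open>-\<close> with the \<open>+\<close> outside
  \<open>A\<close>, directed from \<open>-\<close> to \<open>+\<close>. For caps it is used with the
  complement of the sign set, hence directed from \<open>+\<close> to \<open>-\<close>; these
  directions control the signs along a snake.\<close>

definition arc_matching :: "'a set \<Rightarrow> 'a set \<Rightarrow> 'a set \<Rightarrow> ('a \<times> 'a) set \<Rightarrow> bool" where
  "arc_matching M S A r \<longleftrightarrow>
     (\<forall>(a, b)\<in>r. a \<in> M \<and> a \<notin> A \<and> a \<notin> S \<and> b \<in> M \<and> b \<notin> A \<and> b \<in> S) \<and>
     (\<forall>a\<in>M - A - S. \<exists>b. (a, b) \<in> r) \<and> (\<forall>b\<in>(M - A) \<inter> S. \<exists>a. (a, b) \<in> r) \<and>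
     single_valued r \<and> single_valued (r\<inverse>)"

lemma arc_matchingD:
  assumes "arc_matching M S A r"
  shows "(a, b) \<in> r \<Longrightarrow> a \<in> M \<and> a \<notin> A \<and> a \<notin> S \<and> b \<in> M \<and> b \<notin> A \<and> b \<in> S"
    "a \<in> M \<Longrightarrow> a \<notin> A \<Longrightarrow> a \<notin> S \<Longrightarrow> \<exists>b. (a, b) \<in> r"
    "b \<in> M \<Longrightarrow> b \<notin> A \<Longrightarrow> b \<in> S \<Longrightarrow> \<exists>a. (a, b) \<in> r"
    "(a, b) \<in> r \<Longrightarrow> (a, b') \<in> r \<Longrightarrow> b = b'" "(a, b) \<in> r \<Longrightarrow> (a', b) \<in> r \<Longrightarrow> a = a'"
  using assms unfolding arc_matching_def single_valued_def by blast+

text \<open>Each arc bounds a cup, and the partner of a point in a cup is unique, which makes the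
  arcs a matching; that they cover all points off the strands is
  \<open>half_arcs_of_set\<close>.\<close>

lemma half_arcs:
  assumes "sorted_wrt (<) l" "word S l = half_word False h"
  shows "arc_matching (set l) S (set (strands h l)) (half_arcs_of h l)"
    and "(a, b) \<in> half_arcs_of h l \<Longrightarrow> cup_end (set l) S a b \<and>
      is_cup (set l) S {x \<in> set l. a \<le> x \<and> x \<le> b} \<and> {x \<in> set l. a \<le> x \<and> x \<le> b} \<inter> set (strands h l) = {}"
proof -
  have len: "length l = half_size h" by (metis assms(2) length_half_word length_map)
  have dis: "distinct l" using assms(1) strict_sorted_iff by blast
  have *: "cup_end (set l) S a b \<and> {x \<in> set l. a \<le> x \<and> x \<le> b} \<inter> set (strands h l) = {}"
    if ab: "(a, b) \<in> half_arcs_of h l" for a b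
  proof -
    from half_arcs_of_split[OF len ab assms(2) dis] obtain u m v where "l = u @ a # m @ b # v"
      "encloses (\<lambda>x. x \<in> S) False a m b" "set (a # m @ [b]) \<inter> set (strands h l) = {}" by blast
    with arc_cup_end[OF assms(1) this(1,2)] show ?thesis by simp
  qed
  then show "(a, b) \<in> half_arcs_of h l \<Longrightarrow> cup_end (set l) S a b \<and>
      is_cup (set l) S {x \<in> set l. a \<le> x \<and> x \<le> b} \<and> {x \<in> set l. a \<le> x \<and> x \<le> b} \<inter> set (strands h l) = {}"
    by (simp add: cup_end_def)
  have sub: "a \<notin> S" "b \<in> S" "a \<in> set l" "b \<in> set l" if "(a, b) \<in> half_arcs_of h l" for a b
    using *[OF that] cup_end_sign(2,3)[of "set l" S a b] unfolding cup_end_def by blast+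
  have Field: "Field (half_arcs_of h l) = set l - set (strands h l)" by (rule half_arcs_of_set[OF len dis])
  then have nA: "a \<notin> set (strands h l)" "b \<notin> set (strands h l)" if "(a, b) \<in> half_arcs_of h l" for a b
    using that by (auto simp: Field_def)
  have ex1: "\<exists>b. (a, b) \<in> half_arcs_of h l" if "a \<in> set l - set (strands h l) - S" for a
    using that sub Field by (auto simp: Field_def)
  have ex2: "\<exists>a. (a, b) \<in> half_arcs_of h l" if "b \<in> (set l - set (strands h l)) \<inter> S" for b
  proof -
    have "b \<in> Field (half_arcs_of h l)" using that Field by blast
    then show ?thesis using that sub(1) by (auto simp: Field_def)
  qed
  have sv: "single_valued (half_arcs_of h l)" "single_valued ((half_arcs_of h l)\<inverse>)"
    using * cup_end_unique_right[of "set l" S] cup_end_unique_left[of "set l" S]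
    by (auto simp: single_valued_def) blast+
  show "arc_matching (set l) S (set (strands h l)) (half_arcs_of h l)"
    unfolding arc_matching_def
  proof (intro conjI ballI sv)
    fix x assume "x \<in> half_arcs_of h l"
    with sub nA show "case x of (a, b) \<Rightarrow> a \<in> set l \<and> a \<notin> set (strands h l) \<and> a \<notin> S \<and>
        b \<in> set l \<and> b \<notin> set (strands h l) \<and> b \<in> S"
      by (cases x) simp
  qed (rule ex1 ex2; assumption)+
qed

text \<open>Snakes are defined by the cups of the ambient set, not by the arcs of a diagram. A point
  off the strands lies on an arc, the arc bounds a cup, and partners are unique; so a cup with one
  end off the strands is an arc.\<close>

lemma cup_end_arc:
  assumes "arc_matching M S A r" "\<And>a b. (a, b) \<in> r \<Longrightarrow> cup_end M S a b"
    and "cup_end M S a b" "a \<notin> A \<or> b \<notin> A"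
  shows "(a, b) \<in> r"
proof -
  have ab: "a \<in> M" "b \<in> M" "a \<notin> S" "b \<in> S"
    using assms(3) cup_end_sign(2,3)[OF assms(3)] unfolding cup_end_def by blast+
  from assms(4) show ?thesis
  proof
    assume "a \<notin> A"
    then obtain b' where "(a, b') \<in> r" using arc_matchingD(2)[OF assms(1)] ab by blast
    then show ?thesis using cup_end_unique_right[OF assms(2) assms(3)] by blast
  next
    assume "b \<notin> A"
    then obtain a' where "(a', b) \<in> r" using arc_matchingD(3)[OF assms(1)] ab by blast
    then show ?thesis using cup_end_unique_left[OF assms(2) assms(3)] by blast
  qed
qed

section \<open>Labellings, gluing and snakes\<close>

definition compatible :: "(nat \<Rightarrow> nat) \<Rightarrow> (nat \<Rightarrow> nat) \<Rightarrow> (nat \<times> nat) set \<Rightarrow> bool" where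
  "compatible f g r \<longleftrightarrow> (\<forall>a b. (a, b) \<in> r \<longrightarrow> f a = g b)"

lemma respD: "compatible f g r \<Longrightarrow> (a, b) \<in> r \<Longrightarrow> f a = g b"
  and respI: "(\<And>a b. (a, b) \<in> r \<Longrightarrow> f a = g b) \<Longrightarrow> compatible f g r"
  by (auto simp: compatible_def)

lemma compatible_converse [simp]: "compatible f g (r\<inverse>) \<longleftrightarrow> compatible g f r"
  by (auto simp: compatible_def)

definition strand_rel :: "'a set \<Rightarrow> 'b set \<Rightarrow> ('a \<times> 'b) set \<Rightarrow> bool" where
  "strand_rel A B r \<longleftrightarrow> r \<subseteq> A \<times> B \<and> (\<forall>a\<in>A. \<exists>b. (a, b) \<in> r) \<and> (\<forall>b\<in>B. \<exists>a. (a, b) \<in> r) \<and>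
     single_valued r \<and> single_valued (r\<inverse>)"

lemma strand_relD:
  assumes "strand_rel A B r"
  shows "(a, b) \<in> r \<Longrightarrow> a \<in> A \<and> b \<in> B" "a \<in> A \<Longrightarrow> \<exists>b. (a, b) \<in> r" "b \<in> B \<Longrightarrow> \<exists>a. (a, b) \<in> r"
    "(a, b) \<in> r \<Longrightarrow> (a, b') \<in> r \<Longrightarrow> b = b'" "(a, b) \<in> r \<Longrightarrow> (a', b) \<in> r \<Longrightarrow> a = a'"
  using assms unfolding strand_rel_def single_valued_def by blast+

lemma strand_rel_converse: "strand_rel A B r \<Longrightarrow> strand_rel B A (r\<inverse>)"
  unfolding strand_rel_def by auto

text \<open>
  Two composable diagrams \<open>M \<rightarrow> N \<rightarrow> P\<close> (indices 1 and 2) and a third one \<open>M \<rightarrow> P\<close> (index 3) such that each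
  labelling of the outer boundaries that respects the third extends to the middle. The hypothesis
  \<open>mono\<close> makes the alternating paths of cups and caps in \<open>N\<close> increase, so that they terminate.
\<close>

locale gluing =
  fixes M S A :: "nat set" and cu1 :: "(nat \<times> nat) set" and N T B :: "nat set" and ka1 \<sigma>1 :: "(nat \<times> nat) set"
    and C :: "nat set" and cu2 :: "(nat \<times> nat) set" and P U D :: "nat set" and ka2 \<sigma>2 :: "(nat \<times> nat) set"
    and E :: "nat set" and cu3 :: "(nat \<times> nat) set" and F :: "nat set" and ka3 \<sigma>3 :: "(nat \<times> nat) set"
  assumes fin: "finite N" and sub: "A \<subseteq> M" "B \<subseteq> N" "C \<subseteq> N" "D \<subseteq> P" "E \<subseteq> M" "F \<subseteq> P"
    and cu1: "arc_matching M S A cu1" and ka1: "arc_matching N (- T) B ka1" and s1: "strand_rel A B \<sigma>1"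
    and cu2: "arc_matching N T C cu2" and ka2: "arc_matching P (- U) D ka2" and s2: "strand_rel C D \<sigma>2"
    and cu3: "arc_matching M S E cu3" and ka3: "arc_matching P (- U) F ka3" and s3: "strand_rel E F \<sigma>3"
    and mono: "(a, b) \<in> cu2 \<union> ka1 \<Longrightarrow> a < b"
    and glue: "compatible f f cu3 \<Longrightarrow> compatible h h ka3 \<Longrightarrow> compatible f h \<sigma>3 \<Longrightarrow>
      \<exists>g. compatible f f cu1 \<and> compatible g g ka1 \<and> compatible f g \<sigma>1 \<and> compatible g g cu2 \<and> compatible h h ka2 \<and> compatible g h \<sigma>2"
begin

text \<open>Turning the picture upside down exchanges the two diagrams, cups with caps, and sign
  sets with their complements. Thus one argument treats both the domain and the codomain of a
  composite.\<close>

lemma flip: "gluing P (- U) D ka2 N (- T) C cu2 (\<sigma>2\<inverse>) B ka1 M (- S) A cu1 (\<sigma>1\<inverse>) F ka3 E cu3 (\<sigma>3\<inverse>)"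
proof unfold_locales
  fix f h :: "nat \<Rightarrow> nat"
  assume "compatible f f ka3" "compatible h h cu3" "compatible f h (\<sigma>3\<inverse>)"
  then show "\<exists>g. compatible f f ka2 \<and> compatible g g cu2 \<and> compatible f g (\<sigma>2\<inverse>) \<and> compatible g g ka1 \<and> compatible h h cu1 \<and> compatible g h (\<sigma>1\<inverse>)"
    using glue[of h f] by auto
qed (use fin sub cu1 ka1 s1 cu2 ka2 s2 cu3 ka3 s3 mono in \<open>auto intro: strand_rel_converse\<close>)

text \<open>If \<open>x\<close> were an end of an arc of the third diagram, the labelling with 1 at
  both ends of this arc and 0 elsewhere would extend to the middle. It gives \<open>y\<close> the
  label 1, but \<open>y'\<close>, which a strand connects to \<open>P\<close>, the label 0.\<close>

lemma strandI:
  assumes x: "(x, y) \<in> \<sigma>1" and y': "y' \<in> C" and g: "\<And>g. compatible g g ka1 \<Longrightarrow> compatible g g cu2 \<Longrightarrow> g y = g y'"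
  shows "x \<in> E"
proof (rule ccontr)
  assume "x \<notin> E"
  have xA: "x \<in> A" using strand_relD(1)[OF s1 x] by simp
  then have "x \<in> M" using sub by auto
  then obtain a b where ab: "(a, b) \<in> cu3" "x = a \<or> x = b"
    using arc_matchingD(2,3)[OF cu3, of x] \<open>x \<notin> E\<close> by blast
  define f :: "nat \<Rightarrow> nat" where "f = (\<lambda>z. if z = a \<or> z = b then 1 else 0)"
  have "compatible f f cu3"
  proof (rule respI)
    fix c d assume cd: "(c, d) \<in> cu3"
    have "c = a \<longleftrightarrow> d = b" using arc_matchingD(4,5)[OF cu3] ab(1) cd by blast
    moreover have "c \<noteq> b" "d \<noteq> a" using arc_matchingD(1)[OF cu3] ab(1) cd by blast+
    ultimately show "f c = f d" by (simp add: f_def)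
  qed
  moreover have "compatible f (\<lambda>_. 0) \<sigma>3"
  proof (rule respI)
    fix c d assume "(c, d) \<in> \<sigma>3"
    then have "c \<in> E" using strand_relD(1)[OF s3] by blast
    then have "c \<noteq> a" "c \<noteq> b" using arc_matchingD(1)[OF cu3 ab(1)] by blast+
    then show "f c = 0" by (simp add: f_def)
  qed
  ultimately obtain g where g1: "compatible g g ka1" "compatible f g \<sigma>1" "compatible g g cu2" "compatible g (\<lambda>_. 0) \<sigma>2"
    using glue[of f "\<lambda>_. 0"] by (auto simp: compatible_def)
  obtain z where "(y', z) \<in> \<sigma>2" using strand_relD(2)[OF s2 y'] by blast
  then have "g y' = 0" using respD[OF g1(4)] by blast
  moreover have "f x = g y" using respD[OF g1(2) x] .
  moreover have "f x = 1" using ab(2) by (auto simp: f_def)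
  ultimately show False using g[OF g1(1,3)] by simp
qed

text \<open>The two ends of the strand through \<open>x\<close> are labelled 1 and all other outer
  points 0. In the middle \<open>y\<close> is then the only point of \<open>B\<close> with label 1,
  so the path of cups and caps from \<open>y\<close> can stop only at a point of \<open>C\<close>,
  and it stops because it is monotone.\<close>

lemma strandD:
  assumes "x \<in> E"
  shows "\<exists>y y'. (x, y) \<in> \<sigma>1 \<and> y' \<in> C \<and> ((y, y') \<in> (cu2 O ka1)\<^sup>* \<or> (y', y) \<in> (ka1 O cu2)\<^sup>*)"
proof -
  obtain z where z: "(x, z) \<in> \<sigma>3" using strand_relD(2)[OF s3 assms] by blast
  define f h :: "nat \<Rightarrow> nat" where "f = (\<lambda>c. if c = x then 1 else 0)" and "h = (\<lambda>d. if d = z then 1 else 0)"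
  have "compatible f f cu3"
    by (rule respI) (use arc_matchingD(1)[OF cu3] assms in \<open>auto simp: f_def\<close>)
  moreover have "compatible h h ka3"
    by (rule respI) (use arc_matchingD(1)[OF ka3] strand_relD(1)[OF s3 z] in \<open>auto simp: h_def\<close>)
  moreover have "compatible f h \<sigma>3"
    by (rule respI) (use strand_relD(4,5)[OF s3] z in \<open>auto simp: f_def h_def\<close>)
  ultimately obtain g where g: "compatible f f cu1" "compatible g g ka1" "compatible f g \<sigma>1" "compatible g g cu2"
    using glue by blast
  have xM: "x \<in> M" using assms sub by auto
  have "x \<in> A"
  proof (rule ccontr)
    assume "x \<notin> A"
    then obtain a b where ab: "(a, b) \<in> cu1" "x = a \<or> x = b"
      using arc_matchingD(2,3)[OF cu1, of x] xM by blast
    have "a \<noteq> b" using arc_matchingD(1)[OF cu1 ab(1)] by blast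
    then show False using respD[OF g(1) ab(1)] ab(2) by (auto simp: f_def split: if_splits)
  qed
  then obtain y where y: "(x, y) \<in> \<sigma>1" using strand_relD(2)[OF s1] by blast
  then have gy: "g y = 1" and yB: "y \<in> B" "y \<in> N"
    using respD[OF g(3)] strand_relD(1)[OF s1] sub by (force simp: f_def)+
  have only: "b = y" if "b \<in> B" "g b = 1" for b
  proof -
    obtain a where a: "(a, b) \<in> \<sigma>1" using strand_relD(3)[OF s1 \<open>b \<in> B\<close>] by blast
    then have "f a = 1" using respD[OF g(3)] that by force
    then have "a = x" by (auto simp: f_def split: if_splits)
    then show ?thesis using strand_relD(4)[OF s1 y] a by blast
  qed
  show ?thesis
  proof (cases "y \<in> T")
    case False
    \<comment> \<open>The points reached from \<open>y\<close> by a cup of the second diagram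
      followed by a cap of the first, repeatedly. These steps increase, so \<open>Max R\<close> is
      the end of the path.\<close>
    define R where "R = {y'. (y, y') \<in> (cu2 O ka1)\<^sup>*}"
    have R: "y' \<in> N \<and> y' \<notin> T \<and> g y' = 1" if "y' \<in> R" for y'
      using that unfolding R_def mem_Collect_eq
    proof (induction rule: rtrancl_induct)
      case base
      then show ?case using False yB gy by simp
    next
      case (step y' y'')
      then obtain w where "(y', w) \<in> cu2" "(w, y'') \<in> ka1" by blast
      then show ?case using step arc_matchingD(1)[OF ka1] respD[OF g(2)] respD[OF g(4)] by force
    qed
    have "finite R" "y \<in> R" using fin R by (auto simp: R_def intro: finite_subset[of _ N])
    then have max: "Max R \<in> R" "\<And>r. r \<in> R \<Longrightarrow> r \<le> Max R" by (auto intro: Max_in)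
    have "Max R \<in> C"
    proof (rule ccontr)
      assume "Max R \<notin> C"
      then obtain w where w: "(Max R, w) \<in> cu2"
        using arc_matchingD(2)[OF cu2, of "Max R"] R[OF max(1)] by blast
      have wT: "w \<in> T" "w \<in> N" using arc_matchingD(1)[OF cu2 w] by auto
      have gw: "g w = 1" using respD[OF g(4) w] R[OF max(1)] by simp
      \<comment> \<open>The only point of \<open>B\<close> with label 1 is \<open>y\<close>, but
        \<open>w\<close> has sign \<open>+\<close> and \<open>y\<close> has sign
        \<open>-\<close>.\<close>
      have "w \<notin> B" using only[of w] gw wT False by blast
      then obtain v where v: "(w, v) \<in> ka1" using arc_matchingD(2)[OF ka1, of w] wT by blast
      then have "v \<in> R" using max(1) w unfolding R_def by (auto intro: rtrancl_into_rtrancl)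
      moreover have "Max R < v" using mono w v by (meson UnCI less_trans)
      ultimately show False using max(2) by fastforce
    qed
    then show ?thesis using y max(1) by (auto simp: R_def)
  next
    case True
    \<comment> \<open>From a \<open>+\<close> the arcs are traversed against their direction and
      lead to the left, so the minimum takes the part of the maximum.\<close>
    define R where "R = {y'. (y', y) \<in> (ka1 O cu2)\<^sup>*}"
    have R: "y' \<in> N \<and> y' \<in> T \<and> g y' = 1" if "y' \<in> R" for y'
      using that unfolding R_def mem_Collect_eq
    proof (induction rule: converse_rtrancl_induct)
      case base
      then show ?case using True yB gy by simp
    next
      case (step y' y'')
      then obtain w where "(y', w) \<in> ka1" "(w, y'') \<in> cu2" by blast
      then show ?case using step arc_matchingD(1)[OF ka1] respD[OF g(2)] respD[OF g(4)] by force
    qed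
    have "finite R" "y \<in> R" using fin R by (auto simp: R_def intro: finite_subset[of _ N])
    then have min: "Min R \<in> R" "\<And>r. r \<in> R \<Longrightarrow> Min R \<le> r" by (auto intro: Min_in)
    have "Min R \<in> C"
    proof (rule ccontr)
      assume "Min R \<notin> C"
      then obtain w where w: "(w, Min R) \<in> cu2"
        using arc_matchingD(3)[OF cu2, of "Min R"] R[OF min(1)] by blast
      have wT: "w \<notin> T" "w \<in> N" using arc_matchingD(1)[OF cu2 w] by auto
      have gw: "g w = 1" using respD[OF g(4) w] R[OF min(1)] by simp
      have "w \<notin> B" using only[of w] gw wT True by blast
      then obtain v where v: "(v, w) \<in> ka1" using arc_matchingD(3)[OF ka1, of w] wT by blast
      then have "v \<in> R" using min(1) w unfolding R_def by (auto intro: converse_rtrancl_into_rtrancl)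
      moreover have "v < Min R" using mono w v by (meson UnCI less_trans)
      ultimately show False using min(2) by fastforce
    qed
    then show ?thesis using y min(1) by (auto simp: R_def)
  qed
qed

end

text \<open>Arcs are taken in pairs, so the snake has even length. Each interior point ends one arc
  from \<open>r\<close> and one from \<open>q\<close>, and hence lies off \<open>C\<close> and off
  \<open>B\<close>.\<close>

lemma snake_rtrancl:
  assumes r: "\<And>a b. (a, b) \<in> r \<Longrightarrow> (cup_end N T a b \<or> cap_end N T a b) \<and> a \<in> N \<and> a \<notin> C \<and> b \<in> N \<and> b \<notin> C"
    and q: "\<And>a b. (a, b) \<in> q \<Longrightarrow> (cup_end N T a b \<or> cap_end N T a b) \<and> a \<in> N \<and> a \<notin> B \<and> b \<in> N \<and> b \<notin> B"
    and "(y, y') \<in> (r O q)\<^sup>*"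
  shows "snake N T ((N - B) \<inter> (N - C)) y y'"
proof -
  let ?H = "(N - B) \<inter> (N - C)"
  \<comment> \<open>The clause on \<open>s n\<close> strengthens the induction: the present end
    becomes an interior point in the next step, which by itself only shows that it lies off
    \<open>C\<close>.\<close>
  have "\<exists>(n::nat) s. even n \<and> s 0 = y \<and> s n = y' \<and> (\<forall>i. 0 < i \<and> i < n \<longrightarrow> s i \<in> ?H) \<and>
        (\<forall>m<n. cup_end N T (s m) (s (Suc m)) \<or> cap_end N T (s m) (s (Suc m))) \<and> (n > 0 \<longrightarrow> s n \<notin> B)"
    using assms(3)
  proof (induction rule: rtrancl_induct)
    case base
    show ?case by (rule exI[of _ 0], rule exI[of _ "\<lambda>_. y"]) simp
  next
    case (step y1 y2)
    then obtain n s where s: "even n" "s 0 = y" "s n = y1" "\<And>i. 0 < i \<Longrightarrow> i < n \<Longrightarrow> s i \<in> ?H"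
        "\<And>m. m < n \<Longrightarrow> cup_end N T (s m) (s (Suc m)) \<or> cap_end N T (s m) (s (Suc m))" "n > 0 \<Longrightarrow> s n \<notin> B"
      by blast
    from step obtain w where w: "(y1, w) \<in> r" "(w, y2) \<in> q" by blast
    define s' where "s' = (\<lambda>i. if i \<le> n then s i else if i = Suc n then w else y2)"
    have H: "s' i \<in> ?H" if "0 < i" "i < Suc (Suc n)" for i
      using that s(3,4,6) r[OF w(1)] q[OF w(2)] by (cases "i < n"; cases "i = n") (auto simp: s'_def)
    have st: "cup_end N T (s' m) (s' (Suc m)) \<or> cap_end N T (s' m) (s' (Suc m))" if "m < Suc (Suc n)" for m
      using that s(3) s(5)[of m] r[OF w(1)] q[OF w(2)] by (cases "m < n"; cases "m = n") (auto simp: s'_def)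
    show ?case
      by (rule exI[of _ "Suc (Suc n)"], rule exI[of _ s'])
        (use H st s(1,2) q[OF w(2)] in \<open>auto simp: s'_def\<close>)
  qed
  then show ?thesis unfolding snake_def by blast
qed

text \<open>Every step of the snake has an end at an interior point, which lies off \<open>B\<close>
  and \<open>C\<close>. By \<open>cup_end_arc\<close> the step is then an arc of one of the two
  diagrams, and labels agree along arcs.\<close>

lemma snake_compatible:
  assumes "snake N T ((N - B) \<inter> (N - C)) y y'" "arc_matching N T C cup_arcs" "\<And>a b. (a, b) \<in> cup_arcs \<Longrightarrow> cup_end N T a b"
    and "arc_matching N (- T) B cap_arcs" "\<And>a b. (a, b) \<in> cap_arcs \<Longrightarrow> cup_end N (- T) a b" "compatible g g cup_arcs" "compatible g g cap_arcs"
  shows "g y = g y'"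
proof -
  let ?H = "(N - B) \<inter> (N - C)"
  obtain n s where s: "even n" "s 0 = y" "s n = y'" "\<And>i. 0 < i \<Longrightarrow> i < n \<Longrightarrow> s i \<in> ?H"
      "\<And>m. m < n \<Longrightarrow> cup_end N T (s m) (s (Suc m)) \<or> cap_end N T (s m) (s (Suc m))"
    using assms(1) unfolding snake_def by blast
  have step: "g (s m) = g (s (Suc m))" if m: "m < n" for m
  proof -
    \<comment> \<open>Evenness enters here: a snake of length 1 has no interior point.\<close>
    have "Suc m < n \<or> 0 < m" using m s(1) by (cases m) (auto elim: evenE intro: Suc_lessI)
    then have "s m \<in> ?H \<or> s (Suc m) \<in> ?H" using s(4) m by blast
    then have "s m \<notin> C \<or> s (Suc m) \<notin> C" "s m \<notin> B \<or> s (Suc m) \<notin> B" by blast+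
    then have "(s m, s (Suc m)) \<in> cup_arcs \<or> (s m, s (Suc m)) \<in> cap_arcs"
      using s(5)[OF m] cup_end_arc[OF assms(2,3)] cup_end_arc[OF assms(4,5)] unfolding cap_end_iff by blast
    then show ?thesis using respD assms(6,7) by blast
  qed
  have "m \<le> n \<Longrightarrow> g (s m) = g y" for m
    by (induction m) (use s(2) step in auto)
  then show ?thesis using s(3) by force
qed

section \<open>Morphisms of Dpr as diagrams\<close>

definition points :: "dpr_obj \<Rightarrow> nat list" where "points X = sorted_list_of_set (fst X)"

definition sign_word :: "dpr_obj \<Rightarrow> bool list" where "sign_word X = word (snd X) (points X)"

text \<open>Only the end points of strands are kept; the arcs can be recovered from the signs, by
  \<open>dpr_arrow_inj\<close>.\<close>

definition dpr_arrow :: "dpr_obj \<Rightarrow> diag \<Rightarrow> dpr_obj \<Rightarrow> dpr_arr" where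
  "dpr_arrow X D Y = (X, (set (strands (lower_half D) (points X)), set (strands (upper_half D) (points Y))), Y)"

lemma dpr_Obj_points [simp]:
  assumes "X \<in> dpr_Obj"
  shows "sorted_wrt (<) (points X)" "set (points X) = fst X" "distinct (points X)"
  using assms by (auto simp: points_def dpr_Obj_def)

lemma length_sign_word [simp]: "length (sign_word X) = length (points X)" by (simp add: sign_word_def)

lemma sorted_strands: "length l = half_size h \<Longrightarrow> sorted_wrt (<) l \<Longrightarrow> sorted_wrt (<) (strands h l)"
proof (induction rule: half_list_induct)
  case (HN c t h u a v)
  then show ?case using strands_subset[of v h] by (auto simp: sorted_wrt_append)
qed simp

lemma sign_strands: "length l = half_size h \<Longrightarrow> map w l = half_word s h \<Longrightarrow> map w (strands h l) = signs h"
  by (induction rule: half_list_induct) (auto simp: append_eq_append_conv)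

lemma map_eq_zip: "length xs = length ys \<Longrightarrow> map f xs = map g ys \<longleftrightarrow> (\<forall>(a, b)\<in>set (zip xs ys). f a = g b)"
  by (induction xs ys rule: list_induct2) auto

lemma strand_rel_zip:
  assumes "distinct xs" "distinct ys" "length xs = length ys"
  shows "strand_rel (set xs) (set ys) (set (zip xs ys))"
  unfolding strand_rel_def
proof (intro conjI ballI)
  show "set (zip xs ys) \<subseteq> set xs \<times> set ys" by (auto dest: set_zip_leftD set_zip_rightD)
  show "\<exists>b. (a, b) \<in> set (zip xs ys)" if "a \<in> set xs" for a
    using in_set_impl_in_set_zip1[OF assms(3) that] by blast
  show "\<exists>a. (a, b) \<in> set (zip xs ys)" if "b \<in> set ys" for b
    using in_set_impl_in_set_zip2[OF assms(3) that] by blast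
  show "single_valued (set (zip xs ys))" "single_valued ((set (zip xs ys))\<inverse>)"
    using assms by (auto simp: single_valued_def in_set_zip nth_eq_iff_index_eq)
qed

lemma upper_word: "upper D = sign_word Y \<longleftrightarrow> word (- snd Y) (points Y) = half_word False (half_flip (upper_half D))"
  using half_word_compl[of "snd Y" "points Y" "upper_half D"] by (auto simp: upper_upper_half sign_word_def)

lemma lower_word: "lower D = sign_word X \<longleftrightarrow> word (snd X) (points X) = half_word False (lower_half D)"
  by (auto simp: lower_lower_half sign_word_def)

lemma ex_labelling:
  assumes "distinct ns" "length l = length ns"
  shows "\<exists>g. map g ns = l"
proof
  show "map (the \<circ> map_of (zip ns l)) ns = l"
    using assms by (auto intro!: nth_equalityI simp: map_of_zip_nth)
qed

locale diag_between =
  fixes X D Y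
  assumes X: "X \<in> dpr_Obj" and Y: "Y \<in> dpr_Obj" and lower: "lower D = sign_word X" and upper: "upper D = sign_word Y"
begin

lemma lengths: "length (points X) = half_size (lower_half D)" "length (points Y) = half_size (upper_half D)"
  using lower upper by (metis lower_lower_half length_half_word length_sign_word, metis upper_upper_half length_half_word length_sign_word)

abbreviation "cup_arcs \<equiv> half_arcs_of (lower_half D) (points X)"
abbreviation "cap_arcs \<equiv> half_arcs_of (upper_half D) (points Y)"
abbreviation "A \<equiv> set (strands (lower_half D) (points X))"
abbreviation "B \<equiv> set (strands (upper_half D) (points Y))"
abbreviation "\<sigma> \<equiv> set (zip (strands (lower_half D) (points X)) (strands (upper_half D) (points Y)))"

lemma cup_arcs: "arc_matching (fst X) (snd X) A cup_arcs"
  and cup_arcs_end: "(a, b) \<in> cup_arcs \<Longrightarrow> cup_end (fst X) (snd X) a b \<and>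
    is_cup (fst X) (snd X) {x \<in> fst X. a \<le> x \<and> x \<le> b} \<and> {x \<in> fst X. a \<le> x \<and> x \<le> b} \<inter> A = {}"
  using half_arcs[of "points X" "snd X" "lower_half D"] X lower[unfolded lower_word] by simp_all

lemma cap_arcs: "arc_matching (fst Y) (- snd Y) B cap_arcs"
  and cap_arcs_end: "(a, b) \<in> cap_arcs \<Longrightarrow> cup_end (fst Y) (- snd Y) a b \<and>
    is_cup (fst Y) (- snd Y) {x \<in> fst Y. a \<le> x \<and> x \<le> b} \<and> {x \<in> fst Y. a \<le> x \<and> x \<le> b} \<inter> B = {}"
  using half_arcs[of "points Y" "- snd Y" "half_flip (upper_half D)"] Y upper[unfolded upper_word] by simp_all

lemma subs: "A \<subseteq> fst X" "B \<subseteq> fst Y"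
  using strands_subset[OF lengths(1)] strands_subset[OF lengths(2)] X Y by auto

lemma sorted: "sorted_wrt (<) (strands (lower_half D) (points X))" "sorted_wrt (<) (strands (upper_half D) (points Y))"
  using sorted_strands[OF lengths(1)] sorted_strands[OF lengths(2)] X Y by simp_all

lemma dist: "distinct (strands (lower_half D) (points X))" "distinct (strands (upper_half D) (points Y))"
  using sorted strict_sorted_iff by blast+

lemma strand_rel: "strand_rel A B \<sigma>"
  by (rule strand_rel_zip) (use dist in auto)

lemma cobbers: "cobbers A B a b \<longleftrightarrow> (a, b) \<in> \<sigma>"
  by (rule cobbers_zip) (use sorted in auto)

lemma Rel: "(map f (points X) @- t, map g (points Y) @- t') \<in> Rel D \<longleftrightarrow>
    compatible f f cup_arcs \<and> compatible g g cap_arcs \<and> compatible f g \<sigma> \<and> t = t'"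
  using Rel_iff[OF lengths, of f t g t'] map_eq_zip[of "strands (lower_half D) (points X)" "strands (upper_half D) (points Y)" f g]
  by (auto simp: compatible_def)

lemma signs: "(a, b) \<in> \<sigma> \<Longrightarrow> a \<in> snd X \<longleftrightarrow> b \<in> snd Y"
proof -
  have "word (snd X) (strands (lower_half D) (points X)) = word (snd Y) (strands (upper_half D) (points Y))"
    using sign_strands[OF lengths(1), of "\<lambda>x. x \<in> snd X" False] lower
      sign_strands[OF lengths(2), of "\<lambda>x. x \<in> snd Y" True] upper
    by (simp add: sign_word_def lower_lower_half upper_upper_half)
  then show "(a, b) \<in> \<sigma> \<Longrightarrow> a \<in> snd X \<longleftrightarrow> b \<in> snd Y"
    by (subst (asm) map_eq_zip) auto
qed

end

text \<open>Because of the equation of relations, labellings compatible with \<open>G\<close> extend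
  over the middle boundary, which is the hypothesis of \<open>gluing\<close>. That locale identifies
  the strands of \<open>G\<close> with the points reached by snaking, and its reflection does the
  same for the codomain.\<close>

lemma diag_cmp:
  assumes "diag_between X D1 Y" "diag_between Y D2 Z" "diag_between X G Z" and Rel: "Rel G = Rel D1 O Rel D2"
  shows "dpr_Cmp (dpr_arrow Y D2 Z) (dpr_arrow X D1 Y) = dpr_arrow X G Z"
proof -
  interpret D1: diag_between X D1 Y by fact
  interpret D2: diag_between Y D2 Z by fact
  interpret G: diag_between X G Z by fact
  let ?H = "(fst Y - D1.B) \<inter> (fst Y - D2.A)"
  interpret gl: gluing "fst X" "snd X" D1.A D1.cup_arcs "fst Y" "snd Y" D1.B D1.cap_arcs D1.\<sigma> D2.A D2.cup_arcs
    "fst Z" "snd Z" D2.B D2.cap_arcs D2.\<sigma> G.A G.cup_arcs G.B G.cap_arcs G.\<sigma>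
  proof
    show "finite (fst Y)" using D1.Y by (auto simp: dpr_Obj_def)
    fix a b assume "(a, b) \<in> D2.cup_arcs \<union> D1.cap_arcs"
    then have "cup_end (fst Y) (snd Y) a b \<or> cup_end (fst Y) (- snd Y) a b"
      using D2.cup_arcs_end[of a b] D1.cap_arcs_end[of a b] by blast
    then show "a < b" using cup_end_sign(1) by blast
  next
    fix f h assume r: "compatible f f G.cup_arcs" "compatible h h G.cap_arcs" "compatible f h G.\<sigma>"
    \<comment> \<open>Diagrams pass tails on unchanged, so any common tail serves.\<close>
    let ?t = "sconst (0::nat)"
    have "(map f (points X) @- ?t, map h (points Z) @- ?t) \<in> Rel D1 O Rel D2"
      using r G.Rel Rel by blast
    then obtain y where y: "(map f (points X) @- ?t, y) \<in> Rel D1" "(y, map h (points Z) @- ?t) \<in> Rel D2" by blast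
    \<comment> \<open>The middle stream is cut at the boundary \<open>Y\<close>; its first labels
      are read as a labelling of the points of \<open>Y\<close>.\<close>
    obtain g where g: "map g (points Y) = stake (length (points Y)) y"
      using ex_labelling[of "points Y" "stake (length (points Y)) y"] D1.Y by auto
    have "y = map g (points Y) @- sdrop (length (points Y)) y" unfolding g by (simp add: stake_sdrop)
    with y have "compatible f f D1.cup_arcs \<and> compatible g g D1.cap_arcs \<and> compatible f g D1.\<sigma>" "compatible g g D2.cup_arcs \<and> compatible h h D2.cap_arcs \<and> compatible g h D2.\<sigma>"
      using D1.Rel D2.Rel by metis+
    then show "\<exists>g. compatible f f D1.cup_arcs \<and> compatible g g D1.cap_arcs \<and> compatible f g D1.\<sigma> \<and> compatible g g D2.cup_arcs \<and> compatible h h D2.cap_arcs \<and> compatible g h D2.\<sigma>"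
      by blast
  qed (use D1.cup_arcs D1.cap_arcs D1.strand_rel D2.cup_arcs D2.cap_arcs D2.strand_rel G.cup_arcs G.cap_arcs G.strand_rel D1.subs D2.subs G.subs in auto)
  interpret fl: gluing "fst Z" "- snd Z" D2.B D2.cap_arcs "fst Y" "- snd Y" D2.A D2.cup_arcs "D2.\<sigma>\<inverse>" D1.B D1.cap_arcs
    "fst X" "- snd X" D1.A D1.cup_arcs "D1.\<sigma>\<inverse>" G.B G.cap_arcs G.A G.cup_arcs "G.\<sigma>\<inverse>"
    by (rule gl.flip)
  have cuD: "(cup_end (fst Y) (snd Y) a b \<or> cap_end (fst Y) (snd Y) a b) \<and> a \<in> fst Y \<and> a \<notin> D2.A \<and> b \<in> fst Y \<and> b \<notin> D2.A"
    if "(a, b) \<in> D2.cup_arcs" for a b using D2.cup_arcs_end[OF that] arc_matchingD(1)[OF D2.cup_arcs that] by blast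
  have kaD: "(cup_end (fst Y) (snd Y) a b \<or> cap_end (fst Y) (snd Y) a b) \<and> a \<in> fst Y \<and> a \<notin> D1.B \<and> b \<in> fst Y \<and> b \<notin> D1.B"
    if "(a, b) \<in> D1.cap_arcs" for a b using D1.cap_arcs_end[OF that] arc_matchingD(1)[OF D1.cap_arcs that] unfolding cap_end_iff by blast
  have snake1: "snake (fst Y) (snd Y) ?H y y'" if "(y, y') \<in> (D2.cup_arcs O D1.cap_arcs)\<^sup>*" for y y'
    by (rule snake_rtrancl[OF cuD kaD that])
  \<comment> \<open>The same lemma applies with cups and caps exchanged, because \<open>?H\<close>
    is symmetric in \<open>D1.B\<close> and \<open>D2.A\<close>.\<close>
  have snake2: "snake (fst Y) (snd Y) ?H y y'" if "(y, y') \<in> (D1.cap_arcs O D2.cup_arcs)\<^sup>*" for y y'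
    using snake_rtrancl[OF kaD cuD that] by (simp add: Int_commute)
  have snakeD: "g y = g y'" if "snake (fst Y) (snd Y) ?H y y'" "compatible g g D1.cap_arcs" "compatible g g D2.cup_arcs" for g y y'
    by (rule snake_compatible[OF that(1) D2.cup_arcs _ D1.cap_arcs _ that(3,2)]) (use D2.cup_arcs_end D1.cap_arcs_end in blast)+
  have I1: "x \<in> G.A" if "(x, y) \<in> D1.\<sigma>" "y' \<in> D2.A"
    "snake (fst Y) (snd Y) ?H y y' \<or> snake (fst Y) (snd Y) ?H y' y" for x y y'
  proof (rule gl.strandI[OF that(1,2)])
    fix g assume "compatible g g D1.cap_arcs" "compatible g g D2.cup_arcs"
    with that(3) snakeD[of y y' g] snakeD[of y' y g] show "g y = g y'" by auto
  qed
  have I2: "x \<in> G.B" if "(y, x) \<in> D2.\<sigma>" "y' \<in> D1.B"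
    "snake (fst Y) (snd Y) ?H y y' \<or> snake (fst Y) (snd Y) ?H y' y" for x y y'
  proof (rule fl.strandI[of x y y'])
    show "(x, y) \<in> D2.\<sigma>\<inverse>" "y' \<in> D1.B" using that by auto
    fix g assume "compatible g g D2.cup_arcs" "compatible g g D1.cap_arcs"
    with that(3) snakeD[of y y' g] snakeD[of y' y g] show "g y = g y'" by auto
  qed
  have E: "G.A = {x \<in> D1.A. \<exists>y y'. cobbers D1.A D1.B x y \<and> snake (fst Y) (snd Y) ?H y y' \<and> y' \<in> D2.A} \<union>
      {x' \<in> D1.A. \<exists>y y'. cobbers D1.A D1.B x' y' \<and> snake (fst Y) (snd Y) ?H y y' \<and> y \<in> D2.A}" (is "_ = ?E")
  proof
    show "G.A \<subseteq> ?E"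
    proof
      fix x assume "x \<in> G.A"
      from gl.strandD[OF this] obtain y y' where *: "(x, y) \<in> D1.\<sigma>" "y' \<in> D2.A"
        "(y, y') \<in> (D2.cup_arcs O D1.cap_arcs)\<^sup>* \<or> (y', y) \<in> (D1.cap_arcs O D2.cup_arcs)\<^sup>*" by blast
      then have "x \<in> D1.A" using strand_relD(1)[OF D1.strand_rel] by blast
      with * snake1 snake2 show "x \<in> ?E" unfolding D1.cobbers by blast
    qed
    show "?E \<subseteq> G.A"
      unfolding D1.cobbers using I1 by blast
  qed
  have F: "G.B = {z \<in> D2.B. \<exists>y y'. cobbers D2.A D2.B y z \<and> snake (fst Y) (snd Y) ?H y y' \<and> y' \<in> D1.B} \<union>
      {z' \<in> D2.B. \<exists>y y'. cobbers D2.A D2.B y' z' \<and> snake (fst Y) (snd Y) ?H y y' \<and> y \<in> D1.B}" (is "_ = ?F")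
  proof
    show "G.B \<subseteq> ?F"
    proof
      fix z assume "z \<in> G.B"
      from fl.strandD[OF this] obtain y y' where *: "(y, z) \<in> D2.\<sigma>" "y' \<in> D1.B"
        "(y, y') \<in> (D1.cap_arcs O D2.cup_arcs)\<^sup>* \<or> (y', y) \<in> (D2.cup_arcs O D1.cap_arcs)\<^sup>*" by blast
      then have "z \<in> D2.B" using strand_relD(1)[OF D2.strand_rel] by blast
      with * snake1 snake2 show "z \<in> ?F" unfolding D2.cobbers by blast
    qed
    show "?F \<subseteq> G.B"
      unfolding D2.cobbers using I2 by blast
  qed
  show ?thesis
    unfolding dpr_arrow_def dpr_Cmp_def E F by (cases Y) (simp add: Let_def)
qed

lemma strands_Field: "diag_between X D Y \<Longrightarrow> fst X - set (strands (lower_half D) (points X)) = Field (half_arcs_of (lower_half D) (points X))"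
  "diag_between X D Y \<Longrightarrow> fst Y - set (strands (upper_half D) (points Y)) = Field (half_arcs_of (upper_half D) (points Y))"
  using half_arcs_of_set[of "points X" "lower_half D"] half_arcs_of_set[of "points Y" "upper_half D"] diag_between.lengths[of X D Y]
  by (auto simp: diag_between_def)

text \<open>The intervals spanned by the arcs serve as the required families of cups and caps: they
  avoid the strands and cover all other points.\<close>

lemma dpr_arrow_in:
  assumes "diag_between X D Y"
  shows "dpr_arrow X D Y \<in> dpr_Arr"
proof -
  interpret diag_between X D Y by fact
  obtain M S N T where XY: "X = (M, S)" "Y = (N, T)" by (metis surj_pair)
  have "\<exists>\<K>. (\<forall>K\<in>\<K>. is_cup M S K) \<and> M - A = \<Union>\<K>"
  proof (intro exI conjI)
    let ?K = "(\<lambda>(a, b). {x \<in> M. a \<le> x \<and> x \<le> b}) ` cup_arcs"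
    show "\<forall>K\<in>?K. is_cup M S K" using cup_arcs_end XY by auto
    show "M - A = \<Union>?K"
    proof
      show "\<Union>?K \<subseteq> M - A" using cup_arcs_end XY by fastforce
      show "M - A \<subseteq> \<Union>?K"
      proof
        fix x assume "x \<in> M - A"
        then have "x \<in> Field cup_arcs" unfolding strands_Field(1)[OF assms, symmetric] using XY by simp
        then obtain a b where ab: "(a, b) \<in> cup_arcs" "x = a \<or> x = b" unfolding Field_def by blast
        then have "x \<in> {x \<in> M. a \<le> x \<and> x \<le> b}"
          using cup_arcs_end[OF ab(1)] XY by (auto simp: cup_end_def)
        with ab(1) show "x \<in> \<Union>?K" by blast
      qed
    qed
  qed
  moreover have "\<exists>\<K>. (\<forall>K\<in>\<K>. is_cap N T K) \<and> N - B = \<Union>\<K>"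
  proof (intro exI conjI)
    let ?K = "(\<lambda>(a, b). {x \<in> N. a \<le> x \<and> x \<le> b}) ` cap_arcs"
    show "\<forall>K\<in>?K. is_cap N T K" using cap_arcs_end XY by (auto simp: is_cap_iff)
    show "N - B = \<Union>?K"
    proof
      show "\<Union>?K \<subseteq> N - B" using cap_arcs_end XY by fastforce
      show "N - B \<subseteq> \<Union>?K"
      proof
        fix x assume "x \<in> N - B"
        then have "x \<in> Field cap_arcs" unfolding strands_Field(2)[OF assms, symmetric] using XY by simp
        then obtain a b where ab: "(a, b) \<in> cap_arcs" "x = a \<or> x = b" unfolding Field_def by blast
        then have "x \<in> {x \<in> N. a \<le> x \<and> x \<le> b}"
          using cap_arcs_end[OF ab(1)] XY by (auto simp: cup_end_def)
        with ab(1) show "x \<in> \<Union>?K" by blast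
      qed
    qed
  qed
  moreover have "card A = card B" using dist by (simp add: distinct_card)
  moreover have "\<forall>a b. cobbers A B a b \<longrightarrow> (a \<in> S) = (b \<in> T)" unfolding cobbers using signs XY by auto
  ultimately show ?thesis
    using X Y subs unfolding dpr_arrow_def dpr_Arr_def XY by simp
qed

text \<open>Each boundary is parsed separately by \<open>parse_half\<close>, the upper one with
  complementary signs. The condition on cobbers makes the signs of the strands agree, so the halves
  fit together.\<close>

lemma ex_dpr_arrow:
  assumes "(X, a, Y) \<in> dpr_Arr"
  shows "\<exists>D. diag_between X D Y \<and> (X, a, Y) = dpr_arrow X D Y"
proof -
  obtain M S N T A B where XY: "X = (M, S)" "Y = (N, T)" "a = (A, B)" by (metis surj_pair)
  have o: "X \<in> dpr_Obj" "Y \<in> dpr_Obj" and sub: "A \<subseteq> M" "B \<subseteq> N" and card: "card A = card B"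
    and cob: "\<And>a b. cobbers A B a b \<Longrightarrow> a \<in> S \<longleftrightarrow> b \<in> T"
    using assms unfolding XY dpr_Arr_def by auto
  have KL: "\<exists>\<K>. (\<forall>K\<in>\<K>. is_cup M S K) \<and> M - A = \<Union>\<K>" "\<exists>\<K>. (\<forall>K\<in>\<K>. is_cap N T K) \<and> N - B = \<Union>\<K>"
    using assms unfolding XY dpr_Arr_def by auto
  have KA: "\<exists>K. is_cup M S K \<and> x \<in> K \<and> K \<inter> A = {}" if "x \<in> M - A" for x
    using KL(1) that by blast
  have KB: "\<exists>K. is_cup N (- T) K \<and> x \<in> K \<and> K \<inter> B = {}" if "x \<in> N - B" for x
    using KL(2) that unfolding is_cap_iff by blast
  have "\<exists>h. half_word False h = word S (points X) \<and> set (strands h (points X)) = A"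
    by (rule parse_half) (use o sub KA XY in simp_all)
  then obtain h where h: "half_word False h = word S (points X)" "set (strands h (points X)) = A" by blast
  have "\<exists>h. half_word False h = word (- T) (points Y) \<and> set (strands h (points Y)) = B"
    by (rule parse_half) (use o sub KB XY in simp_all)
  then obtain k' where "half_word False k' = word (- T) (points Y)" "set (strands k' (points Y)) = B" by blast
  then obtain k where k: "half_word True k = word T (points Y)" "set (strands k (points Y)) = B"
    using half_word_compl[of T "points Y" "half_flip k'"] by auto
  have len: "length (points X) = half_size h" "length (points Y) = half_size k"
    using h(1) k(1) by (metis length_half_word length_map)+
  have s: "sorted_wrt (<) (strands h (points X))" "sorted_wrt (<) (strands k (points Y))"
    using sorted_strands[OF len(1)] sorted_strands[OF len(2)] o by simp_all
  then have "distinct (strands h (points X))" "distinct (strands k (points Y))" using strict_sorted_iff by blast+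
  then have len2: "length (strands h (points X)) = length (strands k (points Y))"
    using card h(2) k(2) by (metis distinct_card)
  have "word S (strands h (points X)) = word T (strands k (points Y))"
    unfolding map_eq_zip[OF len2] using cob cobbers_zip[OF s len2] h(2) k(2) by auto
  then have "signs h = signs k"
    using sign_strands[OF len(1), of "\<lambda>x. x \<in> S" False] sign_strands[OF len(2), of "\<lambda>x. x \<in> T" True] h(1) k(1) by simp
  then obtain D where D: "lower_half D = h" "upper_half D = k" using ex_diag by blast
  have "diag_between X D Y"
    using o h(1) k(1) D XY by unfold_locales (auto simp: lower_lower_half upper_upper_half sign_word_def)
  moreover have "(X, a, Y) = dpr_arrow X D Y" using h(2) k(2) D XY by (simp add: dpr_arrow_def)
  ultimately show ?thesis by blast
qed

context adjoint_action
begin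

text \<open>This is the interchange law on the level of evaluations; it comes from naturality of
  \<open>Phi D1\<close> against the value of \<open>E2\<close>.\<close>

lemma Phi_diag_append_Cmp:
  assumes "\<And>x. x \<in> Obj C \<Longrightarrow> Phi G x = Phi D2 x \<cdot> Phi D1 x" "\<And>x. x \<in> Obj C \<Longrightarrow> Phi K x = Phi E2 x \<cdot> Phi E1 x"
    and "upper D1 = lower D2" "upper E1 = lower E2" "lower G = lower D1" "upper K = upper E2" and x: "x \<in> Obj C"
  shows "Phi (diag_append G K) x = Phi (diag_append D2 E2) x \<cdot> Phi (diag_append D1 E1) x"
proof -
  have "WA (upper D1) (Phi E2 x) \<cdot> Phi D1 (WO (lower E2) x) = Phi D1 (WO (upper E2) x) \<cdot> WA (lower D1) (Phi E2 x)"
    using Phi_natural[of "Phi E2 x" D1] x by simp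
  from Cmp_rotate[OF this, of "WA (lower D1) (Phi E1 x)"] show ?thesis
    using x by (simp add: Phi_diag_append assms)
qed

end

section \<open>Uniqueness of the diagram of a morphism\<close>

lemma forest_word_inj_aux:
  "forest_word s f @ x = forest_word s g @ y \<Longrightarrow> x = [] \<or> hd x = (\<not> s) \<Longrightarrow> y = [] \<or> hd y = (\<not> s) \<Longrightarrow> f = g \<and> x = y"
proof (induction f arbitrary: g x y)
  case Leaf
  show ?case
  proof (cases g)
    case (Br g1 g2)
    then have "x \<noteq> []" "hd x = s" using Leaf.prems(1) by auto
    then show ?thesis using Leaf.prems(2) by simp
  qed (use Leaf in simp)
next
  case (Br f1 f2)
  have "g \<noteq> Leaf"
  proof
    assume "g = Leaf"
    then have "y \<noteq> []" "hd y = s" using Br.prems(1) by auto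
    then show False using Br.prems(3) by simp
  qed
  then obtain g1 g2 where g: "g = Br g1 g2" by (cases g) auto
  with Br.prems(1) have eq: "forest_word s f1 @ ((\<not> s) # forest_word s f2 @ x) = forest_word s g1 @ ((\<not> s) # forest_word s g2 @ y)" by simp
  from Br.IH(1)[OF eq] have 1: "f1 = g1" "forest_word s f2 @ x = forest_word s g2 @ y" by simp_all
  from Br.IH(2)[OF 1(2) Br.prems(2,3)] 1(1) g show ?case by simp
qed

lemma forest_word_inj: "forest_word s f = forest_word s g \<Longrightarrow> f = g"
  using forest_word_inj_aux[of s f "[]" g "[]"] by simp

text \<open>A word alone admits several readings, since a cup \<open>- +\<close> might also be two
  strands. Once the strand points are given, the gaps are fixed, and each gap is a Dyck word, which
  comes from only one forest.\<close>

lemma half_unique: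
  assumes "length l = half_size h" "half_word s h = half_word s h'" "distinct l" "set (strands h l) = set (strands h' l)"
  shows "h = h'"
  using assms
proof (induction arbitrary: h' rule: half_list_induct)
  case (HE c u)
  then show ?case by (cases h') (auto simp: strands.simps dest: forest_word_inj)
next
  case (HN c t h u a v)
  show ?case
  proof (cases h')
    case (HE d)
    then show ?thesis using HN by simp
  next
    case h': (HN c' t' h'')
    have len: "length (u @ a # v) = half_size h'" using HN by (metis length_half_word half_size.simps(2) length_Cons length_append add_Suc_right)
    then obtain u' a' v' where l: "u @ a # v = u' @ a' # v'" "length u' = forest_size c'" "length v' = half_size h''"
      using h' by (rule_tac split_length[of "u @ a # v" "forest_size c'" "half_size h''"]) auto
    have s1: "strands (HN c t h) (u @ a # v) = a # strands h v" using HN.hyps by simp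
    have s2: "strands h' (u @ a # v) = a' # strands h'' v'" using l h' by simp
    have sub: "set (strands h v) \<subseteq> set v" "set (strands h'' v') \<subseteq> set v'"
      using strands_subset HN.hyps l by blast+
    have d: "distinct (u @ a # v)" "distinct (u' @ a' # v')" using HN.prems l by simp_all
    \<comment> \<open>If the first strands differed, the earlier one would lie in the first gap of
      the other reading, where no strand ends.\<close>
    have "length u = length u'"
    proof (rule ccontr)
      assume "length u \<noteq> length u'"
      then consider "length u < length u'" | "length u' < length u" by linarith
      then show False
      proof cases
        case 1
        then have "(u @ a # v) ! length u \<in> set u'" unfolding l(1) by (simp add: nth_append)
        then have "a \<in> set u'" by simp
        then have "a \<notin> set (a' # strands h'' v')" using d(2) sub by auto
        moreover have "a \<in> set (a' # strands h'' v')" using HN.prems(3) unfolding s1 s2[symmetric] by auto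
        ultimately show False by contradiction
      next
        case 2
        then have "(u' @ a' # v') ! length u' \<in> set u" unfolding l(1)[symmetric] by (simp add: nth_append)
        then have "a' \<in> set u" by simp
        then have "a' \<notin> set (a # strands h v)" using d(1) sub by auto
        moreover have "a' \<in> set (a # strands h v)" using HN.prems(3) unfolding s1[symmetric] s2 by auto
        ultimately show False by contradiction
      qed
    qed
    then have eq: "u = u'" "a = a'" "v = v'" using l(1) by auto
    have "length (forest_word s c) = length (forest_word s c')" using HN.hyps l(2) eq by simp
    then have w: "forest_word s c = forest_word s c'" "t = t'" "half_word s h = half_word s h''" using HN.prems(1) h' by simp_all
    have "a \<notin> set v" using d by simp
    moreover have "insert a (set (strands h v)) = insert a (set (strands h'' v))"
      using HN.prems(3) unfolding s1 s2 using eq by simp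
    moreover have "set (strands h'' v) \<subseteq> set v" using sub(2) eq(3) by simp
    ultimately have "set (strands h v) = set (strands h'' v)" using sub(1) insert_ident[of a] by (metis subsetD)
    then have "h = h''" using HN.IH w(3) d by simp
    then show ?thesis using h' w forest_word_inj by simp
  qed
qed

lemma dpr_arrow_inj:
  assumes "diag_between X D Y" "diag_between X E Y" "dpr_arrow X D Y = dpr_arrow X E Y"
  shows "D = E"
proof (rule diag_eqI)
  interpret D: diag_between X D Y by fact
  interpret E: diag_between X E Y by fact
  show "lower_half D = lower_half E"
    by (rule half_unique[OF D.lengths(1), of False]) (use D.lower E.lower D.X assms(3) in \<open>auto simp: lower_lower_half dpr_arrow_def\<close>)
  show "upper_half D = upper_half E"
    by (rule half_unique[OF D.lengths(2), of True]) (use D.upper E.upper D.Y assms(3) in \<open>auto simp: upper_upper_half dpr_arrow_def\<close>)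
qed

section \<open>Dpr as a category\<close>

lemma Dpr_simps [simp]: "Obj Dpr = dpr_Obj" "Arr Dpr = dpr_Arr" "Dom Dpr f = fst f" "Cod Dpr f = snd (snd f)"
  "Ident Dpr = dpr_Ident" "Cmp Dpr = dpr_Cmp" "TensO Dpr = dpr_TensO" "TensA Dpr = dpr_TensA"
  "UnitO Dpr = ({}, {})" "Assoc Dpr x y z = dpr_Ident (dpr_TensO (dpr_TensO x y) z)"
  "LUnit Dpr = dpr_Ident" "RUnit Dpr = dpr_Ident"
  by (auto simp: Dpr_def split: prod.splits)

lemma dpr_arrow_simps [simp]: "fst (dpr_arrow X D Y) = X" "snd (snd (dpr_arrow X D Y)) = Y"
  by (simp_all add: dpr_arrow_def)

lemma Hom_Dpr: "f \<in> Hom Dpr X Y \<longleftrightarrow> (\<exists>D. diag_between X D Y \<and> f = dpr_arrow X D Y)"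
proof
  assume "f \<in> Hom Dpr X Y"
  then have "(X, fst (snd f), Y) \<in> dpr_Arr" "f = (X, fst (snd f), Y)" by (auto simp: Hom_def)
  with ex_dpr_arrow show "\<exists>D. diag_between X D Y \<and> f = dpr_arrow X D Y" by metis
next
  assume "\<exists>D. diag_between X D Y \<and> f = dpr_arrow X D Y"
  then obtain D where "diag_between X D Y" "f = dpr_arrow X D Y" by blast
  then show "f \<in> Hom Dpr X Y" using dpr_arrow_in[of X D Y] by (simp add: Hom_def)
qed

lemma diag_compose:
  assumes "diag_between X D Y" "diag_between Y E Z"
  shows "\<exists>G. diag_between X G Z \<and> Rel G = Rel D O Rel E \<and> dpr_Cmp (dpr_arrow Y E Z) (dpr_arrow X D Y) = dpr_arrow X G Z"
proof -
  have "upper D = lower E" using assms by (simp add: diag_between_def)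
  from R.Phi_compose[OF this] obtain G where G: "lower G = lower D" "upper G = upper E" "Rel G = Rel D O Rel E"
    by auto
  then have "diag_between X G Z" using assms by (simp add: diag_between_def)
  with diag_cmp[OF assms] G show ?thesis by blast
qed

lemma strands_diag_ident: "length l = length w \<Longrightarrow> strands (lower_half (diag_ident w)) l = l \<and> strands (upper_half (diag_ident w)) l = l"
proof (induction w arbitrary: l)
  case (Cons s w)
  then show ?case by (cases l) (auto simp: strands.simps)
qed simp

lemma diag_between_diag_ident: "X \<in> dpr_Obj \<Longrightarrow> diag_between X (diag_ident (sign_word X)) X"
  by unfold_locales auto

lemma Ident_dpr_arrow: "X \<in> dpr_Obj \<Longrightarrow> dpr_Ident X = dpr_arrow X (diag_ident (sign_word X)) X"
  using strands_diag_ident[of "points X" "sign_word X"] by (cases X) (simp add: dpr_arrow_def dpr_Ident_def)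

lemma Rel_diag_ident [simp]: "Rel (diag_ident w) = Id"
  by simp

lemma Cmp_Ident_dpr_arrow:
  assumes "diag_between X D Y"
  shows "dpr_Cmp (dpr_Ident Y) (dpr_arrow X D Y) = dpr_arrow X D Y" "dpr_Cmp (dpr_arrow X D Y) (dpr_Ident X) = dpr_arrow X D Y"
proof -
  have o: "X \<in> dpr_Obj" "Y \<in> dpr_Obj" using assms by (auto simp: diag_between_def)
  show "dpr_Cmp (dpr_Ident Y) (dpr_arrow X D Y) = dpr_arrow X D Y"
    unfolding Ident_dpr_arrow[OF o(2)] by (rule diag_cmp[OF assms diag_between_diag_ident[OF o(2)] assms]) simp
  show "dpr_Cmp (dpr_arrow X D Y) (dpr_Ident X) = dpr_arrow X D Y"
    unfolding Ident_dpr_arrow[OF o(1)] by (rule diag_cmp[OF diag_between_diag_ident[OF o(1)] assms assms]) simp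
qed

lemma category_Dpr: "category Dpr"
proof
  show "Dom Dpr f \<in> Obj Dpr" "Cod Dpr f \<in> Obj Dpr" if "f \<in> Arr Dpr" for f
    using that by (auto simp: dpr_Arr_def)
  show "Ident Dpr X \<in> Hom Dpr X X" if "X \<in> Obj Dpr" for X
    using that Ident_dpr_arrow[of X] diag_between_diag_ident[of X] unfolding Hom_Dpr Dpr_simps by blast
  show "Cmp Dpr g f \<in> Hom Dpr X Z" if "f \<in> Hom Dpr X Y" "g \<in> Hom Dpr Y Z" for f g X Y Z
  proof -
    obtain D E where "diag_between X D Y" "f = dpr_arrow X D Y" "diag_between Y E Z" "g = dpr_arrow Y E Z"
      using \<open>f \<in> _\<close> \<open>g \<in> _\<close> unfolding Hom_Dpr by blast
    then show ?thesis using diag_compose[of X D Y E Z] unfolding Hom_Dpr Dpr_simps by blast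
  qed
  show "Cmp Dpr (Ident Dpr Y) f = f" "Cmp Dpr f (Ident Dpr X) = f" if "f \<in> Hom Dpr X Y" for f X Y
    using that Cmp_Ident_dpr_arrow unfolding Hom_Dpr Dpr_simps by blast+
  show "Cmp Dpr (Cmp Dpr h g) f = Cmp Dpr h (Cmp Dpr g f)"
    if "f \<in> Hom Dpr W X" "g \<in> Hom Dpr X Y" "h \<in> Hom Dpr Y Z" for f g h W X Y Z
  proof -
    obtain D1 D2 D3 where D: "diag_between W D1 X" "diag_between X D2 Y" "diag_between Y D3 Z"
      "f = dpr_arrow W D1 X" "g = dpr_arrow X D2 Y" "h = dpr_arrow Y D3 Z" using \<open>f \<in> _\<close> \<open>g \<in> _\<close> \<open>h \<in> _\<close> unfolding Hom_Dpr by blast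
    obtain G where G: "diag_between W G Y" "Rel G = Rel D1 O Rel D2" "dpr_Cmp g f = dpr_arrow W G Y"
      using diag_compose D by blast
    obtain K where K: "diag_between X K Z" "Rel K = Rel D2 O Rel D3" "dpr_Cmp h g = dpr_arrow X K Z"
      using diag_compose D by blast
    obtain L where L: "diag_between W L Z" "Rel L = Rel G O Rel D3" "dpr_Cmp h (dpr_arrow W G Y) = dpr_arrow W L Z"
      using diag_compose[OF G(1) D(3)] D by blast
    \<comment> \<open>Both bracketings have the relation of \<open>L\<close>, and the relation
      determines the composite; associativity reduces to that of \<open>O\<close>.\<close>
    have "dpr_Cmp (dpr_arrow X K Z) f = dpr_arrow W L Z"
      unfolding D(4) by (rule diag_cmp[OF D(1) K(1) L(1)]) (simp add: L G K O_assoc)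
    then show ?thesis using G K L by simp
  qed
qed

section \<open>Ordinal sums and the monoidal structure of Dpr\<close>

lemma offset_greater: "finite M \<Longrightarrow> m \<in> M \<Longrightarrow> m < offset M"
proof -
  assume M: "finite M" "m \<in> M"
  have "\<forall>m\<in>M. m < offset M"
    unfolding offset_def by (rule LeastI[of _ "Suc (Max M)"]) (use M in \<open>auto simp: less_Suc_eq_le\<close>)
  with M show "m < offset M" by blast
qed

lemma offset_le: "(\<And>m. m \<in> M \<Longrightarrow> m < k) \<Longrightarrow> offset M \<le> k"
  unfolding offset_def by (rule Least_le) blast

lemma offset_empty [simp]: "offset {} = 0"
  using offset_le[of "{}" 0] by simp

text \<open>Additivity of the offset is what makes the tensor product strictly associative. Empty
  \<open>M'\<close> is a separate case because then no element of the sum lies above the translate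
  by \<open>offset M\<close>.\<close>

lemma offset_osum: "finite M \<Longrightarrow> finite M' \<Longrightarrow> offset (osum M M M') = offset M + offset M'"
proof (rule antisym)
  assume fin: "finite M" "finite M'"
  show "offset (osum M M M') \<le> offset M + offset M'"
    by (rule offset_le) (use offset_greater fin in \<open>fastforce simp: osum_def\<close>)
  show "offset M + offset M' \<le> offset (osum M M M')"
  proof (cases "M' = {}")
    case True
    then show ?thesis by (simp add: osum_def)
  next
    case False
    have fin': "finite (osum M M M')" using fin by (simp add: osum_def)
    have "offset M + m < offset (osum M M M')" if "m \<in> M'" for m
      using offset_greater[OF fin'] that by (simp add: osum_def)
    then have less: "m < offset (osum M M M') - offset M" "offset M < offset (osum M M M')" if "m \<in> M'" for m
      using that by force+
    then have "offset M' \<le> offset (osum M M M') - offset M" by (intro offset_le)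
    then show ?thesis using less(2) False by fastforce
  qed
qed

lemma TensO_points:
  assumes "X \<in> dpr_Obj" "Y \<in> dpr_Obj"
  shows "dpr_TensO X Y \<in> dpr_Obj" "points (dpr_TensO X Y) = points X @ map ((+) (offset (fst X))) (points Y)"
    "sign_word (dpr_TensO X Y) = sign_word X @ sign_word Y"
proof -
  obtain M S N T where XY: "X = (M, S)" "Y = (N, T)" by (metis surj_pair)
  have fin: "finite M" "finite N" "S \<subseteq> M" "T \<subseteq> N" using assms XY by (auto simp: dpr_Obj_def)
  show in': "dpr_TensO X Y \<in> dpr_Obj"
    using fin XY by (auto simp: dpr_Obj_def dpr_TensO_def osum_def)
  let ?l = "points X @ map ((+) (offset (fst X))) (points Y)"
  have s: "sorted_wrt (<) ?l"
    using assms XY offset_greater[OF fin(1)]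
    by (auto simp: sorted_wrt_append sorted_wrt_map trans_less_add1 intro: sorted_wrt_mono_rel[of _ "(<)"])
  have "set ?l = fst (dpr_TensO X Y)" using assms XY by (auto simp: dpr_TensO_def osum_def)
  then show e: "points (dpr_TensO X Y) = ?l"
    using s in' by (intro sorted_distinct_set_unique) (auto simp: strict_sorted_iff points_def dpr_Obj_def)
  have "word (snd (dpr_TensO X Y)) (points X) = sign_word X"
  proof -
    have "x \<in> osum M S T \<longleftrightarrow> x \<in> S" if "x \<in> M" for x
      using offset_greater[OF fin(1) that] by (auto simp: osum_def)
    then show ?thesis unfolding sign_word_def using XY assms by (auto simp: dpr_TensO_def)
  qed
  moreover have "word (snd (dpr_TensO X Y)) (map ((+) (offset (fst X))) (points Y)) = sign_word Y"
  proof -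
    have "offset M + y \<notin> S" for y using offset_greater[OF fin(1)] fin(3) by (meson not_add_less1 subsetD)
    then show ?thesis unfolding sign_word_def using XY by (auto simp: dpr_TensO_def osum_def)
  qed
  ultimately show "sign_word (dpr_TensO X Y) = sign_word X @ sign_word Y"
    unfolding sign_word_def[of "dpr_TensO X Y"] e by simp
qed

lemma strands_map: "length l = half_size h \<Longrightarrow> strands h (map f l) = map f (strands h l)"
  by (induction rule: half_list_induct) auto

lemma lower_half_diag_prepend [simp]: "lower_half (diag_prepend c k D) = half_prepend c (lower_half D)" and upper_half_diag_prepend [simp]: "upper_half (diag_prepend c k D) = half_prepend k (upper_half D)"
  by (cases D; simp add: half_prepend_def)+

lemma strands_diag_append:
  "length l = half_size (lower_half D) \<Longrightarrow> strands (lower_half (diag_append D E)) (l @ l') = strands (lower_half D) l @ strands (lower_half E) l'"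
  "length l = half_size (upper_half D) \<Longrightarrow> strands (upper_half (diag_append D E)) (l @ l') = strands (upper_half D) l @ strands (upper_half E) l'"
proof (induction D arbitrary: l)
  case (Nx c k s D)
  {
    case 1
    then obtain u a v where l: "l = u @ a # v" "length u = forest_size c" "length v = half_size (lower_half D)"
      by (auto elim: split_length)
    then show ?case using Nx(1)[of v] HN_append(1)[of u c s "lower_half (diag_append D E)" a "v @ l'"] by simp
  next
    case 2
    then obtain u a v where l: "l = u @ a # v" "length u = forest_size k" "length v = half_size (upper_half D)"
      by (auto elim: split_length)
    then show ?case using Nx(2)[of v] HN_append(1)[of u k s "upper_half (diag_append D E)" a "v @ l'"] by simp
  }
qed simp_all

lemma diag_between_diag_append:
  assumes "diag_between X D Y" "diag_between X' D' Y'"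
  shows "diag_between (dpr_TensO X X') (diag_append D D') (dpr_TensO Y Y')"
  using assms TensO_points by (simp add: diag_between_def)

lemma TensA_dpr_arrow:
  assumes "diag_between X D Y" "diag_between X' D' Y'"
  shows "dpr_TensA (dpr_arrow X D Y) (dpr_arrow X' D' Y') = dpr_arrow (dpr_TensO X X') (diag_append D D') (dpr_TensO Y Y')"
proof -
  interpret D: diag_between X D Y by fact
  interpret D': diag_between X' D' Y' by fact
  show ?thesis
    unfolding dpr_arrow_def TensO_points(2)[OF D.X D'.X] TensO_points(2)[OF D.Y D'.Y] dpr_TensA_def
    using D.lengths D'.lengths
    by (cases X; cases Y; cases X'; cases Y') (simp add: strands_diag_append strands_map osum_def image_def)
qed

lemma forest_append_assoc: "forest_append (forest_append c d) e = forest_append c (forest_append d e)" and forest_append_Leaf [simp]: "forest_append c Leaf = c"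
  by (induction c) auto

lemma diag_prepend_diag_prepend: "diag_prepend c k (diag_prepend c' k' D) = diag_prepend (forest_append c c') (forest_append k k') D"
  by (cases D) (auto simp: forest_append_assoc)

lemma diag_append_diag_prepend: "diag_append (diag_prepend c k D) E = diag_prepend c k (diag_append D E)"
  by (cases D) (auto simp: diag_prepend_diag_prepend)

lemma diag_append_assoc: "diag_append (diag_append D E) G = diag_append D (diag_append E G)"
  by (induction D) (auto simp: diag_append_diag_prepend)

lemma diag_prepend_Leaf [simp]: "diag_prepend Leaf Leaf D = D"
  by (cases D) auto

lemma diag_append_empty [simp]: "diag_append D (End Leaf Leaf) = D" "diag_append (End Leaf Leaf) D = D"
  by (induction D) simp_all

lemma diag_ident_append: "diag_append (diag_ident u) (diag_ident v) = diag_ident (u @ v)"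
  by (induction u) auto

lemma TensO_assoc:
  assumes "X \<in> dpr_Obj" "Y \<in> dpr_Obj" "Z \<in> dpr_Obj"
  shows "dpr_TensO (dpr_TensO X Y) Z = dpr_TensO X (dpr_TensO Y Z)"
proof -
  obtain M S N T P U where e: "X = (M, S)" "Y = (N, T)" "Z = (P, U)" by (metis surj_pair)
  have "osum (osum M M N) (osum M A B) C' = osum M A (osum N B C')" for A B C'
  proof -
    have "offset (osum M M N) = offset M + offset N" using assms e by (simp add: offset_osum dpr_Obj_def)
    then show ?thesis unfolding osum_def[of "osum M M N"]
      by (simp add: osum_def[of M] osum_def[of N] image_Un image_image add.assoc Un_assoc)
  qed
  then show ?thesis unfolding e by (simp add: dpr_TensO_def)
qed

lemma TensO_unit [simp]: "dpr_TensO ({}, {}) X = X" "dpr_TensO X ({}, {}) = X"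
  by (cases X; auto simp: dpr_TensO_def osum_def)+

lemma unit_in_dpr_Obj [simp]: "({}, {}) \<in> dpr_Obj" by (simp add: dpr_Obj_def)

lemma sign_word_unit [simp]: "sign_word ({}, {}) = []" "points ({}, {}) = []"
  by (simp_all add: sign_word_def points_def)

lemma TensA_Ident_Dpr:
  assumes "X \<in> dpr_Obj" "Y \<in> dpr_Obj"
  shows "dpr_TensA (dpr_Ident X) (dpr_Ident Y) = dpr_Ident (dpr_TensO X Y)"
  using assms TensA_dpr_arrow[OF diag_between_diag_ident diag_between_diag_ident, of X Y]
  by (simp add: Ident_dpr_arrow TensO_points diag_ident_append)

text \<open>On diagrams the tensor product is concatenation, which is strictly associative and
  unital. Only the interchange law goes beyond a calculation with identities; it is checked on
  relations.\<close>

lemma monoidal_Dpr: "monoidal_category Dpr"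
proof -
  interpret category Dpr by (rule category_Dpr)
  have iso: "iso_arrow Dpr (dpr_Ident X)" if "X \<in> dpr_Obj" for X
    unfolding iso_arrow_def inverse_arrows_def
    by (rule exI[of _ "dpr_Ident X"]) (use that Ident_typing[of X] Ident_cancel[of "dpr_Ident X"] in auto)
  have canc: "dpr_Cmp (dpr_Ident Y) f = f" "dpr_Cmp f (dpr_Ident X) = f" if "f \<in> Hom Dpr X Y" for f X Y
    using that Cmp_Ident_dpr_arrow unfolding Hom_Dpr by blast+
  have idh: "dpr_Ident X \<in> Hom Dpr X X" if "X \<in> dpr_Obj" for X
    using Ident_in[of X] that by simp
  have tens: "dpr_TensA f g \<in> Hom Dpr (dpr_TensO X X') (dpr_TensO Y Y')"
    if "f \<in> Hom Dpr X Y" "g \<in> Hom Dpr X' Y'" for f g X Y X' Y'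
    using that TensA_dpr_arrow diag_between_diag_append unfolding Hom_Dpr by metis
  have assoc: "dpr_TensA (dpr_TensA f g) h = dpr_TensA f (dpr_TensA g h)"
    if "f \<in> Hom Dpr X X'" "g \<in> Hom Dpr Y Y'" "h \<in> Hom Dpr Z Z'" for f g h X X' Y Y' Z Z'
  proof -
    obtain D where D: "diag_between X D X'" "f = dpr_arrow X D X'" using \<open>f \<in> _\<close> unfolding Hom_Dpr by blast
    obtain E where E: "diag_between Y E Y'" "g = dpr_arrow Y E Y'" using \<open>g \<in> _\<close> unfolding Hom_Dpr by blast
    obtain G where G: "diag_between Z G Z'" "h = dpr_arrow Z G Z'" using \<open>h \<in> _\<close> unfolding Hom_Dpr by blast
    have o: "X \<in> dpr_Obj" "Y \<in> dpr_Obj" "Z \<in> dpr_Obj" "X' \<in> dpr_Obj" "Y' \<in> dpr_Obj" "Z' \<in> dpr_Obj"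
      using D(1) E(1) G(1) by (auto simp: diag_between_def)
    show ?thesis
      using D(1) E(1) G(1) o
      by (simp add: D(2) E(2) G(2) TensA_dpr_arrow diag_between_diag_append diag_append_assoc TensO_assoc)
  qed
  have unitl: "dpr_TensA (dpr_Ident ({}, {})) f = f" and unitr: "dpr_TensA f (dpr_Ident ({}, {})) = f"
    if "f \<in> Hom Dpr X Y" for f X Y
    using that diag_between_diag_ident[of "({}, {})"] unfolding Hom_Dpr
    by (auto simp: Ident_dpr_arrow TensA_dpr_arrow)
  show ?thesis
  proof (unfold_locales, simp_all only: Dpr_simps)
    show "({}, {}) \<in> dpr_Obj" by simp
    show "dpr_TensO x y \<in> dpr_Obj" if "x \<in> dpr_Obj" "y \<in> dpr_Obj" for x y using that by (rule TensO_points)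
    show "dpr_TensA f g \<in> Hom Dpr (dpr_TensO x y) (dpr_TensO x' y')" if "f \<in> Hom Dpr x x'" "g \<in> Hom Dpr y y'" for f g x x' y y'
      using that by (rule tens)
    show "dpr_TensA (dpr_Ident x) (dpr_Ident y) = dpr_Ident (dpr_TensO x y)" if "x \<in> dpr_Obj" "y \<in> dpr_Obj" for x y
      using that by (rule TensA_Ident_Dpr)
    show "dpr_TensA (dpr_Cmp f' f) (dpr_Cmp g' g) = dpr_Cmp (dpr_TensA f' g') (dpr_TensA f g)"
      if "f \<in> Hom Dpr x x'" "f' \<in> Hom Dpr x' x''" "g \<in> Hom Dpr y y'" "g' \<in> Hom Dpr y' y''" for f f' g g' x x' x'' y y' y''
    proof -
      obtain D1 D2 E1 E2 where D: "diag_between x D1 x'" "diag_between x' D2 x''" "diag_between y E1 y'" "diag_between y' E2 y''"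
        and e: "f = dpr_arrow x D1 x'" "f' = dpr_arrow x' D2 x''" "g = dpr_arrow y E1 y'" "g' = dpr_arrow y' E2 y''"
        using \<open>f \<in> _\<close> \<open>f' \<in> _\<close> \<open>g \<in> _\<close> \<open>g' \<in> _\<close> unfolding Hom_Dpr by blast
      obtain G where G: "diag_between x G x''" "Rel G = Rel D1 O Rel D2" "dpr_Cmp f' f = dpr_arrow x G x''"
        using diag_compose[OF D(1,2)] e by blast
      obtain K where K: "diag_between y K y''" "Rel K = Rel E1 O Rel E2" "dpr_Cmp g' g = dpr_arrow y K y''"
        using diag_compose[OF D(3,4)] e by blast
      have "dpr_Cmp (dpr_TensA f' g') (dpr_TensA f g) = dpr_arrow (dpr_TensO x y) (diag_append G K) (dpr_TensO x'' y'')"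
        unfolding e TensA_dpr_arrow[OF D(1,3)] TensA_dpr_arrow[OF D(2,4)]
      proof (rule diag_cmp[OF diag_between_diag_append[OF D(1,3)] diag_between_diag_append[OF D(2,4)] diag_between_diag_append[OF G(1) K(1)]])
        show "Rel (diag_append G K) = Rel (diag_append D1 E1) O Rel (diag_append D2 E2)"
          using R.Phi_diag_append_Cmp[of G D2 D1 K E2 E1 0] D G(1,2) K(1,2) by (simp add: diag_between_def)
      qed
      then show ?thesis unfolding G(3) K(3) TensA_dpr_arrow[OF G(1) K(1)] by simp
    qed
    show "dpr_Ident (dpr_TensO (dpr_TensO x y) z) \<in> Hom Dpr (dpr_TensO (dpr_TensO x y) z) (dpr_TensO x (dpr_TensO y z))"
      if "x \<in> dpr_Obj" "y \<in> dpr_Obj" "z \<in> dpr_Obj" for x y z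
      using that idh[of "dpr_TensO (dpr_TensO x y) z"] by (simp add: TensO_points TensO_assoc)
    show "iso_arrow Dpr (dpr_Ident (dpr_TensO (dpr_TensO x y) z))" if "x \<in> dpr_Obj" "y \<in> dpr_Obj" "z \<in> dpr_Obj" for x y z
      using that iso by (simp add: TensO_points)
    show "dpr_Cmp (dpr_Ident (dpr_TensO (dpr_TensO x' y') z')) (dpr_TensA (dpr_TensA f g) h) =
        dpr_Cmp (dpr_TensA f (dpr_TensA g h)) (dpr_Ident (dpr_TensO (dpr_TensO x y) z))"
      if "f \<in> Hom Dpr x x'" "g \<in> Hom Dpr y y'" "h \<in> Hom Dpr z z'" for f g h x x' y y' z z'
    proof -
      have "dpr_TensA (dpr_TensA f g) h \<in> Hom Dpr (dpr_TensO (dpr_TensO x y) z) (dpr_TensO (dpr_TensO x' y') z')"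
        using that tens by blast
      then show ?thesis using canc assoc[OF that] by metis
    qed
    show "dpr_Ident x \<in> Hom Dpr (dpr_TensO ({}, {}) x) x" if "x \<in> dpr_Obj" for x using that idh by simp
    show "iso_arrow Dpr (dpr_Ident x)" if "x \<in> dpr_Obj" for x using that by (rule iso)
    then show "iso_arrow Dpr (dpr_Ident x)" if "x \<in> dpr_Obj" for x using that .
    show "dpr_Cmp (dpr_Ident y) (dpr_TensA (dpr_Ident ({}, {})) f) = dpr_Cmp f (dpr_Ident x)" if "f \<in> Hom Dpr x y" for f x y
      using unitl canc that by metis
    show "dpr_Ident x \<in> Hom Dpr (dpr_TensO x ({}, {})) x" if "x \<in> dpr_Obj" for x using that idh by simp
    show "dpr_Cmp (dpr_Ident y) (dpr_TensA f (dpr_Ident ({}, {}))) = dpr_Cmp f (dpr_Ident x)" if "f \<in> Hom Dpr x y" for f x y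
      using unitr canc that by metis
    show "dpr_Cmp (dpr_TensA (dpr_Ident w) (dpr_Ident (dpr_TensO (dpr_TensO x y) z)))
        (dpr_Cmp (dpr_Ident (dpr_TensO (dpr_TensO w (dpr_TensO x y)) z)) (dpr_TensA (dpr_Ident (dpr_TensO (dpr_TensO w x) y)) (dpr_Ident z)))
      = dpr_Cmp (dpr_Ident (dpr_TensO (dpr_TensO w x) (dpr_TensO y z))) (dpr_Ident (dpr_TensO (dpr_TensO (dpr_TensO w x) y) z))"
      if "w \<in> dpr_Obj" "x \<in> dpr_Obj" "y \<in> dpr_Obj" "z \<in> dpr_Obj" for w x y z
      using that canc[OF idh] by (simp add: TensA_Ident_Dpr TensO_points TensO_assoc)
    show "dpr_Cmp (dpr_TensA (dpr_Ident x) (dpr_Ident y)) (dpr_Ident (dpr_TensO (dpr_TensO x ({}, {})) y))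
      = dpr_TensA (dpr_Ident x) (dpr_Ident y)" if "x \<in> dpr_Obj" "y \<in> dpr_Obj" for x y
      using that canc[OF idh] by (simp add: TensA_Ident_Dpr TensO_points)
  qed
qed

section \<open>Isomorphisms and unit coherence\<close>

context category
begin

lemma inverse_unique:
  assumes "inverse_arrows C f g" "inverse_arrows C f h"
  shows "g = h"
proof -
  have f: "f \<in> Arr C" and g: "g \<in> Arr C" "Dom C g = Cod C f" "g \<cdot> f = Ident C (Dom C f)"
    and h: "h \<in> Arr C" "Cod C h = Dom C f" "f \<cdot> h = Ident C (Cod C f)"
    using assms by (auto simp: inverse_arrows_def)
  have "g \<cdot> (f \<cdot> h) = Ident C (Dom C f) \<cdot> h"
    by (rule Cmp_rotate[OF g(3) g(1) f h(1) g(2) h(2)[symmetric]])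
  then show ?thesis unfolding h(3) Ident_cancel(2)[OF g(1,2)] Ident_cancel(1)[OF h(1,2)] .
qed

lemma inv_arrow_eq: "inverse_arrows C f g \<Longrightarrow> inv_arrow C f = g"
  unfolding inv_arrow_def using inverse_unique by blast

lemma iso_inv:
  assumes "iso_arrow C f"
  shows "inverse_arrows C f (inv_arrow C f)"
  using assms inv_arrow_eq unfolding iso_arrow_def by metis

lemma iso_Arr: "iso_arrow C f \<Longrightarrow> f \<in> Arr C"
  by (auto simp: iso_arrow_def inverse_arrows_def)

lemma inv_simps [simp]:
  assumes "iso_arrow C f"
  shows "inv_arrow C f \<in> Arr C" "Dom C (inv_arrow C f) = Cod C f" "Cod C (inv_arrow C f) = Dom C f"
    "inv_arrow C f \<cdot> f = Ident C (Dom C f)" "f \<cdot> inv_arrow C f = Ident C (Cod C f)"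
  using iso_inv[OF assms] by (auto simp: inverse_arrows_def)

lemma inv_cancel [simp]:
  assumes "iso_arrow C f" "k \<in> Arr C"
  shows "Cod C k = Dom C f \<Longrightarrow> inv_arrow C f \<cdot> (f \<cdot> k) = k"
    "Cod C k = Cod C f \<Longrightarrow> f \<cdot> (inv_arrow C f \<cdot> k) = k"
proof -
  have f: "f \<in> Arr C" using assms(1) by (rule iso_Arr)
  show "inv_arrow C f \<cdot> (f \<cdot> k) = k" if "Cod C k = Dom C f"
    using Cmp_rotate[OF inv_simps(4)[OF assms(1)] inv_simps(1)[OF assms(1)] f assms(2) inv_simps(2)[OF assms(1)] that[symmetric]]
      Ident_cancel(1)[OF assms(2) that] by simp
  show "f \<cdot> (inv_arrow C f \<cdot> k) = k" if "Cod C k = Cod C f"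
    using Cmp_rotate[OF inv_simps(5)[OF assms(1)] f inv_simps(1)[OF assms(1)] assms(2) inv_simps(3)[OF assms(1), symmetric]]
      Ident_cancel(1)[OF assms(2) that] inv_simps(2)[OF assms(1)] that by simp
qed

lemma iso_inv_iso: "iso_arrow C f \<Longrightarrow> iso_arrow C (inv_arrow C f)"
  unfolding iso_arrow_def[of C "inv_arrow C f"] inverse_arrows_def
  using iso_Arr by (intro exI[of _ f]) simp

lemma inv_inv [simp]: "iso_arrow C f \<Longrightarrow> inv_arrow C (inv_arrow C f) = f"
  using iso_Arr by (intro inv_arrow_eq) (simp add: inverse_arrows_def)

lemma iso_Ident [simp]: "x \<in> Obj C \<Longrightarrow> iso_arrow C (Ident C x)"
  "x \<in> Obj C \<Longrightarrow> inv_arrow C (Ident C x) = Ident C x"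
proof -
  assume "x \<in> Obj C"
  then have "inverse_arrows C (Ident C x) (Ident C x)" by (simp add: inverse_arrows_def)
  then show "iso_arrow C (Ident C x)" "inv_arrow C (Ident C x) = Ident C x"
    using inv_arrow_eq by (auto simp: iso_arrow_def)
qed

lemma iso_Cmp:
  assumes "iso_arrow C f" "iso_arrow C g" "Dom C g = Cod C f"
  shows "iso_arrow C (g \<cdot> f)" "inv_arrow C (g \<cdot> f) = inv_arrow C f \<cdot> inv_arrow C g"
proof -
  have "inverse_arrows C (g \<cdot> f) (inv_arrow C f \<cdot> inv_arrow C g)"
    using assms iso_Arr[OF assms(1)] iso_Arr[OF assms(2)] by (simp add: inverse_arrows_def)
  then show "iso_arrow C (g \<cdot> f)" "inv_arrow C (g \<cdot> f) = inv_arrow C f \<cdot> inv_arrow C g"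
    using inv_arrow_eq by (auto simp: iso_arrow_def)
qed

lemma iso_left_cancel:
  assumes "f \<cdot> g = f \<cdot> h" "iso_arrow C f" "g \<in> Arr C" "h \<in> Arr C" "Cod C g = Dom C f" "Cod C h = Dom C f"
  shows "g = h"
  by (metis assms(1) inv_cancel(1)[OF assms(2,3,5)] inv_cancel(1)[OF assms(2,4,6)])

lemma iso_right_cancel:
  assumes "g \<cdot> f = h \<cdot> f" "iso_arrow C f" "g \<in> Arr C" "h \<in> Arr C" "Dom C g = Cod C f" "Dom C h = Cod C f"
  shows "g = h"
proof -
  have *: "(k \<cdot> f) \<cdot> inv_arrow C f = k" if "k \<in> Arr C" "Dom C k = Cod C f" for k
    using that iso_Arr[OF assms(2)] inv_simps[OF assms(2)] by simp
  show ?thesis by (metis assms(1) *[OF assms(3,5)] *[OF assms(4,6)])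
qed

text \<open>Reverses two opposite invertible sides of a commuting square; in this form inverse
  associators and unit constraints are moved past other arrows.\<close>

lemma iso_square:
  assumes "g \<cdot> f = k \<cdot> h" "iso_arrow C f" "iso_arrow C k" "g \<in> Arr C" "h \<in> Arr C"
    "Dom C g = Cod C f" "Dom C k = Cod C h" "Dom C f = Dom C h"
  shows "inv_arrow C k \<cdot> g = h \<cdot> inv_arrow C f"
proof (rule iso_right_cancel[of _ f])
  have "Cod C g = Cod C k" using assms iso_Arr Cmp_typing by metis
  then show "(inv_arrow C k \<cdot> g) \<cdot> f = (h \<cdot> inv_arrow C f) \<cdot> f" "inv_arrow C k \<cdot> g \<in> Arr C"
    "h \<cdot> inv_arrow C f \<in> Arr C" "Dom C (inv_arrow C k \<cdot> g) = Cod C f" "Dom C (h \<cdot> inv_arrow C f) = Cod C f"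
    using assms(2-8) iso_Arr[OF assms(2)] iso_Arr[OF assms(3)] inv_cancel(1)[OF assms(3,5)] assms(1) by simp_all
qed (rule assms)

end

section \<open>Calculus in a monoidal category and coherence of the unit\<close>

context monoidal_category
begin

abbreviation (input) I where "I \<equiv> UnitO C"
abbreviation (input) idn where "idn x \<equiv> Ident C x"

declare UnitO_in [simp] TensO_in [simp]

lemma TensA_typing [simp]:
  assumes "f \<in> Arr C" "g \<in> Arr C"
  shows "f \<otimes> g \<in> Arr C" "Dom C (f \<otimes> g) = Dom C f \<odot> Dom C g" "Cod C (f \<otimes> g) = Cod C f \<odot> Cod C g"
  using TensA_in[of f "Dom C f" "Cod C f" g "Dom C g" "Cod C g"] assms by auto

lemma TensA_Ident' [simp]: "x \<in> Obj C \<Longrightarrow> y \<in> Obj C \<Longrightarrow> idn x \<otimes> idn y = idn (x \<odot> y)"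
  by (rule TensA_Ident)

lemma interchange:
  assumes "f \<in> Arr C" "f' \<in> Arr C" "g \<in> Arr C" "g' \<in> Arr C" "Dom C f' = Cod C f" "Dom C g' = Cod C g"
  shows "(f' \<otimes> g') \<cdot> (f \<otimes> g) = (f' \<cdot> f) \<otimes> (g' \<cdot> g)"
  using TensA_Cmp[of f "Dom C f" "Cod C f" f' "Cod C f'" g "Dom C g" "Cod C g" g' "Cod C g'"] assms by simp

lemma whisker_left [simp]:
  assumes "x \<in> Obj C" "f \<in> Arr C" "g \<in> Arr C" "Dom C g = Cod C f"
  shows "idn x \<otimes> (g \<cdot> f) = (idn x \<otimes> g) \<cdot> (idn x \<otimes> f)"
  using assms by (simp add: interchange)

lemma whisker_right [simp]:
  assumes "x \<in> Obj C" "f \<in> Arr C" "g \<in> Arr C" "Dom C g = Cod C f"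
  shows "(g \<cdot> f) \<otimes> idn x = (g \<otimes> idn x) \<cdot> (f \<otimes> idn x)"
  using assms by (simp add: interchange)

lemma TensA_split:
  assumes "f \<in> Arr C" "g \<in> Arr C"
  shows "f \<otimes> g = (f \<otimes> idn (Cod C g)) \<cdot> (idn (Dom C f) \<otimes> g)"
    "f \<otimes> g = (idn (Cod C f) \<otimes> g) \<cdot> (f \<otimes> idn (Dom C g))"
  using assms by (simp_all add: interchange)

lemma Assoc_typing [simp]:
  assumes "x \<in> Obj C" "y \<in> Obj C" "z \<in> Obj C"
  shows "Assoc C x y z \<in> Arr C" "Dom C (Assoc C x y z) = (x \<odot> y) \<odot> z"
    "Cod C (Assoc C x y z) = x \<odot> (y \<odot> z)" "iso_arrow C (Assoc C x y z)"
  using Assoc_in[OF assms] Assoc_iso[OF assms] by auto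

lemma LUnit_typing [simp]:
  assumes "x \<in> Obj C"
  shows "LUnit C x \<in> Arr C" "Dom C (LUnit C x) = I \<odot> x" "Cod C (LUnit C x) = x" "iso_arrow C (LUnit C x)"
  using LUnit_in[OF assms] LUnit_iso[OF assms] by auto

lemma RUnit_typing [simp]:
  assumes "x \<in> Obj C"
  shows "RUnit C x \<in> Arr C" "Dom C (RUnit C x) = x \<odot> I" "Cod C (RUnit C x) = x" "iso_arrow C (RUnit C x)"
  using RUnit_in[OF assms] RUnit_iso[OF assms] by auto

lemma Assoc_nat:
  assumes "f \<in> Arr C" "g \<in> Arr C" "h \<in> Arr C"
  shows "Assoc C (Cod C f) (Cod C g) (Cod C h) \<cdot> ((f \<otimes> g) \<otimes> h)
    = (f \<otimes> (g \<otimes> h)) \<cdot> Assoc C (Dom C f) (Dom C g) (Dom C h)"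
  by (rule Assoc_natural) (use assms in auto)

lemma LUnit_nat: "f \<in> Arr C \<Longrightarrow> LUnit C (Cod C f) \<cdot> (idn I \<otimes> f) = f \<cdot> LUnit C (Dom C f)"
  by (rule LUnit_natural) auto

lemma RUnit_nat: "f \<in> Arr C \<Longrightarrow> RUnit C (Cod C f) \<cdot> (f \<otimes> idn I) = f \<cdot> RUnit C (Dom C f)"
  by (rule RUnit_natural) auto

lemma iso_TensA [simp]:
  assumes "iso_arrow C f" "iso_arrow C g"
  shows "iso_arrow C (f \<otimes> g)" "inv_arrow C (f \<otimes> g) = inv_arrow C f \<otimes> inv_arrow C g"
proof -
  have "inverse_arrows C (f \<otimes> g) (inv_arrow C f \<otimes> inv_arrow C g)"
    using assms iso_Arr[OF assms(1)] iso_Arr[OF assms(2)] by (simp add: inverse_arrows_def interchange)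
  then show "iso_arrow C (f \<otimes> g)" "inv_arrow C (f \<otimes> g) = inv_arrow C f \<otimes> inv_arrow C g"
    using inv_arrow_eq by (auto simp: iso_arrow_def)
qed

text \<open>Naturality of \<open>LUnit\<close> exhibits tensoring with the unit as isomorphic to the
  identity functor, hence as faithful.\<close>

lemma unit_left_faithful:
  assumes "idn I \<otimes> f = idn I \<otimes> g" "f \<in> Arr C" "g \<in> Arr C" "Dom C f = Dom C g" "Cod C f = Cod C g"
  shows "f = g"
  using LUnit_nat[of f] LUnit_nat[of g] assms
  by (intro iso_right_cancel[of f "LUnit C (Dom C g)"]) auto

lemma unit_right_faithful:
  assumes "f \<otimes> idn I = g \<otimes> idn I" "f \<in> Arr C" "g \<in> Arr C" "Dom C f = Dom C g" "Cod C f = Cod C g"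
  shows "f = g"
  using RUnit_nat[of f] RUnit_nat[of g] assms
  by (intro iso_right_cancel[of f "RUnit C (Dom C g)"]) auto

text \<open>Kelly's argument: after tensoring with the unit on the left, the equation follows from
  the pentagon for \<open>I\<close>, \<open>I\<close>, \<open>x\<close>, \<open>y\<close> and two
  triangles, and this tensoring is faithful.\<close>

lemma LUnit_TensO:
  assumes "x \<in> Obj C" "y \<in> Obj C"
  shows "LUnit C (x \<odot> y) \<cdot> Assoc C I x y = LUnit C x \<otimes> idn y"
proof (rule unit_left_faithful)
  let ?p = "Assoc C I (I \<odot> x) y \<cdot> (Assoc C I I x \<otimes> idn y)"
  have t: "(idn I \<otimes> LUnit C (x \<odot> y)) \<cdot> Assoc C I I (x \<odot> y) = RUnit C I \<otimes> idn (x \<odot> y)"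
    using triangle[of I "x \<odot> y"] assms by simp
  have p: "(idn I \<otimes> Assoc C I x y) \<cdot> ?p = Assoc C I I (x \<odot> y) \<cdot> Assoc C (I \<odot> I) x y"
    using pentagon[of I I x y] assms by simp
  have n1: "Assoc C I x y \<cdot> ((RUnit C I \<otimes> idn x) \<otimes> idn y) = (RUnit C I \<otimes> idn (x \<odot> y)) \<cdot> Assoc C (I \<odot> I) x y"
    using Assoc_nat[of "RUnit C I" "idn x" "idn y"] assms by simp
  have n2: "Assoc C I x y \<cdot> ((idn I \<otimes> LUnit C x) \<otimes> idn y) = (idn I \<otimes> (LUnit C x \<otimes> idn y)) \<cdot> Assoc C I (I \<odot> x) y"
    using Assoc_nat[of "idn I" "LUnit C x" "idn y"] assms by simp
  have t2: "RUnit C I \<otimes> idn x = (idn I \<otimes> LUnit C x) \<cdot> Assoc C I I x"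
    using triangle[of I x] assms by simp
  have "(idn I \<otimes> (LUnit C (x \<odot> y) \<cdot> Assoc C I x y)) \<cdot> ?p =
      (idn I \<otimes> LUnit C (x \<odot> y)) \<cdot> Assoc C I I (x \<odot> y) \<cdot> Assoc C (I \<odot> I) x y"
    using assms p by simp
  also have "\<dots> = Assoc C I x y \<cdot> ((RUnit C I \<otimes> idn x) \<otimes> idn y)"
    using assms n1 by (simp add: Cmp_rotate[OF t])
  also have "\<dots> = (idn I \<otimes> (LUnit C x \<otimes> idn y)) \<cdot> ?p"
    unfolding t2 using assms by (simp add: Cmp_rotate[OF n2])
  finally show "idn I \<otimes> (LUnit C (x \<odot> y) \<cdot> Assoc C I x y) = idn I \<otimes> (LUnit C x \<otimes> idn y)"
    by (rule iso_right_cancel) (use assms in \<open>auto intro!: iso_Cmp\<close>)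
qed (use assms in auto)

text \<open>The mirror image of Kelly's argument, with the pentagon for \<open>x\<close>,
  \<open>y\<close>, \<open>I\<close>, \<open>I\<close>.\<close>

lemma RUnit_TensO:
  assumes "x \<in> Obj C" "y \<in> Obj C"
  shows "(idn x \<otimes> RUnit C y) \<cdot> Assoc C x y I = RUnit C (x \<odot> y)"
proof (rule unit_right_faithful)
  have t: "(idn x \<otimes> (idn y \<otimes> LUnit C I)) \<cdot> (idn x \<otimes> Assoc C y I I) = idn x \<otimes> (RUnit C y \<otimes> idn I)"
    using triangle[of y I] assms by (metis whisker_left Assoc_typing LUnit_typing TensA_typing Ident_typing UnitO_in)
  have p: "(idn x \<otimes> Assoc C y I I) \<cdot> Assoc C x (y \<odot> I) I \<cdot> (Assoc C x y I \<otimes> idn I)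
     = Assoc C x y (I \<odot> I) \<cdot> Assoc C (x \<odot> y) I I"
    using pentagon[of x y I I] assms by simp
  have n1: "Assoc C x y I \<cdot> ((idn x \<otimes> RUnit C y) \<otimes> idn I) = (idn x \<otimes> (RUnit C y \<otimes> idn I)) \<cdot> Assoc C x (y \<odot> I) I"
    using Assoc_nat[of "idn x" "RUnit C y" "idn I"] assms by simp
  have n2: "(idn x \<otimes> (idn y \<otimes> LUnit C I)) \<cdot> Assoc C x y (I \<odot> I) = Assoc C x y I \<cdot> (idn (x \<odot> y) \<otimes> LUnit C I)"
    using Assoc_nat[of "idn x" "idn y" "LUnit C I"] assms by simp
  have t2: "(idn (x \<odot> y) \<otimes> LUnit C I) \<cdot> Assoc C (x \<odot> y) I I = RUnit C (x \<odot> y) \<otimes> idn I"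
    using triangle[of "x \<odot> y" I] assms by simp
  have "Assoc C x y I \<cdot> (((idn x \<otimes> RUnit C y) \<cdot> Assoc C x y I) \<otimes> idn I)
    = (idn x \<otimes> (RUnit C y \<otimes> idn I)) \<cdot> Assoc C x (y \<odot> I) I \<cdot> (Assoc C x y I \<otimes> idn I)"
    using assms by (simp add: Cmp_rotate[OF n1])
  also have "\<dots> = (idn x \<otimes> (idn y \<otimes> LUnit C I)) \<cdot> Assoc C x y (I \<odot> I) \<cdot> Assoc C (x \<odot> y) I I"
    unfolding t[symmetric] using assms p by simp
  also have "\<dots> = Assoc C x y I \<cdot> (RUnit C (x \<odot> y) \<otimes> idn I)"
    using assms t2 by (simp add: Cmp_rotate[OF n2])
  finally show "((idn x \<otimes> RUnit C y) \<cdot> Assoc C x y I) \<otimes> idn I = RUnit C (x \<odot> y) \<otimes> idn I"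
    by (rule iso_left_cancel) (use assms in auto)
qed (use assms in auto)

text \<open>Naturality of \<open>LUnit\<close> at itself, with the constraint cancelled, identifies
  \<open>LUnit C (I \<odot> I)\<close> with \<open>idn I \<otimes> LUnit C I\<close>. Then
  \<open>LUnit_TensO\<close> and the triangle give the same value for both sides tensored with
  \<open>I\<close>.\<close>

lemma LUnit_unit: "LUnit C I = RUnit C I"
proof (rule unit_right_faithful)
  have "LUnit C (I \<odot> I) = idn I \<otimes> LUnit C I"
    by (rule iso_left_cancel[of "LUnit C I"]) (use LUnit_nat[of "LUnit C I"] in auto)
  then show "LUnit C I \<otimes> idn I = RUnit C I \<otimes> idn I"
    using LUnit_TensO[of I I] triangle[of I I] by simp
qed auto

end

section \<open>The action of a dual pair\<close>

locale dual_pair_in = monoidal_category C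
  for C :: "('o, 'm) moncat" (structure) +
  fixes P :: "('o, 'm) dpair"
  assumes dual: "dual_pair C P"
begin

abbreviation (input) X where "X \<equiv> LeftO P"
abbreviation (input) Y where "Y \<equiv> RightO P"
abbreviation (input) \<epsilon> where "\<epsilon> \<equiv> Counit P"
abbreviation (input) \<eta> where "\<eta> \<equiv> UnitA P"

lemma dual_typing [simp]: "X \<in> Obj C" "Y \<in> Obj C" "\<epsilon> \<in> Arr C" "Dom C \<epsilon> = X \<odot> Y" "Cod C \<epsilon> = I"
  "\<eta> \<in> Arr C" "Dom C \<eta> = I" "Cod C \<eta> = Y \<odot> X"
  using dual by (auto simp: dual_pair_def Let_def)

lemma dual_zigzag:
  "LUnit C X \<cdot> (\<epsilon> \<otimes> idn X) \<cdot> inv_arrow C (Assoc C X Y X) \<cdot> (idn X \<otimes> \<eta>) \<cdot> inv_arrow C (RUnit C X) = idn X"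
  "RUnit C Y \<cdot> (idn Y \<otimes> \<epsilon>) \<cdot> Assoc C Y X Y \<cdot> (\<eta> \<otimes> idn Y) \<cdot> inv_arrow C (LUnit C Y) = idn Y"
  using dual by (auto simp: dual_pair_def Let_def)

definition ob :: "bool \<Rightarrow> 'o" where "ob s = (if s then Y else X)"

lemma ob_simps [simp]: "ob True = Y" "ob False = X" "ob s \<in> Obj C"
  by (simp_all add: ob_def)

text \<open>Together with \<open>cvm\<close>, the counit and unit of the adjunction between
  tensoring with \<open>X\<close> and tensoring with \<open>Y\<close> on the left, corrected by
  associators and unit constraints.\<close>

definition evm :: "'o \<Rightarrow> 'm" where
  "evm z = LUnit C z \<cdot> (\<epsilon> \<otimes> idn z) \<cdot> inv_arrow C (Assoc C X Y z)"

definition cvm :: "'o \<Rightarrow> 'm" where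
  "cvm z = Assoc C Y X z \<cdot> (\<eta> \<otimes> idn z) \<cdot> inv_arrow C (LUnit C z)"

lemma evm_typing: "z \<in> Obj C \<Longrightarrow> evm z \<in> Arr C" "z \<in> Obj C \<Longrightarrow> Dom C (evm z) = X \<odot> (Y \<odot> z)"
  "z \<in> Obj C \<Longrightarrow> Cod C (evm z) = z"
  by (simp_all add: evm_def)

lemma cvm_typing: "z \<in> Obj C \<Longrightarrow> cvm z \<in> Arr C" "z \<in> Obj C \<Longrightarrow> Cod C (cvm z) = Y \<odot> (X \<odot> z)"
  "z \<in> Obj C \<Longrightarrow> Dom C (cvm z) = z"
  by (simp_all add: cvm_def)

lemma evm_natural:
  assumes f: "f \<in> Arr C"
  shows "evm (Cod C f) \<cdot> (idn X \<otimes> (idn Y \<otimes> f)) = f \<cdot> evm (Dom C f)"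
proof -
  have 1: "inv_arrow C (Assoc C X Y (Cod C f)) \<cdot> (idn X \<otimes> (idn Y \<otimes> f)) = (idn (X \<odot> Y) \<otimes> f) \<cdot> inv_arrow C (Assoc C X Y (Dom C f))"
    by (rule iso_square) (use Assoc_nat[of "idn X" "idn Y" f] f in auto)
  have 2: "(\<epsilon> \<otimes> idn (Cod C f)) \<cdot> (idn (X \<odot> Y) \<otimes> f) = (idn I \<otimes> f) \<cdot> (\<epsilon> \<otimes> idn (Dom C f))"
    using f by (simp add: interchange)
  have 3: "LUnit C (Cod C f) \<cdot> (idn I \<otimes> f) = f \<cdot> LUnit C (Dom C f)" by (rule LUnit_nat[OF f])
  show ?thesis using f by (simp add: evm_def 1 Cmp_rotate[OF 2] Cmp_rotate[OF 3])
qed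

lemma cvm_natural:
  assumes f: "f \<in> Arr C"
  shows "(idn Y \<otimes> (idn X \<otimes> f)) \<cdot> cvm (Dom C f) = cvm (Cod C f) \<cdot> f"
proof -
  have 1: "(idn Y \<otimes> (idn X \<otimes> f)) \<cdot> Assoc C Y X (Dom C f) = Assoc C Y X (Cod C f) \<cdot> (idn (Y \<odot> X) \<otimes> f)"
    using Assoc_nat[of "idn Y" "idn X" f] f by simp
  have 2: "(idn (Y \<odot> X) \<otimes> f) \<cdot> (\<eta> \<otimes> idn (Dom C f)) = (\<eta> \<otimes> idn (Cod C f)) \<cdot> (idn I \<otimes> f)"
    using f by (simp add: interchange)
  have 3: "inv_arrow C (LUnit C (Cod C f)) \<cdot> f = (idn I \<otimes> f) \<cdot> inv_arrow C (LUnit C (Dom C f))"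
    by (rule iso_square) (use LUnit_nat[of f] f in auto)
  show ?thesis using f by (simp add: cvm_def 3 Cmp_rotate[OF 1] Cmp_rotate[OF 2])
qed

text \<open>The pentagon solved for the inverse of the associator that occurs in \<open>evm\<close>
  at a tensor product.\<close>

lemma pentagon':
  assumes "w \<in> Obj C" "x \<in> Obj C" "y \<in> Obj C" "z \<in> Obj C"
  shows "inv_arrow C (Assoc C w x (y \<odot> z)) \<cdot> (idn w \<otimes> Assoc C x y z) \<cdot> Assoc C w (x \<odot> y) z
    = Assoc C (w \<odot> x) y z \<cdot> (inv_arrow C (Assoc C w x y) \<otimes> idn z)"
proof -
  have "inv_arrow C (Assoc C w x (y \<odot> z)) \<cdot> ((idn w \<otimes> Assoc C x y z) \<cdot> Assoc C w (x \<odot> y) z)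
    = Assoc C (w \<odot> x) y z \<cdot> inv_arrow C (Assoc C w x y \<otimes> idn z)"
    by (rule iso_square) (use pentagon[OF assms] assms in auto)
  then show ?thesis using assms by simp
qed

text \<open>The first triangle identity of the dual pair is tensored with \<open>z\<close> on the
  right; naturality and the pentagon then move \<open>z\<close> to the innermost position.\<close>

lemma zigzag_X:
  assumes z: "z \<in> Obj C"
  shows "evm (X \<odot> z) \<cdot> (idn X \<otimes> cvm z) = idn (X \<odot> z)"
proof -
  have p: "Assoc C (X \<odot> Y) X z \<cdot> (inv_arrow C (Assoc C X Y X) \<otimes> idn z)
      = inv_arrow C (Assoc C X Y (X \<odot> z)) \<cdot> (idn X \<otimes> Assoc C Y X z) \<cdot> Assoc C X (Y \<odot> X) z"
    using pentagon'[of X Y X z] z by simp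
  have l: "LUnit C X \<otimes> idn z = LUnit C (X \<odot> z) \<cdot> Assoc C I X z" using LUnit_TensO[of X z] z by simp
  have n1: "Assoc C I X z \<cdot> ((\<epsilon> \<otimes> idn X) \<otimes> idn z) = (\<epsilon> \<otimes> idn (X \<odot> z)) \<cdot> Assoc C (X \<odot> Y) X z"
    using Assoc_nat[of \<epsilon> "idn X" "idn z"] z by simp
  have n2: "Assoc C X (Y \<odot> X) z \<cdot> ((idn X \<otimes> \<eta>) \<otimes> idn z) = (idn X \<otimes> (\<eta> \<otimes> idn z)) \<cdot> Assoc C X I z"
    using Assoc_nat[of "idn X" \<eta> "idn z"] z by simp
  have t: "Assoc C X I z \<cdot> (inv_arrow C (RUnit C X) \<otimes> idn z) = idn X \<otimes> inv_arrow C (LUnit C z)"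
  proof (rule iso_left_cancel[of "idn X \<otimes> LUnit C z"])
    show "(idn X \<otimes> LUnit C z) \<cdot> (Assoc C X I z \<cdot> (inv_arrow C (RUnit C X) \<otimes> idn z)) = (idn X \<otimes> LUnit C z) \<cdot> (idn X \<otimes> inv_arrow C (LUnit C z))"
      using z Cmp_rotate[OF triangle[of X z], of "inv_arrow C (RUnit C X) \<otimes> idn z"] by (simp add: interchange)
  qed (use z in auto)
  have "idn (X \<odot> z) = (LUnit C X \<cdot> (\<epsilon> \<otimes> idn X) \<cdot> inv_arrow C (Assoc C X Y X) \<cdot> (idn X \<otimes> \<eta>) \<cdot> inv_arrow C (RUnit C X)) \<otimes> idn z"
    unfolding dual_zigzag using z by simp
  also have "\<dots> = LUnit C (X \<odot> z) \<cdot> Assoc C I X z \<cdot> ((\<epsilon> \<otimes> idn X) \<otimes> idn z) \<cdot> (inv_arrow C (Assoc C X Y X) \<otimes> idn z)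
      \<cdot> ((idn X \<otimes> \<eta>) \<otimes> idn z) \<cdot> (inv_arrow C (RUnit C X) \<otimes> idn z)"
    using z by (simp add: l)
  also have "\<dots> = LUnit C (X \<odot> z) \<cdot> (\<epsilon> \<otimes> idn (X \<odot> z)) \<cdot> inv_arrow C (Assoc C X Y (X \<odot> z)) \<cdot> (idn X \<otimes> Assoc C Y X z)
      \<cdot> Assoc C X (Y \<odot> X) z \<cdot> ((idn X \<otimes> \<eta>) \<otimes> idn z) \<cdot> (inv_arrow C (RUnit C X) \<otimes> idn z)"
    using z by (simp add: Cmp_rotate[OF n1] Cmp_rotate[OF p])
  also have "\<dots> = evm (X \<odot> z) \<cdot> (idn X \<otimes> cvm z)"
    using z by (simp add: evm_def cvm_def Cmp_rotate[OF n2] t)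
  finally show ?thesis ..
qed

lemma zigzag_Y:
  assumes z: "z \<in> Obj C"
  shows "(idn Y \<otimes> evm z) \<cdot> cvm (Y \<odot> z) = idn (Y \<odot> z)"
proof -
  have p: "Assoc C Y (X \<odot> Y) z \<cdot> (Assoc C Y X Y \<otimes> idn z)
      = (idn Y \<otimes> inv_arrow C (Assoc C X Y z)) \<cdot> Assoc C Y X (Y \<odot> z) \<cdot> Assoc C (Y \<odot> X) Y z"
  proof (rule iso_left_cancel[of "idn Y \<otimes> Assoc C X Y z"])
    have e: "(idn Y \<otimes> Assoc C X Y z) \<cdot> (idn Y \<otimes> inv_arrow C (Assoc C X Y z)) = idn (Y \<odot> (X \<odot> (Y \<odot> z)))"
      using z by (simp add: interchange)
    show "(idn Y \<otimes> Assoc C X Y z) \<cdot> (Assoc C Y (X \<odot> Y) z \<cdot> (Assoc C Y X Y \<otimes> idn z)) = (idn Y \<otimes> Assoc C X Y z) \<cdot>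
      ((idn Y \<otimes> inv_arrow C (Assoc C X Y z)) \<cdot> Assoc C Y X (Y \<odot> z) \<cdot> Assoc C (Y \<odot> X) Y z)"
      using z pentagon[of Y X Y z] by (simp add: Cmp_rotate[OF e])
  qed (use z in auto)
  have r: "RUnit C Y \<otimes> idn z = (idn Y \<otimes> LUnit C z) \<cdot> Assoc C Y I z" using triangle[of Y z] z by simp
  have n1: "Assoc C Y I z \<cdot> ((idn Y \<otimes> \<epsilon>) \<otimes> idn z) = (idn Y \<otimes> (\<epsilon> \<otimes> idn z)) \<cdot> Assoc C Y (X \<odot> Y) z"
    using Assoc_nat[of "idn Y" \<epsilon> "idn z"] z by simp
  have n2: "Assoc C (Y \<odot> X) Y z \<cdot> ((\<eta> \<otimes> idn Y) \<otimes> idn z) = (\<eta> \<otimes> idn (Y \<odot> z)) \<cdot> Assoc C I Y z"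
    using Assoc_nat[of \<eta> "idn Y" "idn z"] z by simp
  have t: "Assoc C I Y z \<cdot> (inv_arrow C (LUnit C Y) \<otimes> idn z) = inv_arrow C (LUnit C (Y \<odot> z))"
  proof (rule iso_left_cancel[of "LUnit C (Y \<odot> z)"])
    show "LUnit C (Y \<odot> z) \<cdot> (Assoc C I Y z \<cdot> (inv_arrow C (LUnit C Y) \<otimes> idn z)) = LUnit C (Y \<odot> z) \<cdot> inv_arrow C (LUnit C (Y \<odot> z))"
      using z Cmp_rotate[OF LUnit_TensO[of Y z], of "inv_arrow C (LUnit C Y) \<otimes> idn z"] by (simp add: interchange)
  qed (use z in auto)
  have "idn (Y \<odot> z) = (RUnit C Y \<cdot> (idn Y \<otimes> \<epsilon>) \<cdot> Assoc C Y X Y \<cdot> (\<eta> \<otimes> idn Y) \<cdot> inv_arrow C (LUnit C Y)) \<otimes> idn z"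
    unfolding dual_zigzag using z by simp
  also have "\<dots> = (idn Y \<otimes> LUnit C z) \<cdot> Assoc C Y I z \<cdot> ((idn Y \<otimes> \<epsilon>) \<otimes> idn z) \<cdot> (Assoc C Y X Y \<otimes> idn z)
      \<cdot> ((\<eta> \<otimes> idn Y) \<otimes> idn z) \<cdot> (inv_arrow C (LUnit C Y) \<otimes> idn z)"
    using z by (simp add: r)
  also have "\<dots> = (idn Y \<otimes> LUnit C z) \<cdot> (idn Y \<otimes> (\<epsilon> \<otimes> idn z)) \<cdot> (idn Y \<otimes> inv_arrow C (Assoc C X Y z)) \<cdot> Assoc C Y X (Y \<odot> z)
      \<cdot> Assoc C (Y \<odot> X) Y z \<cdot> ((\<eta> \<otimes> idn Y) \<otimes> idn z) \<cdot> (inv_arrow C (LUnit C Y) \<otimes> idn z)"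
    using z by (simp add: Cmp_rotate[OF n1] Cmp_rotate[OF p])
  also have "\<dots> = (idn Y \<otimes> evm z) \<cdot> cvm (Y \<odot> z)"
    using z by (simp add: evm_def cvm_def Cmp_rotate[OF n2] t)
  finally show ?thesis ..
qed

sublocale adjoint_action C "\<lambda>s z. ob s \<odot> z" "\<lambda>s f. idn (ob s) \<otimes> f" evm cvm
  by unfold_locales (use evm_typing cvm_typing evm_natural cvm_natural zigzag_X zigzag_Y in auto)

end

context adjoint_action
begin

text \<open>
  Evaluating in the product with the relational action produces one composite diagram that is correct
  for both actions; since its relation determines it, it is the composite in Dpr.
\<close>

definition product_cat :: "(nat \<times> 'o, (nat stream \<times> nat stream) set \<times> 'm) cat" where
  "product_cat = \<lparr>Obj = {0} \<times> Obj C, Arr = UNIV \<times> Arr C, Dom = \<lambda>(r, f). (0, Dom C f), Cod = \<lambda>(r, f). (0, Cod C f),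
    Ident = \<lambda>(_, x). (Id, Ident C x), Cmp = \<lambda>(s, g) (r, f). (r O s, g \<cdot> f)\<rparr>"

lemma joint_compose:
  assumes "upper D = lower E"
  shows "\<exists>G. lower G = lower D \<and> upper G = upper E \<and> Rel G = Rel D O Rel E \<and>
    (\<forall>x\<in>Obj C. Phi G x = Phi E x \<cdot> Phi D x)"
proof -
  have r: "lift_rel (r O s) = lift_rel r O lift_rel s" "lift_rel Id = (Id :: (nat stream \<times> nat stream) set)"
    "lift_rel (lift_rel r) O contract_rel = contract_rel O r"
    "contract_rel\<inverse> O lift_rel (lift_rel r) = r O contract_rel\<inverse>"
    "lift_rel (contract_rel\<inverse>) O contract_rel = (Id :: (nat stream \<times> nat stream) set)"
    "contract_rel\<inverse> O lift_rel contract_rel = (Id :: (nat stream \<times> nat stream) set)" for r s :: "(nat stream \<times> nat stream) set"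
    using R.TA_Cmp[of r s] R.TA_Ident[of 0] R.ev_natural[of r] R.cv_natural[of r] R.zigzag_False[of 0] R.zigzag_True[of 0]
    by (simp_all add: rel_cat_def)
  interpret Q: adjoint_action product_cat "\<lambda>s (a, x). (a, TO s x)" "\<lambda>s (r, f). (lift_rel r, TA s f)"
    "\<lambda>(a, x). (contract_rel, ev x)" "\<lambda>(a, x). (contract_rel\<inverse>, cv x)"
    by unfold_locales
      (auto simp: product_cat_def Hom_def r O_assoc ev_natural cv_natural zigzag_False zigzag_True simp del: relcomp.simps intro: refl del: equalityI subsetI)
  have p: "Ident product_cat (a, x) = (Id, Ident C x)" "Cmp product_cat (s, g) (r, f) = (r O s, g \<cdot> f)" for a x s g r f
    by (simp_all add: product_cat_def)
  have WO: "Q.WO w (0, x) = (0, WO w x)" for w x by (induction w) auto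
  have cups: "Q.cups c (0, x) = (R.cups c 0, cups c x)" if "x \<in> Obj C" for c x
    using that by (induction c arbitrary: x) (auto simp: WO p O_assoc)
  have caps: "Q.caps c (0, x) = (R.caps c 0, caps c x)" if "x \<in> Obj C" for c x
    using that by (induction c arbitrary: x) (auto simp: WO p O_assoc)
  have Phi: "Q.Phi D (0, x) = (Rel D, Phi D x)" if "x \<in> Obj C" for D x
    using that by (induction D) (auto simp: WO cups caps p O_assoc)
  from Q.Phi_compose[OF assms] obtain G where G: "lower G = lower D" "upper G = upper E"
    "\<And>y. y \<in> Obj product_cat \<Longrightarrow> Q.Phi G y = Cmp product_cat (Q.Phi E y) (Q.Phi D y)" by blast
  have "(Rel G, Phi G x) = (Rel D O Rel E, Phi E x \<cdot> Phi D x)" if "x \<in> Obj C" for x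
    using G(3)[of "(0, x)"] that unfolding Phi[OF that] p by (simp add: product_cat_def)
  show ?thesis
  \<comment> \<open>Without objects in \<open>C\<close> the product has none either, and the claim
    on relations comes from \<open>R.Phi_compose\<close> directly.\<close>
  proof (cases "Obj C = {}")
    case True
    from R.Phi_compose[OF assms] True show ?thesis by auto
  next
    case False
    with \<open>\<And>x. x \<in> Obj C \<Longrightarrow> (Rel G, Phi G x) = (Rel D O Rel E, Phi E x \<cdot> Phi D x)\<close> G(1,2)
    show ?thesis by blast
  qed
qed

end

section \<open>Compatibility of evaluation with tensoring on the right\<close>

context dual_pair_in
begin

text \<open>The coherence isomorphism that moves a right factor \<open>t\<close> inside a word:
  letters act on the left, so tensoring on the right commutes with the action.\<close>

primrec regroup :: "bool list \<Rightarrow> 'o \<Rightarrow> 'o \<Rightarrow> 'm" where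
  "regroup [] z t = idn (z \<odot> t)"
| "regroup (s # w) z t = (idn (ob s) \<otimes> regroup w z t) \<cdot> Assoc C (ob s) (WO w z) t"

lemma regroup_typing [simp]:
  assumes "z \<in> Obj C" "t \<in> Obj C"
  shows "regroup w z t \<in> Arr C" "Dom C (regroup w z t) = WO w z \<odot> t" "Cod C (regroup w z t) = WO w (z \<odot> t)"
    "iso_arrow C (regroup w z t)"
  using assms by (induction w) (auto intro!: iso_Cmp)

lemma regroup_natural:
  assumes "f \<in> Arr C" "g \<in> Arr C"
  shows "regroup w (Cod C f) (Cod C g) \<cdot> (WA w f \<otimes> g) = WA w (f \<otimes> g) \<cdot> regroup w (Dom C f) (Dom C g)"
proof (induction w)
  case (Cons s w)
  let ?a = "Assoc C (ob s) (WO w (Dom C f)) (Dom C g)"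
  have n: "Assoc C (ob s) (WO w (Cod C f)) (Cod C g) \<cdot> ((idn (ob s) \<otimes> WA w f) \<otimes> g) = (idn (ob s) \<otimes> (WA w f \<otimes> g)) \<cdot> ?a"
    using Assoc_nat[of "idn (ob s)" "WA w f" g] assms by simp
  have i: "(idn (ob s) \<otimes> regroup w (Cod C f) (Cod C g)) \<cdot> (idn (ob s) \<otimes> (WA w f \<otimes> g))
      = (idn (ob s) \<otimes> WA w (f \<otimes> g)) \<cdot> (idn (ob s) \<otimes> regroup w (Dom C f) (Dom C g))"
    by (rule TA_eq[OF Cons]) (use assms in auto)
  show ?case using assms by (simp add: n Cmp_rotate[OF i])
qed (use assms in simp)

lemma regroup_append: "z \<in> Obj C \<Longrightarrow> t \<in> Obj C \<Longrightarrow> regroup (u @ v) z t = WA u (regroup v z t) \<cdot> regroup u (WO v z) t"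
  by (induction u) auto

text \<open>A pentagon for words, whose induction step is the pentagon for one letter.\<close>

lemma regroup_assoc:
  assumes "z \<in> Obj C" "t \<in> Obj C" "u \<in> Obj C"
  shows "regroup w z (t \<odot> u) \<cdot> Assoc C (WO w z) t u
    = WA w (Assoc C z t u) \<cdot> regroup w (z \<odot> t) u \<cdot> (regroup w z t \<otimes> idn u)"
proof (induction w)
  case (Cons s w)
  let ?s = "idn (ob s)" and ?a = "Assoc C (ob s) (WO w z) t \<otimes> idn u"
  have p: "Assoc C (ob s) (WO w z) (t \<odot> u) \<cdot> Assoc C (ob s \<odot> WO w z) t u =
    (?s \<otimes> Assoc C (WO w z) t u) \<cdot> Assoc C (ob s) (WO w z \<odot> t) u \<cdot> ?a"
    using pentagon[of "ob s" "WO w z" t u] assms by simp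
  have n: "Assoc C (ob s) (WO w (z \<odot> t)) u \<cdot> ((?s \<otimes> regroup w z t) \<otimes> idn u) = (?s \<otimes> (regroup w z t \<otimes> idn u)) \<cdot> Assoc C (ob s) (WO w z \<odot> t) u"
    using Assoc_nat[of ?s "regroup w z t" "idn u"] assms by simp
  have i: "(?s \<otimes> regroup w z (t \<odot> u)) \<cdot> (?s \<otimes> Assoc C (WO w z) t u) =
     (?s \<otimes> WA w (Assoc C z t u)) \<cdot> (?s \<otimes> regroup w (z \<odot> t) u) \<cdot> (?s \<otimes> (regroup w z t \<otimes> idn u))"
    using arg_cong[OF Cons, of "\<lambda>f. ?s \<otimes> f"] assms by simp
  show ?case
    using assms by (simp add: p Cmp_rotate[OF i] Cmp_rotate[OF n])
qed (use assms in simp)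

lemma regroup_RUnit: "z \<in> Obj C \<Longrightarrow> WA w (RUnit C z) \<cdot> regroup w z I = RUnit C (WO w z)"
proof (induction w)
  case (Cons s w)
  have "(idn (ob s) \<otimes> WA w (RUnit C z)) \<cdot> (idn (ob s) \<otimes> regroup w z I) = idn (ob s) \<otimes> RUnit C (WO w z)"
    using Cons by (simp flip: whisker_left)
  from Cmp_rotate[OF this, of "Assoc C (ob s) (WO w z) I"] show ?case
    using Cons.prems RUnit_TensO[of "ob s" "WO w z"] by simp
qed simp

text \<open>The contraction takes place in the two leftmost factors and is indifferent to a factor
  on the right, up to associativity.\<close>

lemma evm_module:
  assumes "z \<in> Obj C" "t \<in> Obj C"
  shows "evm (z \<odot> t) \<cdot> (idn X \<otimes> Assoc C Y z t) \<cdot> Assoc C X (Y \<odot> z) t = evm z \<otimes> idn t"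
proof -
  have p: "inv_arrow C (Assoc C X Y (z \<odot> t)) \<cdot> (idn X \<otimes> Assoc C Y z t) \<cdot> Assoc C X (Y \<odot> z) t
    = Assoc C (X \<odot> Y) z t \<cdot> (inv_arrow C (Assoc C X Y z) \<otimes> idn t)"
    using pentagon'[of X Y z t] assms by simp
  have n: "(\<epsilon> \<otimes> idn (z \<odot> t)) \<cdot> Assoc C (X \<odot> Y) z t = Assoc C I z t \<cdot> ((\<epsilon> \<otimes> idn z) \<otimes> idn t)"
    using Assoc_nat[of \<epsilon> "idn z" "idn t"] assms by simp
  show ?thesis
    using assms LUnit_TensO[of z t]
    by (simp add: evm_def p Cmp_rotate[OF n] Cmp_rotate[OF LUnit_TensO])
qed

lemma cvm_module:
  assumes "z \<in> Obj C" "t \<in> Obj C"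
  shows "(idn Y \<otimes> Assoc C X z t) \<cdot> Assoc C Y (X \<odot> z) t \<cdot> (cvm z \<otimes> idn t) = cvm (z \<odot> t)"
proof -
  have p: "(idn Y \<otimes> Assoc C X z t) \<cdot> Assoc C Y (X \<odot> z) t \<cdot> (Assoc C Y X z \<otimes> idn t)
    = Assoc C Y X (z \<odot> t) \<cdot> Assoc C (Y \<odot> X) z t"
    using pentagon[of Y X z t] assms by simp
  have n: "Assoc C (Y \<odot> X) z t \<cdot> ((\<eta> \<otimes> idn z) \<otimes> idn t) = (\<eta> \<otimes> idn (z \<odot> t)) \<cdot> Assoc C I z t"
    using Assoc_nat[of \<eta> "idn z" "idn t"] assms by simp
  have l: "Assoc C I z t \<cdot> (inv_arrow C (LUnit C z) \<otimes> idn t) = inv_arrow C (LUnit C (z \<odot> t))"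
  proof (rule iso_left_cancel[of "LUnit C (z \<odot> t)"])
    show "LUnit C (z \<odot> t) \<cdot> (Assoc C I z t \<cdot> (inv_arrow C (LUnit C z) \<otimes> idn t)) = LUnit C (z \<odot> t) \<cdot> inv_arrow C (LUnit C (z \<odot> t))"
      using assms Cmp_rotate[OF LUnit_TensO[of z t], of "inv_arrow C (LUnit C z) \<otimes> idn t"] by (simp add: interchange)
  qed (use assms in auto)
  let ?r = "((\<eta> \<otimes> idn z) \<otimes> idn t) \<cdot> (inv_arrow C (LUnit C z) \<otimes> idn t)"
  have "(idn Y \<otimes> Assoc C X z t) \<cdot> Assoc C Y (X \<odot> z) t \<cdot> (cvm z \<otimes> idn t)
    = ((idn Y \<otimes> Assoc C X z t) \<cdot> Assoc C Y (X \<odot> z) t \<cdot> (Assoc C Y X z \<otimes> idn t)) \<cdot> ?r"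
    using assms by (simp add: cvm_def)
  also have "\<dots> = cvm (z \<odot> t)"
    unfolding p using assms by (simp add: cvm_def Cmp_rotate[OF n] l)
  finally show ?thesis .
qed

text \<open>Compatibility with a right factor passes from \<open>evm\<close> to forests; naturality
  moves \<open>regroup\<close> past the inner cups before the outer contraction is treated.\<close>

lemma cups_module:
  assumes "z \<in> Obj C" "t \<in> Obj C"
  shows "cups c (z \<odot> t) \<cdot> regroup (forest_word False c) z t = cups c z \<otimes> idn t"
  using assms
proof (induction c arbitrary: z)
  case (Br f g)
  let ?g = "forest_word False g" and ?f = "forest_word False f"
  let ?y = "Y \<odot> WO ?g z"
  have o: "?y \<in> Obj C" "WO ?g z \<in> Obj C" using Br.prems by auto
  have 1: "cups f (Y \<odot> WO ?g (z \<odot> t)) \<cdot> WA ?f (regroup (True # ?g) z t) = regroup (True # ?g) z t \<cdot> cups f (?y \<odot> t)"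
    using cups_natural[of "regroup (True # ?g) z t" f] Br.prems by simp
  have 2: "cups f (?y \<odot> t) \<cdot> regroup ?f ?y t = cups f ?y \<otimes> idn t"
    using Br.IH(1)[OF o(1)] Br.prems by simp
  have 3: "Assoc C X ?y t \<cdot> ((idn X \<otimes> cups f ?y) \<otimes> idn t) = (idn X \<otimes> (cups f ?y \<otimes> idn t)) \<cdot> Assoc C X (WO ?f ?y) t"
    using Assoc_nat[of "idn X" "cups f ?y" "idn t"] Br.prems by simp
  have 4: "evm (WO ?g (z \<odot> t)) \<cdot> (idn X \<otimes> (idn Y \<otimes> regroup ?g z t)) = regroup ?g z t \<cdot> evm (WO ?g z \<odot> t)"
    using evm_natural[of "regroup ?g z t"] Br.prems by simp
  have 5: "evm (WO ?g z \<odot> t) \<cdot> (idn X \<otimes> Assoc C Y (WO ?g z) t) \<cdot> Assoc C X ?y t = evm (WO ?g z) \<otimes> idn t"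
    using evm_module[OF o(2)] Br.prems by simp
  have 6: "cups g (z \<odot> t) \<cdot> regroup ?g z t = cups g z \<otimes> idn t" using Br.IH(2) Br.prems by simp
  have "(idn X \<otimes> cups f (Y \<odot> WO ?g (z \<odot> t))) \<cdot> regroup (False # ?f @ True # ?g) z t
    = (idn X \<otimes> (cups f (Y \<odot> WO ?g (z \<odot> t)) \<cdot> WA ?f (regroup (True # ?g) z t) \<cdot> regroup ?f ?y t)) \<cdot> Assoc C X (WO ?f ?y) t"
    using Br.prems regroup_append[of z t ?f "True # ?g"] by simp
  also have "cups f (Y \<odot> WO ?g (z \<odot> t)) \<cdot> WA ?f (regroup (True # ?g) z t) \<cdot> regroup ?f ?y t = regroup (True # ?g) z t \<cdot> (cups f ?y \<otimes> idn t)"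
    using Cmp_rotate[OF 1, of "regroup ?f ?y t"] Br.prems 2 by simp
  also have "(idn X \<otimes> (regroup (True # ?g) z t \<cdot> (cups f ?y \<otimes> idn t))) \<cdot> Assoc C X (WO ?f ?y) t
    = (idn X \<otimes> regroup (True # ?g) z t) \<cdot> Assoc C X ?y t \<cdot> ((idn X \<otimes> cups f ?y) \<otimes> idn t)"
    using Br.prems 3 by simp
  finally have A: "(idn X \<otimes> cups f (Y \<odot> WO ?g (z \<odot> t))) \<cdot> regroup (False # ?f @ True # ?g) z t
    = (idn X \<otimes> (idn Y \<otimes> regroup ?g z t)) \<cdot> (idn X \<otimes> Assoc C Y (WO ?g z) t) \<cdot> Assoc C X ?y t \<cdot> ((idn X \<otimes> cups f ?y) \<otimes> idn t)"
    using Br.prems by simp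
  let ?r = "(idn X \<otimes> cups f ?y) \<otimes> idn t"
  have "cups (Br f g) (z \<odot> t) \<cdot> regroup (forest_word False (Br f g)) z t =
     cups g (z \<odot> t) \<cdot> evm (WO ?g (z \<odot> t)) \<cdot> ((idn X \<otimes> cups f (Y \<odot> WO ?g (z \<odot> t))) \<cdot> regroup (False # ?f @ True # ?g) z t)"
    using Br.prems by simp
  also have "\<dots> = cups g (z \<odot> t) \<cdot> regroup ?g z t \<cdot> (evm (WO ?g z \<odot> t) \<cdot> (idn X \<otimes> Assoc C Y (WO ?g z) t) \<cdot> Assoc C X ?y t) \<cdot> ?r"
    unfolding A using Br.prems by (simp add: Cmp_rotate[OF 4])
  also have "\<dots> = (cups g z \<otimes> idn t) \<cdot> (evm (WO ?g z) \<otimes> idn t) \<cdot> ?r"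
    unfolding 5 using Br.prems by (simp add: Cmp_rotate[OF 6])
  finally show ?case using Br.prems by simp
qed simp

lemma caps_module:
  assumes "z \<in> Obj C" "t \<in> Obj C"
  shows "regroup (forest_word True c) z t \<cdot> (caps c z \<otimes> idn t) = caps c (z \<odot> t)"
  using assms
proof (induction c arbitrary: z)
  case (Br f g)
  let ?g = "forest_word True g" and ?f = "forest_word True f"
  let ?x = "X \<odot> WO ?g z"
  have o: "?x \<in> Obj C" "WO ?g z \<in> Obj C" using Br.prems by auto
  have 1: "WA ?f (regroup (False # ?g) z t) \<cdot> caps f (?x \<odot> t) = caps f (X \<odot> WO ?g (z \<odot> t)) \<cdot> regroup (False # ?g) z t"
    using caps_natural[of "regroup (False # ?g) z t" f] Br.prems by simp
  have 2: "regroup ?f ?x t \<cdot> (caps f ?x \<otimes> idn t) = caps f (?x \<odot> t)"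
    using Br.IH(1)[OF o(1)] Br.prems by simp
  have 3: "Assoc C Y (WO ?f ?x) t \<cdot> ((idn Y \<otimes> caps f ?x) \<otimes> idn t) = (idn Y \<otimes> (caps f ?x \<otimes> idn t)) \<cdot> Assoc C Y ?x t"
    using Assoc_nat[of "idn Y" "caps f ?x" "idn t"] Br.prems by simp
  have 4: "(idn Y \<otimes> (idn X \<otimes> regroup ?g z t)) \<cdot> cvm (WO ?g z \<odot> t) = cvm (WO ?g (z \<odot> t)) \<cdot> regroup ?g z t"
    using cvm_natural[of "regroup ?g z t"] Br.prems by simp
  have 5: "(idn Y \<otimes> Assoc C X (WO ?g z) t) \<cdot> Assoc C Y ?x t \<cdot> (cvm (WO ?g z) \<otimes> idn t) = cvm (WO ?g z \<odot> t)"
    using cvm_module[OF o(2)] Br.prems by simp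
  have 6: "regroup ?g z t \<cdot> (caps g z \<otimes> idn t) = caps g (z \<odot> t)" using Br.IH(2) Br.prems by simp
  have "regroup (True # ?f @ False # ?g) z t \<cdot> ((idn Y \<otimes> caps f ?x) \<otimes> idn t)
    = (idn Y \<otimes> (WA ?f (regroup (False # ?g) z t) \<cdot> regroup ?f ?x t \<cdot> (caps f ?x \<otimes> idn t))) \<cdot> Assoc C Y ?x t"
    using Br.prems regroup_append[of z t ?f "False # ?g"] 3 by simp
  also have "WA ?f (regroup (False # ?g) z t) \<cdot> regroup ?f ?x t \<cdot> (caps f ?x \<otimes> idn t) = caps f (X \<odot> WO ?g (z \<odot> t)) \<cdot> regroup (False # ?g) z t"
    unfolding 2 1 ..
  finally have A: "regroup (True # ?f @ False # ?g) z t \<cdot> ((idn Y \<otimes> caps f ?x) \<otimes> idn t) =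
    (idn Y \<otimes> caps f (X \<odot> WO ?g (z \<odot> t))) \<cdot> (idn Y \<otimes> (idn X \<otimes> regroup ?g z t)) \<cdot> (idn Y \<otimes> Assoc C X (WO ?g z) t) \<cdot> Assoc C Y ?x t"
    using Br.prems by simp
  let ?l = "idn Y \<otimes> caps f (X \<odot> WO ?g (z \<odot> t))"
  have "regroup (forest_word True (Br f g)) z t \<cdot> (caps (Br f g) z \<otimes> idn t) =
     (regroup (True # ?f @ False # ?g) z t \<cdot> ((idn Y \<otimes> caps f ?x) \<otimes> idn t)) \<cdot> (cvm (WO ?g z) \<otimes> idn t) \<cdot> (caps g z \<otimes> idn t)"
    using Br.prems by simp
  also have "\<dots> = ?l \<cdot> (idn Y \<otimes> (idn X \<otimes> regroup ?g z t)) \<cdot>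
      ((idn Y \<otimes> Assoc C X (WO ?g z) t) \<cdot> Assoc C Y ?x t \<cdot> (cvm (WO ?g z) \<otimes> idn t)) \<cdot> (caps g z \<otimes> idn t)"
    unfolding A using Br.prems by simp
  also have "\<dots> = ?l \<cdot> cvm (WO ?g (z \<odot> t)) \<cdot> regroup ?g z t \<cdot> (caps g z \<otimes> idn t)"
    unfolding 5 using Br.prems by (simp add: Cmp_rotate[OF 4])
  finally show ?case unfolding 6 by simp
qed simp

text \<open>With cups and caps compatible with a right factor, whole diagrams are, gap by gap. Taken
  at the unit object, this relates values there to values at other objects, which the multiplication
  \<open>word_mult\<close> relies on.\<close>

lemma Phi_module:
  assumes "z \<in> Obj C" "t \<in> Obj C"
  shows "Phi D (z \<odot> t) \<cdot> regroup (lower D) z t = regroup (upper D) z t \<cdot> (Phi D z \<otimes> idn t)"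
proof (induction D)
  case (End c k)
  have "Phi (End c k) (z \<odot> t) \<cdot> regroup (lower (End c k)) z t = caps k (z \<odot> t) \<cdot> (cups c z \<otimes> idn t)"
    using assms cups_module[of z t c] by simp
  also have "\<dots> = regroup (upper (End c k)) z t \<cdot> (Phi (End c k) z \<otimes> idn t)"
    unfolding caps_module[OF assms, of k, symmetric] using assms by simp
  finally show ?case .
next
  case (Nx c k s D)
  let ?b = "ob s \<odot> WO (lower D) z" and ?t = "ob s \<odot> WO (upper D) z"
  have o: "?b \<in> Obj C" "?t \<in> Obj C" using assms by auto
  have 1: "cups c (ob s \<odot> WO (lower D) (z \<odot> t)) \<cdot> WA (forest_word False c) (regroup (s # lower D) z t) = regroup (s # lower D) z t \<cdot> cups c (?b \<odot> t)"
    using cups_natural[of "regroup (s # lower D) z t" c] assms by simp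
  have 2: "cups c (?b \<odot> t) \<cdot> regroup (forest_word False c) ?b t = cups c ?b \<otimes> idn t"
    by (rule cups_module[OF o(1) assms(2)])
  have 3: "Assoc C (ob s) (WO (upper D) z) t \<cdot> ((idn (ob s) \<otimes> Phi D z) \<otimes> idn t) = (idn (ob s) \<otimes> (Phi D z \<otimes> idn t)) \<cdot> Assoc C (ob s) (WO (lower D) z) t"
    using Assoc_nat[of "idn (ob s)" "Phi D z" "idn t"] assms by simp
  have 4: "(idn (ob s) \<otimes> Phi D (z \<odot> t)) \<cdot> (idn (ob s) \<otimes> regroup (lower D) z t) = (idn (ob s) \<otimes> regroup (upper D) z t) \<cdot> (idn (ob s) \<otimes> (Phi D z \<otimes> idn t))"
    by (rule TA_eq[OF Nx]) (use assms in auto)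
  have 5: "WA (forest_word True k) (regroup (s # upper D) z t) \<cdot> caps k (?t \<odot> t) = caps k (ob s \<odot> WO (upper D) (z \<odot> t)) \<cdot> regroup (s # upper D) z t"
    using caps_natural[of "regroup (s # upper D) z t" k] assms by simp
  have 6: "regroup (forest_word True k) ?t t \<cdot> (caps k ?t \<otimes> idn t) = caps k (?t \<odot> t)"
    by (rule caps_module[OF o(2) assms(2)])
  let ?k = "caps k (ob s \<odot> WO (upper D) (z \<odot> t))"
  have "Phi (Nx c k s D) (z \<odot> t) \<cdot> regroup (lower (Nx c k s D)) z t =
    ?k \<cdot> (idn (ob s) \<otimes> Phi D (z \<odot> t)) \<cdot> cups c (ob s \<odot> WO (lower D) (z \<odot> t)) \<cdot> WA (forest_word False c) (regroup (s # lower D) z t) \<cdot> regroup (forest_word False c) ?b t"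
    using assms regroup_append[of z t "forest_word False c" "s # lower D"] by simp
  also have "\<dots> = ?k \<cdot> (idn (ob s) \<otimes> Phi D (z \<odot> t)) \<cdot> regroup (s # lower D) z t \<cdot> (cups c ?b \<otimes> idn t)"
    using Cmp_rotate[OF 1, of "regroup (forest_word False c) ?b t"] 2 assms by simp
  also have "\<dots> = ?k \<cdot> regroup (s # upper D) z t \<cdot> ((idn (ob s) \<otimes> Phi D z) \<otimes> idn t) \<cdot> (cups c ?b \<otimes> idn t)"
    using assms by (simp add: Cmp_rotate[OF 4] Cmp_rotate[OF 3])
  also have "\<dots> = (WA (forest_word True k) (regroup (s # upper D) z t) \<cdot> regroup (forest_word True k) ?t t \<cdot> (caps k ?t \<otimes> idn t)) \<cdot> ((idn (ob s) \<otimes> Phi D z) \<otimes> idn t) \<cdot> (cups c ?b \<otimes> idn t)"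
    unfolding 6 5 using assms by simp
  also have "\<dots> = regroup (upper (Nx c k s D)) z t \<cdot> (Phi (Nx c k s D) z \<otimes> idn t)"
    using assms regroup_append[of z t "forest_word True k" "s # upper D"] by simp
  finally show ?case .
qed

end

section \<open>The strong monoidal functor of a dual pair\<close>

text \<open>The description is meaningful on morphisms: a diagram exists by
  \<open>ex_dpr_arrow\<close> and is unique by \<open>dpr_arrow_inj\<close>.\<close>

definition shape :: "dpr_arr \<Rightarrow> diag" where
  "shape f = (THE D. diag_between (fst f) D (snd (snd f)) \<and> f = dpr_arrow (fst f) D (snd (snd f)))"

lemma shape_dpr_arrow [simp]:
  assumes "diag_between X D Y"
  shows "shape (dpr_arrow X D Y) = D"
  unfolding shape_def
proof (rule the_equality)
  fix E assume "diag_between (fst (dpr_arrow X D Y)) E (snd (snd (dpr_arrow X D Y))) \<and>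
    dpr_arrow X D Y = dpr_arrow (fst (dpr_arrow X D Y)) E (snd (snd (dpr_arrow X D Y)))"
  then show "E = D" using dpr_arrow_inj[OF _ assms, of E] by simp
qed (use assms in simp)

context dual_pair_in
begin

text \<open>The factor \<open>WO v I\<close> is moved to the innermost position of the word
  \<open>w\<close>, where it absorbs the unit object.\<close>

definition word_mult :: "bool list \<Rightarrow> bool list \<Rightarrow> 'm" where
  "word_mult w v = WA w (LUnit C (WO v I)) \<cdot> regroup w I (WO v I)"

lemma WA_iso [simp]: "iso_arrow C f \<Longrightarrow> iso_arrow C (WA w f)"
  by (induction w) (auto simp: iso_Arr)

lemma word_mult_typing [simp]: "word_mult w v \<in> Arr C" "Dom C (word_mult w v) = WO w I \<odot> WO v I" "Cod C (word_mult w v) = WO (w @ v) I"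
  "iso_arrow C (word_mult w v)"
  by (auto simp: word_mult_def intro!: iso_Cmp)

text \<open>Two different facts meet: \<open>Phi_module\<close> moves \<open>Phi D I\<close> past a
  right factor, and naturality of \<open>regroup\<close> moves \<open>Phi E I\<close> into the
  word.\<close>

lemma word_mult_natural:
  "word_mult (upper D) (upper E) \<cdot> (Phi D I \<otimes> Phi E I) = Phi (diag_append D E) I \<cdot> word_mult (lower D) (lower E)"
proof -
  let ?v = "WO (lower E) I" and ?v' = "WO (upper E) I"
  have 1: "regroup (upper D) I ?v' \<cdot> (Phi D I \<otimes> idn ?v') = Phi D (I \<odot> ?v') \<cdot> regroup (lower D) I ?v'"
    using Phi_module[of I ?v' D] by simp
  have 2: "WA (upper D) (LUnit C ?v') \<cdot> Phi D (I \<odot> ?v') = Phi D ?v' \<cdot> WA (lower D) (LUnit C ?v')"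
    using Phi_natural[of "LUnit C ?v'" D] by simp
  have 3: "regroup (lower D) I ?v' \<cdot> (idn (WO (lower D) I) \<otimes> Phi E I) = WA (lower D) (idn I \<otimes> Phi E I) \<cdot> regroup (lower D) I ?v"
    using regroup_natural[of "idn I" "Phi E I" "lower D"] by simp
  have 4: "WA (lower D) (LUnit C ?v') \<cdot> WA (lower D) (idn I \<otimes> Phi E I) = WA (lower D) (Phi E I) \<cdot> WA (lower D) (LUnit C ?v)"
    using LUnit_nat[of "Phi E I"] by (simp flip: WA_Cmp)
  have "word_mult (upper D) (upper E) \<cdot> (Phi D I \<otimes> Phi E I) =
      WA (upper D) (LUnit C ?v') \<cdot> regroup (upper D) I ?v' \<cdot> (Phi D I \<otimes> idn ?v') \<cdot> (idn (WO (lower D) I) \<otimes> Phi E I)"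
    unfolding word_mult_def TensA_split(1)[OF Phi_typing(1)[OF UnitO_in] Phi_typing(1)[OF UnitO_in], of D E] by simp
  also have "\<dots> = Phi D ?v' \<cdot> WA (lower D) (LUnit C ?v') \<cdot> regroup (lower D) I ?v' \<cdot> (idn (WO (lower D) I) \<otimes> Phi E I)"
    by (simp add: Cmp_rotate[OF 1] Cmp_rotate[OF 2])
  also have "\<dots> = Phi D ?v' \<cdot> WA (lower D) (Phi E I) \<cdot> word_mult (lower D) (lower E)"
    unfolding 3 word_mult_def by (simp add: Cmp_rotate[OF 4])
  finally show ?thesis by (simp add: Phi_diag_append)
qed

lemma word_mult_assoc:
  "word_mult (w @ v) u \<cdot> (word_mult w v \<otimes> idn (WO u I)) =
    word_mult w (v @ u) \<cdot> (idn (WO w I) \<otimes> word_mult v u) \<cdot> Assoc C (WO w I) (WO v I) (WO u I)"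
proof -
  let ?v = "WO v I" and ?u = "WO u I"
  let ?g = "regroup w I ?v \<otimes> idn ?u"
  have 1: "regroup w ?v ?u \<cdot> (WA w (LUnit C ?v) \<otimes> idn ?u) = WA w (LUnit C ?v \<otimes> idn ?u) \<cdot> regroup w (I \<odot> ?v) ?u"
    using regroup_natural[of "LUnit C ?v" "idn ?u" w] by simp
  have 2: "regroup w I (?v \<odot> ?u) \<cdot> Assoc C (WO w I) ?v ?u = WA w (Assoc C I ?v ?u) \<cdot> regroup w (I \<odot> ?v) ?u \<cdot> ?g"
    by (rule regroup_assoc) auto
  have 3: "regroup w I (WO (v @ u) I) \<cdot> (idn (WO w I) \<otimes> word_mult v u) = WA w (idn I \<otimes> word_mult v u) \<cdot> regroup w I (?v \<odot> ?u)"
    using regroup_natural[of "idn I" "word_mult v u" w] by simp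
  have 4: "WA w (LUnit C (WO (v @ u) I)) \<cdot> WA w (idn I \<otimes> word_mult v u) = WA w (word_mult v u) \<cdot> WA w (LUnit C (?v \<odot> ?u))"
    using LUnit_nat[of "word_mult v u"] by (simp flip: WA_Cmp)
  have 5: "WA w (LUnit C (?v \<odot> ?u)) \<cdot> WA w (Assoc C I ?v ?u) = WA w (LUnit C ?v \<otimes> idn ?u)"
    using LUnit_TensO[of ?v ?u] by (simp flip: WA_Cmp)
  have "word_mult (w @ v) u \<cdot> (word_mult w v \<otimes> idn ?u) =
     WA w (word_mult v u) \<cdot> regroup w ?v ?u \<cdot> (WA w (LUnit C ?v) \<otimes> idn ?u) \<cdot> ?g"
    unfolding word_mult_def[of w v] word_mult_def[of "w @ v" u] word_mult_def[of v u] by (simp add: regroup_append)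
  also have "\<dots> = WA w (word_mult v u) \<cdot> WA w (LUnit C ?v \<otimes> idn ?u) \<cdot> regroup w (I \<odot> ?v) ?u \<cdot> ?g"
    by (simp add: Cmp_rotate[OF 1])
  also have "\<dots> = WA w (word_mult v u) \<cdot> WA w (LUnit C (?v \<odot> ?u)) \<cdot> WA w (Assoc C I ?v ?u) \<cdot> regroup w (I \<odot> ?v) ?u \<cdot> ?g"
    by (simp add: Cmp_rotate[OF 5])
  also have "\<dots> = WA w (LUnit C (WO (v @ u) I)) \<cdot> WA w (idn I \<otimes> word_mult v u) \<cdot> regroup w I (?v \<odot> ?u) \<cdot> Assoc C (WO w I) ?v ?u"
    unfolding 2 by (simp add: Cmp_rotate[OF 4[unfolded WO_append]])
  also have "\<dots> = word_mult w (v @ u) \<cdot> (idn (WO w I) \<otimes> word_mult v u) \<cdot> Assoc C (WO w I) ?v ?u"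
    unfolding word_mult_def[of w "v @ u"] using Cmp_rotate[OF 3, of "Assoc C (WO w I) ?v ?u"] by simp
  finally show ?thesis .
qed

lemma word_mult_Nil: "word_mult [] v = LUnit C (WO v I)" "word_mult w [] = RUnit C (WO w I)"
  using regroup_RUnit[of I w] by (simp_all add: word_mult_def LUnit_unit)

text \<open>Restriction and \<open>undefined\<close> serve the extensionality clauses of
  \<open>strong_monoidal_functor\<close>.\<close>

definition free_functor :: "(dpr_obj, dpr_arr, 'o, 'm) monfunc" where
  "free_functor = \<lparr>FObj = \<lambda>X\<in>dpr_Obj. WO (sign_word X) I, FArr = \<lambda>f\<in>dpr_Arr. Phi (shape f) I,
     FMult = \<lambda>X Y. if X \<in> dpr_Obj \<and> Y \<in> dpr_Obj then word_mult (sign_word X) (sign_word Y) else undefined,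
     FUnit = idn I\<rparr>"

lemma free_functor_simps [simp]:
  "Z \<in> dpr_Obj \<Longrightarrow> FObj free_functor Z = WO (sign_word Z) I"
  "diag_between Z D W \<Longrightarrow> FArr free_functor (dpr_arrow Z D W) = Phi D I"
  "Z \<in> dpr_Obj \<Longrightarrow> W \<in> dpr_Obj \<Longrightarrow> FMult free_functor Z W = word_mult (sign_word Z) (sign_word W)"
  "FUnit free_functor = idn I"
  using dpr_arrow_in by (auto simp: free_functor_def)

lemma free_functor_Ident: "Z \<in> dpr_Obj \<Longrightarrow> FArr free_functor (dpr_Ident Z) = idn (WO (sign_word Z) I)"
  by (simp add: Ident_dpr_arrow diag_between_diag_ident)

lemma strong_monoidal_free_functor: "strong_monoidal_functor Dpr C free_functor"
proof (intro strong_monoidal_functor.intro strong_monoidal_functor_axioms.intro cat_functor.intro cat_functor_axioms.intro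
    monoidal_Dpr category_Dpr monoidal_category_axioms category_axioms; (simp only: Dpr_simps)?)
  show "FObj free_functor x \<in> Obj C" if "x \<in> dpr_Obj" for x using that by simp
  show "FArr free_functor f \<in> Hom C (FObj free_functor x) (FObj free_functor y)" if "f \<in> Hom Dpr x y" for f x y
    using that unfolding Hom_Dpr by (auto simp: diag_between_def)
  show "FArr free_functor (dpr_Ident x) = idn (FObj free_functor x)" if "x \<in> dpr_Obj" for x
    using that by (simp add: free_functor_Ident)
  show "FArr free_functor (dpr_Cmp g f) = FArr free_functor g \<cdot> FArr free_functor f"
    if fg: "f \<in> Hom Dpr x y" "g \<in> Hom Dpr y z" for f g x y z
  proof -
    obtain D where D: "diag_between x D y" "f = dpr_arrow x D y" using fg(1) unfolding Hom_Dpr by blast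
    obtain E where E: "diag_between y E z" "g = dpr_arrow y E z" using fg(2) unfolding Hom_Dpr by blast
    have "upper D = lower E" using D E by (simp add: diag_between_def)
    \<comment> \<open>One \<open>G\<close> has to be the composite for relations, which identifies
      it in Dpr, and for the action of the dual pair, which gives its value.\<close>
    from joint_compose[OF this] obtain G where G: "lower G = lower D" "upper G = upper E" "Rel G = Rel D O Rel E"
      "Phi G I = Phi E I \<cdot> Phi D I" by auto
    have b: "diag_between x G z" using G D(1) E(1) by (simp add: diag_between_def)
    show ?thesis using diag_cmp[OF D(1) E(1) b G(3)] D E b G(4) by simp
  qed
  show "FMult free_functor x y \<in> Hom C (FObj free_functor x \<odot> FObj free_functor y) (FObj free_functor (dpr_TensO x y))"
    "iso_arrow C (FMult free_functor x y)" if "x \<in> dpr_Obj" "y \<in> dpr_Obj" for x y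
    using that by (simp_all add: TensO_points)
  show "FMult free_functor x' y' \<cdot> (FArr free_functor f \<otimes> FArr free_functor g) = FArr free_functor (dpr_TensA f g) \<cdot> FMult free_functor x y"
    if fg: "f \<in> Hom Dpr x x'" "g \<in> Hom Dpr y y'" for f g x x' y y'
  proof -
    obtain D where D: "diag_between x D x'" "f = dpr_arrow x D x'" using fg(1) unfolding Hom_Dpr by blast
    obtain E where E: "diag_between y E y'" "g = dpr_arrow y E y'" using fg(2) unfolding Hom_Dpr by blast
    have o: "x \<in> dpr_Obj" "y \<in> dpr_Obj" "x' \<in> dpr_Obj" "y' \<in> dpr_Obj" "sign_word x = lower D" "sign_word x' = upper D" "sign_word y = lower E" "sign_word y' = upper E"
      using D(1) E(1) by (auto simp: diag_between_def)
    show ?thesis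
      using D E o word_mult_natural[of D E] by (simp add: TensA_dpr_arrow[OF D(1) E(1)] diag_between_diag_append[OF D(1) E(1)])
  qed
  show "FUnit free_functor \<in> Hom C (UnitO C) (FObj free_functor ({}, {}))" "iso_arrow C (FUnit free_functor)" by simp_all
  show "FArr free_functor (dpr_Ident (dpr_TensO (dpr_TensO x y) z)) \<cdot> FMult free_functor (dpr_TensO x y) z \<cdot>
      (FMult free_functor x y \<otimes> idn (FObj free_functor z)) =
      FMult free_functor x (dpr_TensO y z) \<cdot> (idn (FObj free_functor x) \<otimes> FMult free_functor y z) \<cdot>
      Assoc C (FObj free_functor x) (FObj free_functor y) (FObj free_functor z)"
    if "x \<in> dpr_Obj" "y \<in> dpr_Obj" "z \<in> dpr_Obj" for x y z
    using that word_mult_assoc[of "sign_word x" "sign_word y" "sign_word z"] by (simp add: free_functor_Ident TensO_points)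
  show "FArr free_functor (dpr_Ident x) \<cdot> FMult free_functor ({}, {}) x \<cdot> (FUnit free_functor \<otimes> idn (FObj free_functor x))
      = LUnit C (FObj free_functor x)" if "x \<in> dpr_Obj" for x
    using that by (simp add: free_functor_Ident word_mult_Nil)
  show "FArr free_functor (dpr_Ident x) \<cdot> FMult free_functor x ({}, {}) \<cdot> (idn (FObj free_functor x) \<otimes> FUnit free_functor)
      = RUnit C (FObj free_functor x)" if "x \<in> dpr_Obj" for x
    using that by (simp add: free_functor_Ident word_mult_Nil)
  show "FObj free_functor \<in> extensional dpr_Obj" "FArr free_functor \<in> extensional dpr_Arr"
    by (simp_all add: free_functor_def)
  show "FMult free_functor x y = undefined" if "\<not> (x \<in> dpr_Obj \<and> y \<in> dpr_Obj)" for x y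
    using that by (auto simp: free_functor_def)
qed

end

section \<open>Functors that preserve adjoint actions\<close>

context cat_functor
begin

lemma F_simps [simp]: "x \<in> Obj A \<Longrightarrow> FObj F x \<in> Obj B"
  "f \<in> Arr A \<Longrightarrow> FArr F f \<in> Arr B" "f \<in> Arr A \<Longrightarrow> Dom B (FArr F f) = FObj F (Dom A f)"
  "f \<in> Arr A \<Longrightarrow> Cod B (FArr F f) = FObj F (Cod A f)"
  "x \<in> Obj A \<Longrightarrow> FArr F (Ident A x) = Ident B (FObj F x)"
  "f \<in> Arr A \<Longrightarrow> g \<in> Arr A \<Longrightarrow> Dom A g = Cod A f \<Longrightarrow> FArr F (g \<cdot>\<^bsub>A\<^esub> f) = FArr F g \<cdot>\<^bsub>B\<^esub> FArr F f"
  using FObj_in FArr_in[of f "Dom A f" "Cod A f"] FArr_Ident FArr_Cmp[of f "Dom A f" "Cod A f" g "Cod A g"] by auto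

end

text \<open>The comparison maps point from the action on the image to the image of the action. The
  instances are strong monoidal functors with an isomorphism of dual pairs, and the passage from Dpr
  to relations.\<close>

locale action_morphism =
  A: adjoint_action A TOA TAA evA cvA + V: adjoint_action V TOV TAV evV cvV + cat_functor A V F
  for A :: "('o, 'm, 'x) cat_scheme" and TOA TAA evA cvA
    and V :: "('p, 'n, 'y) cat_scheme" and TOV TAV evV cvV
    and F :: "('o, 'm, 'p, 'n, 'z) func_scheme" +
  fixes compare :: "bool \<Rightarrow> 'o \<Rightarrow> 'n"
  assumes compare_typing [simp]: "x \<in> Obj A \<Longrightarrow> compare s x \<in> Arr V" "x \<in> Obj A \<Longrightarrow> Dom V (compare s x) = TOV s (FObj F x)"
      "x \<in> Obj A \<Longrightarrow> Cod V (compare s x) = FObj F (TOA s x)"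
    and compare_natural: "f \<in> Arr A \<Longrightarrow> FArr F (TAA s f) \<cdot>\<^bsub>V\<^esub> compare s (Dom A f) = compare s (Cod A f) \<cdot>\<^bsub>V\<^esub> TAV s (FArr F f)"
    and compare_ev: "x \<in> Obj A \<Longrightarrow>
      FArr F (evA x) \<cdot>\<^bsub>V\<^esub> compare False (TOA True x) \<cdot>\<^bsub>V\<^esub> TAV False (compare True x) = evV (FObj F x)"
    and compare_cv: "x \<in> Obj A \<Longrightarrow>
      compare True (TOA False x) \<cdot>\<^bsub>V\<^esub> TAV True (compare False x) \<cdot>\<^bsub>V\<^esub> cvV (FObj F x) = FArr F (cvA x)"
begin

primrec word_compare :: "bool list \<Rightarrow> 'o \<Rightarrow> 'n" where
  "word_compare [] x = Ident V (FObj F x)"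
| "word_compare (s # w) x = compare s (A.WO w x) \<cdot>\<^bsub>V\<^esub> TAV s (word_compare w x)"

lemma word_compare_typing [simp]:
  assumes "x \<in> Obj A"
  shows "word_compare w x \<in> Arr V" "Dom V (word_compare w x) = V.WO w (FObj F x)" "Cod V (word_compare w x) = FObj F (A.WO w x)"
  using assms by (induction w) auto

lemma word_compare_append: "x \<in> Obj A \<Longrightarrow> word_compare (u @ v) x = word_compare u (A.WO v x) \<cdot>\<^bsub>V\<^esub> V.WA u (word_compare v x)"
  by (induction u) auto

text \<open>\<open>compare_ev\<close> treats a single arc; naturality of the comparison carries it
  past the inner forest, and naturality of \<open>evV\<close> past the letters of
  \<open>g\<close>.\<close>

lemma word_compare_cups: "x \<in> Obj A \<Longrightarrow> FArr F (A.cups c x) \<cdot>\<^bsub>V\<^esub> word_compare (forest_word False c) x = V.cups c (FObj F x)"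
proof (induction c arbitrary: x)
  case (Br f g)
  let ?f = "forest_word False f" and ?g = "forest_word False g"
  let ?y = "TOA True (A.WO ?g x)"
  have o: "?y \<in> Obj A" "A.WO ?g x \<in> Obj A" using Br.prems by auto
  have 1: "FArr F (TAA False (A.cups f ?y)) \<cdot>\<^bsub>V\<^esub> compare False (A.WO ?f ?y) = compare False ?y \<cdot>\<^bsub>V\<^esub> TAV False (FArr F (A.cups f ?y))"
    using compare_natural[of "A.cups f ?y" False] o by simp
  have 2: "V.cups f (FObj F ?y) \<cdot>\<^bsub>V\<^esub> V.WA ?f (word_compare (True # ?g) x) = word_compare (True # ?g) x \<cdot>\<^bsub>V\<^esub> V.cups f (TOV True (V.WO ?g (FObj F x)))"
    using V.cups_natural[of "word_compare (True # ?g) x" f] Br.prems by simp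
  have 3: "evV (FObj F (A.WO ?g x)) \<cdot>\<^bsub>V\<^esub> TAV False (TAV True (word_compare ?g x)) = word_compare ?g x \<cdot>\<^bsub>V\<^esub> evV (V.WO ?g (FObj F x))"
    using V.ev_natural[of "word_compare ?g x"] Br.prems by simp
  let ?c = "TAV False (V.cups f (TOV True (V.WO ?g (FObj F x))))"
  have "FArr F (A.cups f ?y) \<cdot>\<^bsub>V\<^esub> word_compare (?f @ True # ?g) x = (FArr F (A.cups f ?y) \<cdot>\<^bsub>V\<^esub> word_compare ?f ?y) \<cdot>\<^bsub>V\<^esub> V.WA ?f (word_compare (True # ?g) x)"
    using Br.prems by (simp add: word_compare_append)
  also have "\<dots> = word_compare (True # ?g) x \<cdot>\<^bsub>V\<^esub> V.cups f (TOV True (V.WO ?g (FObj F x)))"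
    unfolding Br.IH(1)[OF o(1)] 2 ..
  finally have "TAV False (FArr F (A.cups f ?y)) \<cdot>\<^bsub>V\<^esub> TAV False (word_compare (?f @ True # ?g) x) =
      TAV False (word_compare (True # ?g) x) \<cdot>\<^bsub>V\<^esub> ?c"
    by (rule V.TA_eq) (use Br.prems in auto)
  then have "FArr F (A.cups (Br f g) x) \<cdot>\<^bsub>V\<^esub> word_compare (forest_word False (Br f g)) x =
    FArr F (A.cups g x) \<cdot>\<^bsub>V\<^esub> FArr F (evA (A.WO ?g x)) \<cdot>\<^bsub>V\<^esub> compare False ?y \<cdot>\<^bsub>V\<^esub> TAV False (word_compare (True # ?g) x) \<cdot>\<^bsub>V\<^esub> ?c"
    using Br.prems by (simp add: V.Cmp_rotate[OF 1])
  also have "\<dots> = FArr F (A.cups g x) \<cdot>\<^bsub>V\<^esub> (FArr F (evA (A.WO ?g x)) \<cdot>\<^bsub>V\<^esub> compare False ?y \<cdot>\<^bsub>V\<^esub> TAV False (compare True (A.WO ?g x)))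
      \<cdot>\<^bsub>V\<^esub> TAV False (TAV True (word_compare ?g x)) \<cdot>\<^bsub>V\<^esub> ?c"
    using Br.prems by simp
  also have "\<dots> = (FArr F (A.cups g x) \<cdot>\<^bsub>V\<^esub> word_compare ?g x) \<cdot>\<^bsub>V\<^esub> evV (V.WO ?g (FObj F x)) \<cdot>\<^bsub>V\<^esub> ?c"
    unfolding compare_ev[OF o(2)] using Br.prems by (simp add: V.Cmp_rotate[OF 3])
  finally show ?case unfolding Br.IH(2)[OF Br.prems] by simp
qed simp

lemma word_compare_caps: "x \<in> Obj A \<Longrightarrow> word_compare (forest_word True c) x \<cdot>\<^bsub>V\<^esub> V.caps c (FObj F x) = FArr F (A.caps c x)"
proof (induction c arbitrary: x)
  case (Br f g)
  let ?f = "forest_word True f" and ?g = "forest_word True g"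
  let ?y = "TOA False (A.WO ?g x)"
  have o: "?y \<in> Obj A" "A.WO ?g x \<in> Obj A" using Br.prems by auto
  have 1: "FArr F (TAA True (A.caps f ?y)) \<cdot>\<^bsub>V\<^esub> compare True ?y = compare True (A.WO ?f ?y) \<cdot>\<^bsub>V\<^esub> TAV True (FArr F (A.caps f ?y))"
    using compare_natural[of "A.caps f ?y" True] o by simp
  have 2: "V.WA ?f (word_compare (False # ?g) x) \<cdot>\<^bsub>V\<^esub> V.caps f (TOV False (V.WO ?g (FObj F x))) = V.caps f (FObj F ?y) \<cdot>\<^bsub>V\<^esub> word_compare (False # ?g) x"
    using V.caps_natural[of "word_compare (False # ?g) x" f] Br.prems by simp
  have 3: "TAV True (TAV False (word_compare ?g x)) \<cdot>\<^bsub>V\<^esub> cvV (V.WO ?g (FObj F x)) = cvV (FObj F (A.WO ?g x)) \<cdot>\<^bsub>V\<^esub> word_compare ?g x"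
    using V.cv_natural[of "word_compare ?g x"] Br.prems by simp
  let ?r = "cvV (V.WO ?g (FObj F x)) \<cdot>\<^bsub>V\<^esub> V.caps g (FObj F x)"
  have "word_compare (?f @ False # ?g) x \<cdot>\<^bsub>V\<^esub> V.caps f (TOV False (V.WO ?g (FObj F x))) =
     word_compare ?f ?y \<cdot>\<^bsub>V\<^esub> V.WA ?f (word_compare (False # ?g) x) \<cdot>\<^bsub>V\<^esub> V.caps f (TOV False (V.WO ?g (FObj F x)))"
    using Br.prems by (simp add: word_compare_append)
  also have "\<dots> = (word_compare ?f ?y \<cdot>\<^bsub>V\<^esub> V.caps f (FObj F ?y)) \<cdot>\<^bsub>V\<^esub> word_compare (False # ?g) x"
    unfolding 2 using Br.prems by simp
  also have "\<dots> = FArr F (A.caps f ?y) \<cdot>\<^bsub>V\<^esub> word_compare (False # ?g) x"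
    unfolding Br.IH(1)[OF o(1)] ..
  finally have e: "TAV True (word_compare (?f @ False # ?g) x) \<cdot>\<^bsub>V\<^esub> TAV True (V.caps f (TOV False (V.WO ?g (FObj F x)))) =
      TAV True (FArr F (A.caps f ?y)) \<cdot>\<^bsub>V\<^esub> TAV True (word_compare (False # ?g) x)"
    by (rule V.TA_eq) (use Br.prems in auto)
  have "word_compare (forest_word True (Br f g)) x \<cdot>\<^bsub>V\<^esub> V.caps (Br f g) (FObj F x) =
    compare True (A.WO ?f ?y) \<cdot>\<^bsub>V\<^esub> (TAV True (word_compare (?f @ False # ?g) x) \<cdot>\<^bsub>V\<^esub> TAV True (V.caps f (TOV False (V.WO ?g (FObj F x))))) \<cdot>\<^bsub>V\<^esub> ?r"
    using Br.prems by simp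
  also have "\<dots> = (compare True (A.WO ?f ?y) \<cdot>\<^bsub>V\<^esub> TAV True (FArr F (A.caps f ?y))) \<cdot>\<^bsub>V\<^esub> TAV True (compare False (A.WO ?g x)) \<cdot>\<^bsub>V\<^esub> TAV True (TAV False (word_compare ?g x)) \<cdot>\<^bsub>V\<^esub> ?r"
    unfolding e using Br.prems by simp
  also have "\<dots> = FArr F (TAA True (A.caps f ?y)) \<cdot>\<^bsub>V\<^esub> (compare True ?y \<cdot>\<^bsub>V\<^esub> TAV True (compare False (A.WO ?g x)) \<cdot>\<^bsub>V\<^esub> cvV (FObj F (A.WO ?g x))) \<cdot>\<^bsub>V\<^esub> word_compare ?g x \<cdot>\<^bsub>V\<^esub> V.caps g (FObj F x)"
    unfolding 1[symmetric] using Br.prems by (simp add: V.Cmp_rotate[OF 3])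
  also have "\<dots> = FArr F (A.caps (Br f g) x)"
    unfolding compare_cv[OF o(2)] Br.IH(2)[OF Br.prems] using Br.prems by simp
  finally show ?case .
qed simp

lemma word_compare_natural: "f \<in> Arr A \<Longrightarrow> FArr F (A.WA w f) \<cdot>\<^bsub>V\<^esub> word_compare w (Dom A f) = word_compare w (Cod A f) \<cdot>\<^bsub>V\<^esub> V.WA w (FArr F f)"
proof (induction w)
  case (Cons s w)
  have 1: "FArr F (TAA s (A.WA w f)) \<cdot>\<^bsub>V\<^esub> compare s (A.WO w (Dom A f)) = compare s (A.WO w (Cod A f)) \<cdot>\<^bsub>V\<^esub> TAV s (FArr F (A.WA w f))"
    using compare_natural[of "A.WA w f" s] Cons.prems by simp
  have 2: "TAV s (FArr F (A.WA w f)) \<cdot>\<^bsub>V\<^esub> TAV s (word_compare w (Dom A f)) = TAV s (word_compare w (Cod A f)) \<cdot>\<^bsub>V\<^esub> TAV s (V.WA w (FArr F f))"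
    by (rule V.TA_eq) (use Cons in auto)
  show ?case using Cons.prems by (simp add: V.Cmp_rotate[OF 1] 2)
qed simp

text \<open>Comparison along words is natural in all diagrams as soon as it respects one cup and one
  cap, since diagrams are built from these.\<close>

lemma word_compare_Phi: "x \<in> Obj A \<Longrightarrow> FArr F (A.Phi D x) \<cdot>\<^bsub>V\<^esub> word_compare (lower D) x = word_compare (upper D) x \<cdot>\<^bsub>V\<^esub> V.Phi D (FObj F x)"
proof (induction D)
  case (End c k)
  have "FArr F (A.Phi (End c k) x) \<cdot>\<^bsub>V\<^esub> word_compare (lower (End c k)) x = FArr F (A.caps k x) \<cdot>\<^bsub>V\<^esub> (FArr F (A.cups c x) \<cdot>\<^bsub>V\<^esub> word_compare (forest_word False c) x)"
    using End by simp
  also have "\<dots> = word_compare (upper (End c k)) x \<cdot>\<^bsub>V\<^esub> V.Phi (End c k) (FObj F x)"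
    unfolding word_compare_cups[OF End] word_compare_caps[OF End, symmetric] using End by simp
  finally show ?case .
next
  case (Nx c k s D)
  let ?b = "TOA s (A.WO (lower D) x)" and ?t = "TOA s (A.WO (upper D) x)"
  have o: "?b \<in> Obj A" "?t \<in> Obj A" using Nx.prems by auto
  have 1: "V.cups c (FObj F ?b) \<cdot>\<^bsub>V\<^esub> V.WA (forest_word False c) (word_compare (s # lower D) x) = word_compare (s # lower D) x \<cdot>\<^bsub>V\<^esub> V.cups c (TOV s (V.WO (lower D) (FObj F x)))"
    using V.cups_natural[of "word_compare (s # lower D) x" c] Nx.prems by simp
  have 2: "V.WA (forest_word True k) (word_compare (s # upper D) x) \<cdot>\<^bsub>V\<^esub> V.caps k (TOV s (V.WO (upper D) (FObj F x))) = V.caps k (FObj F ?t) \<cdot>\<^bsub>V\<^esub> word_compare (s # upper D) x"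
    using V.caps_natural[of "word_compare (s # upper D) x" k] Nx.prems by simp
  have 3: "FArr F (TAA s (A.Phi D x)) \<cdot>\<^bsub>V\<^esub> compare s (A.WO (lower D) x) = compare s (A.WO (upper D) x) \<cdot>\<^bsub>V\<^esub> TAV s (FArr F (A.Phi D x))"
    using compare_natural[of "A.Phi D x" s] Nx.prems by simp
  have 4: "TAV s (FArr F (A.Phi D x)) \<cdot>\<^bsub>V\<^esub> TAV s (word_compare (lower D) x) = TAV s (word_compare (upper D) x) \<cdot>\<^bsub>V\<^esub> TAV s (V.Phi D (FObj F x))"
    by (rule V.TA_eq) (use Nx in auto)
  have "FArr F (A.Phi (Nx c k s D) x) \<cdot>\<^bsub>V\<^esub> word_compare (lower (Nx c k s D)) x =
    FArr F (A.caps k ?t) \<cdot>\<^bsub>V\<^esub> FArr F (TAA s (A.Phi D x)) \<cdot>\<^bsub>V\<^esub> (FArr F (A.cups c ?b) \<cdot>\<^bsub>V\<^esub> word_compare (forest_word False c) ?b) \<cdot>\<^bsub>V\<^esub> V.WA (forest_word False c) (word_compare (s # lower D) x)"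
    using Nx.prems by (simp add: word_compare_append)
  also have "\<dots> = FArr F (A.caps k ?t) \<cdot>\<^bsub>V\<^esub> FArr F (TAA s (A.Phi D x)) \<cdot>\<^bsub>V\<^esub> compare s (A.WO (lower D) x) \<cdot>\<^bsub>V\<^esub> TAV s (word_compare (lower D) x) \<cdot>\<^bsub>V\<^esub> V.cups c (TOV s (V.WO (lower D) (FObj F x)))"
    unfolding word_compare_cups[OF o(1)] 1 using Nx.prems by simp
  also have "\<dots> = FArr F (A.caps k ?t) \<cdot>\<^bsub>V\<^esub> word_compare (s # upper D) x \<cdot>\<^bsub>V\<^esub> TAV s (V.Phi D (FObj F x)) \<cdot>\<^bsub>V\<^esub> V.cups c (TOV s (V.WO (lower D) (FObj F x)))"
    using Nx.prems by (simp add: V.Cmp_rotate[OF 3] V.Cmp_rotate[OF 4])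
  also have "\<dots> = word_compare (forest_word True k) ?t \<cdot>\<^bsub>V\<^esub> V.caps k (FObj F ?t) \<cdot>\<^bsub>V\<^esub> word_compare (s # upper D) x \<cdot>\<^bsub>V\<^esub> TAV s (V.Phi D (FObj F x)) \<cdot>\<^bsub>V\<^esub> V.cups c (TOV s (V.WO (lower D) (FObj F x)))"
    unfolding word_compare_caps[OF o(2), symmetric] using Nx.prems by simp
  also have "\<dots> = word_compare (forest_word True k) ?t \<cdot>\<^bsub>V\<^esub> (V.WA (forest_word True k) (word_compare (s # upper D) x) \<cdot>\<^bsub>V\<^esub> V.caps k (TOV s (V.WO (upper D) (FObj F x)))) \<cdot>\<^bsub>V\<^esub> TAV s (V.Phi D (FObj F x)) \<cdot>\<^bsub>V\<^esub> V.cups c (TOV s (V.WO (lower D) (FObj F x)))"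
    unfolding 2 using Nx.prems by simp
  also have "\<dots> = word_compare (upper (Nx c k s D)) x \<cdot>\<^bsub>V\<^esub> V.Phi (Nx c k s D) (FObj F x)"
    using Nx.prems by (simp add: word_compare_append)
  finally show ?case .
qed

end

section \<open>The distinguished dual pair\<close>

lemma sign_word_sign [simp]: "sign_word dpr_minus = [False]" "sign_word dpr_plus = [True]" "dpr_minus \<in> dpr_Obj" "dpr_plus \<in> dpr_Obj"
  by (simp_all add: sign_word_def points_def dpr_minus_def dpr_plus_def dpr_Obj_def)

lemma dpr_dpair_simps [simp]: "LeftO dpr_dpair = dpr_minus" "RightO dpr_dpair = dpr_plus"
  "Counit dpr_dpair = dpr_arrow (dpr_TensO dpr_minus dpr_plus) (End (Br Leaf Leaf) Leaf) ({}, {})"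
  "UnitA dpr_dpair = dpr_arrow ({}, {}) (End Leaf (Br Leaf Leaf)) (dpr_TensO dpr_plus dpr_minus)"
  by (simp_all add: dpr_dpair_def dpr_arrow_def)

lemma diag_between_counit: "diag_between (dpr_TensO dpr_minus dpr_plus) (End (Br Leaf Leaf) Leaf) ({}, {})"
  and diag_between_unit: "diag_between ({}, {}) (End Leaf (Br Leaf Leaf)) (dpr_TensO dpr_plus dpr_minus)"
  by (simp_all add: diag_between_def TensO_points)

lemma dpr_arrow_in_Hom: "diag_between X D Y \<Longrightarrow> dpr_arrow X D Y \<in> Hom Dpr X Y"
  using Hom_Dpr by blast

text \<open>The constraints of Dpr are identities, so a zigzag is a composite of two diagrams, and
  by \<open>diag_cmp\<close> it suffices to compute its relation.\<close>

lemma zigzag_Dpr: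
  assumes "diag_between X D Z" "diag_between Z E X" "Rel D O Rel E = Id"
  shows "dpr_Cmp (dpr_Ident X) (dpr_Cmp (dpr_arrow Z E X) (dpr_Cmp (dpr_Ident Z) (dpr_Cmp (dpr_arrow X D Z) (dpr_Ident X)))) = dpr_Ident X"
proof -
  have o: "X \<in> dpr_Obj" using assms(1) by (simp add: diag_between_def)
  have "dpr_Cmp (dpr_arrow Z E X) (dpr_arrow X D Z) = dpr_Ident X"
    unfolding Ident_dpr_arrow[OF o] by (rule diag_cmp[OF assms(1,2) diag_between_diag_ident[OF o]]) (simp add: assms(3))
  then show ?thesis using Cmp_Ident_dpr_arrow[OF assms(1)] Cmp_Ident_dpr_arrow[OF diag_between_diag_ident[OF o]] by (simp add: Ident_dpr_arrow[OF o])
qed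

lemma dual_pair_Dpr: "dual_pair Dpr dpr_dpair"
proof -
  interpret D: monoidal_category Dpr by (rule monoidal_Dpr)
  let ?X = dpr_minus and ?Y = dpr_plus
  let ?E = "End (Br Leaf Leaf) Leaf" and ?H = "End Leaf (Br Leaf Leaf)"
  have o: "dpr_TensO ?X ?Y \<in> dpr_Obj" "dpr_TensO ?Y ?X \<in> dpr_Obj" by (simp_all add: TensO_points)
  have idX: "dpr_Ident ?X = dpr_arrow ?X (diag_ident [False]) ?X" "diag_between ?X (diag_ident [False]) ?X"
    and idY: "dpr_Ident ?Y = dpr_arrow ?Y (diag_ident [True]) ?Y" "diag_between ?Y (diag_ident [True]) ?Y"
    using Ident_dpr_arrow[of ?X] Ident_dpr_arrow[of ?Y] diag_between_diag_ident[of ?X] diag_between_diag_ident[of ?Y] by simp_all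
  have inv: "inv_arrow Dpr (dpr_Ident x) = dpr_Ident x" if "x \<in> dpr_Obj" for x
    using D.iso_Ident(2)[of x] that by simp
  have 1: "dpr_TensA (dpr_arrow (dpr_TensO ?X ?Y) ?E ({}, {})) (dpr_Ident ?X) = dpr_arrow (dpr_TensO (dpr_TensO ?X ?Y) ?X) (diag_append ?E (diag_ident [False])) ?X"
    "diag_between (dpr_TensO (dpr_TensO ?X ?Y) ?X) (diag_append ?E (diag_ident [False])) ?X"
    using TensA_dpr_arrow[OF diag_between_counit idX(2)] diag_between_diag_append[OF diag_between_counit idX(2)] idX(1) by simp_all
  have 2: "dpr_TensA (dpr_Ident ?X) (dpr_arrow ({}, {}) ?H (dpr_TensO ?Y ?X)) = dpr_arrow ?X (diag_append (diag_ident [False]) ?H) (dpr_TensO (dpr_TensO ?X ?Y) ?X)"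
    "diag_between ?X (diag_append (diag_ident [False]) ?H) (dpr_TensO (dpr_TensO ?X ?Y) ?X)"
    using TensA_dpr_arrow[OF idX(2) diag_between_unit] diag_between_diag_append[OF idX(2) diag_between_unit] idX(1) by (simp_all add: TensO_assoc)
  have 3: "dpr_TensA (dpr_Ident ?Y) (dpr_arrow (dpr_TensO ?X ?Y) ?E ({}, {})) = dpr_arrow (dpr_TensO (dpr_TensO ?Y ?X) ?Y) (diag_append (diag_ident [True]) ?E) ?Y"
    "diag_between (dpr_TensO (dpr_TensO ?Y ?X) ?Y) (diag_append (diag_ident [True]) ?E) ?Y"
    using TensA_dpr_arrow[OF idY(2) diag_between_counit] diag_between_diag_append[OF idY(2) diag_between_counit] idY(1) by (simp_all add: TensO_assoc)
  have 4: "dpr_TensA (dpr_arrow ({}, {}) ?H (dpr_TensO ?Y ?X)) (dpr_Ident ?Y) = dpr_arrow ?Y (diag_append ?H (diag_ident [True])) (dpr_TensO (dpr_TensO ?Y ?X) ?Y)"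
    "diag_between ?Y (diag_append ?H (diag_ident [True])) (dpr_TensO (dpr_TensO ?Y ?X) ?Y)"
    using TensA_dpr_arrow[OF diag_between_unit idY(2)] diag_between_diag_append[OF diag_between_unit idY(2)] idY(1) by simp_all
  \<comment> \<open>In relations the two zigzags are the triangle identities for
    \<open>contract_rel\<close> and its converse.\<close>
  have z: "Rel (diag_append (diag_ident [False]) ?H) O Rel (diag_append ?E (diag_ident [False])) = Id" "Rel (diag_append ?H (diag_ident [True])) O Rel (diag_append (diag_ident [True]) ?E) = Id"
    using R.zigzag_False[of 0] R.zigzag_True[of 0] R.TA_Ident[of 0] by (simp_all add: R.Phi_diag_append R.Phi_diag_prepend)
  show ?thesis
    unfolding dual_pair_def Let_def
    using dpr_arrow_in_Hom[OF diag_between_counit] dpr_arrow_in_Hom[OF diag_between_unit]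
      zigzag_Dpr[OF 2(2) 1(2) z(1)] zigzag_Dpr[OF 4(2) 3(2) z(2)] 1(1) 2(1) 3(1) 4(1)
    by (simp add: inv TensO_points)
qed

text \<open>The distinguished pair acts on Dpr itself; \<open>W.WO w ({}, {})\<close> is the
  standard object with sign word \<open>w\<close>.\<close>

interpretation W: dual_pair_in Dpr dpr_dpair
  rewrites "Obj Dpr = dpr_Obj" and "Arr Dpr = dpr_Arr" and "Dom Dpr = fst" and "Cod Dpr = (\<lambda>f. snd (snd f))"
    and "Ident Dpr = dpr_Ident" and "Cmp Dpr = dpr_Cmp" and "TensO Dpr = dpr_TensO" and "TensA Dpr = dpr_TensA"
    and "UnitO Dpr = ({}, {})" and "LUnit Dpr = dpr_Ident" and "RUnit Dpr = dpr_Ident"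
    and "Assoc Dpr = (\<lambda>x y z. dpr_Ident (dpr_TensO (dpr_TensO x y) z))"
  by (intro dual_pair_in.intro monoidal_Dpr dual_pair_in_axioms.intro dual_pair_Dpr) (rule ext | simp)+

lemma sign_word_ob: "sign_word (W.ob s) = [s]" "W.ob s \<in> dpr_Obj"
  by (cases s; simp add: W.ob_def)+

lemma W_WO: "X \<in> dpr_Obj \<Longrightarrow> W.WO w X \<in> dpr_Obj \<and> sign_word (W.WO w X) = w @ sign_word X"
  by (induction w) (auto simp: TensO_points sign_word_ob)

lemma W_WO_append: "X \<in> dpr_Obj \<Longrightarrow> W.WO w X = dpr_TensO (W.WO w ({}, {})) X"
  by (induction w) (auto simp: TensO_assoc sign_word_ob W_WO)

text \<open>
  Evaluating a diagram in Dpr itself returns that diagram: by naturality of the relational evaluation,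
  both have the same relation.
\<close>

definition rel_functor :: "(dpr_obj, dpr_arr, nat, (nat stream \<times> nat stream) set) func" where
  "rel_functor = \<lparr>FObj = \<lambda>_. 0, FArr = \<lambda>f. Rel (shape f)\<rparr>"

lemma dpr_Arr_dpr_arrow:
  assumes "f \<in> dpr_Arr"
  obtains X D Y where "diag_between X D Y" "f = dpr_arrow X D Y" "X = fst f" "Y = snd (snd f)"
proof -
  have "f = (fst f, fst (snd f), snd (snd f))" by simp
  with assms ex_dpr_arrow[of "fst f" "fst (snd f)" "snd (snd f)"] that show ?thesis by metis
qed

lemma shape_TensA_Ident:
  assumes "diag_between X D Y"
  shows "dpr_TensA (dpr_Ident (W.ob s)) (dpr_arrow X D Y) = dpr_arrow (dpr_TensO (W.ob s) X) (Nx Leaf Leaf s D) (dpr_TensO (W.ob s) Y)"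
    "diag_between (dpr_TensO (W.ob s) X) (Nx Leaf Leaf s D) (dpr_TensO (W.ob s) Y)"
  using TensA_dpr_arrow[OF diag_between_diag_ident[OF sign_word_ob(2)] assms, of s] diag_between_diag_append[OF diag_between_diag_ident[OF sign_word_ob(2)] assms, of s]
  by (simp_all add: Ident_dpr_arrow sign_word_ob)

lemma W_evm:
  assumes "X \<in> dpr_Obj"
  shows "W.evm X = dpr_arrow (dpr_TensO dpr_minus (dpr_TensO dpr_plus X)) (diag_append (End (Br Leaf Leaf) Leaf) (diag_ident (sign_word X))) X"
    "diag_between (dpr_TensO dpr_minus (dpr_TensO dpr_plus X)) (diag_append (End (Br Leaf Leaf) Leaf) (diag_ident (sign_word X))) X"
proof -
  note i = diag_between_diag_ident[OF assms]
  have t: "dpr_TensA (dpr_arrow (dpr_TensO dpr_minus dpr_plus) (End (Br Leaf Leaf) Leaf) ({}, {})) (dpr_arrow X (diag_ident (sign_word X)) X)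
    = dpr_arrow (dpr_TensO dpr_minus (dpr_TensO dpr_plus X)) (diag_append (End (Br Leaf Leaf) Leaf) (diag_ident (sign_word X))) X"
    using TensA_dpr_arrow[OF diag_between_counit i] assms by (simp add: TensO_assoc)
  show b: "diag_between (dpr_TensO dpr_minus (dpr_TensO dpr_plus X)) (diag_append (End (Br Leaf Leaf) Leaf) (diag_ident (sign_word X))) X"
    using diag_between_diag_append[OF diag_between_counit i] assms by (simp add: TensO_assoc)
  have "inv_arrow Dpr (dpr_Ident (dpr_TensO (dpr_TensO dpr_minus dpr_plus) X)) = dpr_Ident (dpr_TensO dpr_minus (dpr_TensO dpr_plus X))"
    using W.iso_Ident(2)[of "dpr_TensO (dpr_TensO dpr_minus dpr_plus) X"] assms by (simp add: TensO_points TensO_assoc)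
  then show "W.evm X = dpr_arrow (dpr_TensO dpr_minus (dpr_TensO dpr_plus X)) (diag_append (End (Br Leaf Leaf) Leaf) (diag_ident (sign_word X))) X"
    using Cmp_Ident_dpr_arrow[OF b] unfolding W.evm_def by (simp add: Ident_dpr_arrow[OF assms] t)
qed

lemma W_cvm:
  assumes "X \<in> dpr_Obj"
  shows "W.cvm X = dpr_arrow X (diag_append (End Leaf (Br Leaf Leaf)) (diag_ident (sign_word X))) (dpr_TensO dpr_plus (dpr_TensO dpr_minus X))"
    "diag_between X (diag_append (End Leaf (Br Leaf Leaf)) (diag_ident (sign_word X))) (dpr_TensO dpr_plus (dpr_TensO dpr_minus X))"
proof -
  note i = diag_between_diag_ident[OF assms]
  have t: "dpr_TensA (dpr_arrow ({}, {}) (End Leaf (Br Leaf Leaf)) (dpr_TensO dpr_plus dpr_minus)) (dpr_arrow X (diag_ident (sign_word X)) X)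
    = dpr_arrow X (diag_append (End Leaf (Br Leaf Leaf)) (diag_ident (sign_word X))) (dpr_TensO dpr_plus (dpr_TensO dpr_minus X))"
    using TensA_dpr_arrow[OF diag_between_unit i] assms by (simp add: TensO_assoc)
  show b: "diag_between X (diag_append (End Leaf (Br Leaf Leaf)) (diag_ident (sign_word X))) (dpr_TensO dpr_plus (dpr_TensO dpr_minus X))"
    using diag_between_diag_append[OF diag_between_unit i] assms by (simp add: TensO_assoc)
  have inv: "inv_arrow Dpr (dpr_Ident X) = dpr_Ident X" using W.iso_Ident(2)[of X] assms by simp
  show "W.cvm X = dpr_arrow X (diag_append (End Leaf (Br Leaf Leaf)) (diag_ident (sign_word X))) (dpr_TensO dpr_plus (dpr_TensO dpr_minus X))"
    using Cmp_Ident_dpr_arrow[OF b] assms unfolding W.cvm_def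
    by (simp add: inv t[folded Ident_dpr_arrow[OF assms]] TensO_assoc)
qed

text \<open>With identities as comparison maps, \<open>word_compare_Phi\<close> says that evaluation
  in Dpr followed by taking relations is evaluation in relations.\<close>

interpretation RF: action_morphism Dpr "\<lambda>s z. dpr_TensO (W.ob s) z" "\<lambda>s f. dpr_TensA (dpr_Ident (W.ob s)) f" W.evm W.cvm
  "rel_cat :: (nat, (nat stream \<times> nat stream) set) cat" "\<lambda>s x. x" "\<lambda>s. lift_rel" "\<lambda>_. contract_rel" "\<lambda>_. contract_rel\<inverse>"
  rel_functor "\<lambda>_ _. Id"
proof (intro action_morphism.intro action_morphism_axioms.intro cat_functor.intro cat_functor_axioms.intro category_Dpr R.category_axioms R.adjoint_action_axioms)
  show "adjoint_action Dpr (\<lambda>s z. dpr_TensO (W.ob s) z) (\<lambda>s f. dpr_TensA (dpr_Ident (W.ob s)) f) W.evm W.cvm"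
    using W.adjoint_action_axioms by simp
  show "FArr rel_functor f \<in> Hom rel_cat (FObj rel_functor x) (FObj rel_functor y)" for f x y by (simp add: rel_functor_def)
  show "FArr rel_functor (Cmp Dpr g f) = Cmp rel_cat (FArr rel_functor g) (FArr rel_functor f)"
    if fg: "f \<in> Hom Dpr x y" "g \<in> Hom Dpr y z" for f g x y z
  proof -
    obtain D where D: "diag_between x D y" "f = dpr_arrow x D y" using fg(1) unfolding Hom_Dpr by blast
    obtain E where E: "diag_between y E z" "g = dpr_arrow y E z" using fg(2) unfolding Hom_Dpr by blast
    from diag_compose[OF D(1) E(1)] obtain G where "diag_between x G z" "Rel G = Rel D O Rel E"
      "dpr_Cmp (dpr_arrow y E z) (dpr_arrow x D y) = dpr_arrow x G z" by blast
    then show ?thesis using D E by (simp add: rel_functor_def)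
  qed
  show "FArr rel_functor (Ident Dpr x) = Ident rel_cat (FObj rel_functor x)" if "x \<in> Obj Dpr" for x
    using that by (simp add: rel_functor_def Ident_dpr_arrow diag_between_diag_ident)
  show "Cmp rel_cat (FArr rel_functor (dpr_TensA (dpr_Ident (W.ob s)) f)) Id = Cmp rel_cat Id (lift_rel (FArr rel_functor f))"
    if f: "f \<in> Arr Dpr" for f s
  proof -
    obtain X D Y where D: "diag_between X D Y" "f = dpr_arrow X D Y" using f by (auto elim: dpr_Arr_dpr_arrow)
    show ?thesis using D(1) shape_TensA_Ident[OF D(1), of s] by (simp add: D(2) rel_functor_def)
  qed
  show "Cmp rel_cat (FArr rel_functor (W.evm x)) (Cmp rel_cat Id (lift_rel Id)) = contract_rel" if "x \<in> Obj Dpr" for x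
    using that R.TA_Ident[of 0] W_evm(2)[of x] by (simp add: rel_functor_def W_evm(1) R.Phi_diag_append R.Phi_diag_prepend)
  show "Cmp rel_cat Id (Cmp rel_cat (lift_rel Id) (contract_rel\<inverse>)) = FArr rel_functor (W.cvm x)" if "x \<in> Obj Dpr" for x
    using that R.TA_Ident[of 0] W_cvm(2)[of x] by (simp add: rel_functor_def W_cvm(1) R.Phi_diag_append R.Phi_diag_prepend)
qed (auto simp: rel_functor_def rel_cat_def)

lemma FArr_rel_functor: "FArr rel_functor f = Rel (shape f)" "FObj rel_functor x = 0"
  by (simp_all add: rel_functor_def)

lemma RF_word_compare [simp]: "RF.word_compare w x = Id"
  using R.TA_Ident[of 0] by (induction w) auto

lemma W_Phi:
  "W.Phi D ({}, {}) = dpr_arrow (W.WO (lower D) ({}, {})) D (W.WO (upper D) ({}, {}))"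
  "diag_between (W.WO (lower D) ({}, {})) D (W.WO (upper D) ({}, {}))"
proof -
  let ?X = "W.WO (lower D) ({}, {})" and ?Y = "W.WO (upper D) ({}, {})"
  have o: "?X \<in> dpr_Obj" "?Y \<in> dpr_Obj" "sign_word ?X = lower D" "sign_word ?Y = upper D" using W_WO[of "({}, {})"] by simp_all
  show b: "diag_between ?X D ?Y" using o by unfold_locales auto
  have "W.Phi D ({}, {}) \<in> Hom Dpr ?X ?Y" using W.Phi_typing[of "({}, {})" D] by (simp add: Hom_def)
  then obtain E where E: "diag_between ?X E ?Y" "W.Phi D ({}, {}) = dpr_arrow ?X E ?Y" unfolding Hom_Dpr by blast
  have "Rel E = Rel D"
    using RF.word_compare_Phi[of "({}, {})" D] E by (simp add: FArr_rel_functor)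
  \<comment> \<open>\<open>E\<close> has the relation of \<open>D\<close> preceded by an identity,
    so by \<open>diag_cmp\<close> its arrow is that composite. In this way equal relations give
    equal arrows.\<close>
  then have "dpr_Cmp (dpr_arrow ?X D ?Y) (dpr_Ident ?X) = dpr_arrow ?X E ?Y"
    unfolding Ident_dpr_arrow[OF o(1)] by (intro diag_cmp[OF diag_between_diag_ident[OF o(1)] b E(1)]) simp
  then show "W.Phi D ({}, {}) = dpr_arrow ?X D ?Y" using Cmp_Ident_dpr_arrow(2)[OF b] E(2) by simp
qed

lemma W_regroup: "z \<in> dpr_Obj \<Longrightarrow> t \<in> dpr_Obj \<Longrightarrow> W.regroup w z t = dpr_Ident (dpr_TensO (W.WO w z) t)"
proof (induction w)
  case (Cons s w)
  let ?z = "dpr_TensO (dpr_TensO (W.ob s) (W.WO w z)) t"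
  have o: "W.WO w z \<in> dpr_Obj" "?z \<in> dpr_Obj" using Cons.prems W_WO TensO_points sign_word_ob by auto
  have "dpr_TensA (dpr_Ident (W.ob s)) (dpr_Ident (dpr_TensO (W.WO w z) t)) = dpr_Ident ?z"
    using o Cons.prems by (simp add: TensA_Ident_Dpr sign_word_ob TensO_points TensO_assoc)
  then show ?case using Cons o(2) Cmp_Ident_dpr_arrow[OF diag_between_diag_ident[OF o(2)]] by (simp add: Ident_dpr_arrow[OF o(2)])
qed simp

context monoidal_category
begin

text \<open>
  Compatibility with the counits suffices, because a counit determines its unit.
\<close>

lemma dual_pair_transport:
  assumes "dual_pair C P" "dual_pair C Q"
    and t: "iso_arrow C tL" "Dom C tL = LeftO P" "Cod C tL = LeftO Q"
      "tR \<in> Arr C" "Dom C tR = RightO P" "Cod C tR = RightO Q"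
    and counit: "Counit Q \<cdot> (tL \<otimes> tR) = Counit P" and z: "z \<in> Obj C"
  shows "dual_pair_in.evm C Q z \<cdot> (tL \<otimes> (tR \<otimes> idn z)) = dual_pair_in.evm C P z"
    and "(tR \<otimes> (tL \<otimes> idn z)) \<cdot> dual_pair_in.cvm C P z = dual_pair_in.cvm C Q z"
proof -
  interpret P: dual_pair_in C P by unfold_locales fact
  interpret Q: dual_pair_in C Q by unfold_locales fact
  note t' = t iso_Arr[OF t(1)]
  have ev: "Q.evm y \<cdot> (tL \<otimes> (tR \<otimes> idn y)) = P.evm y" if y: "y \<in> Obj C" for y
  proof -
    have 1: "inv_arrow C (Assoc C Q.X Q.Y y) \<cdot> (tL \<otimes> (tR \<otimes> idn y)) = ((tL \<otimes> tR) \<otimes> idn y) \<cdot> inv_arrow C (Assoc C P.X P.Y y)"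
      by (rule iso_square) (use Assoc_nat[of tL tR "idn y"] t' y in auto)
    have 2: "(Counit Q \<otimes> idn y) \<cdot> ((tL \<otimes> tR) \<otimes> idn y) = Counit P \<otimes> idn y"
      using t' y counit by (simp add: interchange)
    show ?thesis using t' y by (simp add: Q.evm_def P.evm_def 1 Cmp_rotate[OF 2])
  qed
  show "Q.evm z \<cdot> (tL \<otimes> (tR \<otimes> idn z)) = P.evm z" by (rule ev[OF z])
  let ?c = "(tR \<otimes> (tL \<otimes> idn z)) \<cdot> P.cvm z"
  let ?x = "P.X \<odot> z" and ?x' = "Q.X \<odot> z"
  have c: "?c \<in> Arr C" "Dom C ?c = z" "Cod C ?c = Q.Y \<odot> ?x'" using t' z by simp_all
  \<comment> \<open>\<open>?c\<close> satisfies the triangle identity that characterizes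
    \<open>Q.cvm z\<close>. Precomposition with the invertible \<open>tL \<otimes> idn z\<close>
    reduces this to the triangle identity of \<open>P\<close>.\<close>
  have b: "Q.evm ?x' \<cdot> (idn Q.X \<otimes> ?c) = idn ?x'"
  proof (rule iso_right_cancel)
    have 1: "Q.evm ?x' \<cdot> (tL \<otimes> (tR \<otimes> idn ?x')) = P.evm ?x'" using ev z by simp
    have 2: "P.evm ?x' \<cdot> (idn P.X \<otimes> (idn P.Y \<otimes> (tL \<otimes> idn z))) = (tL \<otimes> idn z) \<cdot> P.evm ?x"
      using P.evm_natural[of "tL \<otimes> idn z"] t' z by simp
    have 3: "P.evm ?x \<cdot> (idn P.X \<otimes> P.cvm z) = idn ?x" using P.zigzag_X z by simp
    have "(idn Q.X \<otimes> ?c) \<cdot> (tL \<otimes> idn z) = (tL \<otimes> (tR \<otimes> (tL \<otimes> idn z))) \<cdot> (idn P.X \<otimes> P.cvm z)"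
      using t' z by (simp add: interchange del: whisker_left P.TA_Cmp Q.TA_Cmp)
    also have "\<dots> = (tL \<otimes> (tR \<otimes> idn ?x')) \<cdot> (idn P.X \<otimes> (idn P.Y \<otimes> (tL \<otimes> idn z))) \<cdot> (idn P.X \<otimes> P.cvm z)"
    proof -
      have "tL \<otimes> (tR \<otimes> (tL \<otimes> idn z)) = (tL \<otimes> (tR \<otimes> idn ?x')) \<cdot> (idn P.X \<otimes> (idn P.Y \<otimes> (tL \<otimes> idn z)))"
        using t' z by (simp add: interchange)
      then show ?thesis using t' z by simp
    qed
    finally have "Q.evm ?x' \<cdot> ((idn Q.X \<otimes> ?c) \<cdot> (tL \<otimes> idn z)) = tL \<otimes> idn z"
      using t' z by (simp add: Cmp_rotate[OF 1] Cmp_rotate[OF 2] 3)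
    then show "(Q.evm ?x' \<cdot> (idn Q.X \<otimes> ?c)) \<cdot> (tL \<otimes> idn z) = idn ?x' \<cdot> (tL \<otimes> idn z)"
      using t' z c by (simp del: whisker_left P.TA_Cmp Q.TA_Cmp)
  qed (use t' z c in \<open>auto simp del: whisker_left P.TA_Cmp Q.TA_Cmp\<close>)
  have d: "(idn Q.Y \<otimes> Q.evm ?x') \<cdot> (idn Q.Y \<otimes> (idn Q.X \<otimes> ?c)) = idn (Q.Y \<odot> ?x')"
    using b t' z c by (simp add: interchange del: whisker_left P.TA_Cmp Q.TA_Cmp)
  have e: "cvm' \<cdot> ?c = (idn Q.Y \<otimes> (idn Q.X \<otimes> ?c)) \<cdot> Q.cvm z" if "cvm' = Q.cvm (Q.Y \<odot> ?x')" for cvm'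
    using Q.cvm_natural[OF c(1)] unfolding c that ..
  \<comment> \<open>Uniqueness of the unit: the other triangle identity of \<open>Q\<close> is
    inserted in front of \<open>?c\<close>, naturality of \<open>Q.cvm\<close> moves
    \<open>?c\<close> inside, and \<open>d\<close> removes it.\<close>
  have "?c = ((idn Q.Y \<otimes> Q.evm ?x') \<cdot> Q.cvm (Q.Y \<odot> ?x')) \<cdot> ?c"
    using Q.zigzag_Y[of ?x'] c z by (simp del: whisker_left P.TA_Cmp Q.TA_Cmp)
  also have "\<dots> = (idn Q.Y \<otimes> Q.evm ?x') \<cdot> (Q.cvm (Q.Y \<odot> ?x') \<cdot> ?c)"
    using c z by (intro Cmp_assoc') simp_all
  also have "\<dots> = ((idn Q.Y \<otimes> Q.evm ?x') \<cdot> (idn Q.Y \<otimes> (idn Q.X \<otimes> ?c))) \<cdot> Q.cvm z"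
    unfolding e[OF refl] using c z by (intro Cmp_assoc'[symmetric]) simp_all
  also have "\<dots> = Q.cvm z" unfolding d using z by simp
  finally show "(tR \<otimes> (tL \<otimes> idn z)) \<cdot> P.cvm z = Q.cvm z" .
qed

end

section \<open>Images of dual pairs under strong monoidal functors\<close>

context strong_monoidal_functor
begin

lemma F_iso: 
  assumes "iso_arrow A f"
  shows "iso_arrow V (FArr F f)" "inv_arrow V (FArr F f) = FArr F (inv_arrow A f)"
proof -
  note f = A.iso_Arr[OF assms]
  have "inverse_arrows V (FArr F f) (FArr F (inv_arrow A f))"
    using assms f by (simp add: inverse_arrows_def flip: F_simps(6))
  then show "iso_arrow V (FArr F f)" "inv_arrow V (FArr F f) = FArr F (inv_arrow A f)"
    using V.inv_arrow_eq by (auto simp: iso_arrow_def)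
qed

lemma FMult_typing [simp]:
  assumes "x \<in> Obj A" "y \<in> Obj A"
  shows "FMult F x y \<in> Arr V" "Dom V (FMult F x y) = FObj F x \<odot>\<^bsub>V\<^esub> FObj F y"
    "Cod V (FMult F x y) = FObj F (x \<odot>\<^bsub>A\<^esub> y)" "iso_arrow V (FMult F x y)"
  using FMult_in[OF assms] FMult_iso[OF assms] by auto

lemma FUnit_typing [simp]: "FUnit F \<in> Arr V" "Dom V (FUnit F) = UnitO V" "Cod V (FUnit F) = FObj F (UnitO A)"
  "iso_arrow V (FUnit F)"
  using FUnit_in FUnit_iso by auto

lemma FMult_nat:
  assumes "f \<in> Arr A" "g \<in> Arr A"
  shows "FMult F (Cod A f) (Cod A g) \<cdot>\<^bsub>V\<^esub> (FArr F f \<otimes>\<^bsub>V\<^esub> FArr F g) = FArr F (f \<otimes>\<^bsub>A\<^esub> g) \<cdot>\<^bsub>V\<^esub> FMult F (Dom A f) (Dom A g)"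
  by (rule FMult_natural) (use assms in auto)

lemma F_assoc_inv:
  assumes "x \<in> Obj A" "y \<in> Obj A" "z \<in> Obj A"
  shows "FMult F (x \<odot>\<^bsub>A\<^esub> y) z \<cdot>\<^bsub>V\<^esub> (FMult F x y \<otimes>\<^bsub>V\<^esub> Ident V (FObj F z)) \<cdot>\<^bsub>V\<^esub> inv_arrow V (Assoc V (FObj F x) (FObj F y) (FObj F z))
    = FArr F (inv_arrow A (Assoc A x y z)) \<cdot>\<^bsub>V\<^esub> FMult F x (y \<odot>\<^bsub>A\<^esub> z) \<cdot>\<^bsub>V\<^esub> (Ident V (FObj F x) \<otimes>\<^bsub>V\<^esub> FMult F y z)"
proof -
  have "inv_arrow V (FArr F (Assoc A x y z)) \<cdot>\<^bsub>V\<^esub> (FMult F x (y \<odot>\<^bsub>A\<^esub> z) \<cdot>\<^bsub>V\<^esub> (Ident V (FObj F x) \<otimes>\<^bsub>V\<^esub> FMult F y z))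
    = (FMult F (x \<odot>\<^bsub>A\<^esub> y) z \<cdot>\<^bsub>V\<^esub> (FMult F x y \<otimes>\<^bsub>V\<^esub> Ident V (FObj F z))) \<cdot>\<^bsub>V\<^esub> inv_arrow V (Assoc V (FObj F x) (FObj F y) (FObj F z))"
    by (rule V.iso_square) (use F_assoc[OF assms] assms F_iso in auto)
  then show ?thesis using assms F_iso[of "Assoc A x y z"] by simp
qed

lemma F_lunit_inv:
  assumes "x \<in> Obj A"
  shows "FMult F (UnitO A) x \<cdot>\<^bsub>V\<^esub> (FUnit F \<otimes>\<^bsub>V\<^esub> Ident V (FObj F x)) \<cdot>\<^bsub>V\<^esub> inv_arrow V (LUnit V (FObj F x)) = FArr F (inv_arrow A (LUnit A x))"
proof (rule V.iso_left_cancel[of "FArr F (LUnit A x)"])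
  have "FArr F (LUnit A x) \<cdot>\<^bsub>V\<^esub> (FMult F (UnitO A) x \<cdot>\<^bsub>V\<^esub> (FUnit F \<otimes>\<^bsub>V\<^esub> Ident V (FObj F x)) \<cdot>\<^bsub>V\<^esub> inv_arrow V (LUnit V (FObj F x)))
    = (FArr F (LUnit A x) \<cdot>\<^bsub>V\<^esub> FMult F (UnitO A) x \<cdot>\<^bsub>V\<^esub> (FUnit F \<otimes>\<^bsub>V\<^esub> Ident V (FObj F x))) \<cdot>\<^bsub>V\<^esub> inv_arrow V (LUnit V (FObj F x))"
    using assms by simp
  also have "\<dots> = FArr F (LUnit A x) \<cdot>\<^bsub>V\<^esub> FArr F (inv_arrow A (LUnit A x))"
    unfolding F_lunit[OF assms] using assms by (simp flip: F_simps(6))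
  finally show "FArr F (LUnit A x) \<cdot>\<^bsub>V\<^esub> (FMult F (UnitO A) x \<cdot>\<^bsub>V\<^esub> (FUnit F \<otimes>\<^bsub>V\<^esub> Ident V (FObj F x)) \<cdot>\<^bsub>V\<^esub> inv_arrow V (LUnit V (FObj F x)))
    = FArr F (LUnit A x) \<cdot>\<^bsub>V\<^esub> FArr F (inv_arrow A (LUnit A x))" .
qed (use assms F_iso in auto)

lemma F_runit_inv:
  assumes "x \<in> Obj A"
  shows "FMult F x (UnitO A) \<cdot>\<^bsub>V\<^esub> (Ident V (FObj F x) \<otimes>\<^bsub>V\<^esub> FUnit F) \<cdot>\<^bsub>V\<^esub> inv_arrow V (RUnit V (FObj F x)) = FArr F (inv_arrow A (RUnit A x))"
proof (rule V.iso_left_cancel[of "FArr F (RUnit A x)"])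
  have "FArr F (RUnit A x) \<cdot>\<^bsub>V\<^esub> (FMult F x (UnitO A) \<cdot>\<^bsub>V\<^esub> (Ident V (FObj F x) \<otimes>\<^bsub>V\<^esub> FUnit F) \<cdot>\<^bsub>V\<^esub> inv_arrow V (RUnit V (FObj F x)))
    = (FArr F (RUnit A x) \<cdot>\<^bsub>V\<^esub> FMult F x (UnitO A) \<cdot>\<^bsub>V\<^esub> (Ident V (FObj F x) \<otimes>\<^bsub>V\<^esub> FUnit F)) \<cdot>\<^bsub>V\<^esub> inv_arrow V (RUnit V (FObj F x))"
    using assms by simp
  also have "\<dots> = FArr F (RUnit A x) \<cdot>\<^bsub>V\<^esub> FArr F (inv_arrow A (RUnit A x))"
    unfolding F_runit[OF assms] using assms by (simp flip: F_simps(6))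
  finally show "FArr F (RUnit A x) \<cdot>\<^bsub>V\<^esub> (FMult F x (UnitO A) \<cdot>\<^bsub>V\<^esub> (Ident V (FObj F x) \<otimes>\<^bsub>V\<^esub> FUnit F) \<cdot>\<^bsub>V\<^esub> inv_arrow V (RUnit V (FObj F x)))
    = FArr F (RUnit A x) \<cdot>\<^bsub>V\<^esub> FArr F (inv_arrow A (RUnit A x))" .
qed (use assms F_iso in auto)

end

locale functor_dual = strong_monoidal_functor A V F + Q: dual_pair_in A Q
  for A :: "('o, 'm) moncat" and V :: "('p, 'n) moncat" and F :: "('o, 'm, 'p, 'n) monfunc" and Q :: "('o, 'm) dpair"
begin

abbreviation (input) cmp (infixr "\<bullet>" 60) where "g \<bullet> f \<equiv> g \<cdot>\<^bsub>V\<^esub> f"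
abbreviation (input) tens (infixr "\<otimes>\<otimes>" 70) where "f \<otimes>\<otimes> g \<equiv> f \<otimes>\<^bsub>V\<^esub> g"
abbreviation (input) iF where "iF x \<equiv> Ident V (FObj F x)"
abbreviation (input) IA where "IA \<equiv> UnitO A"

abbreviation (input) PF where "PF \<equiv> image_dpair A V Q F"

lemma PF_simps [simp]: "LeftO PF = FObj F Q.X" "RightO PF = FObj F Q.Y"
  "Counit PF = inv_arrow V (FUnit F) \<bullet> FArr F (Counit Q) \<bullet> FMult F Q.X Q.Y"
  "UnitA PF = inv_arrow V (FMult F Q.Y Q.X) \<bullet> FArr F (UnitA Q) \<bullet> FUnit F"
  by (simp_all add: image_dpair_def)

text \<open>The counit of the image pair contains the inverse of \<open>FUnit F\<close>, which the
  factor in front of it cancels; what remains is naturality of \<open>FMult\<close>. The next three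
  lemmas treat the other side and the unit in the same manner.\<close>

lemma counit_step:
  assumes "x \<in> Obj A"
  shows "FMult F IA x \<bullet> (FUnit F \<otimes>\<otimes> iF x) \<bullet> (Counit PF \<otimes>\<otimes> iF x)
    = FArr F (Counit Q \<otimes>\<^bsub>A\<^esub> Ident A x) \<bullet> FMult F (Q.X \<odot>\<^bsub>A\<^esub> Q.Y) x \<bullet> (FMult F Q.X Q.Y \<otimes>\<otimes> iF x)"
proof -
  have 1: "(FUnit F \<otimes>\<otimes> iF x) \<bullet> (Counit PF \<otimes>\<otimes> iF x) = (FArr F (Counit Q) \<otimes>\<otimes> iF x) \<bullet> (FMult F Q.X Q.Y \<otimes>\<otimes> iF x)"
    using assms by (simp add: V.interchange del: V.whisker_right)
  have 2: "FMult F IA x \<bullet> (FArr F (Counit Q) \<otimes>\<otimes> iF x) = FArr F (Counit Q \<otimes>\<^bsub>A\<^esub> Ident A x) \<bullet> FMult F (Q.X \<odot>\<^bsub>A\<^esub> Q.Y) x"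
    using FMult_nat[of "Counit Q" "Ident A x"] assms by simp
  show ?thesis unfolding 1 using assms by (simp add: V.Cmp_rotate[OF 2])
qed

lemma counit_step':
  assumes "x \<in> Obj A"
  shows "FMult F x IA \<bullet> (iF x \<otimes>\<otimes> FUnit F) \<bullet> (iF x \<otimes>\<otimes> Counit PF)
    = FArr F (Ident A x \<otimes>\<^bsub>A\<^esub> Counit Q) \<bullet> FMult F x (Q.X \<odot>\<^bsub>A\<^esub> Q.Y) \<bullet> (iF x \<otimes>\<otimes> FMult F Q.X Q.Y)"
proof -
  have 1: "(iF x \<otimes>\<otimes> FUnit F) \<bullet> (iF x \<otimes>\<otimes> Counit PF) = (iF x \<otimes>\<otimes> FArr F (Counit Q)) \<bullet> (iF x \<otimes>\<otimes> FMult F Q.X Q.Y)"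
    using assms by (simp add: V.interchange del: V.whisker_left)
  have 2: "FMult F x IA \<bullet> (iF x \<otimes>\<otimes> FArr F (Counit Q)) = FArr F (Ident A x \<otimes>\<^bsub>A\<^esub> Counit Q) \<bullet> FMult F x (Q.X \<odot>\<^bsub>A\<^esub> Q.Y)"
    using FMult_nat[of "Ident A x" "Counit Q"] assms by simp
  show ?thesis unfolding 1 using assms by (simp add: V.Cmp_rotate[OF 2])
qed

lemma unit_step:
  assumes "x \<in> Obj A"
  shows "FMult F (Q.Y \<odot>\<^bsub>A\<^esub> Q.X) x \<bullet> (FMult F Q.Y Q.X \<otimes>\<otimes> iF x) \<bullet> (UnitA PF \<otimes>\<otimes> iF x)
    = FArr F (UnitA Q \<otimes>\<^bsub>A\<^esub> Ident A x) \<bullet> FMult F IA x \<bullet> (FUnit F \<otimes>\<otimes> iF x)"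
proof -
  have 1: "(FMult F Q.Y Q.X \<otimes>\<otimes> iF x) \<bullet> (UnitA PF \<otimes>\<otimes> iF x) = (FArr F (UnitA Q) \<otimes>\<otimes> iF x) \<bullet> (FUnit F \<otimes>\<otimes> iF x)"
    using assms by (simp add: V.interchange del: V.whisker_right)
  have 2: "FMult F (Q.Y \<odot>\<^bsub>A\<^esub> Q.X) x \<bullet> (FArr F (UnitA Q) \<otimes>\<otimes> iF x) = FArr F (UnitA Q \<otimes>\<^bsub>A\<^esub> Ident A x) \<bullet> FMult F IA x"
    using FMult_nat[of "UnitA Q" "Ident A x"] assms by simp
  show ?thesis unfolding 1 using assms by (simp add: V.Cmp_rotate[OF 2])
qed

lemma unit_step':
  assumes "x \<in> Obj A"
  shows "FMult F x (Q.Y \<odot>\<^bsub>A\<^esub> Q.X) \<bullet> (iF x \<otimes>\<otimes> FMult F Q.Y Q.X) \<bullet> (iF x \<otimes>\<otimes> UnitA PF)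
    = FArr F (Ident A x \<otimes>\<^bsub>A\<^esub> UnitA Q) \<bullet> FMult F x IA \<bullet> (iF x \<otimes>\<otimes> FUnit F)"
proof -
  have 1: "(iF x \<otimes>\<otimes> FMult F Q.Y Q.X) \<bullet> (iF x \<otimes>\<otimes> UnitA PF) = (iF x \<otimes>\<otimes> FArr F (UnitA Q)) \<bullet> (iF x \<otimes>\<otimes> FUnit F)"
    using assms by (simp add: V.interchange del: V.whisker_left)
  have 2: "FMult F x (Q.Y \<odot>\<^bsub>A\<^esub> Q.X) \<bullet> (iF x \<otimes>\<otimes> FArr F (UnitA Q)) = FArr F (Ident A x \<otimes>\<^bsub>A\<^esub> UnitA Q) \<bullet> FMult F x IA"
    using FMult_nat[of "Ident A x" "UnitA Q"] assms by simp
  show ?thesis unfolding 1 using assms by (simp add: V.Cmp_rotate[OF 2])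
qed

lemma PF_typing [simp]: "Counit PF \<in> Arr V" "Dom V (Counit PF) = FObj F Q.X \<odot>\<^bsub>V\<^esub> FObj F Q.Y" "Cod V (Counit PF) = UnitO V"
  "UnitA PF \<in> Arr V" "Cod V (UnitA PF) = FObj F Q.Y \<odot>\<^bsub>V\<^esub> FObj F Q.X" "Dom V (UnitA PF) = UnitO V"
  by simp_all

text \<open>The constraints are pushed through \<open>F\<close> from left to right until the
  composite is \<open>F\<close> applied to a triangle identity of \<open>Q\<close>.\<close>

lemma dual_pair_image: "dual_pair V PF"
proof -
  let ?FX = "FObj F Q.X" and ?FY = "FObj F Q.Y"
  note [simp del] = PF_simps(3,4)
  have "LUnit V ?FX \<bullet> (Counit PF \<otimes>\<otimes> iF Q.X) \<bullet> inv_arrow V (Assoc V ?FX ?FY ?FX) \<bullet> (iF Q.X \<otimes>\<otimes> UnitA PF) \<bullet> inv_arrow V (RUnit V ?FX)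
    = FArr F (LUnit A Q.X) \<bullet> (FMult F IA Q.X \<bullet> (FUnit F \<otimes>\<otimes> iF Q.X) \<bullet> (Counit PF \<otimes>\<otimes> iF Q.X)) \<bullet> inv_arrow V (Assoc V ?FX ?FY ?FX) \<bullet> (iF Q.X \<otimes>\<otimes> UnitA PF) \<bullet> inv_arrow V (RUnit V ?FX)"
    unfolding F_lunit[OF Q.dual_typing(1), symmetric] by simp
  also have "\<dots> = FArr F (LUnit A Q.X) \<bullet> FArr F (Counit Q \<otimes>\<^bsub>A\<^esub> Ident A Q.X) \<bullet> (FMult F (Q.X \<odot>\<^bsub>A\<^esub> Q.Y) Q.X \<bullet> (FMult F Q.X Q.Y \<otimes>\<otimes> iF Q.X) \<bullet> inv_arrow V (Assoc V ?FX ?FY ?FX)) \<bullet> (iF Q.X \<otimes>\<otimes> UnitA PF) \<bullet> inv_arrow V (RUnit V ?FX)"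
    unfolding counit_step[OF Q.dual_typing(1)] by simp
  also have "\<dots> = FArr F (LUnit A Q.X) \<bullet> FArr F (Counit Q \<otimes>\<^bsub>A\<^esub> Ident A Q.X) \<bullet> FArr F (inv_arrow A (Assoc A Q.X Q.Y Q.X)) \<bullet> (FMult F Q.X (Q.Y \<odot>\<^bsub>A\<^esub> Q.X) \<bullet> (iF Q.X \<otimes>\<otimes> FMult F Q.Y Q.X) \<bullet> (iF Q.X \<otimes>\<otimes> UnitA PF)) \<bullet> inv_arrow V (RUnit V ?FX)"
    unfolding F_assoc_inv[OF Q.dual_typing(1,2,1)] by simp
  also have "\<dots> = FArr F (LUnit A Q.X) \<bullet> FArr F (Counit Q \<otimes>\<^bsub>A\<^esub> Ident A Q.X) \<bullet> FArr F (inv_arrow A (Assoc A Q.X Q.Y Q.X)) \<bullet> FArr F (Ident A Q.X \<otimes>\<^bsub>A\<^esub> UnitA Q) \<bullet> (FMult F Q.X IA \<bullet> (iF Q.X \<otimes>\<otimes> FUnit F) \<bullet> inv_arrow V (RUnit V ?FX))"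
    unfolding unit_step'[OF Q.dual_typing(1)] by simp
  also have "\<dots> = FArr F (LUnit A Q.X \<cdot>\<^bsub>A\<^esub> (Counit Q \<otimes>\<^bsub>A\<^esub> Ident A Q.X) \<cdot>\<^bsub>A\<^esub> inv_arrow A (Assoc A Q.X Q.Y Q.X) \<cdot>\<^bsub>A\<^esub> (Ident A Q.X \<otimes>\<^bsub>A\<^esub> UnitA Q) \<cdot>\<^bsub>A\<^esub> inv_arrow A (RUnit A Q.X))"
    unfolding F_runit_inv[OF Q.dual_typing(1)] by simp
  also have "\<dots> = iF Q.X" unfolding Q.dual_zigzag by simp
  finally have 1: "LUnit V ?FX \<bullet> (Counit PF \<otimes>\<otimes> iF Q.X) \<bullet> inv_arrow V (Assoc V ?FX ?FY ?FX) \<bullet> (iF Q.X \<otimes>\<otimes> UnitA PF) \<bullet> inv_arrow V (RUnit V ?FX) = iF Q.X" .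
  have "RUnit V ?FY \<bullet> (iF Q.Y \<otimes>\<otimes> Counit PF) \<bullet> Assoc V ?FY ?FX ?FY \<bullet> (UnitA PF \<otimes>\<otimes> iF Q.Y) \<bullet> inv_arrow V (LUnit V ?FY)
    = FArr F (RUnit A Q.Y) \<bullet> (FMult F Q.Y IA \<bullet> (iF Q.Y \<otimes>\<otimes> FUnit F) \<bullet> (iF Q.Y \<otimes>\<otimes> Counit PF)) \<bullet> Assoc V ?FY ?FX ?FY \<bullet> (UnitA PF \<otimes>\<otimes> iF Q.Y) \<bullet> inv_arrow V (LUnit V ?FY)"
    unfolding F_runit[OF Q.dual_typing(2), symmetric] by simp
  also have "\<dots> = FArr F (RUnit A Q.Y) \<bullet> FArr F (Ident A Q.Y \<otimes>\<^bsub>A\<^esub> Counit Q) \<bullet> (FMult F Q.Y (Q.X \<odot>\<^bsub>A\<^esub> Q.Y) \<bullet> (iF Q.Y \<otimes>\<otimes> FMult F Q.X Q.Y) \<bullet> Assoc V ?FY ?FX ?FY) \<bullet> (UnitA PF \<otimes>\<otimes> iF Q.Y) \<bullet> inv_arrow V (LUnit V ?FY)"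
    unfolding counit_step'[OF Q.dual_typing(2)] by simp
  also have "\<dots> = FArr F (RUnit A Q.Y) \<bullet> FArr F (Ident A Q.Y \<otimes>\<^bsub>A\<^esub> Counit Q) \<bullet> FArr F (Assoc A Q.Y Q.X Q.Y) \<bullet> (FMult F (Q.Y \<odot>\<^bsub>A\<^esub> Q.X) Q.Y \<bullet> (FMult F Q.Y Q.X \<otimes>\<otimes> iF Q.Y) \<bullet> (UnitA PF \<otimes>\<otimes> iF Q.Y)) \<bullet> inv_arrow V (LUnit V ?FY)"
    unfolding F_assoc[OF Q.dual_typing(2,1,2), symmetric] by simp
  also have "\<dots> = FArr F (RUnit A Q.Y) \<bullet> FArr F (Ident A Q.Y \<otimes>\<^bsub>A\<^esub> Counit Q) \<bullet> FArr F (Assoc A Q.Y Q.X Q.Y) \<bullet> FArr F (UnitA Q \<otimes>\<^bsub>A\<^esub> Ident A Q.Y) \<bullet> (FMult F IA Q.Y \<bullet> (FUnit F \<otimes>\<otimes> iF Q.Y) \<bullet> inv_arrow V (LUnit V ?FY))"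
    unfolding unit_step[OF Q.dual_typing(2)] by simp
  also have "\<dots> = FArr F (RUnit A Q.Y \<cdot>\<^bsub>A\<^esub> (Ident A Q.Y \<otimes>\<^bsub>A\<^esub> Counit Q) \<cdot>\<^bsub>A\<^esub> Assoc A Q.Y Q.X Q.Y \<cdot>\<^bsub>A\<^esub> (UnitA Q \<otimes>\<^bsub>A\<^esub> Ident A Q.Y) \<cdot>\<^bsub>A\<^esub> inv_arrow A (LUnit A Q.Y))"
    unfolding F_lunit_inv[OF Q.dual_typing(2)] by simp
  also have "\<dots> = iF Q.Y" unfolding Q.dual_zigzag by simp
  finally have 2: "RUnit V ?FY \<bullet> (iF Q.Y \<otimes>\<otimes> Counit PF) \<bullet> Assoc V ?FY ?FX ?FY \<bullet> (UnitA PF \<otimes>\<otimes> iF Q.Y) \<bullet> inv_arrow V (LUnit V ?FY) = iF Q.Y" .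
  show ?thesis
    unfolding dual_pair_def Let_def PF_simps(1,2)
    using 1 2 by simp
qed

sublocale M: dual_pair_in V "image_dpair A V Q F"
  by unfold_locales (rule dual_pair_image)

text \<open>With \<open>cv_image\<close>, this is the compatibility required of comparison maps in
  the case where the map of dual pairs is an identity.\<close>

lemma ev_image:
  assumes "x \<in> Obj A"
  shows "FArr F (Q.evm x) \<bullet> FMult F Q.X (Q.Y \<odot>\<^bsub>A\<^esub> x) \<bullet> (iF Q.X \<otimes>\<otimes> FMult F Q.Y x) = M.evm (FObj F x)"
proof -
  note [simp del] = PF_simps(3,4)
  let ?a = "inv_arrow V (Assoc V (FObj F Q.X) (FObj F Q.Y) (FObj F x))"
  have "FArr F (Q.evm x) \<bullet> FMult F Q.X (Q.Y \<odot>\<^bsub>A\<^esub> x) \<bullet> (iF Q.X \<otimes>\<otimes> FMult F Q.Y x)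
    = FArr F (LUnit A x) \<bullet> FArr F (Counit Q \<otimes>\<^bsub>A\<^esub> Ident A x) \<bullet> (FArr F (inv_arrow A (Assoc A Q.X Q.Y x)) \<bullet> FMult F Q.X (Q.Y \<odot>\<^bsub>A\<^esub> x) \<bullet> (iF Q.X \<otimes>\<otimes> FMult F Q.Y x))"
    using assms by (simp add: Q.evm_def)
  also have "\<dots> = FArr F (LUnit A x) \<bullet> (FArr F (Counit Q \<otimes>\<^bsub>A\<^esub> Ident A x) \<bullet> FMult F (Q.X \<odot>\<^bsub>A\<^esub> Q.Y) x \<bullet> (FMult F Q.X Q.Y \<otimes>\<otimes> iF x)) \<bullet> ?a"
    unfolding F_assoc_inv[OF Q.dual_typing(1,2) assms, symmetric] using assms by simp
  also have "\<dots> = (FArr F (LUnit A x) \<bullet> FMult F IA x \<bullet> (FUnit F \<otimes>\<otimes> iF x)) \<bullet> (Counit PF \<otimes>\<otimes> iF x) \<bullet> ?a"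
    unfolding counit_step[OF assms, symmetric] using assms by simp
  also have "\<dots> = M.evm (FObj F x)"
    unfolding F_lunit[OF assms] using assms by (simp add: M.evm_def)
  finally show ?thesis .
qed

lemma cv_image:
  assumes "x \<in> Obj A"
  shows "FMult F Q.Y (Q.X \<odot>\<^bsub>A\<^esub> x) \<bullet> (iF Q.Y \<otimes>\<otimes> FMult F Q.X x) \<bullet> M.cvm (FObj F x) = FArr F (Q.cvm x)"
proof -
  note [simp del] = PF_simps(3,4)
  let ?l = "inv_arrow V (LUnit V (FObj F x))"
  have "FMult F Q.Y (Q.X \<odot>\<^bsub>A\<^esub> x) \<bullet> (iF Q.Y \<otimes>\<otimes> FMult F Q.X x) \<bullet> M.cvm (FObj F x)
    = (FMult F Q.Y (Q.X \<odot>\<^bsub>A\<^esub> x) \<bullet> (iF Q.Y \<otimes>\<otimes> FMult F Q.X x) \<bullet> Assoc V (FObj F Q.Y) (FObj F Q.X) (FObj F x)) \<bullet> (UnitA PF \<otimes>\<otimes> iF x) \<bullet> ?l"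
    using assms by (simp add: M.cvm_def)
  also have "\<dots> = FArr F (Assoc A Q.Y Q.X x) \<bullet> (FMult F (Q.Y \<odot>\<^bsub>A\<^esub> Q.X) x \<bullet> (FMult F Q.Y Q.X \<otimes>\<otimes> iF x) \<bullet> (UnitA PF \<otimes>\<otimes> iF x)) \<bullet> ?l"
    unfolding F_assoc[OF Q.dual_typing(2,1) assms, symmetric] using assms by simp
  also have "\<dots> = FArr F (Assoc A Q.Y Q.X x) \<bullet> FArr F (UnitA Q \<otimes>\<^bsub>A\<^esub> Ident A x) \<bullet> (FMult F IA x \<bullet> (FUnit F \<otimes>\<otimes> iF x) \<bullet> ?l)"
    unfolding unit_step[OF assms] using assms by simp
  also have "\<dots> = FArr F (Q.cvm x)"
    unfolding F_lunit_inv[OF assms] using assms by (simp add: Q.cvm_def)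
  finally show ?thesis .
qed

end

text \<open>An isomorphism from \<open>P\<close> to the image of \<open>Q\<close> in covariant form:
  \<open>t True\<close> points in the same direction as \<open>t False\<close>, opposite to the
  right component of a morphism of dual pairs.\<close>

locale pair_map = functor_dual A V F Q + P: dual_pair_in V P
  for A :: "('o, 'm) moncat" and V :: "('p, 'n) moncat" and F :: "('o, 'm, 'p, 'n) monfunc" and Q :: "('o, 'm) dpair"
    and P :: "('p, 'n) dpair" +
  fixes t :: "bool \<Rightarrow> 'n"
  assumes t_iso [simp]: "iso_arrow V (t s)" and t_typing [simp]: "Dom V (t s) = P.ob s" "Cod V (t s) = FObj F (Q.ob s)"
    and t_counit: "Counit (image_dpair A V Q F) \<bullet> (t False \<otimes>\<otimes> t True) = Counit P"
begin

lemma t_Arr [simp]: "t s \<in> Arr V"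
  by (rule V.iso_Arr) simp

definition compare :: "bool \<Rightarrow> 'o \<Rightarrow> 'n" where
  "compare s x = FMult F (Q.ob s) x \<bullet> (t s \<otimes>\<otimes> iF x)"

lemma compare_props: "x \<in> Obj A \<Longrightarrow> compare s x \<in> Arr V" "x \<in> Obj A \<Longrightarrow> Dom V (compare s x) = P.ob s \<odot>\<^bsub>V\<^esub> FObj F x"
  "x \<in> Obj A \<Longrightarrow> Cod V (compare s x) = FObj F (Q.ob s \<odot>\<^bsub>A\<^esub> x)" "x \<in> Obj A \<Longrightarrow> iso_arrow V (compare s x)"
  by (auto simp: compare_def intro!: V.iso_Cmp)

lemma transport:
  assumes "z \<in> Obj V"
  shows "M.evm z \<bullet> (t False \<otimes>\<otimes> (t True \<otimes>\<otimes> Ident V z)) = P.evm z"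
    "(t True \<otimes>\<otimes> (t False \<otimes>\<otimes> Ident V z)) \<bullet> P.cvm z = M.cvm z"
  using V.dual_pair_transport[OF P.dual M.dual t_iso[of False] _ _ t_Arr[of True] _ _ t_counit assms] by simp_all

lemma compare_step:
  assumes "x \<in> Obj A"
  shows "compare s (Q.ob s' \<odot>\<^bsub>A\<^esub> x) \<bullet> (Ident V (P.ob s) \<otimes>\<otimes> compare s' x) =
    FMult F (Q.ob s) (Q.ob s' \<odot>\<^bsub>A\<^esub> x) \<bullet> (iF (Q.ob s) \<otimes>\<otimes> FMult F (Q.ob s') x) \<bullet> (t s \<otimes>\<otimes> (t s' \<otimes>\<otimes> iF x))"
proof -
  have "(t s \<otimes>\<otimes> iF (Q.ob s' \<odot>\<^bsub>A\<^esub> x)) \<bullet> (Ident V (P.ob s) \<otimes>\<otimes> compare s' x) = (iF (Q.ob s) \<otimes>\<otimes> FMult F (Q.ob s') x) \<bullet> (t s \<otimes>\<otimes> (t s' \<otimes>\<otimes> iF x))"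
    using assms by (simp add: compare_def V.interchange del: V.whisker_left P.TA_Cmp M.TA_Cmp)
  then show ?thesis using assms compare_props by (simp add: compare_def[of s] del: V.whisker_left P.TA_Cmp M.TA_Cmp)
qed

sublocale action_morphism A "\<lambda>s z. Q.ob s \<odot>\<^bsub>A\<^esub> z" "\<lambda>s f. Ident A (Q.ob s) \<otimes>\<^bsub>A\<^esub> f" Q.evm Q.cvm
  V "\<lambda>s z. P.ob s \<odot>\<^bsub>V\<^esub> z" "\<lambda>s f. Ident V (P.ob s) \<otimes>\<^bsub>V\<^esub> f" P.evm P.cvm F compare
proof unfold_locales
  show "FArr F (Ident A (Q.ob s) \<otimes>\<^bsub>A\<^esub> f) \<bullet> compare s (Dom A f) = compare s (Cod A f) \<bullet> (Ident V (P.ob s) \<otimes>\<otimes> FArr F f)"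
    if f: "f \<in> Arr A" for f s
  proof -
    have 1: "FArr F (Ident A (Q.ob s) \<otimes>\<^bsub>A\<^esub> f) \<bullet> FMult F (Q.ob s) (Dom A f) = FMult F (Q.ob s) (Cod A f) \<bullet> (iF (Q.ob s) \<otimes>\<otimes> FArr F f)"
      using FMult_nat[of "Ident A (Q.ob s)" f] f by simp
    have 2: "(iF (Q.ob s) \<otimes>\<otimes> FArr F f) \<bullet> (t s \<otimes>\<otimes> iF (Dom A f)) = (t s \<otimes>\<otimes> iF (Cod A f)) \<bullet> (Ident V (P.ob s) \<otimes>\<otimes> FArr F f)"
      using f by (simp add: V.interchange)
    show ?thesis using f by (simp add: compare_def V.Cmp_rotate[OF 1] 2)
  qed
  show "FArr F (Q.evm x) \<bullet> compare False (Q.ob True \<odot>\<^bsub>A\<^esub> x) \<bullet> (Ident V (P.ob False) \<otimes>\<otimes> compare True x) = P.evm (FObj F x)" if x: "x \<in> Obj A" for x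
  proof -
    have "FArr F (Q.evm x) \<bullet> compare False (Q.ob True \<odot>\<^bsub>A\<^esub> x) \<bullet> (Ident V (P.ob False) \<otimes>\<otimes> compare True x)
      = (FArr F (Q.evm x) \<bullet> FMult F Q.X (Q.Y \<odot>\<^bsub>A\<^esub> x) \<bullet> (iF Q.X \<otimes>\<otimes> FMult F Q.Y x)) \<bullet> (t False \<otimes>\<otimes> (t True \<otimes>\<otimes> iF x))"
      unfolding compare_step[OF x] using x by simp
    then show ?thesis unfolding ev_image[OF x] using transport(1)[of "FObj F x"] x by simp
  qed
  show "compare True (Q.ob False \<odot>\<^bsub>A\<^esub> x) \<bullet> (Ident V (P.ob True) \<otimes>\<otimes> compare False x) \<bullet> P.cvm (FObj F x) = FArr F (Q.cvm x)" if x: "x \<in> Obj A" for x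
  proof -
    have "compare True (Q.ob False \<odot>\<^bsub>A\<^esub> x) \<bullet> (Ident V (P.ob True) \<otimes>\<otimes> compare False x) \<bullet> P.cvm (FObj F x)
      = (compare True (Q.ob False \<odot>\<^bsub>A\<^esub> x) \<bullet> (Ident V (P.ob True) \<otimes>\<otimes> compare False x)) \<bullet> P.cvm (FObj F x)"
      using x compare_props by simp
    also have "\<dots> = FMult F Q.Y (Q.X \<odot>\<^bsub>A\<^esub> x) \<bullet> (iF Q.Y \<otimes>\<otimes> FMult F Q.X x) \<bullet> ((t True \<otimes>\<otimes> (t False \<otimes>\<otimes> iF x)) \<bullet> P.cvm (FObj F x))"
      unfolding compare_step[OF x] using x by simp
    finally show ?thesis unfolding transport(2)[OF F_simps(1)[OF x]] using cv_image[OF x] by simp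
  qed
qed (use compare_props in auto)

lemma word_compare_iso [simp]: "x \<in> Obj A \<Longrightarrow> iso_arrow V (word_compare w x)"
proof (induction w)
  case (Cons s w)
  then show ?case using compare_props by (auto intro!: V.iso_Cmp)
qed simp

text \<open>Prepares the monoidality of the comparison: moving a right factor into a word commutes
  with comparing. The induction step is \<open>F_assoc\<close> for one letter.\<close>

lemma word_compare_regroup:
  assumes "z \<in> Obj A" "u \<in> Obj A"
  shows "FArr F (Q.regroup w z u) \<bullet> FMult F (Q.WO w z) u \<bullet> (word_compare w z \<otimes>\<otimes> iF u)
    = word_compare w (z \<odot>\<^bsub>A\<^esub> u) \<bullet> P.WA w (FMult F z u) \<bullet> P.regroup w (FObj F z) (FObj F u)"
proof (induction w)
  case (Cons s w)
  let ?W = "Q.WO w z" and ?s = "Q.ob s"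
  let ?av = "Assoc V (P.ob s) (P.WO w (FObj F z)) (FObj F u)"
  have k: "word_compare (s # w) z = FMult F ?s ?W \<bullet> (t s \<otimes>\<otimes> word_compare w z)"
    using assms compare_props by (simp add: compare_def V.interchange del: V.whisker_left V.whisker_right P.TA_Cmp M.TA_Cmp)
  have k': "word_compare (s # w) (z \<odot>\<^bsub>A\<^esub> u) = FMult F ?s (Q.WO w (z \<odot>\<^bsub>A\<^esub> u)) \<bullet> (t s \<otimes>\<otimes> word_compare w (z \<odot>\<^bsub>A\<^esub> u))"
    using assms compare_props by (simp add: compare_def V.interchange del: V.whisker_left V.whisker_right P.TA_Cmp M.TA_Cmp)
  have 1: "FArr F (Assoc A ?s ?W u) \<bullet> FMult F (?s \<odot>\<^bsub>A\<^esub> ?W) u \<bullet> (FMult F ?s ?W \<otimes>\<otimes> iF u) =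
    FMult F ?s (?W \<odot>\<^bsub>A\<^esub> u) \<bullet> (iF ?s \<otimes>\<otimes> FMult F ?W u) \<bullet> Assoc V (FObj F ?s) (FObj F ?W) (FObj F u)"
    by (rule F_assoc) (use assms in auto)
  have 2: "Assoc V (FObj F ?s) (FObj F ?W) (FObj F u) \<bullet> ((t s \<otimes>\<otimes> word_compare w z) \<otimes>\<otimes> iF u) = (t s \<otimes>\<otimes> (word_compare w z \<otimes>\<otimes> iF u)) \<bullet> ?av"
    using V.Assoc_nat[of "t s" "word_compare w z" "iF u"] assms by simp
  have 3: "FArr F (Ident A ?s \<otimes>\<^bsub>A\<^esub> Q.regroup w z u) \<bullet> FMult F ?s (?W \<odot>\<^bsub>A\<^esub> u) = FMult F ?s (Q.WO w (z \<odot>\<^bsub>A\<^esub> u)) \<bullet> (iF ?s \<otimes>\<otimes> FArr F (Q.regroup w z u))"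
    using FMult_nat[of "Ident A ?s" "Q.regroup w z u"] assms by simp
  have "FArr F (Q.regroup (s # w) z u) \<bullet> FMult F (Q.WO (s # w) z) u \<bullet> (word_compare (s # w) z \<otimes>\<otimes> iF u)
    = FArr F (Ident A ?s \<otimes>\<^bsub>A\<^esub> Q.regroup w z u) \<bullet> (FArr F (Assoc A ?s ?W u) \<bullet> FMult F (?s \<odot>\<^bsub>A\<^esub> ?W) u \<bullet> (FMult F ?s ?W \<otimes>\<otimes> iF u)) \<bullet> ((t s \<otimes>\<otimes> word_compare w z) \<otimes>\<otimes> iF u)"
    unfolding k using assms by simp
  also have "\<dots> = FMult F ?s (Q.WO w (z \<odot>\<^bsub>A\<^esub> u)) \<bullet> ((iF ?s \<otimes>\<otimes> FArr F (Q.regroup w z u)) \<bullet> (iF ?s \<otimes>\<otimes> FMult F ?W u) \<bullet> (t s \<otimes>\<otimes> (word_compare w z \<otimes>\<otimes> iF u))) \<bullet> ?av"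
    unfolding 1 using assms by (simp add: 2 V.Cmp_rotate[OF 3])
  also have "(iF ?s \<otimes>\<otimes> FArr F (Q.regroup w z u)) \<bullet> (iF ?s \<otimes>\<otimes> FMult F ?W u) \<bullet> (t s \<otimes>\<otimes> (word_compare w z \<otimes>\<otimes> iF u))
      = t s \<otimes>\<otimes> (FArr F (Q.regroup w z u) \<bullet> FMult F ?W u \<bullet> (word_compare w z \<otimes>\<otimes> iF u))"
    using assms by (simp add: V.interchange del: V.whisker_left V.whisker_right P.TA_Cmp M.TA_Cmp)
  also have "\<dots> = (t s \<otimes>\<otimes> word_compare w (z \<odot>\<^bsub>A\<^esub> u)) \<bullet> (Ident V (P.ob s) \<otimes>\<otimes> P.WA w (FMult F z u)) \<bullet> (Ident V (P.ob s) \<otimes>\<otimes> P.regroup w (FObj F z) (FObj F u))"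
    unfolding Cons.IH using assms by (simp add: V.interchange del: V.whisker_left V.whisker_right P.TA_Cmp M.TA_Cmp)
  finally show ?case unfolding k' using assms by simp
qed (use assms in simp)

text \<open>\<open>word_compare\<close> starts from \<open>FObj F IA\<close>; the factor
  \<open>FUnit F\<close> makes it start from the unit of \<open>V\<close>, where diagrams are
  evaluated.\<close>

definition unit_compare :: "bool list \<Rightarrow> 'n" where
  "unit_compare w = word_compare w IA \<bullet> P.WA w (FUnit F)"

lemma unit_compare_typing [simp]: "unit_compare w \<in> Arr V" "Dom V (unit_compare w) = P.WO w (UnitO V)" "Cod V (unit_compare w) = FObj F (Q.WO w IA)"
  "iso_arrow V (unit_compare w)"
  by (auto simp: unit_compare_def intro!: V.iso_Cmp)

lemma unit_compare_Phi: "FArr F (Q.Phi D IA) \<bullet> unit_compare (lower D) = unit_compare (upper D) \<bullet> P.Phi D (UnitO V)"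
proof -
  have 1: "FArr F (Q.Phi D IA) \<bullet> word_compare (lower D) IA = word_compare (upper D) IA \<bullet> P.Phi D (FObj F IA)"
    by (rule word_compare_Phi) simp
  have 2: "P.WA (upper D) (FUnit F) \<bullet> P.Phi D (UnitO V) = P.Phi D (FObj F IA) \<bullet> P.WA (lower D) (FUnit F)"
    using P.Phi_natural[of "FUnit F" D] by simp
  show ?thesis by (simp add: unit_compare_def V.Cmp_rotate[OF 1] 2)
qed

text \<open>\<open>word_compare_regroup\<close> treats the left word, and \<open>F_lunit\<close>
  absorbs the unit object between the two words. The result is the monoidality of the comparison
  with the free functor.\<close>

lemma unit_compare_word_mult:
  "FArr F (Q.word_mult w v) \<bullet> FMult F (Q.WO w IA) (Q.WO v IA) \<bullet> (unit_compare w \<otimes>\<otimes> unit_compare v) = unit_compare (w @ v) \<bullet> P.word_mult w v"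
proof -
  let ?v = "Q.WO v IA" and ?I = "UnitO V"
  let ?pv = "P.WO v ?I"
  have 1: "FArr F (Q.regroup w IA ?v) \<bullet> FMult F (Q.WO w IA) ?v \<bullet> (word_compare w IA \<otimes>\<otimes> iF ?v)
    = word_compare w (IA \<odot>\<^bsub>A\<^esub> ?v) \<bullet> P.WA w (FMult F IA ?v) \<bullet> P.regroup w (FObj F IA) (FObj F ?v)"
    by (rule word_compare_regroup) auto
  have 2: "FArr F (Q.WA w (LUnit A ?v)) \<bullet> word_compare w (IA \<odot>\<^bsub>A\<^esub> ?v) = word_compare w ?v \<bullet> P.WA w (FArr F (LUnit A ?v))"
    using word_compare_natural[of "LUnit A ?v" w] by simp
  have 3: "P.regroup w (FObj F IA) (FObj F ?v) \<bullet> (P.WA w (FUnit F) \<otimes>\<otimes> unit_compare v) = P.WA w (FUnit F \<otimes>\<otimes> unit_compare v) \<bullet> P.regroup w ?I ?pv"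
    using P.regroup_natural[of "FUnit F" "unit_compare v" w] by simp
  have 4: "FArr F (LUnit A ?v) \<bullet> FMult F IA ?v \<bullet> (FUnit F \<otimes>\<otimes> unit_compare v) = unit_compare v \<bullet> LUnit V ?pv"
  proof -
    have "FUnit F \<otimes>\<otimes> unit_compare v = (FUnit F \<otimes>\<otimes> iF ?v) \<bullet> (Ident V ?I \<otimes>\<otimes> unit_compare v)" by (simp add: V.interchange del: V.whisker_left V.whisker_right P.TA_Cmp M.TA_Cmp)
    then have "FArr F (LUnit A ?v) \<bullet> FMult F IA ?v \<bullet> (FUnit F \<otimes>\<otimes> unit_compare v)
      = (FArr F (LUnit A ?v) \<bullet> FMult F IA ?v \<bullet> (FUnit F \<otimes>\<otimes> iF ?v)) \<bullet> (Ident V ?I \<otimes>\<otimes> unit_compare v)" by simp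
    then show ?thesis using F_lunit[of ?v] V.LUnit_nat[of "unit_compare v"] by simp
  qed
  have 5: "P.WA w (FArr F (LUnit A ?v)) \<bullet> P.WA w (FMult F IA ?v) \<bullet> P.WA w (FUnit F \<otimes>\<otimes> unit_compare v) = P.WA w (unit_compare v) \<bullet> P.WA w (LUnit V ?pv)"
    using arg_cong[OF 4, of "P.WA w"] by simp
  have "unit_compare w \<otimes>\<otimes> unit_compare v = (word_compare w IA \<otimes>\<otimes> iF ?v) \<bullet> (P.WA w (FUnit F) \<otimes>\<otimes> unit_compare v)"
    by (simp add: V.interchange unit_compare_def[of w] del: V.whisker_left V.whisker_right P.TA_Cmp M.TA_Cmp)
  then have "FArr F (Q.word_mult w v) \<bullet> FMult F (Q.WO w IA) ?v \<bullet> (unit_compare w \<otimes>\<otimes> unit_compare v)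
    = FArr F (Q.WA w (LUnit A ?v)) \<bullet> (FArr F (Q.regroup w IA ?v) \<bullet> FMult F (Q.WO w IA) ?v \<bullet> (word_compare w IA \<otimes>\<otimes> iF ?v)) \<bullet> (P.WA w (FUnit F) \<otimes>\<otimes> unit_compare v)"
    by (simp add: Q.word_mult_def)
  also have "\<dots> = word_compare w ?v \<bullet> (P.WA w (FArr F (LUnit A ?v)) \<bullet> P.WA w (FMult F IA ?v) \<bullet> P.WA w (FUnit F \<otimes>\<otimes> unit_compare v)) \<bullet> P.regroup w ?I ?pv"
    unfolding 1 by (simp add: V.Cmp_rotate[OF 2] 3)
  also have "\<dots> = unit_compare (w @ v) \<bullet> P.word_mult w v"
    unfolding 5 by (simp add: unit_compare_def P.word_mult_def word_compare_append)
  finally show ?thesis .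
qed

text \<open>Recovers the given map of dual pairs from the comparison, up to right unit
  constraints.\<close>

lemma unit_compare_single: "FArr F (RUnit A (Q.ob s)) \<bullet> unit_compare [s] = t s \<bullet> RUnit V (P.ob s)"
proof -
  have k: "unit_compare [s] = FMult F (Q.ob s) IA \<bullet> (iF (Q.ob s) \<otimes>\<otimes> FUnit F) \<bullet> (t s \<otimes>\<otimes> Ident V (UnitO V))"
    by (simp add: unit_compare_def compare_def V.interchange del: V.whisker_left V.whisker_right P.TA_Cmp M.TA_Cmp)
  have "FArr F (RUnit A (Q.ob s)) \<bullet> unit_compare [s] = (FArr F (RUnit A (Q.ob s)) \<bullet> FMult F (Q.ob s) IA \<bullet> (iF (Q.ob s) \<otimes>\<otimes> FUnit F)) \<bullet> (t s \<otimes>\<otimes> Ident V (UnitO V))"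
    unfolding k by simp
  then show ?thesis using F_runit[of "Q.ob s"] V.RUnit_nat[of "t s"] by simp
qed

end

section \<open>Comparison of functors on Dpr with the free one\<close>

lemma monoidal_nat_isoD:
  assumes "monoidal_nat_iso A V F G \<sigma>" "strong_monoidal_functor A V F" "strong_monoidal_functor A V G"
  shows "x \<in> Obj A \<Longrightarrow> \<sigma> x \<in> Arr V" "x \<in> Obj A \<Longrightarrow> Dom V (\<sigma> x) = FObj F x" "x \<in> Obj A \<Longrightarrow> Cod V (\<sigma> x) = FObj G x"
    "x \<in> Obj A \<Longrightarrow> iso_arrow V (\<sigma> x)" "\<sigma> \<in> extensional (Obj A)"
    "f \<in> Arr A \<Longrightarrow> \<sigma> (Cod A f) \<cdot>\<^bsub>V\<^esub> FArr F f = FArr G f \<cdot>\<^bsub>V\<^esub> \<sigma> (Dom A f)"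
    "x \<in> Obj A \<Longrightarrow> y \<in> Obj A \<Longrightarrow> \<sigma> (x \<odot>\<^bsub>A\<^esub> y) \<cdot>\<^bsub>V\<^esub> FMult F x y = FMult G x y \<cdot>\<^bsub>V\<^esub> (\<sigma> x \<otimes>\<^bsub>V\<^esub> \<sigma> y)"
    "\<sigma> (UnitO A) \<cdot>\<^bsub>V\<^esub> FUnit F = FUnit G"
proof -
  interpret F: strong_monoidal_functor A V F by fact
  interpret G: strong_monoidal_functor A V G by fact
  show "f \<in> Arr A \<Longrightarrow> \<sigma> (Cod A f) \<cdot>\<^bsub>V\<^esub> FArr F f = FArr G f \<cdot>\<^bsub>V\<^esub> \<sigma> (Dom A f)"
    using assms(1) F.A.Dom_in F.A.Cod_in unfolding monoidal_nat_iso_def nat_iso_def nat_trans_def by auto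
qed (use assms(1) in \<open>auto simp: monoidal_nat_iso_def nat_iso_def nat_trans_def Hom_def\<close>)

lemma monoidal_nat_isoI:
  assumes "category A" "\<And>x. x \<in> Obj A \<Longrightarrow> \<sigma> x \<in> Hom V (FObj F x) (FObj G x)" "\<And>x. x \<in> Obj A \<Longrightarrow> iso_arrow V (\<sigma> x)"
    "\<sigma> \<in> extensional (Obj A)"
    "\<And>f. f \<in> Arr A \<Longrightarrow> \<sigma> (Cod A f) \<cdot>\<^bsub>V\<^esub> FArr F f = FArr G f \<cdot>\<^bsub>V\<^esub> \<sigma> (Dom A f)"
    "\<And>x y. x \<in> Obj A \<Longrightarrow> y \<in> Obj A \<Longrightarrow> \<sigma> (x \<odot>\<^bsub>A\<^esub> y) \<cdot>\<^bsub>V\<^esub> FMult F x y = FMult G x y \<cdot>\<^bsub>V\<^esub> (\<sigma> x \<otimes>\<^bsub>V\<^esub> \<sigma> y)"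
    "\<sigma> (UnitO A) \<cdot>\<^bsub>V\<^esub> FUnit F = FUnit G"
  shows "monoidal_nat_iso A V F G \<sigma>"
  unfolding monoidal_nat_iso_def nat_iso_def nat_trans_def
  using assms by (auto simp: Hom_def)

text \<open>Objects are arbitrary finite sets of numbers, while words of signs produce only standard
  ones. The identity diagram read between the two is the canonical isomorphism.\<close>

definition from_word :: "dpr_obj \<Rightarrow> dpr_arr" where
  "from_word X = dpr_arrow (W.WO (sign_word X) ({}, {})) (diag_ident (sign_word X)) X"

lemma from_word:
  assumes "X \<in> dpr_Obj"
  shows "diag_between (W.WO (sign_word X) ({}, {})) (diag_ident (sign_word X)) X" "from_word X \<in> dpr_Arr" "fst (from_word X) = W.WO (sign_word X) ({}, {})"
    "snd (snd (from_word X)) = X" "iso_arrow Dpr (from_word X)"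
proof -
  let ?W = "W.WO (sign_word X) ({}, {})"
  have o: "?W \<in> dpr_Obj" "sign_word ?W = sign_word X" using W_WO[of "({}, {})"] by simp_all
  show b: "diag_between ?W (diag_ident (sign_word X)) X" using o assms by unfold_locales auto
  have b': "diag_between X (diag_ident (sign_word X)) ?W" using o assms by unfold_locales auto
  show "from_word X \<in> dpr_Arr" unfolding from_word_def by (rule dpr_arrow_in[OF b])
  show s: "fst (from_word X) = ?W" "snd (snd (from_word X)) = X" by (simp_all add: from_word_def)
  have "dpr_Cmp (dpr_arrow X (diag_ident (sign_word X)) ?W) (dpr_arrow ?W (diag_ident (sign_word X)) X) = dpr_arrow ?W (diag_ident (sign_word ?W)) ?W"
    by (rule diag_cmp[OF b b' diag_between_diag_ident[OF o(1)]]) simp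
  moreover have "dpr_Cmp (dpr_arrow ?W (diag_ident (sign_word X)) X) (dpr_arrow X (diag_ident (sign_word X)) ?W) = dpr_arrow X (diag_ident (sign_word X)) X"
    by (rule diag_cmp[OF b' b diag_between_diag_ident[OF assms]]) simp
  ultimately have "inverse_arrows Dpr (from_word X) (dpr_arrow X (diag_ident (sign_word X)) ?W)"
    using dpr_arrow_in[OF b] dpr_arrow_in[OF b'] o assms
    by (simp add: inverse_arrows_def Hom_def from_word_def Ident_dpr_arrow)
  then show "iso_arrow Dpr (from_word X)" unfolding iso_arrow_def by blast
qed

text \<open>Both composites are the diagram \<open>D\<close> read from the standard object to
  \<open>Y\<close>.\<close>

lemma from_word_natural:
  assumes "diag_between X D Y"
  shows "dpr_Cmp (dpr_arrow X D Y) (from_word X) = dpr_Cmp (from_word Y) (W.Phi D ({}, {}))"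
proof -
  have o: "X \<in> dpr_Obj" "Y \<in> dpr_Obj" "sign_word X = lower D" "sign_word Y = upper D" using assms by (auto simp: diag_between_def)
  let ?W = "W.WO (lower D) ({}, {})"
  have bx: "diag_between ?W (diag_ident (lower D)) X" and bY: "diag_between (W.WO (upper D) ({}, {})) (diag_ident (upper D)) Y"
    using from_word(1)[OF o(1)] from_word(1)[OF o(2)] o by simp_all
  have b: "diag_between ?W D Y" using W_WO[of "({}, {})" "lower D"] o by (simp add: diag_between_def)
  have "dpr_Cmp (dpr_arrow X D Y) (dpr_arrow ?W (diag_ident (lower D)) X) = dpr_arrow ?W D Y"
    by (rule diag_cmp[OF bx assms b]) simp
  moreover have "dpr_Cmp (dpr_arrow (W.WO (upper D) ({}, {})) (diag_ident (upper D)) Y) (W.Phi D ({}, {})) = dpr_arrow ?W D Y"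
    unfolding W_Phi(1) by (rule diag_cmp[OF W_Phi(2) bY b]) simp
  ultimately show ?thesis by (simp add: from_word_def o)
qed

lemma from_word_TensA:
  assumes "X \<in> dpr_Obj" "Y \<in> dpr_Obj"
  shows "dpr_TensA (from_word X) (from_word Y) = from_word (dpr_TensO X Y)"
    "dpr_TensO (W.WO (sign_word X) ({}, {})) (W.WO (sign_word Y) ({}, {})) = W.WO (sign_word X @ sign_word Y) ({}, {})"
proof -
  show e: "dpr_TensO (W.WO (sign_word X) ({}, {})) (W.WO (sign_word Y) ({}, {})) = W.WO (sign_word X @ sign_word Y) ({}, {})"
    using W_WO_append[of "W.WO (sign_word Y) ({}, {})" "sign_word X"] W_WO[of "({}, {})"] by simp
  show "dpr_TensA (from_word X) (from_word Y) = from_word (dpr_TensO X Y)"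
    unfolding from_word_def TensA_dpr_arrow[OF from_word(1)[OF assms(1)] from_word(1)[OF assms(2)]] e
    using assms by (simp add: diag_ident_append TensO_points)
qed

lemma from_word_special: "from_word ({}, {}) = dpr_Ident ({}, {})" "from_word dpr_minus = dpr_Ident dpr_minus"
  "from_word dpr_plus = dpr_Ident dpr_plus"
  by (simp_all add: from_word_def Ident_dpr_arrow)

lemma W_word_mult: "W.word_mult w v = dpr_Ident (W.WO (w @ v) ({}, {}))"
proof -
  have o: "W.WO (w @ v) ({}, {}) \<in> dpr_Obj" "W.WO v ({}, {}) \<in> dpr_Obj" by (simp_all add: W_WO)
  have "W.WA w (dpr_Ident (W.WO v ({}, {}))) = dpr_Ident (W.WO (w @ v) ({}, {}))"
    using W.WA_Ident[OF o(2), of w] by simp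
  moreover have "W.regroup w ({}, {}) (W.WO v ({}, {})) = dpr_Ident (W.WO (w @ v) ({}, {}))"
    using W_regroup[of "({}, {})" "W.WO v ({}, {})" w] o W_WO_append[OF o(2), of w] by simp
  ultimately show ?thesis
    using Cmp_Ident_dpr_arrow[OF diag_between_diag_ident[OF o(1)]] unfolding W.word_mult_def by (simp add: Ident_dpr_arrow[OF o(1)])
qed

context pair_map
begin

lemma unit_compare_Nil: "unit_compare [] = FUnit F"
  by (simp add: unit_compare_def)

end

locale dpr_map = pair_map Dpr V F dpr_dpair P t
  for V :: "('p, 'n) moncat" and F :: "(dpr_obj, dpr_arr, 'p, 'n) monfunc" and P :: "('p, 'n) dpair" and t
begin

text \<open>On standard objects this is \<open>unit_compare\<close> up to an identity;
  \<open>from_word\<close> carries it to all other objects.\<close>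

definition theta :: "dpr_obj \<Rightarrow> 'n" where
  "theta = (\<lambda>X\<in>dpr_Obj. FArr F (from_word X) \<bullet> unit_compare (sign_word X))"

lemma F_Dpr [simp]: "x \<in> dpr_Obj \<Longrightarrow> FObj F x \<in> Obj V"
  "f \<in> dpr_Arr \<Longrightarrow> FArr F f \<in> Arr V" "f \<in> dpr_Arr \<Longrightarrow> Dom V (FArr F f) = FObj F (fst f)"
  "f \<in> dpr_Arr \<Longrightarrow> Cod V (FArr F f) = FObj F (snd (snd f))"
  "x \<in> dpr_Obj \<Longrightarrow> FArr F (dpr_Ident x) = Ident V (FObj F x)"
  using F_simps(1,5)[of x] F_simps(2-4)[of f] by simp_all

lemma F_Dpr_Cmp: "f \<in> dpr_Arr \<Longrightarrow> g \<in> dpr_Arr \<Longrightarrow> fst g = snd (snd f) \<Longrightarrow>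
    FArr F (dpr_Cmp g f) = FArr F g \<bullet> FArr F f"
  using F_simps(6)[of f g] by simp

lemma theta_typing [simp]:
  assumes "X \<in> dpr_Obj"
  shows "theta X \<in> Arr V" "Dom V (theta X) = P.WO (sign_word X) (UnitO V)" "Cod V (theta X) = FObj F X" "iso_arrow V (theta X)"
  using assms from_word[OF assms] F_iso[of "from_word X"]
  by (auto simp: theta_def intro!: V.iso_Cmp)

lemma theta_natural:
  assumes "diag_between X D Y"
  shows "theta Y \<bullet> P.Phi D (UnitO V) = FArr F (dpr_arrow X D Y) \<bullet> theta X"
proof -
  have o: "X \<in> dpr_Obj" "Y \<in> dpr_Obj" "sign_word X = lower D" "sign_word Y = upper D" using assms by (auto simp: diag_between_def)
  note fx = from_word(2-4)[OF o(1)] and fy = from_word(2-4)[OF o(2)]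
  have ph: "W.Phi D ({}, {}) \<in> dpr_Arr" "fst (W.Phi D ({}, {})) = W.WO (lower D) ({}, {})"
    "snd (snd (W.Phi D ({}, {}))) = W.WO (upper D) ({}, {})"
    using W.Phi_typing[of "({}, {})" D] by simp_all
  have k: "FArr F (W.Phi D ({}, {})) \<bullet> unit_compare (lower D) = unit_compare (upper D) \<bullet> P.Phi D (UnitO V)"
    using unit_compare_Phi[of D] by simp
  have c: "FArr F (dpr_arrow X D Y) \<bullet> FArr F (from_word X) = FArr F (from_word Y) \<bullet> FArr F (W.Phi D ({}, {}))"
    using from_word_natural[OF assms] F_Dpr_Cmp[of "from_word X" "dpr_arrow X D Y"] F_Dpr_Cmp[of "W.Phi D ({}, {})" "from_word Y"]
      fx fy ph o dpr_arrow_in[OF assms] by simp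
  show ?thesis
    using o fx fy ph dpr_arrow_in[OF assms] by (simp add: theta_def k V.Cmp_rotate[OF c])
qed

lemma theta_mult:
  assumes "X \<in> dpr_Obj" "Y \<in> dpr_Obj"
  shows "theta (dpr_TensO X Y) \<bullet> P.word_mult (sign_word X) (sign_word Y) = FMult F X Y \<bullet> (theta X \<otimes>\<otimes> theta Y)"
proof -
  let ?x = "W.WO (sign_word X) ({}, {})" and ?y = "W.WO (sign_word Y) ({}, {})"
  have o: "?x \<in> dpr_Obj" "?y \<in> dpr_Obj" "W.WO (sign_word X @ sign_word Y) ({}, {}) \<in> dpr_Obj" by (simp_all add: W_WO)
  note fx = from_word(2-4)[OF assms(1)] and fy = from_word(2-4)[OF assms(2)]
  have xy: "dpr_TensO X Y \<in> dpr_Obj" "sign_word (dpr_TensO X Y) = sign_word X @ sign_word Y" using assms by (simp_all add: TensO_points)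
  note fxy = from_word(2-4)[OF xy(1)]
  have m: "FMult F X Y \<in> Arr V" "Dom V (FMult F X Y) = FObj F X \<odot>\<^bsub>V\<^esub> FObj F Y" "Cod V (FMult F X Y) = FObj F (dpr_TensO X Y)"
    "FMult F ?x ?y \<in> Arr V" "Dom V (FMult F ?x ?y) = FObj F ?x \<odot>\<^bsub>V\<^esub> FObj F ?y" "Cod V (FMult F ?x ?y) = FObj F (W.WO (sign_word X @ sign_word Y) ({}, {}))"
    using FMult_typing[of X Y] FMult_typing[of ?x ?y] assms o from_word_TensA(2)[OF assms] by simp_all
  have 1: "FMult F X Y \<bullet> (FArr F (from_word X) \<otimes>\<otimes> FArr F (from_word Y)) = FArr F (from_word (dpr_TensO X Y)) \<bullet> FMult F ?x ?y"
    using FMult_nat[of "from_word X" "from_word Y"] fx fy by (simp add: from_word_TensA(1)[OF assms])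
  have "FArr F (W.word_mult (sign_word X) (sign_word Y)) \<bullet> FMult F ?x ?y \<bullet> (unit_compare (sign_word X) \<otimes>\<otimes> unit_compare (sign_word Y)) = unit_compare (sign_word X @ sign_word Y) \<bullet> P.word_mult (sign_word X) (sign_word Y)"
    using unit_compare_word_mult[of "sign_word X" "sign_word Y"] by simp
  then have 2: "FMult F ?x ?y \<bullet> (unit_compare (sign_word X) \<otimes>\<otimes> unit_compare (sign_word Y)) = unit_compare (sign_word X @ sign_word Y) \<bullet> P.word_mult (sign_word X) (sign_word Y)"
    using o m by (simp add: W_word_mult)
  have 3: "theta X \<otimes>\<otimes> theta Y = (FArr F (from_word X) \<otimes>\<otimes> FArr F (from_word Y)) \<bullet> (unit_compare (sign_word X) \<otimes>\<otimes> unit_compare (sign_word Y))"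
    using assms fx fy by (simp add: theta_def V.interchange)
  show ?thesis
    unfolding 3 using assms fx fy fxy xy m by (simp add: V.Cmp_rotate[OF 1] 2) (simp add: theta_def xy)
qed

lemma theta_unit: "theta ({}, {}) \<bullet> Ident V (UnitO V) = FUnit F"
proof -
  show ?thesis using FUnit_typing by (simp add: theta_def from_word_special unit_compare_Nil)
qed

lemma theta_sign: "theta dpr_minus = t False \<bullet> RUnit V P.X" "theta dpr_plus = t True \<bullet> RUnit V P.Y"
  using unit_compare_single[of False] unit_compare_single[of True] by (simp_all add: theta_def from_word_special W.ob_def)

lemma theta: "monoidal_nat_iso Dpr V P.free_functor F theta"
proof (rule monoidal_nat_isoI[OF category_Dpr])
  show "theta x \<in> Hom V (FObj P.free_functor x) (FObj F x)" "iso_arrow V (theta x)" if "x \<in> Obj Dpr" for x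
    using that by simp_all
  show "theta \<in> extensional (Obj Dpr)" by (simp add: theta_def)
  show "theta (Cod Dpr f) \<bullet> FArr P.free_functor f = FArr F f \<bullet> theta (Dom Dpr f)" if f: "f \<in> Arr Dpr" for f
  proof -
    obtain X D Y where D: "diag_between X D Y" "f = dpr_arrow X D Y" using f by (auto elim: dpr_Arr_dpr_arrow)
    then show ?thesis using theta_natural[OF D(1)] by simp
  qed
  show "theta (TensO Dpr x y) \<bullet> FMult P.free_functor x y = FMult F x y \<bullet> (theta x \<otimes>\<otimes> theta y)"
    if "x \<in> Obj Dpr" "y \<in> Obj Dpr" for x y
    using theta_mult[of x y] that by simp
  show "theta (UnitO Dpr) \<bullet> FUnit P.free_functor = FUnit F"
    using theta_unit by simp
qed

end

text \<open>The value at the unit object is forced by \<open>FUnit\<close>, values at tensor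
  products are forced by \<open>FMult\<close>, and \<open>from_word\<close> connects every object
  with an iterated tensor product of signs. Off the objects both maps are extensional.\<close>

lemma monoidal_nat_iso_eqI:
  assumes "monoidal_nat_iso Dpr V F G \<sigma>" "monoidal_nat_iso Dpr V F G \<tau>"
    and "strong_monoidal_functor Dpr V F" "strong_monoidal_functor Dpr V G"
    and "\<sigma> dpr_minus = \<tau> dpr_minus" "\<sigma> dpr_plus = \<tau> dpr_plus"
  shows "\<sigma> = \<tau>"
proof -
  interpret F: strong_monoidal_functor Dpr V F by fact
  interpret G: strong_monoidal_functor Dpr V G by fact
  note s = monoidal_nat_isoD[OF assms(1,3,4), simplified Dpr_simps] and t = monoidal_nat_isoD[OF assms(2,3,4), simplified Dpr_simps]
  have unit: "\<sigma> ({}, {}) = \<tau> ({}, {})"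
  proof (rule F.V.iso_right_cancel[of _ "FUnit F"])
    show "\<sigma> ({}, {}) \<cdot>\<^bsub>V\<^esub> FUnit F = \<tau> ({}, {}) \<cdot>\<^bsub>V\<^esub> FUnit F" unfolding s(8) t(8) ..
  qed (use s t F.FUnit_typing in auto)
  have ob: "\<sigma> (W.ob b) = \<tau> (W.ob b)" for b using assms(5,6) by (simp add: W.ob_def)
  have word: "\<sigma> (W.WO w ({}, {})) = \<tau> (W.WO w ({}, {}))" for w
  proof (induction w)
    case (Cons b w)
    let ?x = "W.WO w ({}, {})"
    have o: "?x \<in> dpr_Obj" "W.ob b \<in> dpr_Obj" "dpr_TensO (W.ob b) ?x \<in> dpr_Obj" using W_WO[of "({}, {})"] sign_word_ob TensO_points by auto
    show ?case unfolding W.WO.simps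
    proof (rule F.V.iso_right_cancel[of _ "FMult F (W.ob b) ?x"])
      show "\<sigma> (dpr_TensO (W.ob b) ?x) \<cdot>\<^bsub>V\<^esub> FMult F (W.ob b) ?x = \<tau> (dpr_TensO (W.ob b) ?x) \<cdot>\<^bsub>V\<^esub> FMult F (W.ob b) ?x"
        unfolding s(7)[OF o(2,1)] t(7)[OF o(2,1)] ob Cons.IH ..
    qed (use s t o F.FMult_typing[of "W.ob b" ?x] in auto)
  qed (simp add: unit)
  show ?thesis
  proof
    fix X
    show "\<sigma> X = \<tau> X"
    proof (cases "X \<in> dpr_Obj")
      case True
      note f = from_word[OF True]
      have o: "W.WO (sign_word X) ({}, {}) \<in> dpr_Obj" using f(1) by (simp add: diag_between_def)
      show ?thesis
      proof (rule F.V.iso_right_cancel[of _ "FArr F (from_word X)"])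
        show "\<sigma> X \<cdot>\<^bsub>V\<^esub> FArr F (from_word X) = \<tau> X \<cdot>\<^bsub>V\<^esub> FArr F (from_word X)"
          using s(6)[OF f(2)] t(6)[OF f(2)] f(3,4) word by simp
        show "iso_arrow V (FArr F (from_word X))" by (rule F.F_iso[OF f(5)])
      qed (use s t True f(2-4) F.F_simps(4)[of "from_word X"] in auto)
    next
      case False
      then show ?thesis using extensional_arb[OF s(5)] extensional_arb[OF t(5)] by simp
    qed
  qed
qed

section \<open>The equivalence of groupoids\<close>

text \<open>The quasi-inverse is chosen: an object and an isomorphism for every object of
  \<open>B\<close>, and preimages of the arrows conjugated by these isomorphisms. Its equations are
  checked after applying \<open>F\<close>, by faithfulness.\<close>

lemma equivalence_of_categoriesI:
  fixes F :: "('o, 'm, 'p, 'n) func"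
  assumes F: "cat_functor A B F"
    and full: "\<And>x y g. x \<in> Obj A \<Longrightarrow> y \<in> Obj A \<Longrightarrow> g \<in> Hom B (FObj F x) (FObj F y) \<Longrightarrow> \<exists>f\<in>Hom A x y. FArr F f = g"
    and faithful: "\<And>x y f f'. f \<in> Hom A x y \<Longrightarrow> f' \<in> Hom A x y \<Longrightarrow> FArr F f = FArr F f' \<Longrightarrow> f = f'"
    and surj: "\<And>b. b \<in> Obj B \<Longrightarrow> \<exists>a\<in>Obj A. \<exists>e\<in>Hom B (FObj F a) b. iso_arrow B e"
  shows "equivalence_of_categories A B F"
proof -
  interpret F: cat_functor A B F by fact
  obtain a where a: "\<And>b. b \<in> Obj B \<Longrightarrow> a b \<in> Obj A \<and> (\<exists>e\<in>Hom B (FObj F (a b)) b. iso_arrow B e)"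
    using surj by metis
  then obtain e where e: "\<And>b. b \<in> Obj B \<Longrightarrow> e b \<in> Hom B (FObj F (a b)) b \<and> iso_arrow B (e b)"
    by metis
  have e': "e b \<in> Arr B" "Dom B (e b) = FObj F (a b)" "Cod B (e b) = b" "iso_arrow B (e b)" "a b \<in> Obj A" if "b \<in> Obj B" for b
    using e[OF that] a[OF that] by auto
  define lift where "lift x y g = (SOME f. f \<in> Hom A x y \<and> FArr F f = g)" for x y g
  have lift: "lift x y g \<in> Arr A" "Dom A (lift x y g) = x" "Cod A (lift x y g) = y" "FArr F (lift x y g) = g"
    if "x \<in> Obj A" "y \<in> Obj A" "g \<in> Arr B" "Dom B g = FObj F x" "Cod B g = FObj F y" for x y g
  proof -
    have "\<exists>f. f \<in> Hom A x y \<and> FArr F f = g" using full[of x y g] that by auto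
    then have "lift x y g \<in> Hom A x y \<and> FArr F (lift x y g) = g" unfolding lift_def by (rule someI_ex)
    then show "lift x y g \<in> Arr A" "Dom A (lift x y g) = x" "Cod A (lift x y g) = y" "FArr F (lift x y g) = g" by auto
  qed
  have eqI: "f = f'" if "FArr F f = FArr F f'" "f \<in> Arr A" "f' \<in> Arr A" "Dom A f = Dom A f'" "Cod A f = Cod A f'" for f f'
    using faithful[of f "Dom A f" "Cod A f" f'] that by auto
  define G :: "('p, 'n, 'o, 'm) func" where
    "G = \<lparr>FObj = a, FArr = \<lambda>g. lift (a (Dom B g)) (a (Cod B g)) (inv_arrow B (e (Cod B g)) \<cdot>\<^bsub>B\<^esub> g \<cdot>\<^bsub>B\<^esub> e (Dom B g))\<rparr>"
  have G: "FArr G g \<in> Arr A" "Dom A (FArr G g) = a (Dom B g)" "Cod A (FArr G g) = a (Cod B g)"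
    "FArr F (FArr G g) = inv_arrow B (e (Cod B g)) \<cdot>\<^bsub>B\<^esub> g \<cdot>\<^bsub>B\<^esub> e (Dom B g)" if "g \<in> Arr B" for g
    using lift[of "a (Dom B g)" "a (Cod B g)" "inv_arrow B (e (Cod B g)) \<cdot>\<^bsub>B\<^esub> g \<cdot>\<^bsub>B\<^esub> e (Dom B g)"] e' that
    by (simp_all add: G_def)
  have GO: "FObj G = a" by (simp add: G_def)
  have G_fun: "cat_functor B A G"
  proof (intro cat_functor.intro cat_functor_axioms.intro F.A.category_axioms F.B.category_axioms)
    show "FObj G x \<in> Obj A" if "x \<in> Obj B" for x using e' that by (simp add: GO)
    show "FArr G f \<in> Hom A (FObj G x) (FObj G y)" if "f \<in> Hom B x y" for f x y
      using G[of f] that by (simp add: GO)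
    show "FArr G (Ident B x) = Ident A (FObj G x)" if "x \<in> Obj B" for x
      by (rule eqI) (use G[of "Ident B x"] e' that in \<open>simp_all add: GO\<close>)
    show "FArr G (g \<cdot>\<^bsub>B\<^esub> f) = FArr G g \<cdot>\<^bsub>A\<^esub> FArr G f" if "f \<in> Hom B x y" "g \<in> Hom B y z" for f g x y z
    proof -
      have fg: "f \<in> Arr B" "g \<in> Arr B" "Dom B g = Cod B f" using that by auto
      show ?thesis by (rule eqI) (use G[of f] G[of g] G[of "g \<cdot>\<^bsub>B\<^esub> f"] e' fg in simp_all)
    qed
  qed
  have tau: "nat_iso B B (comp_func F G) id_func e"
    unfolding nat_iso_def nat_trans_def
  proof (intro conjI ballI)
    show "e x \<in> Hom B (FObj (comp_func F G) x) (FObj id_func x)" "iso_arrow B (e x)" if "x \<in> Obj B" for x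
      using e' that by (simp_all add: comp_func_def id_func_def GO)
    show "e y \<cdot>\<^bsub>B\<^esub> FArr (comp_func F G) f = FArr id_func f \<cdot>\<^bsub>B\<^esub> e x" if "x \<in> Obj B" "y \<in> Obj B" "f \<in> Hom B x y" for x y f
      using G[of f] e' that by (simp add: comp_func_def id_func_def)
  qed
  define s where "s x = lift x (a (FObj F x)) (inv_arrow B (e (FObj F x)))" for x
  have s: "s x \<in> Arr A" "Dom A (s x) = x" "Cod A (s x) = a (FObj F x)" "FArr F (s x) = inv_arrow B (e (FObj F x))"
    if "x \<in> Obj A" for x
    using lift[of x "a (FObj F x)" "inv_arrow B (e (FObj F x))"] e' that by (simp_all add: s_def)
  have sigma: "nat_iso A A id_func (comp_func G F) s"
    unfolding nat_iso_def nat_trans_def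
  proof (intro conjI ballI)
    show "s x \<in> Hom A (FObj id_func x) (FObj (comp_func G F) x)" if "x \<in> Obj A" for x
      using s that by (simp add: comp_func_def id_func_def GO)
    show "iso_arrow A (s x)" if x: "x \<in> Obj A" for x
    proof -
      let ?r = "lift (a (FObj F x)) x (e (FObj F x))"
      have r: "?r \<in> Arr A" "Dom A ?r = a (FObj F x)" "Cod A ?r = x" "FArr F ?r = e (FObj F x)"
        using lift[of "a (FObj F x)" x "e (FObj F x)"] e' x by simp_all
      have 1: "?r \<cdot>\<^bsub>A\<^esub> s x = Ident A x" by (rule eqI) (use r s x e' in simp_all)
      have 2: "s x \<cdot>\<^bsub>A\<^esub> ?r = Ident A (a (FObj F x))" by (rule eqI) (use r s x e' in simp_all)
      show ?thesis unfolding iso_arrow_def inverse_arrows_def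
        by (rule exI[of _ ?r]) (use 1 2 r s x in simp)
    qed
    show "s y \<cdot>\<^bsub>A\<^esub> FArr id_func f = FArr (comp_func G F) f \<cdot>\<^bsub>A\<^esub> s x" if "x \<in> Obj A" "y \<in> Obj A" "f \<in> Hom A x y" for x y f
    proof -
      have f: "f \<in> Arr A" "Dom A f = x" "Cod A f = y" using that by auto
      have "s y \<cdot>\<^bsub>A\<^esub> f = FArr G (FArr F f) \<cdot>\<^bsub>A\<^esub> s x"
        by (rule eqI) (use s G[of "FArr F f"] e' f that in simp_all)
      then show ?thesis by (simp add: comp_func_def id_func_def)
    qed
  qed
  show ?thesis unfolding equivalence_of_categories_def using F G_fun sigma tau by blast
qed

lemma groupoid_core:
  assumes "category C"
  shows "groupoid (core C)"
proof -
  interpret category C by fact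
  have H: "f \<in> Hom (core C) x y \<longleftrightarrow> f \<in> Hom C x y \<and> iso_arrow C f" for f x y by (auto simp: core_def Hom_def)
  have c: "Obj (core C) = Obj C" "Dom (core C) = Dom C" "Cod (core C) = Cod C" "Ident (core C) = Ident C" "Cmp (core C) = Cmp C"
    "f \<in> Arr (core C) \<longleftrightarrow> f \<in> Arr C \<and> iso_arrow C f" for f
    by (auto simp: core_def)
  show ?thesis
  proof
    show "Cmp (core C) g f \<in> Hom (core C) x z" if "f \<in> Hom (core C) x y" "g \<in> Hom (core C) y z" for f g x y z
      using that iso_Cmp(1)[of f g] by (simp add: H c)
    show "iso_arrow (core C) f" if "f \<in> Arr (core C)" for f
      using that iso_inv_iso[of f] unfolding iso_arrow_def[of "core C"] inverse_arrows_def
      by (intro exI[of _ "inv_arrow C f"]) (simp add: H c)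
  qed (auto simp: H c)
qed

section \<open>The groupoids of dual pairs and of strong monoidal functors\<close>

lemma Dp_simps [simp]: "Obj (Dp V) = {P. dual_pair V P}" "Dom (Dp V) (P, a, Q) = P" "Cod (Dp V) (P, a, Q) = Q"
  "Ident (Dp V) P = (P, (Ident V (LeftO P), Ident V (RightO P)), P)"
  "Cmp (Dp V) (Q, (u', v'), R) (P, (u, v), Q') = (P, (u' \<cdot>\<^bsub>V\<^esub> u, v \<cdot>\<^bsub>V\<^esub> v'), R)"
  by (simp_all add: Dp_def)

context monoidal_category
begin

lemma Arr_Dp: "(P, (u, v), Q) \<in> Arr (Dp C) \<longleftrightarrow> dual_pair C P \<and> dual_pair C Q \<and>
    u \<in> Arr C \<and> Dom C u = LeftO P \<and> Cod C u = LeftO Q \<and> v \<in> Arr C \<and> Dom C v = RightO Q \<and> Cod C v = RightO P \<and>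
    Counit Q \<cdot> (u \<otimes> idn (RightO Q)) = Counit P \<cdot> (idn (LeftO P) \<otimes> v)"
  by (auto simp: Dp_def)

lemma Hom_Dp: "f \<in> Hom (Dp C) P Q \<longleftrightarrow> (\<exists>u v. f = (P, (u, v), Q) \<and> (P, (u, v), Q) \<in> Arr (Dp C))"
  unfolding Hom_def by (cases f) auto

lemma Dp_cmp_in:
  assumes "(P, (u, v), Q) \<in> Arr (Dp C)" "(Q, (u', v'), R) \<in> Arr (Dp C)"
  shows "(P, (u' \<cdot> u, v \<cdot> v'), R) \<in> Arr (Dp C)"
proof -
  note a = assms[unfolded Arr_Dp]
  interpret P: dual_pair_in C P by unfold_locales (use a in blast)
  interpret Q: dual_pair_in C Q by unfold_locales (use a in blast)
  interpret R: dual_pair_in C R by unfold_locales (use a in blast)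
  have 1: "Counit R \<cdot> (u' \<otimes> idn R.Y) = Counit Q \<cdot> (idn Q.X \<otimes> v')" and 2: "Counit Q \<cdot> (u \<otimes> idn Q.Y) = Counit P \<cdot> (idn P.X \<otimes> v)"
    using a by blast+
  have 3: "(idn Q.X \<otimes> v') \<cdot> (u \<otimes> idn R.Y) = (u \<otimes> idn Q.Y) \<cdot> (idn P.X \<otimes> v')" using a by (simp add: interchange)
  have "Counit R \<cdot> ((u' \<cdot> u) \<otimes> idn R.Y) = Counit P \<cdot> (idn P.X \<otimes> (v \<cdot> v'))"
    using a by (simp add: Cmp_rotate[OF 1] 3 Cmp_rotate[OF 2])
  then show ?thesis using a unfolding Arr_Dp by simp
qed

lemma category_Dp: "category (Dp C)"
proof
  show "Dom (Dp C) f \<in> Obj (Dp C)" "Cod (Dp C) f \<in> Obj (Dp C)" if "f \<in> Arr (Dp C)" for f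
    using that by (auto simp: Dp_def)
  show "Ident (Dp C) P \<in> Hom (Dp C) P P" if "P \<in> Obj (Dp C)" for P
  proof -
    interpret P: dual_pair_in C P by unfold_locales (use that in simp)
    show ?thesis using P.dual by (simp add: Hom_Dp Arr_Dp)
  qed
  show "Cmp (Dp C) g f \<in> Hom (Dp C) P R" if fg: "f \<in> Hom (Dp C) P Q" "g \<in> Hom (Dp C) Q R" for f g P Q R
  proof -
    obtain u v where f: "f = (P, (u, v), Q)" "(P, (u, v), Q) \<in> Arr (Dp C)" using fg(1) unfolding Hom_Dp by blast
    obtain u' v' where g: "g = (Q, (u', v'), R)" "(Q, (u', v'), R) \<in> Arr (Dp C)" using fg(2) unfolding Hom_Dp by blast
    show ?thesis using Dp_cmp_in[OF f(2) g(2)] unfolding f(1) g(1) Hom_Dp Dp_simps by blast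
  qed
  show "Cmp (Dp C) (Ident (Dp C) Q) f = f" "Cmp (Dp C) f (Ident (Dp C) P) = f" if f: "f \<in> Hom (Dp C) P Q" for f P Q
  proof -
    obtain u v where f': "f = (P, (u, v), Q)" "(P, (u, v), Q) \<in> Arr (Dp C)" using f unfolding Hom_Dp by blast
    then show "Cmp (Dp C) (Ident (Dp C) Q) f = f" "Cmp (Dp C) f (Ident (Dp C) P) = f" unfolding Arr_Dp by simp_all
  qed
  show "Cmp (Dp C) (Cmp (Dp C) h g) f = Cmp (Dp C) h (Cmp (Dp C) g f)"
    if fgh: "f \<in> Hom (Dp C) P Q" "g \<in> Hom (Dp C) Q R" "h \<in> Hom (Dp C) R S" for f g h P Q R S
  proof -
    obtain u v where f: "f = (P, (u, v), Q)" "(P, (u, v), Q) \<in> Arr (Dp C)" using fgh(1) unfolding Hom_Dp by blast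
    obtain u' v' where g: "g = (Q, (u', v'), R)" "(Q, (u', v'), R) \<in> Arr (Dp C)" using fgh(2) unfolding Hom_Dp by blast
    obtain u'' v'' where h: "h = (R, (u'', v''), S)" "(R, (u'', v''), S) \<in> Arr (Dp C)" using fgh(3) unfolding Hom_Dp by blast
    show ?thesis using f g h unfolding Arr_Dp by simp
  qed
qed

text \<open>Composing the counit condition with the tensor product of the two inverses shows that
  these again form a morphism of dual pairs.\<close>

lemma iso_Dp:
  assumes a: "(P, (u, v), Q) \<in> Arr (Dp C)"
  shows "iso_arrow (Dp C) (P, (u, v), Q) \<longleftrightarrow> iso_arrow C u \<and> iso_arrow C v"
proof
  assume "iso_arrow (Dp C) (P, (u, v), Q)"
  then obtain g where g: "g \<in> Hom (Dp C) Q P" "Cmp (Dp C) g (P, (u, v), Q) = Ident (Dp C) P" "Cmp (Dp C) (P, (u, v), Q) g = Ident (Dp C) Q"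
    unfolding iso_arrow_def inverse_arrows_def by auto
  obtain u' v' where g': "g = (Q, (u', v'), P)" "(Q, (u', v'), P) \<in> Arr (Dp C)" using g(1) unfolding Hom_Dp by blast
  have "inverse_arrows C u u'" "inverse_arrows C v v'"
    using g(2,3) a g'(2) unfolding g'(1) Arr_Dp inverse_arrows_def by simp_all
  then show "iso_arrow C u \<and> iso_arrow C v" unfolding iso_arrow_def by blast
next
  assume iso: "iso_arrow C u \<and> iso_arrow C v"
  note a' = a[unfolded Arr_Dp]
  interpret P: dual_pair_in C P by unfold_locales (use a' in blast)
  interpret Q: dual_pair_in C Q by unfold_locales (use a' in blast)
  let ?u = "inv_arrow C u" and ?v = "inv_arrow C v"
  have c: "Counit Q \<cdot> (u \<otimes> idn Q.Y) = Counit P \<cdot> (idn P.X \<otimes> v)" using a' by blast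
  have t: "u \<in> Arr C" "Dom C u = P.X" "Cod C u = Q.X" "v \<in> Arr C" "Dom C v = Q.Y" "Cod C v = P.Y" using a' by blast+
  have 1: "(u \<otimes> idn Q.Y) \<cdot> (?u \<otimes> ?v) = idn Q.X \<otimes> ?v" "(idn P.X \<otimes> v) \<cdot> (?u \<otimes> ?v) = ?u \<otimes> idn P.Y"
    using t iso by (simp_all add: interchange)
  have "Counit Q \<cdot> (idn Q.X \<otimes> ?v) = (Counit Q \<cdot> (u \<otimes> idn Q.Y)) \<cdot> (?u \<otimes> ?v)"
    using t iso by (simp add: 1)
  also have "\<dots> = Counit P \<cdot> (?u \<otimes> idn P.Y)" unfolding c using t iso by (simp add: 1)
  finally have "(Q, (?u, ?v), P) \<in> Arr (Dp C)" using a' iso unfolding Arr_Dp by simp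
  then have "inverse_arrows (Dp C) (P, (u, v), Q) (Q, (?u, ?v), P)"
    using a a' iso unfolding inverse_arrows_def Hom_Dp by simp
  then show "iso_arrow (Dp C) (P, (u, v), Q)" unfolding iso_arrow_def by blast
qed

lemma Dp_g_simps: "Obj (Dp_g C) = {P. dual_pair C P}" "Dom (Dp_g C) = Dom (Dp C)" "Cod (Dp_g C) = Cod (Dp C)"
  "Ident (Dp_g C) = Ident (Dp C)" "Cmp (Dp_g C) = Cmp (Dp C)"
  by (simp_all add: Dp_g_def core_def)

lemma Hom_Dp_g: "f \<in> Hom (Dp_g C) P Q \<longleftrightarrow>
    (\<exists>u v. f = (P, (u, v), Q) \<and> (P, (u, v), Q) \<in> Arr (Dp C) \<and> iso_arrow C u \<and> iso_arrow C v)"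
proof -
  have "f \<in> Hom (Dp_g C) P Q \<longleftrightarrow> f \<in> Hom (Dp C) P Q \<and> iso_arrow (Dp C) f" by (auto simp: Dp_g_def core_def Hom_def)
  then show ?thesis unfolding Hom_Dp using iso_Dp by blast
qed

end

lemma StMon_g_simps [simp]: "Obj (StMon_g A V) = {F. strong_monoidal_functor A V F}"
  "(F, \<sigma>, G) \<in> Arr (StMon_g A V) \<longleftrightarrow> strong_monoidal_functor A V F \<and> strong_monoidal_functor A V G \<and> monoidal_nat_iso A V F G \<sigma>"
  "Dom (StMon_g A V) (F, \<sigma>, G) = F" "Cod (StMon_g A V) (F, \<sigma>, G) = G"
  "Ident (StMon_g A V) F = (F, \<lambda>x\<in>Obj A. Ident V (FObj F x), F)"
  "Cmp (StMon_g A V) (G, \<tau>, H) (F, \<sigma>, G') = (F, \<lambda>x\<in>Obj A. \<tau> x \<cdot>\<^bsub>V\<^esub> \<sigma> x, H)"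
  by (auto simp: StMon_g_def)

lemma Hom_StMon_g: "f \<in> Hom (StMon_g A V) F G \<longleftrightarrow> (\<exists>\<sigma>. f = (F, \<sigma>, G) \<and>
    strong_monoidal_functor A V F \<and> strong_monoidal_functor A V G \<and> monoidal_nat_iso A V F G \<sigma>)"
  unfolding Hom_def by (cases f) auto

lemma monoidal_nat_iso_Ident:
  assumes "strong_monoidal_functor A V F"
  shows "monoidal_nat_iso A V F F (\<lambda>x\<in>Obj A. Ident V (FObj F x))"
proof -
  interpret F: strong_monoidal_functor A V F by fact
  show ?thesis by (rule monoidal_nat_isoI[OF F.A.category_axioms]) auto
qed

lemma monoidal_nat_iso_Cmp:
  assumes F: "strong_monoidal_functor A V F" and G: "strong_monoidal_functor A V G" and H: "strong_monoidal_functor A V H"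
    and st: "monoidal_nat_iso A V F G \<sigma>" "monoidal_nat_iso A V G H \<tau>"
  shows "monoidal_nat_iso A V F H (\<lambda>x\<in>Obj A. \<tau> x \<cdot>\<^bsub>V\<^esub> \<sigma> x)"
proof -
  interpret F: strong_monoidal_functor A V F by fact
  interpret G: strong_monoidal_functor A V G by fact
  interpret H: strong_monoidal_functor A V H by fact
  note s = monoidal_nat_isoD[OF st(1) F G] and t = monoidal_nat_isoD[OF st(2) G H]
  show ?thesis
  proof (rule monoidal_nat_isoI[OF F.A.category_axioms])
    show "(\<lambda>x\<in>Obj A. \<tau> x \<cdot>\<^bsub>V\<^esub> \<sigma> x) x \<in> Hom V (FObj F x) (FObj H x)" "iso_arrow V ((\<lambda>x\<in>Obj A. \<tau> x \<cdot>\<^bsub>V\<^esub> \<sigma> x) x)" if "x \<in> Obj A" for x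
      using s(1-4)[OF that] t(1-4)[OF that] that F.V.iso_Cmp(1)[of "\<sigma> x" "\<tau> x"] by simp_all
    show "(\<lambda>x\<in>Obj A. \<tau> x \<cdot>\<^bsub>V\<^esub> \<sigma> x) (Cod A f) \<cdot>\<^bsub>V\<^esub> FArr F f = FArr H f \<cdot>\<^bsub>V\<^esub> (\<lambda>x\<in>Obj A. \<tau> x \<cdot>\<^bsub>V\<^esub> \<sigma> x) (Dom A f)" if f: "f \<in> Arr A" for f
      using f s(1-4) t(1-4) s(6)[OF f] F.V.Cmp_rotate[OF t(6)[OF f], of "\<sigma> (Dom A f)"] by simp
    show "(\<lambda>x\<in>Obj A. \<tau> x \<cdot>\<^bsub>V\<^esub> \<sigma> x) (x \<odot>\<^bsub>A\<^esub> y) \<cdot>\<^bsub>V\<^esub> FMult F x y =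
      FMult H x y \<cdot>\<^bsub>V\<^esub> ((\<lambda>x\<in>Obj A. \<tau> x \<cdot>\<^bsub>V\<^esub> \<sigma> x) x \<otimes>\<^bsub>V\<^esub> (\<lambda>x\<in>Obj A. \<tau> x \<cdot>\<^bsub>V\<^esub> \<sigma> x) y)" if xy: "x \<in> Obj A" "y \<in> Obj A" for x y
    proof -
      have "(\<tau> x \<cdot>\<^bsub>V\<^esub> \<sigma> x) \<otimes>\<^bsub>V\<^esub> (\<tau> y \<cdot>\<^bsub>V\<^esub> \<sigma> y) = (\<tau> x \<otimes>\<^bsub>V\<^esub> \<tau> y) \<cdot>\<^bsub>V\<^esub> (\<sigma> x \<otimes>\<^bsub>V\<^esub> \<sigma> y)"
        using xy s(1-3) t(1-3) by (simp add: F.V.interchange)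
      then show ?thesis using xy s(1-4) t(1-4) s(7)[OF xy] F.V.Cmp_rotate[OF t(7)[OF xy], of "\<sigma> x \<otimes>\<^bsub>V\<^esub> \<sigma> y"] by simp
    qed
    show "(\<lambda>x\<in>Obj A. \<tau> x \<cdot>\<^bsub>V\<^esub> \<sigma> x) (UnitO A) \<cdot>\<^bsub>V\<^esub> FUnit F = FUnit H"
      using s(1-4)[of "UnitO A"] t(1-4)[of "UnitO A"] s(8) t(8) by simp
  qed simp
qed

lemma monoidal_nat_iso_inv:
  assumes F: "strong_monoidal_functor A V F" and G: "strong_monoidal_functor A V G"
    and st: "monoidal_nat_iso A V F G \<sigma>"
  shows "monoidal_nat_iso A V G F (\<lambda>x\<in>Obj A. inv_arrow V (\<sigma> x))"
proof -
  interpret F: strong_monoidal_functor A V F by fact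
  interpret G: strong_monoidal_functor A V G by fact
  note s = monoidal_nat_isoD[OF st F G]
  show ?thesis
  proof (rule monoidal_nat_isoI[OF F.A.category_axioms])
    show "(\<lambda>x\<in>Obj A. inv_arrow V (\<sigma> x)) x \<in> Hom V (FObj G x) (FObj F x)" "iso_arrow V ((\<lambda>x\<in>Obj A. inv_arrow V (\<sigma> x)) x)" if "x \<in> Obj A" for x
      using s(1-4)[OF that] that F.V.iso_inv_iso by simp_all
    show "(\<lambda>x\<in>Obj A. inv_arrow V (\<sigma> x)) (Cod A f) \<cdot>\<^bsub>V\<^esub> FArr G f = FArr F f \<cdot>\<^bsub>V\<^esub> (\<lambda>x\<in>Obj A. inv_arrow V (\<sigma> x)) (Dom A f)" if f: "f \<in> Arr A" for f
      using F.V.iso_square[OF s(6)[OF f, symmetric]] s(1-4) f by simp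
    show "(\<lambda>x\<in>Obj A. inv_arrow V (\<sigma> x)) (x \<odot>\<^bsub>A\<^esub> y) \<cdot>\<^bsub>V\<^esub> FMult G x y =
      FMult F x y \<cdot>\<^bsub>V\<^esub> ((\<lambda>x\<in>Obj A. inv_arrow V (\<sigma> x)) x \<otimes>\<^bsub>V\<^esub> (\<lambda>x\<in>Obj A. inv_arrow V (\<sigma> x)) y)" if xy: "x \<in> Obj A" "y \<in> Obj A" for x y
      using F.V.iso_square[OF s(7)[OF xy, symmetric]] s(1-4) xy by simp
    show "(\<lambda>x\<in>Obj A. inv_arrow V (\<sigma> x)) (UnitO A) \<cdot>\<^bsub>V\<^esub> FUnit G = FUnit F"
      unfolding s(8)[symmetric] using s(1-4)[of "UnitO A"] by simp
  qed simp
qed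

lemma groupoid_StMon_g: "groupoid (StMon_g A V)"
proof -
  \<comment> \<open>Components are extensional, so the identity laws hold as equations between
    functions.\<close>
  have ext: "(\<lambda>x\<in>Obj A. f x) = \<sigma>" if "\<sigma> \<in> extensional (Obj A)" "\<And>x. x \<in> Obj A \<Longrightarrow> f x = \<sigma> x" for f \<sigma>
    using that by (auto simp: extensional_def restrict_def)
  show ?thesis
  proof
    show "Dom (StMon_g A V) f \<in> Obj (StMon_g A V)" "Cod (StMon_g A V) f \<in> Obj (StMon_g A V)" if "f \<in> Arr (StMon_g A V)" for f
      using that by (cases f; simp)+
    show "Ident (StMon_g A V) F \<in> Hom (StMon_g A V) F F" if "F \<in> Obj (StMon_g A V)" for F
      using that monoidal_nat_iso_Ident by (simp add: Hom_StMon_g)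
    show "Cmp (StMon_g A V) g f \<in> Hom (StMon_g A V) F H" if "f \<in> Hom (StMon_g A V) F G" "g \<in> Hom (StMon_g A V) G H" for f g F G H
      using that monoidal_nat_iso_Cmp by (fastforce simp: Hom_StMon_g)
    show "Cmp (StMon_g A V) (Ident (StMon_g A V) G) f = f" "Cmp (StMon_g A V) f (Ident (StMon_g A V) F) = f"
      if f: "f \<in> Hom (StMon_g A V) F G" for f F G
    proof -
      obtain \<sigma> where s: "f = (F, \<sigma>, G)" and FG: "strong_monoidal_functor A V F" "strong_monoidal_functor A V G" "monoidal_nat_iso A V F G \<sigma>"
        using f unfolding Hom_StMon_g by blast
      interpret F: strong_monoidal_functor A V F by fact
      note m = monoidal_nat_isoD[OF FG(3,1,2)]
      show "Cmp (StMon_g A V) (Ident (StMon_g A V) G) f = f" "Cmp (StMon_g A V) f (Ident (StMon_g A V) F) = f"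
        unfolding s using m by (auto intro!: ext)
    qed
    show "Cmp (StMon_g A V) (Cmp (StMon_g A V) h g) f = Cmp (StMon_g A V) h (Cmp (StMon_g A V) g f)"
      if fgh: "f \<in> Hom (StMon_g A V) F G" "g \<in> Hom (StMon_g A V) G H" "h \<in> Hom (StMon_g A V) H K" for f g h F G H K
    proof -
      obtain \<sigma> where s: "f = (F, \<sigma>, G)" and F: "strong_monoidal_functor A V F" "monoidal_nat_iso A V F G \<sigma>"
        using fgh(1) unfolding Hom_StMon_g by blast
      obtain \<tau> where t: "g = (G, \<tau>, H)" and G: "strong_monoidal_functor A V G" "monoidal_nat_iso A V G H \<tau>"
        using fgh(2) unfolding Hom_StMon_g by blast
      obtain \<rho> where r: "h = (H, \<rho>, K)" and H: "strong_monoidal_functor A V H" "strong_monoidal_functor A V K" "monoidal_nat_iso A V H K \<rho>"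
        using fgh(3) unfolding Hom_StMon_g by blast
      interpret F: strong_monoidal_functor A V F by fact
      note m = monoidal_nat_isoD[OF F(2,1) G(1)] monoidal_nat_isoD[OF G(2,1) H(1)] monoidal_nat_isoD[OF H(3,1,2)]
      show ?thesis unfolding s t r using m by (auto intro!: restrict_ext)
    qed
    show "iso_arrow (StMon_g A V) f" if f: "f \<in> Arr (StMon_g A V)" for f
    proof -
      obtain F \<sigma> G where s: "f = (F, \<sigma>, G)" by (cases f) auto
      then have FG: "strong_monoidal_functor A V F" "strong_monoidal_functor A V G" "monoidal_nat_iso A V F G \<sigma>"
        using f by simp_all
      interpret F: strong_monoidal_functor A V F by fact
      note m = monoidal_nat_isoD[OF FG(3,1,2)]
      have "inverse_arrows (StMon_g A V) f (G, \<lambda>x\<in>Obj A. inv_arrow V (\<sigma> x), F)"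
        unfolding s inverse_arrows_def using FG monoidal_nat_iso_inv[OF FG] m by (auto simp: Hom_StMon_g intro!: restrict_ext)
      then show ?thesis unfolding iso_arrow_def by blast
    qed
  qed
qed

context monoidal_category
begin

text \<open>Passes from the contravariant form of the counit condition to the covariant one, in
  which both components point in the same direction, as \<open>pair_map\<close> demands.\<close>

lemma counit_turn:
  assumes "dual_pair C P" "dual_pair C Q" "u \<in> Arr C" "Dom C u = LeftO P" "Cod C u = LeftO Q"
    "iso_arrow C v" "Dom C v = RightO P" "Cod C v = RightO Q"
  shows "Counit Q \<cdot> (u \<otimes> idn (RightO Q)) = Counit P \<cdot> (idn (LeftO P) \<otimes> inv_arrow C v) \<longleftrightarrow>
    Counit Q \<cdot> (u \<otimes> v) = Counit P"
proof -
  interpret P: dual_pair_in C P by unfold_locales fact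
  interpret Q: dual_pair_in C Q by unfold_locales fact
  have v: "v \<in> Arr C" using assms by (rule_tac iso_Arr)
  have 1: "(u \<otimes> idn Q.Y) \<cdot> (idn P.X \<otimes> v) = u \<otimes> v" "(u \<otimes> v) \<cdot> (idn P.X \<otimes> inv_arrow C v) = u \<otimes> idn Q.Y"
    "(idn P.X \<otimes> inv_arrow C v) \<cdot> (idn P.X \<otimes> v) = idn (P.X \<odot> P.Y)"
    using assms v by (simp_all add: interchange)
  show ?thesis
  proof
    assume e: "Counit Q \<cdot> (u \<otimes> idn Q.Y) = Counit P \<cdot> (idn P.X \<otimes> inv_arrow C v)"
    have "Counit Q \<cdot> (u \<otimes> v) = (Counit Q \<cdot> (u \<otimes> idn Q.Y)) \<cdot> (idn P.X \<otimes> v)" using assms v by (simp add: 1)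
    also have "\<dots> = Counit P" unfolding e using assms v by (simp add: 1)
    finally show "Counit Q \<cdot> (u \<otimes> v) = Counit P" .
  next
    assume e: "Counit Q \<cdot> (u \<otimes> v) = Counit P"
    have "Counit Q \<cdot> (u \<otimes> idn Q.Y) = (Counit Q \<cdot> (u \<otimes> v)) \<cdot> (idn P.X \<otimes> inv_arrow C v)" using assms v by (simp add: 1)
    then show "Counit Q \<cdot> (u \<otimes> idn Q.Y) = Counit P \<cdot> (idn P.X \<otimes> inv_arrow C v)" unfolding e .
  qed
qed

lemma Dp_g_arrow:
  assumes "dual_pair C P" "dual_pair C Q" "iso_arrow C u" "Dom C u = LeftO P" "Cod C u = LeftO Q"
    "iso_arrow C v" "Dom C v = RightO P" "Cod C v = RightO Q"
  shows "(P, (u, inv_arrow C v), Q) \<in> Hom (Dp_g C) P Q \<longleftrightarrow> Counit Q \<cdot> (u \<otimes> v) = Counit P"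
proof -
  have a: "u \<in> Arr C" "v \<in> Arr C" "iso_arrow C (inv_arrow C v)"
    using assms iso_Arr iso_inv_iso by auto
  show ?thesis
    unfolding Hom_Dp_g Arr_Dp counit_turn[OF assms(1,2) a(1) assms(4-8), symmetric] using a assms by simp
qed

end

section \<open>The evaluation functor: full, faithful and essentially surjective\<close>

lemma counit_monoidal_nat_iso:
  assumes "dual_pair A Q" "strong_monoidal_functor A V F" "strong_monoidal_functor A V G" "monoidal_nat_iso A V F G \<sigma>"
  shows "Counit (image_dpair A V Q G) \<cdot>\<^bsub>V\<^esub> (\<sigma> (LeftO Q) \<otimes>\<^bsub>V\<^esub> \<sigma> (RightO Q)) = Counit (image_dpair A V Q F)"
proof -
  interpret F: strong_monoidal_functor A V F by fact
  interpret G: strong_monoidal_functor A V G by fact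
  interpret Q: dual_pair_in A Q by unfold_locales fact
  note s = monoidal_nat_isoD[OF assms(4,2,3)]
  let ?I = "UnitO A" and ?XY = "Q.X \<odot>\<^bsub>A\<^esub> Q.Y"
  have 1: "\<sigma> ?I \<cdot>\<^bsub>V\<^esub> FArr F (Counit Q) = FArr G (Counit Q) \<cdot>\<^bsub>V\<^esub> \<sigma> ?XY"
    using s(6)[of "Counit Q"] by simp
  have 2: "inv_arrow V (FUnit G) \<cdot>\<^bsub>V\<^esub> \<sigma> ?I = inv_arrow V (FUnit F)"
    by (rule F.V.iso_right_cancel[where f = "FUnit F"]) (use s(8) s(1-3)[of ?I] in simp_all)
  have "FArr G (Counit Q) \<cdot>\<^bsub>V\<^esub> FMult G Q.X Q.Y \<cdot>\<^bsub>V\<^esub> (\<sigma> Q.X \<otimes>\<^bsub>V\<^esub> \<sigma> Q.Y)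
    = (FArr G (Counit Q) \<cdot>\<^bsub>V\<^esub> \<sigma> ?XY) \<cdot>\<^bsub>V\<^esub> FMult F Q.X Q.Y"
    using s(7)[of Q.X Q.Y, symmetric] s(1-3)[of Q.X] s(1-3)[of Q.Y] s(1-3)[of ?XY] by simp
  also have "\<dots> = \<sigma> ?I \<cdot>\<^bsub>V\<^esub> FArr F (Counit Q) \<cdot>\<^bsub>V\<^esub> FMult F Q.X Q.Y"
    unfolding 1[symmetric] using s(1-3)[of ?I] by simp
  finally have 3: "FArr G (Counit Q) \<cdot>\<^bsub>V\<^esub> FMult G Q.X Q.Y \<cdot>\<^bsub>V\<^esub> (\<sigma> Q.X \<otimes>\<^bsub>V\<^esub> \<sigma> Q.Y)
    = \<sigma> ?I \<cdot>\<^bsub>V\<^esub> FArr F (Counit Q) \<cdot>\<^bsub>V\<^esub> FMult F Q.X Q.Y" .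
  have "Counit (image_dpair A V Q G) \<cdot>\<^bsub>V\<^esub> (\<sigma> Q.X \<otimes>\<^bsub>V\<^esub> \<sigma> Q.Y)
    = inv_arrow V (FUnit G) \<cdot>\<^bsub>V\<^esub> (FArr G (Counit Q) \<cdot>\<^bsub>V\<^esub> FMult G Q.X Q.Y \<cdot>\<^bsub>V\<^esub> (\<sigma> Q.X \<otimes>\<^bsub>V\<^esub> \<sigma> Q.Y))"
    using s(1-3)[of Q.X] s(1-3)[of Q.Y] by (simp add: image_dpair_def)
  also have "\<dots> = Counit (image_dpair A V Q F)"
    unfolding 3 using F.V.Cmp_rotate[OF 2, of "FArr F (Counit Q) \<cdot>\<^bsub>V\<^esub> FMult F Q.X Q.Y"] s(1-3)[of ?I]
    by (simp add: image_dpair_def)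
  finally show ?thesis .
qed

lemma image_dpair_sel [simp]: "LeftO (image_dpair A V Q F) = FObj F (LeftO Q)" "RightO (image_dpair A V Q F) = FObj F (RightO Q)"
  by (simp_all add: image_dpair_def)

lemma dual_pair_image_dpair:
  assumes "dual_pair A Q" "strong_monoidal_functor A V F"
  shows "dual_pair V (image_dpair A V Q F)"
proof -
  interpret F: strong_monoidal_functor A V F by fact
  interpret functor_dual A V F Q by unfold_locales fact
  show ?thesis by (rule dual_pair_image)
qed

lemma eval_functor_simps [simp]: "FObj (eval_functor A V Q) = image_dpair A V Q"
  "FArr (eval_functor A V Q) (F, \<sigma>, G)
    = (image_dpair A V Q F, (\<sigma> (LeftO Q), inv_arrow V (\<sigma> (RightO Q))), image_dpair A V Q G)"
  by (simp_all add: eval_functor_def)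

lemma cat_functor_eval:
  assumes V: "monoidal_category V" and Q: "dual_pair A Q"
    and A: "monoidal_category A"
  shows "cat_functor (StMon_g A V) (Dp_g V) (eval_functor A V Q)"
proof -
  interpret V: monoidal_category V by fact
  interpret A: monoidal_category A by fact
  interpret Q: dual_pair_in A Q by unfold_locales fact
  note V.Dp_g_simps [simp]
  show ?thesis
  proof (intro cat_functor.intro cat_functor_axioms.intro)
    show "category (StMon_g A V)" using groupoid_StMon_g by (rule groupoid.axioms)
    show "category (Dp_g V)" unfolding Dp_g_def using groupoid_core[OF V.category_Dp] by (rule groupoid.axioms)
    show "FObj (eval_functor A V Q) F \<in> Obj (Dp_g V)" if "F \<in> Obj (StMon_g A V)" for F
      using that dual_pair_image_dpair[OF Q] by simp
    show "FArr (eval_functor A V Q) f \<in> Hom (Dp_g V) (FObj (eval_functor A V Q) F) (FObj (eval_functor A V Q) G)"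
      if f: "f \<in> Hom (StMon_g A V) F G" for f F G
    proof -
      obtain \<sigma> where s: "f = (F, \<sigma>, G)" and FG: "strong_monoidal_functor A V F" "strong_monoidal_functor A V G" "monoidal_nat_iso A V F G \<sigma>"
        using f unfolding Hom_StMon_g by blast
      note m = monoidal_nat_isoD[OF FG(3,1,2)]
      show ?thesis
        using V.Dp_g_arrow[OF dual_pair_image_dpair[OF Q FG(1)] dual_pair_image_dpair[OF Q FG(2)], of "\<sigma> Q.X" "\<sigma> Q.Y"]
          m(1-4)[of Q.X] m(1-4)[of Q.Y] counit_monoidal_nat_iso[OF Q FG] unfolding s by simp
    qed
    show "FArr (eval_functor A V Q) (Ident (StMon_g A V) F) = Ident (Dp_g V) (FObj (eval_functor A V Q) F)"
      if "F \<in> Obj (StMon_g A V)" for F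
    proof -
      interpret F: strong_monoidal_functor A V F using that by simp
      show ?thesis by simp
    qed
    show "FArr (eval_functor A V Q) (Cmp (StMon_g A V) g f) = Cmp (Dp_g V) (FArr (eval_functor A V Q) g) (FArr (eval_functor A V Q) f)"
      if fg: "f \<in> Hom (StMon_g A V) F G" "g \<in> Hom (StMon_g A V) G H" for f g F G H
    proof -
      obtain \<sigma> where s: "f = (F, \<sigma>, G)" and F: "strong_monoidal_functor A V F" "monoidal_nat_iso A V F G \<sigma>"
        using fg(1) unfolding Hom_StMon_g by blast
      obtain \<tau> where t: "g = (G, \<tau>, H)" and G: "strong_monoidal_functor A V G" "strong_monoidal_functor A V H" "monoidal_nat_iso A V G H \<tau>"
        using fg(2) unfolding Hom_StMon_g by blast
      note m = monoidal_nat_isoD[OF F(2,1) G(1)] monoidal_nat_isoD[OF G(3,1,2)]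
      show ?thesis unfolding s t using m(1-4)[of Q.Y] m(9-12)[of Q.Y] V.iso_Cmp(2)[of "\<sigma> Q.Y" "\<tau> Q.Y"] by simp
    qed
  qed
qed

text \<open>The free functor sends each sign to the corresponding object of \<open>P\<close>
  tensored with the unit object on the right, so the right unit constraints are the comparison. The
  calculation rests on the triangle, \<open>LUnit_unit\<close> and
  \<open>RUnit_TensO\<close>.\<close>

lemma free_functor_pair:
  assumes V: "monoidal_category V" and P: "dual_pair V P"
  shows "Counit P \<cdot>\<^bsub>V\<^esub> (RUnit V (LeftO P) \<otimes>\<^bsub>V\<^esub> RUnit V (RightO P))
    = Counit (image_dpair Dpr V dpr_dpair (dual_pair_in.free_functor V P))"
proof -
  interpret V: monoidal_category V by fact
  interpret P: dual_pair_in V P by unfold_locales fact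
  let ?I = "UnitO V"
  have ob: "P.ob False = P.X" "P.ob True = P.Y" by (simp_all add: P.ob_def)
  have "Counit (image_dpair Dpr V dpr_dpair P.free_functor) = P.Phi (End (Br Leaf Leaf) Leaf) ?I \<cdot>\<^bsub>V\<^esub> P.word_mult [False] [True]"
    using diag_between_counit by (simp add: image_dpair_def)
  also have "P.Phi (End (Br Leaf Leaf) Leaf) ?I = LUnit V ?I \<cdot>\<^bsub>V\<^esub> (Counit P \<otimes>\<^bsub>V\<^esub> Ident V ?I) \<cdot>\<^bsub>V\<^esub> inv_arrow V (Assoc V P.X P.Y ?I)"
    by (simp add: ob P.evm_def)
  also have "P.word_mult [False] [True] = RUnit V P.X \<otimes>\<^bsub>V\<^esub> Ident V (P.Y \<odot>\<^bsub>V\<^esub> ?I)"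
    by (simp add: P.word_mult_def ob V.triangle)
  also have "(LUnit V ?I \<cdot>\<^bsub>V\<^esub> (Counit P \<otimes>\<^bsub>V\<^esub> Ident V ?I) \<cdot>\<^bsub>V\<^esub> inv_arrow V (Assoc V P.X P.Y ?I)) \<cdot>\<^bsub>V\<^esub> (RUnit V P.X \<otimes>\<^bsub>V\<^esub> Ident V (P.Y \<odot>\<^bsub>V\<^esub> ?I))
    = Counit P \<cdot>\<^bsub>V\<^esub> (RUnit V (P.X \<odot>\<^bsub>V\<^esub> P.Y) \<cdot>\<^bsub>V\<^esub> inv_arrow V (Assoc V P.X P.Y ?I)) \<cdot>\<^bsub>V\<^esub> (RUnit V P.X \<otimes>\<^bsub>V\<^esub> Ident V (P.Y \<odot>\<^bsub>V\<^esub> ?I))"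
    using V.Cmp_rotate[OF V.RUnit_nat[of "Counit P"]] by (simp add: V.LUnit_unit)
  also have "RUnit V (P.X \<odot>\<^bsub>V\<^esub> P.Y) \<cdot>\<^bsub>V\<^esub> inv_arrow V (Assoc V P.X P.Y ?I) = Ident V P.X \<otimes>\<^bsub>V\<^esub> RUnit V P.Y"
    unfolding V.RUnit_TensO[OF P.dual_typing(1,2), symmetric] by simp
  also have "(Ident V P.X \<otimes>\<^bsub>V\<^esub> RUnit V P.Y) \<cdot>\<^bsub>V\<^esub> (RUnit V P.X \<otimes>\<^bsub>V\<^esub> Ident V (P.Y \<odot>\<^bsub>V\<^esub> ?I)) = RUnit V P.X \<otimes>\<^bsub>V\<^esub> RUnit V P.Y"
    by (simp add: V.interchange)
  finally show ?thesis ..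
qed

text \<open>Both \<open>F\<close> and \<open>G\<close> are compared with the free functor of the
  image pair of \<open>F\<close>; the lift of \<open>g\<close> is the second comparison after the
  inverse of the first.\<close>

lemma eval_functor_full:
  assumes V: "monoidal_category V" and F: "strong_monoidal_functor Dpr V F" and G: "strong_monoidal_functor Dpr V G"
    and g: "g \<in> Hom (Dp_g V) (image_dpair Dpr V dpr_dpair F) (image_dpair Dpr V dpr_dpair G)"
  shows "\<exists>f\<in>Hom (StMon_g Dpr V) F G. FArr (eval_functor Dpr V dpr_dpair) f = g"
proof -
  interpret V: monoidal_category V by fact
  interpret F: strong_monoidal_functor Dpr V F by fact
  interpret G: strong_monoidal_functor Dpr V G by fact
  let ?P = "image_dpair Dpr V dpr_dpair F" and ?Q = "image_dpair Dpr V dpr_dpair G"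
  have dp: "dual_pair V ?P" "dual_pair V ?Q" using dual_pair_image_dpair[OF dual_pair_Dpr] F G by blast+
  interpret P: dual_pair_in V ?P by unfold_locales fact
  obtain u v where uv: "g = (?P, (u, v), ?Q)" "(?P, (u, v), ?Q) \<in> Arr (Dp V)" "iso_arrow V u" "iso_arrow V v"
    using g unfolding V.Hom_Dp_g by blast
  note uv' = uv(2)[unfolded V.Arr_Dp]
  have ty: "Dom V u = P.X" "Cod V u = LeftO ?Q" "Dom V v = RightO ?Q" "Cod V v = P.Y" "v \<in> Arr V" using uv' by blast+
  let ?w = "inv_arrow V v"
  have w: "iso_arrow V ?w" "Dom V ?w = P.Y" "Cod V ?w = RightO ?Q" "inv_arrow V ?w = v"
    using V.iso_inv_iso[OF uv(4)] V.inv_simps[OF uv(4)] V.inv_inv[OF uv(4)] ty by simp_all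
  have counit: "Counit ?Q \<cdot>\<^bsub>V\<^esub> (u \<otimes>\<^bsub>V\<^esub> ?w) = Counit ?P"
    using V.Dp_g_arrow[OF dp uv(3) ty(1,2) w(1-3)] g unfolding w(4) uv(1) by blast
  \<comment> \<open>The first comparison uses identities, since \<open>?P\<close> is itself the
    image of the distinguished pair under \<open>F\<close>.\<close>
  interpret T1: dpr_map V F ?P "\<lambda>s. Ident V (P.ob s)"
  proof unfold_locales
    show "Counit ?P \<cdot>\<^bsub>V\<^esub> (Ident V (P.ob False) \<otimes>\<^bsub>V\<^esub> Ident V (P.ob True)) = Counit ?P" by (simp add: P.ob_def)
  qed (simp_all add: P.ob_def W.ob_def dual_pair_Dpr split: if_splits)
  \<comment> \<open>The second comparison uses the components of \<open>g\<close>, the right one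
    inverted to make it covariant.\<close>
  interpret T2: dpr_map V G ?P "\<lambda>s. if s then ?w else u"
  proof unfold_locales
    show "Counit ?Q \<cdot>\<^bsub>V\<^esub> ((if False then ?w else u) \<otimes>\<^bsub>V\<^esub> (if True then ?w else u)) = Counit ?P" by (simp add: counit)
  qed (use ty w uv(3) in \<open>simp_all add: P.ob_def W.ob_def\<close>)
  have free: "strong_monoidal_functor Dpr V P.free_functor" by (rule P.strong_monoidal_free_functor)
  let ?\<sigma> = "\<lambda>x\<in>Obj Dpr. T2.theta x \<cdot>\<^bsub>V\<^esub> (\<lambda>x\<in>Obj Dpr. inv_arrow V (T1.theta x)) x"
  have s: "monoidal_nat_iso Dpr V F G ?\<sigma>"
    by (rule monoidal_nat_iso_Cmp[OF F free G monoidal_nat_iso_inv[OF free F T1.theta] T2.theta])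
  have XY: "P.X \<in> Obj V" "P.Y \<in> Obj V" by simp_all
  have ob: "P.ob False = P.X" "P.ob True = P.Y" by (simp_all add: P.ob_def)
  \<comment> \<open>At a single sign both comparisons contain the same right unit constraint, which
    cancels and leaves the map of dual pairs.\<close>
  have e: "?\<sigma> dpr_minus = u" "?\<sigma> dpr_plus = ?w"
    using XY ty w uv(3) V.iso_Arr[OF uv(3)] V.iso_Arr[OF w(1)] by (simp_all add: T1.theta_sign T2.theta_sign ob)
  show ?thesis
    by (rule bexI[of _ "(F, ?\<sigma>, G)"]) (use F G s e w(4) uv(1) in \<open>simp_all add: Hom_StMon_g\<close>)
qed

lemma eval_functor_faithful:
  assumes V: "monoidal_category V" and fg: "f \<in> Hom (StMon_g Dpr V) F G" "g \<in> Hom (StMon_g Dpr V) F G"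
    and eq: "FArr (eval_functor Dpr V dpr_dpair) f = FArr (eval_functor Dpr V dpr_dpair) g"
  shows "f = g"
proof -
  interpret V: monoidal_category V by fact
  obtain \<sigma> where s: "f = (F, \<sigma>, G)" and FG: "strong_monoidal_functor Dpr V F" "strong_monoidal_functor Dpr V G" "monoidal_nat_iso Dpr V F G \<sigma>"
    using fg(1) unfolding Hom_StMon_g by blast
  obtain \<tau> where t: "g = (F, \<tau>, G)" "monoidal_nat_iso Dpr V F G \<tau>"
    using fg(2) unfolding Hom_StMon_g by blast
  have i: "iso_arrow V (\<sigma> dpr_plus)" "iso_arrow V (\<tau> dpr_plus)"
    using monoidal_nat_isoD(4)[OF FG(3,1,2)] monoidal_nat_isoD(4)[OF t(2) FG(1,2)] by simp_all
  have e: "\<sigma> dpr_minus = \<tau> dpr_minus" "inv_arrow V (\<sigma> dpr_plus) = inv_arrow V (\<tau> dpr_plus)"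
    using eq unfolding s t by simp_all
  have "\<sigma> dpr_plus = \<tau> dpr_plus" using V.inv_inv[OF i(1)] V.inv_inv[OF i(2)] unfolding e(2) by (rule trans[OF sym])
  then have "\<sigma> = \<tau>" by (intro monoidal_nat_iso_eqI[OF FG(3) t(2) FG(1,2) e(1)])
  then show ?thesis using s t by simp
qed

text \<open>Any arrow suffices as a witness, because all arrows of \<open>Dp_g V\<close> are
  invertible. Here it consists of right unit constraints, by
  \<open>free_functor_pair\<close>.\<close>

lemma eval_functor_surjective:
  assumes V: "monoidal_category V" and P: "dual_pair V P"
  shows "\<exists>F. strong_monoidal_functor Dpr V F \<and>
    (\<exists>e\<in>Hom (Dp_g V) (image_dpair Dpr V dpr_dpair F) P. True)"
proof -
  interpret V: monoidal_category V by fact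
  interpret P: dual_pair_in V P by unfold_locales fact
  have free: "strong_monoidal_functor Dpr V P.free_functor" by (rule P.strong_monoidal_free_functor)
  have ob: "P.ob False = P.X" "P.ob True = P.Y" by (simp_all add: P.ob_def)
  have "(image_dpair Dpr V dpr_dpair P.free_functor, (RUnit V P.X, inv_arrow V (RUnit V P.Y)), P)
    \<in> Hom (Dp_g V) (image_dpair Dpr V dpr_dpair P.free_functor) P"
    using V.Dp_g_arrow[OF dual_pair_image_dpair[OF dual_pair_Dpr free] P, of "RUnit V P.X" "RUnit V P.Y"]
      free_functor_pair[OF V P] by (simp add: ob)
  with free show ?thesis by blast
qed

theorem proposition6:
  fixes V :: "('o, 'm) moncat"
  assumes "monoidal_category V"
  shows "equivalence_of_groupoids (StMon_g Dpr V) (Dp_g V) (eval_functor Dpr V dpr_dpair)"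
proof -
  interpret V: monoidal_category V by fact
  have g: "groupoid (Dp_g V)" unfolding Dp_g_def by (rule groupoid_core[OF V.category_Dp])
  have iso: "iso_arrow (Dp_g V) e" if "e \<in> Hom (Dp_g V) P Q" for e P Q
    using groupoid.all_iso[OF g] that by (auto simp: Hom_def)
  have "equivalence_of_categories (StMon_g Dpr V) (Dp_g V) (eval_functor Dpr V dpr_dpair)"
  proof (rule equivalence_of_categoriesI[OF cat_functor_eval[OF assms dual_pair_Dpr monoidal_Dpr]])
    show "\<exists>f\<in>Hom (StMon_g Dpr V) F G. FArr (eval_functor Dpr V dpr_dpair) f = h"
      if "F \<in> Obj (StMon_g Dpr V)" "G \<in> Obj (StMon_g Dpr V)"
        "h \<in> Hom (Dp_g V) (FObj (eval_functor Dpr V dpr_dpair) F) (FObj (eval_functor Dpr V dpr_dpair) G)" for F G h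
      using eval_functor_full[OF assms] that by simp
    show "f = f'" if "f \<in> Hom (StMon_g Dpr V) F G" "f' \<in> Hom (StMon_g Dpr V) F G"
      "FArr (eval_functor Dpr V dpr_dpair) f = FArr (eval_functor Dpr V dpr_dpair) f'" for F G f f'
      using eval_functor_faithful[OF assms] that by blast
    show "\<exists>F\<in>Obj (StMon_g Dpr V). \<exists>e\<in>Hom (Dp_g V) (FObj (eval_functor Dpr V dpr_dpair) F) P. iso_arrow (Dp_g V) e"
      if P: "P \<in> Obj (Dp_g V)" for P
    proof -
      obtain F e where F: "strong_monoidal_functor Dpr V F" and e: "e \<in> Hom (Dp_g V) (image_dpair Dpr V dpr_dpair F) P"
        using eval_functor_surjective[OF assms, of P] P by (auto simp: V.Dp_g_simps)
      show ?thesis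
        by (rule bexI[of _ F], rule bexI[of _ e]) (use F e iso[OF e] in simp_all)
    qed
  qed
  then show ?thesis unfolding equivalence_of_groupoids_def using groupoid_StMon_g g by blast
qed

end
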